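(* Let $(T,\gamma)$ be a tame $B$-$A$ herd with pen $\widehat{T}$, and let $A'$, $B'$ be the (possibly non-unital) rings constructed from the associated coherd (as described in the context). (1) There are ring morphisms $\nu_A:A'\to A$ and $\nu_B:B'\to B$. (2) If the map $h:\overline{T}\to\widehat{T}$, $\sum_i\hat{x}_i\otimes_S x_i\otimes_R\hat{y}_i\mapsto\sum_i\mathrm{ev}(\hat{x}_i\otimes_S x_i)\hat{y}_i=\sum_i\hat{x}_i\widehat{\mathrm{ev}}(x_i\otimes_R\hat{y}_i)$, is an isomorphism, then $\nu_A$ and $\nu_B$ are isomorphisms; in particular $A'$ and $B'$ are unital rings. (3) If $\widehat{T}$ is flat as a left $R$-module and as a right $S$-module and $\overline{T}=\widehat{T}\otimes_S D=C\otimes_R\widehat{T}$, then the maps $\nu_A$ and $\nu_B$ are isomorphisms of rings.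
   Context: All rings are associative and, unless stated otherwise, unital. $\alpha:R\to A$ and $\beta:S\to B$ are fixed ring homomorphisms; $A$-modules are regarded as $R$-modules via $\alpha$ and $B$-modules as $S$-modules via $\beta$. The identity map on an object $X$ is denoted $X$. Formal dual: given a $B$-$A$ bimodule $T$, an $A$-$B$ bimodule $\widehat{T}$ is a formal dual of $T$ if there exist an $A$-bimodule map $\mathrm{ev}:\widehat{T}\otimes_S T\to A$ and a $B$-bimodule map $\widehat{\mathrm{ev}}:T\otimes_R\widehat{T}\to B$ such that for all $x,y\in T$, $\hat{x},\hat{y}\in\widehat{T}$: $$\widehat{\mathrm{ev}}(x\otimes_R\hat{x})\,y=x\,\mathrm{ev}(\hat{x}\otimes_S y),\qquad \hat{x}\,\widehat{\mathrm{ev}}(x\otimes_R\hat{y})=\mathrm{ev}(\hat{x}\otimes_S x)\,\hat{y}.$$ Herd: a $B$-$A$ bimodule $T$ with a formal dual $\widehat{T}$ (called the pen) is a bimodule herd, or $B$-$A$ herd, $(T,\gamma)$ if there is an $S$-$R$ bimodule map (the shepherd) $\gamma:T\to T\otimes_R\widehat{T}\otimes_S T$, written $\gamma(x)=x^{\langle1\rangle}\otimes_R x^{\langle2\rangle}\otimes_S x^{\langle3\rangle}$ (summation implicit), such that for all $x\in T$: $\widehat{\mathrm{ev}}(x^{\langle1\rangle}\otimes_R x^{\langle2\rangle})\otimes_S x^{\langle3\rangle}=1_B\otimes_S x$ in $B\otimes_S T$; $x^{\langle1\rangle}\otimes_R\mathrm{ev}(x^{\langle2\rangle}\otimes_S x^{\langle3\rangle})=x\otimes_R1_A$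 in $T\otimes_R A$; and $(\gamma\otimes_R\widehat{T}\otimes_S T)\circ\gamma=(T\otimes_R\widehat{T}\otimes_S\gamma)\circ\gamma$. The herd is tame if $\mathrm{ev}$ and $\widehat{\mathrm{ev}}$ are surjective and $T$ is faithfully flat as a right $R$-module and as a left $S$-module. Associated corings: for a tame herd, $$C=\{c\in\widehat{T}\otimes_S T:(\mathrm{ev}\otimes_R\widehat{T}\otimes_S T)(\widehat{T}\otimes_S\gamma)(c)=1_A\otimes_R c\}$$ is an $R$-coring with coproduct $\Delta_C=(\widehat{T}\otimes_S\gamma)|_C$ and counit $\varepsilon_C=\mathrm{ev}|_C$ (with values in $R\subseteq A$; $\alpha$ is injective), and $$D=\{d\in T\otimes_R\widehat{T}:(T\otimes_R\widehat{T}\otimes_S\widehat{\mathrm{ev}})(\gamma\otimes_R\widehat{T})(d)=d\otimes_S1_B\}$$ is an $S$-coring with coproduct $\Delta_D=(\gamma\otimes_R\widehat{T})|_D$ and counit $\varepsilon_D=\widehat{\mathrm{ev}}|_D$ (with values in $S\subseteq B$). Associated coherd: $\overline{T}=(C\otimes_R\widehat{T})\cap(\widehat{T}\otimes_S D)\subseteq\widehat{T}\otimes_S T\otimes_R\widehat{T}$; $\chi:T\otimes_R\overline{T}\otimes_S T\to T$, $\chi(x\otimes_R\hat{x}\otimes_S y\otimes_R\hat{y}\otimes_S z)=\widehat{\mathrm{ev}}(x\otimes_R\hat{x})\,y\,\mathrm{ev}(\hat{y}\otimes_S z)$; $\mathrm{cov}:C\to\overline{T}\otimes_S T$ is $\Delta_C$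 viewed with values in $\overline{T}\otimes_S T\subseteq\widehat{T}\otimes_S T\otimes_R\widehat{T}\otimes_S T$; $\overline{\mathrm{cov}}:D\to T\otimes_R\overline{T}$ is $\Delta_D$ viewed with values in $T\otimes_R\overline{T}$. The rings: $A'$ is the $R$-bimodule coequaliser $\pi_A:\overline{T}\otimes_S T\to A'$ of the maps $(\overline{T}\otimes_S\chi)\circ(\mathrm{cov}\otimes_R\overline{T}\otimes_S T)$ and $\varepsilon_C\otimes_R\overline{T}\otimes_S T$ from $C\otimes_R\overline{T}\otimes_S T$ to $\overline{T}\otimes_S T$, with the associative (possibly non-unital) product induced by $\overline{T}\otimes_S\chi:(\overline{T}\otimes_S T)\otimes_R(\overline{T}\otimes_S T)\to\overline{T}\otimes_S T$. Symmetrically, $B'$ is the $S$-bimodule coequaliser $\pi_B:T\otimes_R\overline{T}\to B'$ of the maps $(\chi\otimes_R\overline{T})\circ(T\otimes_R\overline{T}\otimes_S\overline{\mathrm{cov}})$ and $T\otimes_R\overline{T}\otimes_S\varepsilon_D$ from $T\otimes_R\overline{T}\otimes_S D$ to $T\otimes_R\overline{T}$, with product induced by $\chi\otimes_R\overline{T}$. The equalities in (3) are equalities of subobjects of $\widehat{T}\otimes_S T\otimes_R\widehat{T}$. Ring morphisms out of $A'$, $B'$ are additive multiplicative maps. *)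

theory Defs
  imports "HOL-Algebra.QuotRing" "HOL-Algebra.Free_Abelian_Groups"
begin

section \<open>Modules and bimodules over noncommutative rings\<close>

text \<open>As for the library's \<open>module\<close> record, the fields \<^const>\<open>monoid.mult\<close> and \<^const>\<open>monoid.one\<close> inherited from
  \<open>ring\<close> carry no information; only the additive structure matters. A one-sided module is a record
  of which only one of the two actions is used.\<close>

record ('l, 'm, 'r) bimod = "'m ring" +
  lact :: "'l \<Rightarrow> 'm \<Rightarrow> 'm"  (infixr "\<rightharpoonup>\<index>" 72)
  ract :: "'m \<Rightarrow> 'r \<Rightarrow> 'm"  (infixl "\<leftharpoonup>\<index>" 72)

locale left_module = lring: ring R + M: abelian_group M
  for R :: "('l, 'z) ring_scheme" and M :: "('l, 'm, 'r) bimod" +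
  assumes lact_closed: "\<lbrakk>a \<in> carrier R; x \<in> carrier M\<rbrakk> \<Longrightarrow> a \<rightharpoonup>\<^bsub>M\<^esub> x \<in> carrier M"
    and lact_add: "\<lbrakk>a \<in> carrier R; x \<in> carrier M; y \<in> carrier M\<rbrakk>
      \<Longrightarrow> a \<rightharpoonup>\<^bsub>M\<^esub> (x \<oplus>\<^bsub>M\<^esub> y) = (a \<rightharpoonup>\<^bsub>M\<^esub> x) \<oplus>\<^bsub>M\<^esub> (a \<rightharpoonup>\<^bsub>M\<^esub> y)"
    and add_lact: "\<lbrakk>a \<in> carrier R; b \<in> carrier R; x \<in> carrier M\<rbrakk>
      \<Longrightarrow> (a \<oplus>\<^bsub>R\<^esub> b) \<rightharpoonup>\<^bsub>M\<^esub> x = (a \<rightharpoonup>\<^bsub>M\<^esub> x) \<oplus>\<^bsub>M\<^esub> (b \<rightharpoonup>\<^bsub>M\<^esub> x)"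
    and mult_lact: "\<lbrakk>a \<in> carrier R; b \<in> carrier R; x \<in> carrier M\<rbrakk>
      \<Longrightarrow> (a \<otimes>\<^bsub>R\<^esub> b) \<rightharpoonup>\<^bsub>M\<^esub> x = a \<rightharpoonup>\<^bsub>M\<^esub> (b \<rightharpoonup>\<^bsub>M\<^esub> x)"
    and one_lact: "x \<in> carrier M \<Longrightarrow> \<one>\<^bsub>R\<^esub> \<rightharpoonup>\<^bsub>M\<^esub> x = x"

locale right_module = rring: ring R + M: abelian_group M
  for R :: "('r, 'z) ring_scheme" and M :: "('l, 'm, 'r) bimod" +
  assumes ract_closed: "\<lbrakk>a \<in> carrier R; x \<in> carrier M\<rbrakk> \<Longrightarrow> x \<leftharpoonup>\<^bsub>M\<^esub> a \<in> carrier M"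
    and add_ract: "\<lbrakk>a \<in> carrier R; x \<in> carrier M; y \<in> carrier M\<rbrakk>
      \<Longrightarrow> (x \<oplus>\<^bsub>M\<^esub> y) \<leftharpoonup>\<^bsub>M\<^esub> a = (x \<leftharpoonup>\<^bsub>M\<^esub> a) \<oplus>\<^bsub>M\<^esub> (y \<leftharpoonup>\<^bsub>M\<^esub> a)"
    and ract_add: "\<lbrakk>a \<in> carrier R; b \<in> carrier R; x \<in> carrier M\<rbrakk>
      \<Longrightarrow> x \<leftharpoonup>\<^bsub>M\<^esub> (a \<oplus>\<^bsub>R\<^esub> b) = (x \<leftharpoonup>\<^bsub>M\<^esub> a) \<oplus>\<^bsub>M\<^esub> (x \<leftharpoonup>\<^bsub>M\<^esub> b)"
    and ract_mult: "\<lbrakk>a \<in> carrier R; b \<in> carrier R; x \<in> carrier M\<rbrakk>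
      \<Longrightarrow> x \<leftharpoonup>\<^bsub>M\<^esub> (a \<otimes>\<^bsub>R\<^esub> b) = (x \<leftharpoonup>\<^bsub>M\<^esub> a) \<leftharpoonup>\<^bsub>M\<^esub> b"
    and ract_one: "x \<in> carrier M \<Longrightarrow> x \<leftharpoonup>\<^bsub>M\<^esub> \<one>\<^bsub>R\<^esub> = x"

locale bimodule = left_module L M + right_module R M
  for L :: "('l, 'y) ring_scheme" and R :: "('r, 'z) ring_scheme" and M :: "('l, 'm, 'r) bimod" +
  assumes lact_ract: "\<lbrakk>a \<in> carrier L; b \<in> carrier R; x \<in> carrier M\<rbrakk>
      \<Longrightarrow> (a \<rightharpoonup>\<^bsub>M\<^esub> x) \<leftharpoonup>\<^bsub>M\<^esub> b = a \<rightharpoonup>\<^bsub>M\<^esub> (x \<leftharpoonup>\<^bsub>M\<^esub> b)"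

definition add_hom :: "('m, 'y) ring_scheme \<Rightarrow> ('n, 'z) ring_scheme \<Rightarrow> ('m \<Rightarrow> 'n) set" where
  "add_hom M N = hom (add_monoid M) (add_monoid N)"

definition left_hom ::
    "('l, 'z) ring_scheme \<Rightarrow> ('l, 'm, 'r) bimod \<Rightarrow> ('l, 'n, 'k) bimod \<Rightarrow> ('m \<Rightarrow> 'n) set" where
  "left_hom R M N =
     {f \<in> add_hom M N. \<forall>a\<in>carrier R. \<forall>x\<in>carrier M. f (a \<rightharpoonup>\<^bsub>M\<^esub> x) = a \<rightharpoonup>\<^bsub>N\<^esub> f x}"

definition right_hom ::
    "('r, 'z) ring_scheme \<Rightarrow> ('l, 'm, 'r) bimod \<Rightarrow> ('k, 'n, 'r) bimod \<Rightarrow> ('m \<Rightarrow> 'n) set" where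
  "right_hom R M N =
     {f \<in> add_hom M N. \<forall>a\<in>carrier R. \<forall>x\<in>carrier M. f (x \<leftharpoonup>\<^bsub>M\<^esub> a) = f x \<leftharpoonup>\<^bsub>N\<^esub> a}"

definition bimod_hom ::
    "('l, 'y) ring_scheme \<Rightarrow> ('r, 'z) ring_scheme \<Rightarrow> ('l, 'm, 'r) bimod \<Rightarrow> ('l, 'n, 'r) bimod
      \<Rightarrow> ('m \<Rightarrow> 'n) set" where
  "bimod_hom L R M N = left_hom L M N \<inter> right_hom R M N"

definition bimod_iso ::
    "('l, 'y) ring_scheme \<Rightarrow> ('r, 'z) ring_scheme \<Rightarrow> ('l, 'm, 'r) bimod \<Rightarrow> ('l, 'n, 'r) bimod
      \<Rightarrow> ('m \<Rightarrow> 'n) set" where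
  "bimod_iso L R M N = {f \<in> bimod_hom L R M N. bij_betw f (carrier M) (carrier N)}"

definition restr :: "('k \<Rightarrow> 'l) \<Rightarrow> ('q \<Rightarrow> 'r) \<Rightarrow> ('l, 'm, 'r) bimod \<Rightarrow> ('k, 'm, 'q) bimod" where
  "restr \<phi> \<psi> M = \<lparr>carrier = carrier M, monoid.mult = monoid.mult M, one = \<one>\<^bsub>M\<^esub>,
     ring.zero = \<zero>\<^bsub>M\<^esub>, add = ring.add M,
     lact = (\<lambda>a x. \<phi> a \<rightharpoonup>\<^bsub>M\<^esub> x), ract = (\<lambda>x a. x \<leftharpoonup>\<^bsub>M\<^esub> \<psi> a)\<rparr>"

definition regular :: "('r, 'z) ring_scheme \<Rightarrow> ('r, 'r, 'r) bimod" where
  "regular R = \<lparr>carrier = carrier R, monoid.mult = monoid.mult R, one = \<one>\<^bsub>R\<^esub>,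
     ring.zero = \<zero>\<^bsub>R\<^esub>, add = ring.add R,
     lact = monoid.mult R, ract = monoid.mult R\<rparr>"

definition sub_bimod :: "('l, 'm, 'r) bimod \<Rightarrow> 'm set \<Rightarrow> ('l, 'm, 'r) bimod" where
  "sub_bimod M X = M\<lparr>carrier := X\<rparr>"


section \<open>Tensor products\<close>

text \<open>\<open>M \<boxtimes>\<^bsub>R\<^esub> N\<close> is the free abelian group on pairs modulo the subgroup generated by the usual
  relations. It uses the right action of \<open>M\<close> and the left action of \<open>N\<close>, and keeps the left action
  of \<open>M\<close> and the right action of \<open>N\<close>. The underlying group depends only on the two inner actions, so
  that it does not change when the outer actions are restricted along a ring homomorphism.\<close>

definition tensor_rels ::
    "('r, 'z) ring_scheme \<Rightarrow> ('l, 'm, 'r) bimod \<Rightarrow> ('r, 'n, 'k) bimod \<Rightarrow> ('m \<times> 'n \<Rightarrow>\<^sub>0 int) set" where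
  "tensor_rels R M N =
     {frag_of (x \<oplus>\<^bsub>M\<^esub> x', y) - frag_of (x, y) - frag_of (x', y) | x x' y.
        x \<in> carrier M \<and> x' \<in> carrier M \<and> y \<in> carrier N} \<union>
     {frag_of (x, y \<oplus>\<^bsub>N\<^esub> y') - frag_of (x, y) - frag_of (x, y') | x y y'.
        x \<in> carrier M \<and> y \<in> carrier N \<and> y' \<in> carrier N} \<union>
     {frag_of (x \<leftharpoonup>\<^bsub>M\<^esub> a, y) - frag_of (x, a \<rightharpoonup>\<^bsub>N\<^esub> y) | x a y.
        x \<in> carrier M \<and> a \<in> carrier R \<and> y \<in> carrier N}"

definition tensor_ker ::
    "('r, 'z) ring_scheme \<Rightarrow> ('l, 'm, 'r) bimod \<Rightarrow> ('r, 'n, 'k) bimod \<Rightarrow> ('m \<times> 'n \<Rightarrow>\<^sub>0 int) set" where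
  "tensor_ker R M N =
     generate (free_Abelian_group (carrier M \<times> carrier N)) (tensor_rels R M N)"

definition tens :: "('r, 'z) ring_scheme \<Rightarrow> ('l, 'm, 'r) bimod \<Rightarrow> ('r, 'n, 'k) bimod \<Rightarrow> 'm \<Rightarrow> 'n
    \<Rightarrow> ('m \<times> 'n \<Rightarrow>\<^sub>0 int) set" where
  "tens R M N x y =
     tensor_ker R M N #>\<^bsub>free_Abelian_group (carrier M \<times> carrier N)\<^esub> frag_of (x, y)"

definition tensor_group :: "('r, 'z) ring_scheme \<Rightarrow> ('l, 'm, 'r) bimod \<Rightarrow> ('r, 'n, 'k) bimod
    \<Rightarrow> (('m \<times> 'n \<Rightarrow>\<^sub>0 int) set) ring" where
  "tensor_group R M N =
     (let Q = free_Abelian_group (carrier M \<times> carrier N) Mod tensor_ker R M N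
      in \<lparr>carrier = carrier Q, monoid.mult = undefined, one = undefined,
          ring.zero = \<one>\<^bsub>Q\<^esub>, add = monoid.mult Q\<rparr>)"

text \<open>The additive map on \<open>M \<boxtimes>\<^bsub>R\<^esub> N\<close> induced by an \<open>R\<close>-balanced biadditive map \<open>\<phi>\<close>.
  (The value is meaningless when \<open>\<phi>\<close> is not balanced.)\<close>

definition tensor_lift :: "('r, 'z) ring_scheme \<Rightarrow> ('l, 'm, 'r) bimod \<Rightarrow> ('r, 'n, 'k) bimod
    \<Rightarrow> ('w, 'y) ring_scheme \<Rightarrow> ('m \<Rightarrow> 'n \<Rightarrow> 'w) \<Rightarrow> ('m \<times> 'n \<Rightarrow>\<^sub>0 int) set \<Rightarrow> 'w" where
  "tensor_lift R M N K \<phi> =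
     (THE f. f \<in> extensional (carrier (tensor_group R M N)) \<and> f \<in> add_hom (tensor_group R M N) K \<and>
        (\<forall>x\<in>carrier M. \<forall>y\<in>carrier N. f (tens R M N x y) = \<phi> x y))"

definition tensor :: "('l, 'm, 'r) bimod \<Rightarrow> ('r, 'z) ring_scheme \<Rightarrow> ('r, 'n, 'k) bimod
    \<Rightarrow> ('l, ('m \<times> 'n \<Rightarrow>\<^sub>0 int) set, 'k) bimod"  ("_ \<boxtimes>\<^bsub>_\<^esub> _" [71, 0, 70] 70) where
  "M \<boxtimes>\<^bsub>R\<^esub> N = ring.extend (tensor_group R M N) (bimod.fields
     (\<lambda>a. tensor_lift R M N (tensor_group R M N) (\<lambda>x y. tens R M N (a \<rightharpoonup>\<^bsub>M\<^esub> x) y))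
     (\<lambda>u a. tensor_lift R M N (tensor_group R M N) (\<lambda>x y. tens R M N x (y \<leftharpoonup>\<^bsub>N\<^esub> a)) u))"

definition tensor_map :: "('r, 'z) ring_scheme \<Rightarrow> ('l, 'm, 'r) bimod \<Rightarrow> ('r, 'n, 'k) bimod
    \<Rightarrow> ('l', 'm', 'r) bimod \<Rightarrow> ('r, 'n', 'k') bimod \<Rightarrow> ('m \<Rightarrow> 'm') \<Rightarrow> ('n \<Rightarrow> 'n')
    \<Rightarrow> ('m \<times> 'n \<Rightarrow>\<^sub>0 int) set \<Rightarrow> ('m' \<times> 'n' \<Rightarrow>\<^sub>0 int) set" where
  "tensor_map R M N M' N' f g =
     tensor_lift R M N (M' \<boxtimes>\<^bsub>R\<^esub> N') (\<lambda>x y. tens R M' N' (f x) (g y))"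

text \<open>The associativity isomorphism from \<open>(M \<boxtimes>\<^bsub>R\<^esub> N) \<boxtimes>\<^bsub>S\<^esub> P\<close> to \<open>M \<boxtimes>\<^bsub>R\<^esub> (N \<boxtimes>\<^bsub>S\<^esub> P)\<close> and its inverse.\<close>

definition assoc :: "('r, 'y) ring_scheme \<Rightarrow> ('s, 'z) ring_scheme \<Rightarrow> ('l, 'm, 'r) bimod
    \<Rightarrow> ('r, 'n, 's) bimod \<Rightarrow> ('s, 'p, 'k) bimod
    \<Rightarrow> (('m \<times> 'n \<Rightarrow>\<^sub>0 int) set \<times> 'p \<Rightarrow>\<^sub>0 int) set \<Rightarrow> ('m \<times> ('n \<times> 'p \<Rightarrow>\<^sub>0 int) set \<Rightarrow>\<^sub>0 int) set" where
  "assoc R S M N P = tensor_lift S (M \<boxtimes>\<^bsub>R\<^esub> N) P (M \<boxtimes>\<^bsub>R\<^esub> (N \<boxtimes>\<^bsub>S\<^esub> P))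
     (\<lambda>u z. tensor_lift R M N (M \<boxtimes>\<^bsub>R\<^esub> (N \<boxtimes>\<^bsub>S\<^esub> P))
        (\<lambda>x y. tens R M (N \<boxtimes>\<^bsub>S\<^esub> P) x (tens S N P y z)) u)"

definition assoc_inv :: "('r, 'y) ring_scheme \<Rightarrow> ('s, 'z) ring_scheme \<Rightarrow> ('l, 'm, 'r) bimod
    \<Rightarrow> ('r, 'n, 's) bimod \<Rightarrow> ('s, 'p, 'k) bimod
    \<Rightarrow> ('m \<times> ('n \<times> 'p \<Rightarrow>\<^sub>0 int) set \<Rightarrow>\<^sub>0 int) set \<Rightarrow> (('m \<times> 'n \<Rightarrow>\<^sub>0 int) set \<times> 'p \<Rightarrow>\<^sub>0 int) set" where
  "assoc_inv R S M N P = tensor_lift R M (N \<boxtimes>\<^bsub>S\<^esub> P) ((M \<boxtimes>\<^bsub>R\<^esub> N) \<boxtimes>\<^bsub>S\<^esub> P)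
     (\<lambda>x u. tensor_lift S N P ((M \<boxtimes>\<^bsub>R\<^esub> N) \<boxtimes>\<^bsub>S\<^esub> P)
        (\<lambda>y z. tens S (M \<boxtimes>\<^bsub>R\<^esub> N) P (tens R M N x y) z) u)"


section \<open>Flatness and faithful flatness\<close>

definition exact_at :: "('l, 'y) ring_scheme \<Rightarrow> ('n, 'z) ring_scheme \<Rightarrow> ('k, 'w) ring_scheme
    \<Rightarrow> ('l \<Rightarrow> 'n) \<Rightarrow> ('n \<Rightarrow> 'k) \<Rightarrow> bool" where
  "exact_at X Y Z f g \<longleftrightarrow> f ` carrier X = {y \<in> carrier Y. g y = \<zero>\<^bsub>Z\<^esub>}"

text \<open>HOL cannot quantify over types, so the modules \<open>X\<close>, \<open>Y\<close>, \<open>Z\<close> on which flatness is tested are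
  those whose carrier lies in a type \<open>'x\<close> passed as an argument. This is flatness in the usual sense
  as soon as \<open>'x\<close> is infinite and at least as large as the ring: it then contains isomorphic copies
  of all countably generated modules, and (faithful) flatness is detected by these.\<close>

definition flat_right ::
    "'x itself \<Rightarrow> ('r, 'z) ring_scheme \<Rightarrow> ('l, 'm, 'r) bimod \<Rightarrow> bool" where
  "flat_right U R M \<longleftrightarrow>
     (\<forall>(X :: ('r, 'x, unit) bimod) (Y :: ('r, 'x, unit) bimod) (Z :: ('r, 'x, unit) bimod) f g.
        left_module R X \<and> left_module R Y \<and> left_module R Z \<and>
        f \<in> left_hom R X Y \<and> g \<in> left_hom R Y Z \<longrightarrow>
        exact_at X Y Z f g \<longrightarrow>
        exact_at (M \<boxtimes>\<^bsub>R\<^esub> X) (M \<boxtimes>\<^bsub>R\<^esub> Y) (M \<boxtimes>\<^bsub>R\<^esub> Z)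
          (tensor_map R M X M Y id f) (tensor_map R M Y M Z id g))"

definition flat_left ::
    "'x itself \<Rightarrow> ('r, 'z) ring_scheme \<Rightarrow> ('r, 'm, 'k) bimod \<Rightarrow> bool" where
  "flat_left U R M \<longleftrightarrow>
     (\<forall>(X :: (unit, 'x, 'r) bimod) (Y :: (unit, 'x, 'r) bimod) (Z :: (unit, 'x, 'r) bimod) f g.
        right_module R X \<and> right_module R Y \<and> right_module R Z \<and>
        f \<in> right_hom R X Y \<and> g \<in> right_hom R Y Z \<longrightarrow>
        exact_at X Y Z f g \<longrightarrow>
        exact_at (X \<boxtimes>\<^bsub>R\<^esub> M) (Y \<boxtimes>\<^bsub>R\<^esub> M) (Z \<boxtimes>\<^bsub>R\<^esub> M)
          (tensor_map R X M Y M f id) (tensor_map R Y M Z M g id))"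

definition faithfully_flat_right ::
    "'x itself \<Rightarrow> ('r, 'z) ring_scheme \<Rightarrow> ('l, 'm, 'r) bimod \<Rightarrow> bool" where
  "faithfully_flat_right U R M \<longleftrightarrow>
     (\<forall>(X :: ('r, 'x, unit) bimod) (Y :: ('r, 'x, unit) bimod) (Z :: ('r, 'x, unit) bimod) f g.
        left_module R X \<and> left_module R Y \<and> left_module R Z \<and>
        f \<in> left_hom R X Y \<and> g \<in> left_hom R Y Z \<longrightarrow>
        (exact_at X Y Z f g \<longleftrightarrow>
         exact_at (M \<boxtimes>\<^bsub>R\<^esub> X) (M \<boxtimes>\<^bsub>R\<^esub> Y) (M \<boxtimes>\<^bsub>R\<^esub> Z)
           (tensor_map R M X M Y id f) (tensor_map R M Y M Z id g)))"

definition faithfully_flat_left ::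
    "'x itself \<Rightarrow> ('r, 'z) ring_scheme \<Rightarrow> ('r, 'm, 'k) bimod \<Rightarrow> bool" where
  "faithfully_flat_left U R M \<longleftrightarrow>
     (\<forall>(X :: (unit, 'x, 'r) bimod) (Y :: (unit, 'x, 'r) bimod) (Z :: (unit, 'x, 'r) bimod) f g.
        right_module R X \<and> right_module R Y \<and> right_module R Z \<and>
        f \<in> right_hom R X Y \<and> g \<in> right_hom R Y Z \<longrightarrow>
        (exact_at X Y Z f g \<longleftrightarrow>
         exact_at (X \<boxtimes>\<^bsub>R\<^esub> M) (Y \<boxtimes>\<^bsub>R\<^esub> M) (Z \<boxtimes>\<^bsub>R\<^esub> M)
           (tensor_map R X M Y M f id) (tensor_map R Y M Z M g id)))"

text \<open>The carrier type of the test modules used for herds. It also has room for all iterated tensor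
  products of the bimodules of a herd.\<close>

type_synonym ('r, 's, 'a, 'b, 't, 'p) test = "('r + 's + 'a + 'b + 't + 'p) list"


section \<open>Possibly non-unital rings\<close>

text \<open>A possibly non-unital ring is a \<open>ring\<close> record whose field \<^const>\<open>monoid.one\<close> is ignored.\<close>

definition rng_hom :: "('m, 'y) ring_scheme \<Rightarrow> ('n, 'z) ring_scheme \<Rightarrow> ('m \<Rightarrow> 'n) set" where
  "rng_hom P Q = add_hom P Q \<inter> hom P Q"

definition rng_iso :: "('m, 'y) ring_scheme \<Rightarrow> ('n, 'z) ring_scheme \<Rightarrow> ('m \<Rightarrow> 'n) set" where
  "rng_iso P Q = {f \<in> rng_hom P Q. bij_betw f (carrier P) (carrier Q)}"

definition unital :: "'m ring \<Rightarrow> bool" where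
  "unital P \<longleftrightarrow> (\<exists>e\<in>carrier P. ring (P\<lparr>one := e\<rparr>))"


section \<open>Formal duals and herds\<close>

locale formal_dual =
  alpha: ring_hom_ring R A \<alpha> + beta: ring_hom_ring S B \<beta> +
  T: bimodule B A T + That: bimodule A B That
  for R :: "('r, 'x1) ring_scheme" and S :: "('s, 'x2) ring_scheme"
    and A :: "('a, 'x3) ring_scheme" and B :: "('b, 'x4) ring_scheme"
    and \<alpha> :: "'r \<Rightarrow> 'a" and \<beta> :: "'s \<Rightarrow> 'b"
    and T :: "('b, 't, 'a) bimod" and That :: "('a, 'p, 'b) bimod" +
  fixes ev :: "('p \<times> 't \<Rightarrow>\<^sub>0 int) set \<Rightarrow> 'a"
    and evh :: "('t \<times> 'p \<Rightarrow>\<^sub>0 int) set \<Rightarrow> 'b"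
  assumes ev_hom: "ev \<in> bimod_hom A A (restr id \<beta> That \<boxtimes>\<^bsub>S\<^esub> restr \<beta> id T) (regular A)"
    and evh_hom: "evh \<in> bimod_hom B B (restr id \<alpha> T \<boxtimes>\<^bsub>R\<^esub> restr \<alpha> id That) (regular B)"
    and evh_ev: "\<lbrakk>x \<in> carrier T; y \<in> carrier T; p \<in> carrier That\<rbrakk> \<Longrightarrow>
      evh (tens R (restr \<beta> \<alpha> T) (restr \<alpha> \<beta> That) x p) \<rightharpoonup>\<^bsub>T\<^esub> y =
      x \<leftharpoonup>\<^bsub>T\<^esub> ev (tens S (restr \<alpha> \<beta> That) (restr \<beta> \<alpha> T) p y)"
    and ev_evh: "\<lbrakk>x \<in> carrier T; p \<in> carrier That; q \<in> carrier That\<rbrakk> \<Longrightarrow>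
      p \<leftharpoonup>\<^bsub>That\<^esub> evh (tens R (restr \<beta> \<alpha> T) (restr \<alpha> \<beta> That) x q) =
      ev (tens S (restr \<alpha> \<beta> That) (restr \<beta> \<alpha> T) p x) \<rightharpoonup>\<^bsub>That\<^esub> q"
begin

text \<open>\<open>T\<close> as an \<open>S\<close>-\<open>R\<close> bimodule, \<open>That\<close> as an \<open>R\<close>-\<open>S\<close> bimodule, \<open>A\<close> as an \<open>R\<close>-bimodule and \<open>B\<close> as an
  \<open>S\<close>-bimodule.\<close>

abbreviation "T0 \<equiv> restr \<beta> \<alpha> T"
abbreviation "P0 \<equiv> restr \<alpha> \<beta> That"
abbreviation "A0 \<equiv> restr \<alpha> \<alpha> (regular A)"
abbreviation "B0 \<equiv> restr \<beta> \<beta> (regular B)"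

abbreviation "PT \<equiv> P0 \<boxtimes>\<^bsub>S\<^esub> T0"
abbreviation "TP \<equiv> T0 \<boxtimes>\<^bsub>R\<^esub> P0"
abbreviation "TPT \<equiv> T0 \<boxtimes>\<^bsub>R\<^esub> PT"
abbreviation "PTP \<equiv> P0 \<boxtimes>\<^bsub>S\<^esub> TP"

end

text \<open>Iterated tensor products are bracketed to the right throughout. In the coassociativity law the
  left-hand side takes values in \<open>TPT \<boxtimes>\<^bsub>R\<^esub> PT\<close>.\<close>

locale herd = formal_dual R S A B \<alpha> \<beta> T That ev evh
  for R :: "('r, 'x1) ring_scheme" and S :: "('s, 'x2) ring_scheme"
    and A :: "('a, 'x3) ring_scheme" and B :: "('b, 'x4) ring_scheme"
    and \<alpha> :: "'r \<Rightarrow> 'a" and \<beta> :: "'s \<Rightarrow> 'b"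
    and T :: "('b, 't, 'a) bimod" and That :: "('a, 'p, 'b) bimod"
    and ev :: "('p \<times> 't \<Rightarrow>\<^sub>0 int) set \<Rightarrow> 'a"
    and evh :: "('t \<times> 'p \<Rightarrow>\<^sub>0 int) set \<Rightarrow> 'b" +
  fixes \<gamma> :: "'t \<Rightarrow> ('t \<times> ('p \<times> 't \<Rightarrow>\<^sub>0 int) set \<Rightarrow>\<^sub>0 int) set"
  assumes shepherd_hom: "\<gamma> \<in> bimod_hom S R T0 TPT"
    and evh_shepherd: "x \<in> carrier T \<Longrightarrow>
      tensor_map S TP T0 B0 T0 evh id (assoc_inv R S T0 P0 T0 (\<gamma> x)) = tens S B0 T0 \<one>\<^bsub>B\<^esub> x"
    and ev_shepherd: "x \<in> carrier T \<Longrightarrow>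
      tensor_map R T0 PT T0 A0 id ev (\<gamma> x) = tens R T0 A0 x \<one>\<^bsub>A\<^esub>"
    and shepherd_coassoc: "x \<in> carrier T \<Longrightarrow>
      tensor_map R T0 (PT \<boxtimes>\<^bsub>R\<^esub> PT) T0 (P0 \<boxtimes>\<^bsub>S\<^esub> TPT) id (assoc S R P0 T0 PT)
        (assoc R R T0 PT PT (tensor_map R T0 PT TPT PT \<gamma> id (\<gamma> x))) =
      tensor_map R T0 PT T0 (P0 \<boxtimes>\<^bsub>S\<^esub> TPT) id (tensor_map S P0 T0 P0 TPT id \<gamma>) (\<gamma> x)"
begin

subsection \<open>The associated corings\<close>

definition C :: "('r, ('p \<times> 't \<Rightarrow>\<^sub>0 int) set, 'r) bimod" where
  "C = sub_bimod PT {c \<in> carrier PT.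
     tensor_map R PT PT A0 PT ev id
       (assoc_inv S R P0 T0 PT (tensor_map S P0 T0 P0 TPT id \<gamma> c)) = tens R A0 PT \<one>\<^bsub>A\<^esub> c}"

definition D :: "('s, ('t \<times> 'p \<Rightarrow>\<^sub>0 int) set, 's) bimod" where
  "D = sub_bimod TP {d \<in> carrier TP.
     tensor_map S TP TP TP B0 id evh
       (assoc_inv R S T0 P0 TP (tensor_map R T0 (PT \<boxtimes>\<^bsub>R\<^esub> P0) T0 PTP id (assoc S R P0 T0 P0)
         (assoc R R T0 PT P0 (tensor_map R T0 P0 TPT P0 \<gamma> id d)))) = tens S TP B0 d \<one>\<^bsub>B\<^esub>}"

definition counit_C :: "('p \<times> 't \<Rightarrow>\<^sub>0 int) set \<Rightarrow> 'r" where
  "counit_C c = inv_into (carrier R) \<alpha> (ev c)"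

definition counit_D :: "('t \<times> 'p \<Rightarrow>\<^sub>0 int) set \<Rightarrow> 's" where
  "counit_D d = inv_into (carrier S) \<beta> (evh d)"

subsection \<open>The associated coherd\<close>

text \<open>\<open>C \<boxtimes>\<^bsub>R\<^esub> P0\<close> and \<open>P0 \<boxtimes>\<^bsub>S\<^esub> D\<close> as subobjects of \<open>PTP\<close>.\<close>

definition CP :: "('p \<times> ('t \<times> 'p \<Rightarrow>\<^sub>0 int) set \<Rightarrow>\<^sub>0 int) set set" where
  "CP = (assoc S R P0 T0 P0 \<circ> tensor_map R C P0 PT P0 id id) ` carrier (C \<boxtimes>\<^bsub>R\<^esub> P0)"

definition PD :: "('p \<times> ('t \<times> 'p \<Rightarrow>\<^sub>0 int) set \<Rightarrow>\<^sub>0 int) set set" where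
  "PD = tensor_map S P0 D P0 TP id id ` carrier (P0 \<boxtimes>\<^bsub>S\<^esub> D)"

definition Tbar :: "('r, ('p \<times> ('t \<times> 'p \<Rightarrow>\<^sub>0 int) set \<Rightarrow>\<^sub>0 int) set, 's) bimod" where
  "Tbar = sub_bimod PTP (CP \<inter> PD)"

abbreviation "TbT \<equiv> Tbar \<boxtimes>\<^bsub>S\<^esub> T0"
abbreviation "TTb \<equiv> T0 \<boxtimes>\<^bsub>R\<^esub> Tbar"

definition chi :: "('t \<times> (('p \<times> ('t \<times> 'p \<Rightarrow>\<^sub>0 int) set \<Rightarrow>\<^sub>0 int) set \<times> 't \<Rightarrow>\<^sub>0 int) set \<Rightarrow>\<^sub>0 int) set \<Rightarrow> 't"
  where "chi = tensor_lift R T0 TbT T (\<lambda>x. tensor_lift S Tbar T0 T (\<lambda>w z.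
     tensor_lift S P0 TP T (\<lambda>p. tensor_lift R T0 P0 T (\<lambda>y q.
       (evh (tens R T0 P0 x p) \<rightharpoonup>\<^bsub>T\<^esub> y) \<leftharpoonup>\<^bsub>T\<^esub> ev (tens S P0 T0 q z))) w))"

text \<open>\<open>cov\<close> and \<open>covbar\<close> are the coproducts of \<open>C\<close> and \<open>D\<close>, pulled back along the inclusions of
  \<open>TbT\<close> and \<open>TTb\<close> into the four-fold tensor products (which are injective by flatness of \<open>T\<close>).\<close>

definition incl_TbT where
  "incl_TbT = tensor_map S P0 (TP \<boxtimes>\<^bsub>S\<^esub> T0) P0 TPT id (assoc R S T0 P0 T0) \<circ>
     assoc S S P0 TP T0 \<circ> tensor_map S Tbar T0 PTP T0 id id"

definition incl_TTb where
  "incl_TTb = tensor_map R T0 Tbar T0 PTP id id"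

definition cov where
  "cov c = inv_into (carrier TbT) incl_TbT (tensor_map S P0 T0 P0 TPT id \<gamma> c)"

definition covbar where
  "covbar d = inv_into (carrier TTb) incl_TTb
     (tensor_map R T0 (PT \<boxtimes>\<^bsub>R\<^esub> P0) T0 PTP id (assoc S R P0 T0 P0)
       (assoc R R T0 PT P0 (tensor_map R T0 P0 TPT P0 \<gamma> id d)))"

definition h :: "('p \<times> ('t \<times> 'p \<Rightarrow>\<^sub>0 int) set \<Rightarrow>\<^sub>0 int) set \<Rightarrow> 'p" where
  "h = tensor_lift S P0 TP That (\<lambda>p. tensor_lift R T0 P0 That (\<lambda>x q.
     ev (tens S P0 T0 p x) \<rightharpoonup>\<^bsub>That\<^esub> q))"

subsection \<open>The rings obtained from the coherd\<close>

text \<open>A coequaliser of bimodule maps \<open>f\<close>, \<open>g\<close> is the quotient by the image of \<open>f - g\<close>. Once \<open>TbT\<close> is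
  given its product, this quotient together with the induced product is \<^const>\<open>FactRing\<close>.\<close>

definition mult_A where
  "mult_A = tensor_map S Tbar (T0 \<boxtimes>\<^bsub>R\<^esub> TbT) Tbar T0 id chi \<circ> assoc S R Tbar T0 TbT"

definition mult_B where
  "mult_B = tensor_map R (TTb \<boxtimes>\<^bsub>S\<^esub> T0) Tbar T0 Tbar (chi \<circ> assoc R S T0 Tbar T0) id \<circ>
     assoc_inv S R TTb T0 Tbar"

definition ker_A where
  "ker_A = (\<lambda>u. mult_A (tensor_map R C TbT TbT TbT cov id u) \<ominus>\<^bsub>TbT\<^esub>
     tensor_lift R C TbT TbT (\<lambda>c w. counit_C c \<rightharpoonup>\<^bsub>TbT\<^esub> w) u) ` carrier (C \<boxtimes>\<^bsub>R\<^esub> TbT)"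

definition ker_B where
  "ker_B = (\<lambda>u. mult_B (tensor_map S TTb D TTb TTb id covbar u) \<ominus>\<^bsub>TTb\<^esub>
     tensor_lift S TTb D TTb (\<lambda>w d. w \<leftharpoonup>\<^bsub>TTb\<^esub> counit_D d) u) ` carrier (TTb \<boxtimes>\<^bsub>S\<^esub> D)"

definition A' where
  "A' = TbT\<lparr>monoid.mult := \<lambda>u v. mult_A (tens R TbT TbT u v)\<rparr> Quot ker_A"

definition B' where
  "B' = TTb\<lparr>monoid.mult := \<lambda>u v. mult_B (tens S TTb TTb u v)\<rparr> Quot ker_B"

definition pi_A where "pi_A w = ker_A +>\<^bsub>TbT\<^esub> w"

definition pi_B where "pi_B w = ker_B +>\<^bsub>TTb\<^esub> w"

text \<open>The maps from \<open>TbT\<close> to \<open>A\<close> and from \<open>TTb\<close> to \<open>B\<close> that evaluate both factors; on elementary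
  tensors of \<open>PTP \<boxtimes>\<^bsub>S\<^esub> T0\<close> the first one sends \<open>p \<otimes> x \<otimes> q \<otimes> y\<close> to the product of
  \<open>ev (p \<otimes> x)\<close> and \<open>ev (q \<otimes> y)\<close>.\<close>

definition eval_A where "eval_A w = ev (tensor_map S Tbar T0 P0 T0 h id w)"

definition eval_B where "eval_B w = evh (tensor_map R T0 Tbar T0 P0 id h w)"

end

locale tame_herd = herd R S A B \<alpha> \<beta> T That ev evh \<gamma>
  for R :: "('r, 'x1) ring_scheme" and S :: "('s, 'x2) ring_scheme"
    and A :: "('a, 'x3) ring_scheme" and B :: "('b, 'x4) ring_scheme"
    and \<alpha> :: "'r \<Rightarrow> 'a" and \<beta> :: "'s \<Rightarrow> 'b"
    and T :: "('b, 't, 'a) bimod" and That :: "('a, 'p, 'b) bimod"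
    and ev :: "('p \<times> 't \<Rightarrow>\<^sub>0 int) set \<Rightarrow> 'a"
    and evh :: "('t \<times> 'p \<Rightarrow>\<^sub>0 int) set \<Rightarrow> 'b"
    and \<gamma> :: "'t \<Rightarrow> ('t \<times> ('p \<times> 't \<Rightarrow>\<^sub>0 int) set \<Rightarrow>\<^sub>0 int) set" +
  assumes ev_surj: "ev ` carrier PT = carrier A"
    and evh_surj: "evh ` carrier TP = carrier B"
    and T_right_ff: "faithfully_flat_right TYPE(('r, 's, 'a, 'b, 't, 'p) test) R T0"
    and T_left_ff: "faithfully_flat_left TYPE(('r, 's, 'a, 'b, 't, 'p) test) S T0"

end

theory Submission
  imports Defs
begin

text \<open>The balanced map \<open>x \<otimes> v \<mapsto> x \<cdot> eval_A v\<close> is \<open>chi\<close>, so the product of \<open>TbT\<close> is \<open>u v = u \<cdot> eval_A v\<close>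
  and \<open>eval_A\<close> is multiplicative; it kills the relations of \<open>A'\<close> because \<open>eval_A (cov c) = ev c\<close>.
  Faithful flatness of \<open>T\<close> provides \<open>c \<in> C\<close> with \<open>ev c = 1\<close>, and for such \<open>c\<close> the relation at
  \<open>c \<otimes> v\<close> shows that every \<open>v\<close> with \<open>eval_A v = 0\<close> vanishes in \<open>A'\<close>. Hence \<open>\<nu>\<^sub>A\<close> is always
  injective, and it is surjective as soon as \<open>h\<close> is. In (3), \<open>h (p \<otimes> d) = p\<close> for any \<open>d \<in> D\<close> with
  \<open>evh d = 1\<close>.

  The delicate point is that \<open>cov\<close> and \<open>covbar\<close> exist, that is, that the coproduct of \<open>C\<close> takes values in
  \<open>TbT\<close>. Since \<open>PT\<close> is not assumed flat, one first tensors with \<open>T\<close>: there the inclusion of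
  \<open>C\<close> into \<open>PT\<close> is split by \<open>x \<otimes> p \<otimes> y \<mapsto> evh (x \<otimes> p) \<gamma> y\<close>, and faithful flatness descends the conclusion.\<close>

text \<open>The hinge behind the descent arguments is that \<open>\<gamma>\<close> itself takes
  values in T \<otimes> C and in D \<otimes> T. Coassociativity and one counit law place
  \<open>\<gamma> x\<close> in the equalizer that defines the coring, and tensoring with a flat
  module preserves equalizers. Therefore the coproduct of \<open>c\<close> lies in C \<otimes> P
  \<otimes> T and also in P \<otimes> D \<otimes> T (P being \<open>That\<close>), and flatness of T
  preserves the intersection that defines \<open>Tbar\<close>. The counits land in R and S by the
  same kind of descent, with injectivity of \<alpha> and \<beta> obtained along the way.

  Two constraints shape the details. Flatness speaks only about test modules whose carrier lies in
  one fixed infinite type, so every sequence is copied into that type, and a cardinality bound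
  guarantees that iterated tensor products fit. Moreover \<open>tensor_lift\<close> is a definite
  description, meaningful only if a suitable additive map exists; nested lifts such as those in
  \<open>h\<close> and \<open>chi\<close> therefore receive closed forms from the inside out before
  balancedness of the outer map can be shown.\<close>

lemma add_hom_iff:
  "f \<in> add_hom M N \<longleftrightarrow> (\<forall>x\<in>carrier M. f x \<in> carrier N) \<and>
     (\<forall>x\<in>carrier M. \<forall>y\<in>carrier M. f (x \<oplus>\<^bsub>M\<^esub> y) = f x \<oplus>\<^bsub>N\<^esub> f y)"
  by (auto simp: add_hom_def hom_def)

lemma add_homI:
  assumes "\<And>x. x \<in> carrier M \<Longrightarrow> f x \<in> carrier N"
    and "\<And>x y. \<lbrakk>x \<in> carrier M; y \<in> carrier M\<rbrakk> \<Longrightarrow> f (x \<oplus>\<^bsub>M\<^esub> y) = f x \<oplus>\<^bsub>N\<^esub> f y"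
  shows "f \<in> add_hom M N"
  using assms by (simp add: add_hom_iff)

lemma add_hom_closed: "\<lbrakk>f \<in> add_hom M N; x \<in> carrier M\<rbrakk> \<Longrightarrow> f x \<in> carrier N"
  by (simp add: add_hom_iff)

lemma add_hom_add:
  "\<lbrakk>f \<in> add_hom M N; x \<in> carrier M; y \<in> carrier M\<rbrakk> \<Longrightarrow> f (x \<oplus>\<^bsub>M\<^esub> y) = f x \<oplus>\<^bsub>N\<^esub> f y"
  by (simp add: add_hom_iff)

lemma add_hom_zero:
  assumes "abelian_group M" "abelian_group N" "f \<in> add_hom M N"
  shows "f \<zero>\<^bsub>M\<^esub> = \<zero>\<^bsub>N\<^esub>"
proof -
  interpret M: abelian_group M by fact
  interpret N: abelian_group N by fact
  have "f \<zero>\<^bsub>M\<^esub> \<oplus>\<^bsub>N\<^esub> f \<zero>\<^bsub>M\<^esub> = f \<zero>\<^bsub>M\<^esub>"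
    using add_hom_add[OF assms(3), of "\<zero>\<^bsub>M\<^esub>" "\<zero>\<^bsub>M\<^esub>"] by simp
  then show ?thesis
    using add_hom_closed[OF assms(3), of "\<zero>\<^bsub>M\<^esub>"] by (metis M.zero_closed N.add.l_cancel_one)
qed

lemma add_hom_minus:
  assumes "abelian_group M" "abelian_group N" "f \<in> add_hom M N" "x \<in> carrier M"
  shows "f (\<ominus>\<^bsub>M\<^esub> x) = \<ominus>\<^bsub>N\<^esub> f x"
proof -
  interpret M: abelian_group M by fact
  interpret N: abelian_group N by fact
  have "f (\<ominus>\<^bsub>M\<^esub> x) \<oplus>\<^bsub>N\<^esub> f x = \<zero>\<^bsub>N\<^esub>"
    using add_hom_add[OF assms(3), of "\<ominus>\<^bsub>M\<^esub> x" x] assms add_hom_zero[OF assms(1-3)]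
    by (simp add: M.l_neg)
  then show ?thesis
    using N.minus_equality assms add_hom_closed[OF assms(3)] by fastforce
qed

lemma add_hom_diff:
  assumes "abelian_group M" "abelian_group N" "f \<in> add_hom M N" "x \<in> carrier M" "y \<in> carrier M"
  shows "f (x \<ominus>\<^bsub>M\<^esub> y) = f x \<ominus>\<^bsub>N\<^esub> f y"
proof -
  interpret M: abelian_group M by fact
  show ?thesis
    using assms by (simp add: a_minus_def add_hom_add[OF assms(3)] add_hom_minus[OF assms(1-3)])
qed

text \<open>The additive group of a record does not see its actions, its product or further fields.
  This carries it over to \<open>restr\<close>, \<open>regular\<close>, the tensor product and the
  records whose product is redefined.\<close>

lemma abelian_group_cong:
  assumes "abelian_group M" "carrier M' = carrier M" "ring.add M' = ring.add M" "\<zero>\<^bsub>M'\<^esub> = \<zero>\<^bsub>M\<^esub>"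
  shows "abelian_group M'"
proof -
  interpret abelian_group M by fact
  show ?thesis
    using assms(2-) by (intro abelian_groupI) (auto simp: a_ac intro: l_neg)
qed

lemma left_hom_iff: "f \<in> left_hom R M N \<longleftrightarrow> f \<in> add_hom M N \<and>
     (\<forall>a\<in>carrier R. \<forall>x\<in>carrier M. f (a \<rightharpoonup>\<^bsub>M\<^esub> x) = a \<rightharpoonup>\<^bsub>N\<^esub> f x)"
  by (auto simp: left_hom_def)

lemma right_hom_iff: "f \<in> right_hom R M N \<longleftrightarrow> f \<in> add_hom M N \<and>
     (\<forall>a\<in>carrier R. \<forall>x\<in>carrier M. f (x \<leftharpoonup>\<^bsub>M\<^esub> a) = f x \<leftharpoonup>\<^bsub>N\<^esub> a)"
  by (auto simp: right_hom_def)

lemma left_hom_add_hom: "f \<in> left_hom R M N \<Longrightarrow> f \<in> add_hom M N"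
  by (simp add: left_hom_iff)

lemma right_hom_add_hom: "f \<in> right_hom R M N \<Longrightarrow> f \<in> add_hom M N"
  by (simp add: right_hom_iff)

lemma left_hom_lact:
  "\<lbrakk>f \<in> left_hom R M N; a \<in> carrier R; x \<in> carrier M\<rbrakk> \<Longrightarrow> f (a \<rightharpoonup>\<^bsub>M\<^esub> x) = a \<rightharpoonup>\<^bsub>N\<^esub> f x"
  by (simp add: left_hom_iff)

lemma right_hom_ract:
  "\<lbrakk>f \<in> right_hom R M N; a \<in> carrier R; x \<in> carrier M\<rbrakk> \<Longrightarrow> f (x \<leftharpoonup>\<^bsub>M\<^esub> a) = f x \<leftharpoonup>\<^bsub>N\<^esub> a"
  by (simp add: right_hom_iff)

lemma id_left_hom [simp]: "id \<in> left_hom R M M"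
  by (simp add: left_hom_iff add_hom_iff)

lemma id_right_hom [simp]: "id \<in> right_hom R M M"
  by (simp add: right_hom_iff add_hom_iff)

lemma ident_left_hom [simp]: "(\<lambda>x. x) \<in> left_hom R M M"
  by (simp add: left_hom_iff add_hom_iff)

lemma ident_right_hom [simp]: "(\<lambda>x. x) \<in> right_hom R M M"
  by (simp add: right_hom_iff add_hom_iff)

section \<open>The universal property of the tensor product\<close>

lemma left_moduleD:
  assumes "left_module R M"
  shows left_module_ring: "ring R" and left_module_abelian_group: "abelian_group M"
  using assms by (auto simp: left_module_def)

lemma right_moduleD:
  assumes "right_module R M"
  shows right_module_ring: "ring R" and right_module_abelian_group: "abelian_group M"
  using assms by (auto simp: right_module_def)

lemma tensor_rels_carrier:
  assumes "right_module R M" "left_module R N"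
  shows "tensor_rels R M N \<subseteq> carrier (free_Abelian_group (carrier M \<times> carrier N))"
proof -
  interpret M: right_module R M by fact
  interpret N: left_module R N by fact
  show ?thesis
    unfolding tensor_rels_def
    by (auto simp: M.ract_closed N.lact_closed dest!: subsetD[OF keys_diff])
qed

lemma tensor_ker_subgroup:
  assumes "right_module R M" "left_module R N"
  shows "subgroup (tensor_ker R M N) (free_Abelian_group (carrier M \<times> carrier N))"
  unfolding tensor_ker_def
  by (simp add: group.generate_is_subgroup tensor_rels_carrier[OF assms])

lemma tensor_ker_normal:
  assumes "right_module R M" "left_module R N"
  shows "tensor_ker R M N \<lhd> free_Abelian_group (carrier M \<times> carrier N)"
  by (simp add: abelian_free_Abelian_group comm_group.subgroup_imp_normal tensor_ker_subgroup[OF assms])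

text \<open>The actions on a tensor product are themselves lifts into \<open>tensor_group\<close>,
  so everything additive is settled on this common underlying group before the actions are
  touched.\<close>

lemma tensor_simps:
  "carrier (M \<boxtimes>\<^bsub>R\<^esub> N) = carrier (tensor_group R M N)"
  "ring.add (M \<boxtimes>\<^bsub>R\<^esub> N) = ring.add (tensor_group R M N)"
  "ring.zero (M \<boxtimes>\<^bsub>R\<^esub> N) = ring.zero (tensor_group R M N)"
  by (simp_all add: tensor_def ring.defs bimod.defs)

lemma tensor_abelian_group [simp]:
  assumes "right_module R M" "left_module R N"
  shows "abelian_group (M \<boxtimes>\<^bsub>R\<^esub> N)"
proof -
  let ?G = "free_Abelian_group (carrier M \<times> carrier N)"
  have "comm_group (?G Mod tensor_ker R M N)"
    by (simp add: abelian_free_Abelian_group comm_group.abelian_FactGroup tensor_ker_subgroup[OF assms])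
  then have "comm_group (add_monoid (tensor_group R M N))"
    by (simp add: tensor_group_def Let_def FactGroup_def)
  then have "abelian_group (tensor_group R M N)"
    by (rule comm_group_abelian_groupI)
  then show ?thesis
    by (rule abelian_group_cong) (simp_all add: tensor_simps)
qed

lemma carrier_tensor:
  "carrier (M \<boxtimes>\<^bsub>R\<^esub> N) = (\<lambda>f. tensor_ker R M N #>\<^bsub>free_Abelian_group (carrier M \<times> carrier N)\<^esub> f) `
     carrier (free_Abelian_group (carrier M \<times> carrier N))"
  by (auto simp: tensor_simps tensor_group_def Let_def FactGroup_def RCOSETS_def)

lemma tensor_add_rcos:
  assumes "right_module R M" "left_module R N"
    and "Poly_Mapping.keys f \<subseteq> carrier M \<times> carrier N" "Poly_Mapping.keys g \<subseteq> carrier M \<times> carrier N"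
  defines "G \<equiv> free_Abelian_group (carrier M \<times> carrier N)"
  shows "(tensor_ker R M N #>\<^bsub>G\<^esub> f) \<oplus>\<^bsub>M \<boxtimes>\<^bsub>R\<^esub> N\<^esub> (tensor_ker R M N #>\<^bsub>G\<^esub> g) = tensor_ker R M N #>\<^bsub>G\<^esub> (f + g)"
  using normal.rcos_sum[OF tensor_ker_normal[OF assms(1,2)], of f g] assms(3,4)
  by (simp add: tensor_simps tensor_group_def Let_def FactGroup_def G_def)

lemma tens_closed [simp]:
  assumes "x \<in> carrier M" "y \<in> carrier N"
  shows "tens R M N x y \<in> carrier (M \<boxtimes>\<^bsub>R\<^esub> N)"
  using assms unfolding tens_def carrier_tensor by (intro imageI) simp

lemma tensor_ker_rcos_eqI:
  assumes "right_module R M" "left_module R N"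
    and "Poly_Mapping.keys f \<subseteq> carrier M \<times> carrier N" "Poly_Mapping.keys g \<subseteq> carrier M \<times> carrier N"
    and "f - g \<in> tensor_ker R M N"
  defines "G \<equiv> free_Abelian_group (carrier M \<times> carrier N)"
  shows "tensor_ker R M N #>\<^bsub>G\<^esub> f = tensor_ker R M N #>\<^bsub>G\<^esub> g"
proof -
  interpret G: group G
    by (simp add: G_def)
  have K: "subgroup (tensor_ker R M N) G"
    using tensor_ker_subgroup[OF assms(1,2)] by (simp add: G_def)
  have "f \<otimes>\<^bsub>G\<^esub> inv\<^bsub>G\<^esub> g \<in> tensor_ker R M N"
    using assms(3-5) by (simp add: G_def)
  then have "f \<in> tensor_ker R M N #>\<^bsub>G\<^esub> g"
    using K subgroup.rcos_module_rev[OF K G.is_group, of g f] assms(3,4) by (simp add: G_def)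
  then show ?thesis
    using G.repr_independence[OF _ _ K, of f g] assms(3,4) by (simp add: G_def)
qed

context
  fixes R :: "('r, 'z) ring_scheme" and M :: "('l, 'm, 'r) bimod" and N :: "('r, 'n, 'k) bimod"
  assumes M: "right_module R M" and N: "left_module R N"
begin

interpretation M: right_module R M by (rule M)
interpretation N: left_module R N by (rule N)

lemma tens_add_left:
  assumes "x \<in> carrier M" "x' \<in> carrier M" "y \<in> carrier N"
  shows "tens R M N (x \<oplus>\<^bsub>M\<^esub> x') y = tens R M N x y \<oplus>\<^bsub>M \<boxtimes>\<^bsub>R\<^esub> N\<^esub> tens R M N x' y"
proof -
  have "tens R M N (x \<oplus>\<^bsub>M\<^esub> x') y =
    tensor_ker R M N #>\<^bsub>free_Abelian_group (carrier M \<times> carrier N)\<^esub> (frag_of (x, y) + frag_of (x', y))"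
    unfolding tens_def
  proof (rule tensor_ker_rcos_eqI[OF M N])
    show "frag_of (x \<oplus>\<^bsub>M\<^esub> x', y) - (frag_of (x, y) + frag_of (x', y)) \<in> tensor_ker R M N"
      unfolding tensor_ker_def
      using assms by (intro generate.incl) (force simp: tensor_rels_def diff_diff_eq)
  qed (use assms in \<open>auto simp: dest!: subsetD[OF keys_add]\<close>)
  then show ?thesis
    using assms tensor_add_rcos[OF M N, of "frag_of (x, y)" "frag_of (x', y)"] by (simp add: tens_def)
qed

lemma tens_add_right:
  assumes "x \<in> carrier M" "y \<in> carrier N" "y' \<in> carrier N"
  shows "tens R M N x (y \<oplus>\<^bsub>N\<^esub> y') = tens R M N x y \<oplus>\<^bsub>M \<boxtimes>\<^bsub>R\<^esub> N\<^esub> tens R M N x y'"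
proof -
  have "tens R M N x (y \<oplus>\<^bsub>N\<^esub> y') =
    tensor_ker R M N #>\<^bsub>free_Abelian_group (carrier M \<times> carrier N)\<^esub> (frag_of (x, y) + frag_of (x, y'))"
    unfolding tens_def
  proof (rule tensor_ker_rcos_eqI[OF M N])
    show "frag_of (x, y \<oplus>\<^bsub>N\<^esub> y') - (frag_of (x, y) + frag_of (x, y')) \<in> tensor_ker R M N"
      unfolding tensor_ker_def
      using assms by (intro generate.incl) (force simp: tensor_rels_def diff_diff_eq)
  qed (use assms in \<open>auto simp: dest!: subsetD[OF keys_add]\<close>)
  then show ?thesis
    using assms tensor_add_rcos[OF M N, of "frag_of (x, y)" "frag_of (x, y')"] by (simp add: tens_def)
qed

lemma tens_ract:
  assumes "x \<in> carrier M" "y \<in> carrier N" "a \<in> carrier R"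
  shows "tens R M N (x \<leftharpoonup>\<^bsub>M\<^esub> a) y = tens R M N x (a \<rightharpoonup>\<^bsub>N\<^esub> y)"
  unfolding tens_def
proof (rule tensor_ker_rcos_eqI[OF M N])
  show "frag_of (x \<leftharpoonup>\<^bsub>M\<^esub> a, y) - frag_of (x, a \<rightharpoonup>\<^bsub>N\<^esub> y) \<in> tensor_ker R M N"
    unfolding tensor_ker_def
    using assms by (intro generate.incl) (force simp: tensor_rels_def)
qed (use assms M.ract_closed N.lact_closed in auto)

lemma tens_zero_left: "y \<in> carrier N \<Longrightarrow> tens R M N \<zero>\<^bsub>M\<^esub> y = \<zero>\<^bsub>M \<boxtimes>\<^bsub>R\<^esub> N\<^esub>"
  using add_hom_zero[of M "M \<boxtimes>\<^bsub>R\<^esub> N" "\<lambda>x. tens R M N x y"]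
  by (simp add: add_hom_iff tens_add_left M N right_module_abelian_group[OF M])

lemma tens_zero_right: "x \<in> carrier M \<Longrightarrow> tens R M N x \<zero>\<^bsub>N\<^esub> = \<zero>\<^bsub>M \<boxtimes>\<^bsub>R\<^esub> N\<^esub>"
  using add_hom_zero[of N "M \<boxtimes>\<^bsub>R\<^esub> N" "\<lambda>y. tens R M N x y"]
  by (simp add: add_hom_iff tens_add_right M N left_module_abelian_group[OF N])

lemma tens_minus_left:
  "\<lbrakk>x \<in> carrier M; y \<in> carrier N\<rbrakk> \<Longrightarrow> tens R M N (\<ominus>\<^bsub>M\<^esub> x) y = \<ominus>\<^bsub>M \<boxtimes>\<^bsub>R\<^esub> N\<^esub> tens R M N x y"
  using add_hom_minus[of M "M \<boxtimes>\<^bsub>R\<^esub> N" "\<lambda>x. tens R M N x y"]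
  by (simp add: add_hom_iff tens_add_left M N right_module_abelian_group[OF M])

end

text \<open>Elements come from integer combinations of pairs, but a negative coefficient is absorbed
  by \<open>- (x \<otimes> y) = (- x) \<otimes> y\<close>. Hence elementary tensors and sums are the
  only cases.\<close>

lemma tensor_induct [consumes 3, case_names tens add]:
  assumes M: "right_module R M" and N: "left_module R N" and u: "u \<in> carrier (M \<boxtimes>\<^bsub>R\<^esub> N)"
    and tens: "\<And>x y. \<lbrakk>x \<in> carrier M; y \<in> carrier N\<rbrakk> \<Longrightarrow> P (tens R M N x y)"
    and add: "\<And>u v. \<lbrakk>u \<in> carrier (M \<boxtimes>\<^bsub>R\<^esub> N); v \<in> carrier (M \<boxtimes>\<^bsub>R\<^esub> N); P u; P v\<rbrakk> \<Longrightarrow> P (u \<oplus>\<^bsub>M \<boxtimes>\<^bsub>R\<^esub> N\<^esub> v)"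
  shows "P u"
proof -
  interpret M: right_module R M by (rule M)
  interpret N: left_module R N by (rule N)
  let ?Z = "carrier M \<times> carrier N"
  let ?q = "\<lambda>f. tensor_ker R M N #>\<^bsub>free_Abelian_group ?Z\<^esub> f"
  have q: "?q f \<in> carrier (M \<boxtimes>\<^bsub>R\<^esub> N)" if "Poly_Mapping.keys f \<subseteq> ?Z" for f
    using that by (auto simp: carrier_tensor)
  \<comment> \<open>The coset of 0 is idempotent under addition, hence zero, and zero is the
    elementary tensor of two zeros; so \<open>tens\<close> covers it.\<close>
  have q0: "?q 0 = tens R M N \<zero>\<^bsub>M\<^esub> \<zero>\<^bsub>N\<^esub>"
  proof -
    interpret T: abelian_group "M \<boxtimes>\<^bsub>R\<^esub> N" using M N by simp
    have "?q 0 \<oplus>\<^bsub>M \<boxtimes>\<^bsub>R\<^esub> N\<^esub> ?q 0 = ?q 0"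
      using tensor_add_rcos[OF M N, of 0 0] by simp
    then show ?thesis
      using q[of 0] by (simp add: T.add.l_cancel_one tens_zero_left M N)
  qed
  have P0: "P (?q 0)"
    unfolding q0 by (rule tens) auto
  \<comment> \<open>Induction on the free abelian group forms differences \<open>f - g\<close>,
    whereas \<open>P\<close> is only known to pass to sums. Carrying \<open>P\<close> for
    \<open>f\<close> and \<open>- f\<close> together turns a difference into a sum.\<close>
  have main: "P (?q f) \<and> P (?q (- f))" if "Poly_Mapping.keys f \<subseteq> ?Z" for f
    using that
  proof (induction f rule: free_Abelian_group_induct [consumes 1])
    case (3 a)
    then obtain x y where z: "a = (x, y)" "x \<in> carrier M" "y \<in> carrier N" by auto
    interpret T: abelian_group "M \<boxtimes>\<^bsub>R\<^esub> N" using M N by simp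
    have kb: "Poly_Mapping.keys (frag_of a) \<subseteq> ?Z" using z by simp
    have pos: "?q (frag_of a) = tens R M N x y"
      by (simp add: z tens_def)
    have "?q (frag_of a) \<oplus>\<^bsub>M \<boxtimes>\<^bsub>R\<^esub> N\<^esub> ?q (- frag_of a) = \<zero>\<^bsub>M \<boxtimes>\<^bsub>R\<^esub> N\<^esub>"
      using tensor_add_rcos[OF M N, of "frag_of a" "- frag_of a"] z q0 by (simp add: tens_zero_left M N)
    then have "?q (- frag_of a) = \<ominus>\<^bsub>M \<boxtimes>\<^bsub>R\<^esub> N\<^esub> ?q (frag_of a)"
      using q[of "frag_of a"] q[of "- frag_of a"] z by (metis "3"(1) T.add.inv_equality T.add.m_comm keys_minus kb)
    then have neg: "?q (- frag_of a) = tens R M N (\<ominus>\<^bsub>M\<^esub> x) y"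
      using z by (simp add: tens_def tens_minus_left[OF M N, unfolded tens_def])
    show ?case
      unfolding pos neg using z by (auto intro: tens)
  next
    case (2 f g)
    have kg: "Poly_Mapping.keys (- g) \<subseteq> ?Z" "Poly_Mapping.keys (- f) \<subseteq> ?Z"
      using 2 by simp_all
    have "P (?q (f + - g))" "P (?q (- f + g))"
      using 2 kg tensor_add_rcos[OF M N, of f "- g", symmetric] tensor_add_rcos[OF M N, of "- f" g, symmetric]
      by (auto intro!: add q)
    then show ?case by (simp add: algebra_simps)
  qed (use P0 in simp)
  show ?thesis
    using u main by (auto simp: carrier_tensor)
qed

text \<open>The group structure of the target is part of the notion, so that this single condition
  yields the existence of the lift, its additivity and its values.\<close>

definition balanced :: "('r, 'z) ring_scheme \<Rightarrow> ('l, 'm, 'r) bimod \<Rightarrow> ('r, 'n, 'k) bimod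
    \<Rightarrow> ('w, 'y) ring_scheme \<Rightarrow> ('m \<Rightarrow> 'n \<Rightarrow> 'w) \<Rightarrow> bool" where
  "balanced R M N K \<phi> \<longleftrightarrow> abelian_group K \<and>
     (\<forall>x\<in>carrier M. \<forall>y\<in>carrier N. \<phi> x y \<in> carrier K) \<and>
     (\<forall>x\<in>carrier M. \<forall>x'\<in>carrier M. \<forall>y\<in>carrier N. \<phi> (x \<oplus>\<^bsub>M\<^esub> x') y = \<phi> x y \<oplus>\<^bsub>K\<^esub> \<phi> x' y) \<and>
     (\<forall>x\<in>carrier M. \<forall>y\<in>carrier N. \<forall>y'\<in>carrier N. \<phi> x (y \<oplus>\<^bsub>N\<^esub> y') = \<phi> x y \<oplus>\<^bsub>K\<^esub> \<phi> x y') \<and>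
     (\<forall>x\<in>carrier M. \<forall>a\<in>carrier R. \<forall>y\<in>carrier N. \<phi> (x \<leftharpoonup>\<^bsub>M\<^esub> a) y = \<phi> x (a \<rightharpoonup>\<^bsub>N\<^esub> y))"

text \<open>The values on pairs extend to the free abelian group. Biadditivity and balancedness say
  exactly that the extension kills the generators of \<open>tensor_ker\<close>, so it factors
  through the quotient.\<close>

lemma tensor_universal:
  assumes M: "right_module R M" and N: "left_module R N" and \<phi>: "balanced R M N K \<phi>"
  obtains f where "f \<in> add_hom (M \<boxtimes>\<^bsub>R\<^esub> N) K"
    "\<And>x y. \<lbrakk>x \<in> carrier M; y \<in> carrier N\<rbrakk> \<Longrightarrow> f (tens R M N x y) = \<phi> x y"
proof -
  interpret M: right_module R M by (rule M)
  interpret N: left_module R N by (rule N)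
  interpret K: abelian_group K using \<phi> by (simp add: balanced_def)
  let ?G = "free_Abelian_group (carrier M \<times> carrier N)" and ?H = "add_monoid K"
  interpret H: comm_group ?H by (rule K.a_comm_group)
  obtain g where g: "g \<in> hom ?G ?H"
    and g_of: "\<And>z. z \<in> carrier M \<times> carrier N \<Longrightarrow> g (frag_of z) = (case z of (x, y) \<Rightarrow> \<phi> x y)"
  proof (rule comm_group.free_Abelian_group_universal[OF K.a_comm_group, where f = "case_prod \<phi>" and S = "carrier M \<times> carrier N"])
    show "case_prod \<phi> ` (carrier M \<times> carrier N) \<subseteq> carrier ?H"
      using \<phi> by (auto simp: balanced_def)
  qed auto
  interpret g: group_hom ?G ?H g
    using g by (simp add: group_hom_def group_hom_axioms_def)
  have g_diff: "g (u - v) = g u \<ominus>\<^bsub>K\<^esub> g v"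
    if "Poly_Mapping.keys u \<subseteq> carrier M \<times> carrier N" "Poly_Mapping.keys v \<subseteq> carrier M \<times> carrier N" for u v
  proof -
    have "g (u - v) = g u \<otimes>\<^bsub>?H\<^esub> g (- v)"
      using that g.hom_mult[of u "- v"] by simp
    moreover have "g (- v) = inv\<^bsub>?H\<^esub> g v"
      using that g.hom_inv[of v] by simp
    ultimately show ?thesis
      by (simp add: a_minus_def a_inv_def)
  qed
  have keys: "Poly_Mapping.keys (u - v) \<subseteq> carrier M \<times> carrier N"
    if "Poly_Mapping.keys u \<subseteq> carrier M \<times> carrier N" "Poly_Mapping.keys v \<subseteq> carrier M \<times> carrier N"
    for u v
    using that keys_diff[of u v] by blast
  have c: "\<phi> x y \<in> carrier K" if "x \<in> carrier M" "y \<in> carrier N" for x y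
    using \<phi> that by (simp add: balanced_def)
  have neg: "a \<oplus>\<^bsub>K\<^esub> (b \<oplus>\<^bsub>K\<^esub> (\<ominus>\<^bsub>K\<^esub> a \<oplus>\<^bsub>K\<^esub> \<ominus>\<^bsub>K\<^esub> b)) = \<zero>\<^bsub>K\<^esub>"
    if "a \<in> carrier K" "b \<in> carrier K" for a b
    using that K.r_neg[of "a \<oplus>\<^bsub>K\<^esub> b"] by (simp add: K.minus_add K.a_assoc)
  have "tensor_rels R M N \<subseteq> kernel ?G ?H g"
    unfolding tensor_rels_def kernel_def
    using \<phi> M.ract_closed N.lact_closed
    by (auto simp: keys g_diff g_of balanced_def c a_minus_def K.a_assoc K.r_neg neg
        dest!: subsetD[OF keys_diff])
  then have ker: "tensor_ker R M N \<subseteq> kernel ?G ?H g"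
    unfolding tensor_ker_def
    by (intro group.generate_subgroup_incl) (auto simp: g.subgroup_kernel)
  obtain f where f: "f \<in> hom (?G Mod tensor_ker R M N) ?H"
    and f_q: "\<And>u. u \<in> carrier ?G \<Longrightarrow> f (tensor_ker R M N #>\<^bsub>?G\<^esub> u) = g u"
    using g.FactGroup_universal_kernel[OF tensor_ker_normal[OF M N] ker] by blast
  show thesis
  proof
    show "f \<in> add_hom (M \<boxtimes>\<^bsub>R\<^esub> N) K"
      using f by (auto simp: add_hom_iff hom_def tensor_simps tensor_group_def Let_def)
    show "f (tens R M N x y) = \<phi> x y" if "x \<in> carrier M" "y \<in> carrier N" for x y
      using that by (simp add: tens_def f_q g_of)
  qed
qed

lemma tensor_ext:
  assumes "right_module R M" "left_module R N"
    and f: "f \<in> add_hom (M \<boxtimes>\<^bsub>R\<^esub> N) K" and g: "g \<in> add_hom (M \<boxtimes>\<^bsub>R\<^esub> N) K"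
    and "\<And>x y. \<lbrakk>x \<in> carrier M; y \<in> carrier N\<rbrakk> \<Longrightarrow> f (tens R M N x y) = g (tens R M N x y)"
    and "u \<in> carrier (M \<boxtimes>\<^bsub>R\<^esub> N)"
  shows "f u = g u"
  using assms(1,2,6)
  by (induction rule: tensor_induct)
    (simp_all add: assms(5) add_hom_add[OF f] add_hom_add[OF g])

text \<open>An additive map with the prescribed values on elementary tensors settles the existence
  part of the description and, by \<open>tensor_ext\<close>, its uniqueness. The closed forms of the
  nested lifts in \<open>h\<close> and \<open>chi\<close> rest on this.\<close>

lemma tensor_lift_eq:
  assumes MN: "right_module R M" "left_module R N"
    and f: "f \<in> add_hom (M \<boxtimes>\<^bsub>R\<^esub> N) K"
    and f_tens: "\<And>x y. \<lbrakk>x \<in> carrier M; y \<in> carrier N\<rbrakk> \<Longrightarrow> f (tens R M N x y) = \<phi> x y"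
    and u: "u \<in> carrier (M \<boxtimes>\<^bsub>R\<^esub> N)"
  shows "tensor_lift R M N K \<phi> u = f u"
proof -
  \<comment> \<open>The description asks for an extensional function, since the values outside the
    carrier would otherwise be free; hence the restriction of \<open>f\<close>.\<close>
  have "tensor_lift R M N K \<phi> = restrict f (carrier (M \<boxtimes>\<^bsub>R\<^esub> N))"
    unfolding tensor_lift_def tensor_simps(1)[symmetric]
  proof (rule the_equality, safe)
    interpret T: abelian_group "M \<boxtimes>\<^bsub>R\<^esub> N" using MN by simp
    show "restrict f (carrier (M \<boxtimes>\<^bsub>R\<^esub> N)) \<in> add_hom (tensor_group R M N) K"
      using f T.add.m_closed by (auto simp: add_hom_iff tensor_simps[symmetric])
    show "restrict f (carrier (M \<boxtimes>\<^bsub>R\<^esub> N)) (tens R M N x y) = \<phi> x y"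
      if "x \<in> carrier M" "y \<in> carrier N" for x y
      using that by (simp add: f_tens)
    fix g assume g: "g \<in> extensional (carrier (M \<boxtimes>\<^bsub>R\<^esub> N))" "g \<in> add_hom (tensor_group R M N) K"
      "\<forall>x\<in>carrier M. \<forall>y\<in>carrier N. g (tens R M N x y) = \<phi> x y"
    have "g u = f u" if "u \<in> carrier (M \<boxtimes>\<^bsub>R\<^esub> N)" for u
      using g by (intro tensor_ext[OF MN _ f _ that])
        (auto simp: f_tens add_hom_iff tensor_simps)
    then show "g = restrict f (carrier (M \<boxtimes>\<^bsub>R\<^esub> N))"
      using g(1) by (auto simp: extensional_def restrict_def)
  qed auto
  then show ?thesis using u by simp
qed

lemma
  assumes MN: "right_module R M" "left_module R N" and \<phi>: "balanced R M N K \<phi>"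
  shows tensor_lift_hom: "tensor_lift R M N K \<phi> \<in> add_hom (M \<boxtimes>\<^bsub>R\<^esub> N) K"
    and tensor_lift_tens: "\<lbrakk>x \<in> carrier M; y \<in> carrier N\<rbrakk> \<Longrightarrow> tensor_lift R M N K \<phi> (tens R M N x y) = \<phi> x y"
proof -
  obtain f where f: "f \<in> add_hom (M \<boxtimes>\<^bsub>R\<^esub> N) K"
    "\<And>x y. \<lbrakk>x \<in> carrier M; y \<in> carrier N\<rbrakk> \<Longrightarrow> f (tens R M N x y) = \<phi> x y"
    by (rule tensor_universal[OF MN \<phi>]) blast
  interpret T: abelian_group "M \<boxtimes>\<^bsub>R\<^esub> N" using MN by simp
  show "tensor_lift R M N K \<phi> \<in> add_hom (M \<boxtimes>\<^bsub>R\<^esub> N) K"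
    using f(1) by (simp add: add_hom_iff tensor_lift_eq[OF MN f])
  show "tensor_lift R M N K \<phi> (tens R M N x y) = \<phi> x y" if "x \<in> carrier M" "y \<in> carrier N"
    using that by (simp add: tensor_lift_eq[OF MN f] f(2))
qed


section \<open>Bimodule structure and functoriality\<close>

lemma bimoduleD:
  assumes "bimodule L R M"
  shows bimodule_left_module: "left_module L M" and bimodule_right_module: "right_module R M"
  using assms by (auto simp: bimodule_def)

lemma left_module_lact_closed [simp]:
    "\<lbrakk>a \<in> carrier R; left_module R M; x \<in> carrier M\<rbrakk> \<Longrightarrow> a \<rightharpoonup>\<^bsub>M\<^esub> x \<in> carrier M"
  and left_module_lact_add [simp]:
    "\<lbrakk>a \<in> carrier R; left_module R M; x \<in> carrier M; y \<in> carrier M\<rbrakk>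
      \<Longrightarrow> a \<rightharpoonup>\<^bsub>M\<^esub> (x \<oplus>\<^bsub>M\<^esub> y) = (a \<rightharpoonup>\<^bsub>M\<^esub> x) \<oplus>\<^bsub>M\<^esub> (a \<rightharpoonup>\<^bsub>M\<^esub> y)"
  by (auto simp: left_module_def left_module_axioms_def)

lemma right_module_ract_closed [simp]:
    "\<lbrakk>a \<in> carrier R; right_module R M; x \<in> carrier M\<rbrakk> \<Longrightarrow> x \<leftharpoonup>\<^bsub>M\<^esub> a \<in> carrier M"
  and right_module_ract_add [simp]:
    "\<lbrakk>a \<in> carrier R; right_module R M; x \<in> carrier M; y \<in> carrier M\<rbrakk>
      \<Longrightarrow> (x \<oplus>\<^bsub>M\<^esub> y) \<leftharpoonup>\<^bsub>M\<^esub> a = (x \<leftharpoonup>\<^bsub>M\<^esub> a) \<oplus>\<^bsub>M\<^esub> (y \<leftharpoonup>\<^bsub>M\<^esub> a)"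
  by (auto simp: right_module_def right_module_axioms_def)

lemma bimodule_lact_ract:
  "\<lbrakk>a \<in> carrier L; b \<in> carrier R; bimodule L R M; x \<in> carrier M\<rbrakk>
    \<Longrightarrow> (a \<rightharpoonup>\<^bsub>M\<^esub> x) \<leftharpoonup>\<^bsub>M\<^esub> b = a \<rightharpoonup>\<^bsub>M\<^esub> (x \<leftharpoonup>\<^bsub>M\<^esub> b)"
  by (simp add: bimodule_def bimodule_axioms_def)

lemma lact_right_hom:
  "\<lbrakk>bimodule L R M; a \<in> carrier L\<rbrakk> \<Longrightarrow> (\<lambda>x. a \<rightharpoonup>\<^bsub>M\<^esub> x) \<in> right_hom R M M"
  using bimoduleD[of L R M]
  by (auto simp: right_hom_iff add_hom_iff left_module_lact_closed left_module_lact_add bimodule_lact_ract)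

lemma ract_left_hom:
  "\<lbrakk>bimodule L R M; a \<in> carrier R\<rbrakk> \<Longrightarrow> (\<lambda>x. x \<leftharpoonup>\<^bsub>M\<^esub> a) \<in> left_hom L M M"
  using bimoduleD[of L R M]
  by (auto simp: left_hom_iff add_hom_iff right_module_ract_closed right_module_ract_add bimodule_lact_ract)

lemma balanced_tens:
  assumes "right_module R M'" "left_module R N'"
    and f: "f \<in> right_hom R M M'" and g: "g \<in> left_hom R N N'"
  shows "balanced R M N (M' \<boxtimes>\<^bsub>R\<^esub> N') (\<lambda>x y. tens R M' N' (f x) (g y))"
  using assms add_hom_closed[OF right_hom_add_hom[OF f]] add_hom_closed[OF left_hom_add_hom[OF g]]
  by (auto simp: balanced_def tens_add_left tens_add_right tens_ract right_hom_ract[OF f] left_hom_lact[OF g]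
      add_hom_add[OF right_hom_add_hom[OF f]] add_hom_add[OF left_hom_add_hom[OF g]])

context
  fixes R :: "('r, 'z) ring_scheme" and M :: "('l, 'm, 'r) bimod" and N :: "('r, 'n, 'k) bimod"
    and M' :: "('l1, 'm1, 'r) bimod" and N' :: "('r, 'n1, 'k1) bimod" and f g
  assumes M: "right_module R M" "left_module R N" and M': "right_module R M'" "left_module R N'"
    and f: "f \<in> right_hom R M M'" and g: "g \<in> left_hom R N N'"
begin

lemma tensor_map_hom: "tensor_map R M N M' N' f g \<in> add_hom (M \<boxtimes>\<^bsub>R\<^esub> N) (M' \<boxtimes>\<^bsub>R\<^esub> N')"
  unfolding tensor_map_def by (intro tensor_lift_hom M balanced_tens M' f g)

lemma tensor_map_tens [simp]:
  "\<lbrakk>x \<in> carrier M; y \<in> carrier N\<rbrakk> \<Longrightarrow> tensor_map R M N M' N' f g (tens R M N x y) = tens R M' N' (f x) (g y)"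
  unfolding tensor_map_def by (intro tensor_lift_tens M balanced_tens M' f g)

lemma tensor_map_closed [simp]:
  "u \<in> carrier (M \<boxtimes>\<^bsub>R\<^esub> N) \<Longrightarrow> tensor_map R M N M' N' f g u \<in> carrier (M' \<boxtimes>\<^bsub>R\<^esub> N')"
  using tensor_map_hom by (rule add_hom_closed)

lemma tensor_map_add [simp]:
  "\<lbrakk>u \<in> carrier (M \<boxtimes>\<^bsub>R\<^esub> N); v \<in> carrier (M \<boxtimes>\<^bsub>R\<^esub> N)\<rbrakk> \<Longrightarrow>
     tensor_map R M N M' N' f g (u \<oplus>\<^bsub>M \<boxtimes>\<^bsub>R\<^esub> N\<^esub> v) =
     tensor_map R M N M' N' f g u \<oplus>\<^bsub>M' \<boxtimes>\<^bsub>R\<^esub> N'\<^esub> tensor_map R M N M' N' f g v"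
  using tensor_map_hom by (rule add_hom_add)

end

lemma tensor_map_eqI:
  assumes "right_module R M" "left_module R N" "F \<in> add_hom (M \<boxtimes>\<^bsub>R\<^esub> N) (M' \<boxtimes>\<^bsub>R\<^esub> N')"
    and "\<And>x y. \<lbrakk>x \<in> carrier M; y \<in> carrier N\<rbrakk> \<Longrightarrow> F (tens R M N x y) = tens R M' N' (f x) (g y)"
    and "u \<in> carrier (M \<boxtimes>\<^bsub>R\<^esub> N)"
  shows "tensor_map R M N M' N' f g u = F u"
  unfolding tensor_map_def by (rule tensor_lift_eq[OF assms(1-5)])

text \<open>A lift looks only at the carrier and the addition of its target, which
  \<open>tensor_group\<close> shares with the tensor product. This turns both actions into instances
  of \<open>tensor_map\<close>.\<close>

lemma tensor_lift_tensor_group: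
  "tensor_lift R M N (tensor_group R M' N') = tensor_lift R M N (M' \<boxtimes>\<^bsub>R\<^esub> N')"
  by (intro ext) (simp add: tensor_lift_def add_hom_iff tensor_simps)

lemma lact_tensor: "lact (M \<boxtimes>\<^bsub>R\<^esub> N) a = tensor_map R M N M N (\<lambda>x. a \<rightharpoonup>\<^bsub>M\<^esub> x) id"
  unfolding tensor_map_def tensor_lift_tensor_group[symmetric]
  by (simp add: tensor_def ring.defs bimod.defs)

lemma ract_tensor: "ract (M \<boxtimes>\<^bsub>R\<^esub> N) u a = tensor_map R M N M N id (\<lambda>x. x \<leftharpoonup>\<^bsub>N\<^esub> a) u"
  unfolding tensor_map_def tensor_lift_tensor_group[symmetric]
  by (simp add: tensor_def ring.defs bimod.defs)

lemma lact_tens [simp]: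
  assumes "a \<in> carrier L" "bimodule L R M" "left_module R N" "x \<in> carrier M" "y \<in> carrier N"
  shows "a \<rightharpoonup>\<^bsub>M \<boxtimes>\<^bsub>R\<^esub> N\<^esub> tens R M N x y = tens R M N (a \<rightharpoonup>\<^bsub>M\<^esub> x) y"
  using assms by (simp add: lact_tensor bimoduleD lact_right_hom)

lemma ract_tens [simp]:
  assumes "a \<in> carrier K" "right_module R M" "bimodule R K N" "x \<in> carrier M" "y \<in> carrier N"
  shows "tens R M N x y \<leftharpoonup>\<^bsub>M \<boxtimes>\<^bsub>R\<^esub> N\<^esub> a = tens R M N x (y \<leftharpoonup>\<^bsub>N\<^esub> a)"
  using assms by (simp add: ract_tensor bimoduleD ract_left_hom)

lemma tensor_left_module [simp]:
  assumes M: "bimodule L R M" and N: "left_module R N"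
  shows "left_module L (M \<boxtimes>\<^bsub>R\<^esub> N)"
proof -
  interpret M: bimodule L R M by fact
  interpret N: left_module R N by fact
  note [simp] = bimoduleD[OF M] N
  interpret T: abelian_group "M \<boxtimes>\<^bsub>R\<^esub> N" by simp
  have hom: "(\<lambda>u. a \<rightharpoonup>\<^bsub>M \<boxtimes>\<^bsub>R\<^esub> N\<^esub> u) \<in> add_hom (M \<boxtimes>\<^bsub>R\<^esub> N) (M \<boxtimes>\<^bsub>R\<^esub> N)" if "a \<in> carrier L" for a
    unfolding lact_tensor by (rule tensor_map_hom) (use that M in \<open>auto simp: lact_right_hom\<close>)
  note [simp] = add_hom_closed[OF hom] add_hom_add[OF hom] lact_tens[OF _ M N]
  show ?thesis
  proof unfold_locales
    fix a b u
    assume "a \<in> carrier L" "b \<in> carrier L" and u: "u \<in> carrier (M \<boxtimes>\<^bsub>R\<^esub> N)"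
    show "(a \<oplus>\<^bsub>L\<^esub> b) \<rightharpoonup>\<^bsub>M \<boxtimes>\<^bsub>R\<^esub> N\<^esub> u = (a \<rightharpoonup>\<^bsub>M \<boxtimes>\<^bsub>R\<^esub> N\<^esub> u) \<oplus>\<^bsub>M \<boxtimes>\<^bsub>R\<^esub> N\<^esub> (b \<rightharpoonup>\<^bsub>M \<boxtimes>\<^bsub>R\<^esub> N\<^esub> u)"
      using bimoduleD(2)[OF M] N u \<open>a \<in> carrier L\<close> \<open>b \<in> carrier L\<close>
      by (induction rule: tensor_induct)
        (simp_all add: M.add_lact M.lact_closed tens_add_left T.a_ac)
    show "(a \<otimes>\<^bsub>L\<^esub> b) \<rightharpoonup>\<^bsub>M \<boxtimes>\<^bsub>R\<^esub> N\<^esub> u = a \<rightharpoonup>\<^bsub>M \<boxtimes>\<^bsub>R\<^esub> N\<^esub> (b \<rightharpoonup>\<^bsub>M \<boxtimes>\<^bsub>R\<^esub> N\<^esub> u)"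
      using bimoduleD(2)[OF M] N u \<open>a \<in> carrier L\<close> \<open>b \<in> carrier L\<close>
      by (induction rule: tensor_induct) (simp_all add: M.mult_lact M.lact_closed)
  next
    fix u assume u: "u \<in> carrier (M \<boxtimes>\<^bsub>R\<^esub> N)"
    show "\<one>\<^bsub>L\<^esub> \<rightharpoonup>\<^bsub>M \<boxtimes>\<^bsub>R\<^esub> N\<^esub> u = u"
      using bimoduleD(2)[OF M] N u
      by (induction rule: tensor_induct) (simp_all add: M.one_lact)
  qed simp_all
qed

lemma tensor_right_module [simp]:
  assumes M: "right_module R M" and N: "bimodule R K N"
  shows "right_module K (M \<boxtimes>\<^bsub>R\<^esub> N)"
proof -
  interpret M: right_module R M by fact
  interpret N: bimodule R K N by fact
  note [simp] = bimoduleD[OF N] M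
  interpret T: abelian_group "M \<boxtimes>\<^bsub>R\<^esub> N" by simp
  have hom: "(\<lambda>u. u \<leftharpoonup>\<^bsub>M \<boxtimes>\<^bsub>R\<^esub> N\<^esub> a) \<in> add_hom (M \<boxtimes>\<^bsub>R\<^esub> N) (M \<boxtimes>\<^bsub>R\<^esub> N)" if "a \<in> carrier K" for a
    unfolding ract_tensor by (rule tensor_map_hom) (use that N in \<open>auto simp: ract_left_hom\<close>)
  note [simp] = add_hom_closed[OF hom] add_hom_add[OF hom] ract_tens[OF _ M N]
  show ?thesis
  proof unfold_locales
    fix a b u
    assume "a \<in> carrier K" "b \<in> carrier K" and u: "u \<in> carrier (M \<boxtimes>\<^bsub>R\<^esub> N)"
    show "u \<leftharpoonup>\<^bsub>M \<boxtimes>\<^bsub>R\<^esub> N\<^esub> (a \<oplus>\<^bsub>K\<^esub> b) = (u \<leftharpoonup>\<^bsub>M \<boxtimes>\<^bsub>R\<^esub> N\<^esub> a) \<oplus>\<^bsub>M \<boxtimes>\<^bsub>R\<^esub> N\<^esub> (u \<leftharpoonup>\<^bsub>M \<boxtimes>\<^bsub>R\<^esub> N\<^esub> b)"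
      using M bimoduleD(1)[OF N] u \<open>a \<in> carrier K\<close> \<open>b \<in> carrier K\<close>
      by (induction rule: tensor_induct)
        (simp_all add: N.ract_add N.ract_closed tens_add_right T.a_ac)
    show "u \<leftharpoonup>\<^bsub>M \<boxtimes>\<^bsub>R\<^esub> N\<^esub> (a \<otimes>\<^bsub>K\<^esub> b) = (u \<leftharpoonup>\<^bsub>M \<boxtimes>\<^bsub>R\<^esub> N\<^esub> a) \<leftharpoonup>\<^bsub>M \<boxtimes>\<^bsub>R\<^esub> N\<^esub> b"
      using M bimoduleD(1)[OF N] u \<open>a \<in> carrier K\<close> \<open>b \<in> carrier K\<close>
      by (induction rule: tensor_induct) (simp_all add: N.ract_mult N.ract_closed)
  next
    fix u assume u: "u \<in> carrier (M \<boxtimes>\<^bsub>R\<^esub> N)"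
    show "u \<leftharpoonup>\<^bsub>M \<boxtimes>\<^bsub>R\<^esub> N\<^esub> \<one>\<^bsub>K\<^esub> = u"
      using M bimoduleD(1)[OF N] u
      by (induction rule: tensor_induct) (simp_all add: N.ract_one)
  qed simp_all
qed


lemma tensor_bimodule [simp]:
  assumes M: "bimodule L R M" and N: "bimodule R K N"
  shows "bimodule L K (M \<boxtimes>\<^bsub>R\<^esub> N)"
proof -
  interpret M: bimodule L R M by fact
  interpret N: bimodule R K N by fact
  note MN = bimoduleD(2)[OF M] bimoduleD(1)[OF N]
  interpret L: left_module L "M \<boxtimes>\<^bsub>R\<^esub> N" by (rule tensor_left_module[OF M MN(2)])
  interpret K: right_module K "M \<boxtimes>\<^bsub>R\<^esub> N" by (rule tensor_right_module[OF MN(1) N])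
  show ?thesis
  proof
    fix a b u assume ab: "a \<in> carrier L" "b \<in> carrier K" and u: "u \<in> carrier (M \<boxtimes>\<^bsub>R\<^esub> N)"
    show "(a \<rightharpoonup>\<^bsub>M \<boxtimes>\<^bsub>R\<^esub> N\<^esub> u) \<leftharpoonup>\<^bsub>M \<boxtimes>\<^bsub>R\<^esub> N\<^esub> b = a \<rightharpoonup>\<^bsub>M \<boxtimes>\<^bsub>R\<^esub> N\<^esub> (u \<leftharpoonup>\<^bsub>M \<boxtimes>\<^bsub>R\<^esub> N\<^esub> b)"
      using MN u ab
      by (induction rule: tensor_induct)
        (simp_all add: M N MN M.lact_closed N.ract_closed L.lact_add K.add_ract L.lact_closed K.ract_closed)
  qed
qed

lemma tensor_map_left_hom [simp]:
  assumes M: "bimodule L R M" "left_module R N" and M': "bimodule L R M'" "left_module R N'"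
    and f: "f \<in> left_hom L M M'" "f \<in> right_hom R M M'" and g: "g \<in> left_hom R N N'"
  shows "tensor_map R M N M' N' f g \<in> left_hom L (M \<boxtimes>\<^bsub>R\<^esub> N) (M' \<boxtimes>\<^bsub>R\<^esub> N')"
  unfolding left_hom_iff
proof (intro conjI ballI)
  note [simp] = bimoduleD[OF M(1)] bimoduleD[OF M'(1)] M M' f g
  show "tensor_map R M N M' N' f g \<in> add_hom (M \<boxtimes>\<^bsub>R\<^esub> N) (M' \<boxtimes>\<^bsub>R\<^esub> N')"
    by (simp add: tensor_map_hom)
  fix a u assume a: "a \<in> carrier L" and u: "u \<in> carrier (M \<boxtimes>\<^bsub>R\<^esub> N)"
  have L: "left_module L (M \<boxtimes>\<^bsub>R\<^esub> N)" "left_module L (M' \<boxtimes>\<^bsub>R\<^esub> N')"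
    using M M' by (blast intro: tensor_left_module)+
  show "tensor_map R M N M' N' f g (a \<rightharpoonup>\<^bsub>M \<boxtimes>\<^bsub>R\<^esub> N\<^esub> u) = a \<rightharpoonup>\<^bsub>M' \<boxtimes>\<^bsub>R\<^esub> N'\<^esub> tensor_map R M N M' N' f g u"
    using bimoduleD(2)[OF M(1)] M(2) u a
    by (induction rule: tensor_induct)
      (simp_all add: lact_tens[OF _ M] lact_tens[OF _ M'] left_hom_lact[OF f(1)]
        add_hom_closed[OF left_hom_add_hom[OF f(1)]] add_hom_closed[OF left_hom_add_hom[OF g]]
        L)
qed

lemma tensor_map_right_hom [simp]:
  assumes M: "right_module R M" "bimodule R K N" and M': "right_module R M'" "bimodule R K N'"
    and f: "f \<in> right_hom R M M'" and g: "g \<in> left_hom R N N'" "g \<in> right_hom K N N'"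
  shows "tensor_map R M N M' N' f g \<in> right_hom K (M \<boxtimes>\<^bsub>R\<^esub> N) (M' \<boxtimes>\<^bsub>R\<^esub> N')"
  unfolding right_hom_iff
proof (intro conjI ballI)
  note [simp] = bimoduleD[OF M(2)] bimoduleD[OF M'(2)] M M' f g
  show "tensor_map R M N M' N' f g \<in> add_hom (M \<boxtimes>\<^bsub>R\<^esub> N) (M' \<boxtimes>\<^bsub>R\<^esub> N')"
    by (simp add: tensor_map_hom)
  fix a u assume a: "a \<in> carrier K" and u: "u \<in> carrier (M \<boxtimes>\<^bsub>R\<^esub> N)"
  have L: "right_module K (M \<boxtimes>\<^bsub>R\<^esub> N)" "right_module K (M' \<boxtimes>\<^bsub>R\<^esub> N')"
    using M M' by (blast intro: tensor_right_module)+
  show "tensor_map R M N M' N' f g (u \<leftharpoonup>\<^bsub>M \<boxtimes>\<^bsub>R\<^esub> N\<^esub> a) = tensor_map R M N M' N' f g u \<leftharpoonup>\<^bsub>M' \<boxtimes>\<^bsub>R\<^esub> N'\<^esub> a"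
    using M(1) bimoduleD(1)[OF M(2)] u a
    by (induction rule: tensor_induct)
      (simp_all add: ract_tens[OF _ M] ract_tens[OF _ M'] right_hom_ract[OF g(2)]
        add_hom_closed[OF right_hom_add_hom[OF f(1)]] add_hom_closed[OF left_hom_add_hom[OF g(1)]]
        L)
qed

lemma tensor_map_comp:
  assumes "right_module R M" "left_module R N" "right_module R M'" "left_module R N'"
    "right_module R M''" "left_module R N''"
    and f: "f \<in> right_hom R M M'" "f' \<in> right_hom R M' M''"
    and g: "g \<in> left_hom R N N'" "g' \<in> left_hom R N' N''"
    and u: "u \<in> carrier (M \<boxtimes>\<^bsub>R\<^esub> N)"
  shows "tensor_map R M' N' M'' N'' f' g' (tensor_map R M N M' N' f g u) =
    tensor_map R M N M'' N'' (\<lambda>x. f' (f x)) (\<lambda>y. g' (g y)) u"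
proof (rule tensor_map_eqI[symmetric])
  show "(\<lambda>u. tensor_map R M' N' M'' N'' f' g' (tensor_map R M N M' N' f g u)) \<in> add_hom (M \<boxtimes>\<^bsub>R\<^esub> N) (M'' \<boxtimes>\<^bsub>R\<^esub> N'')"
    using assms by (intro add_homI) auto
  show "tensor_map R M' N' M'' N'' f' g' (tensor_map R M N M' N' f g (tens R M N x y)) = tens R M'' N'' (f' (f x)) (g' (g y))"
    if "x \<in> carrier M" "y \<in> carrier N" for x y
    using assms that add_hom_closed[OF right_hom_add_hom[OF f(1)]] add_hom_closed[OF left_hom_add_hom[OF g(1)]] by simp
qed (use assms in auto)

lemma tensor_map_id:
  assumes "right_module R M" "left_module R N" "u \<in> carrier (M \<boxtimes>\<^bsub>R\<^esub> N)"
    and "\<And>x. x \<in> carrier M \<Longrightarrow> f x = x" "\<And>y. y \<in> carrier N \<Longrightarrow> g y = y"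
  shows "tensor_map R M N M N f g u = u"
  using assms by (intro tensor_map_eqI) (auto simp: add_hom_iff)

lemma tensor_map_cong:
  assumes "right_module R M" "left_module R N" "right_module R M'" "left_module R N'"
    and "f \<in> right_hom R M M'" "g \<in> left_hom R N N'" "u \<in> carrier (M \<boxtimes>\<^bsub>R\<^esub> N)"
    and "\<And>x. x \<in> carrier M \<Longrightarrow> f x = f' x" "\<And>y. y \<in> carrier N \<Longrightarrow> g y = g' y"
  shows "tensor_map R M N M' N' f g u = tensor_map R M N M' N' f' g' u"
  using assms by (intro tensor_map_eqI[symmetric]) (auto simp: tensor_map_hom)

section \<open>Associativity\<close>

context
  fixes R :: "('r, 'y) ring_scheme" and S :: "('s, 'z) ring_scheme"
    and M :: "('l, 'm, 'r) bimod" and N :: "('r, 'n, 's) bimod" and P :: "('s, 'p, 'k) bimod"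
  assumes M: "right_module R M" and N: "bimodule R S N" and P: "left_module S P"
begin

private lemma N1: "left_module R N" "right_module S N"
  by (rule bimoduleD[OF N])+

private lemma inner_balanced:
  "z \<in> carrier P \<Longrightarrow> balanced R M N (M \<boxtimes>\<^bsub>R\<^esub> (N \<boxtimes>\<^bsub>S\<^esub> P)) (\<lambda>x y. tens R M (N \<boxtimes>\<^bsub>S\<^esub> P) x (tens S N P y z))"
  using M N P N1 unfolding balanced_def
  by (auto simp: tens_add_left tens_add_right tens_ract N1 left_module_lact_closed simp flip: lact_tens)

private lemma inner_hom:
  "z \<in> carrier P \<Longrightarrow> tensor_lift R M N (M \<boxtimes>\<^bsub>R\<^esub> (N \<boxtimes>\<^bsub>S\<^esub> P)) (\<lambda>x y. tens R M (N \<boxtimes>\<^bsub>S\<^esub> P) x (tens S N P y z))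
    \<in> add_hom (M \<boxtimes>\<^bsub>R\<^esub> N) (M \<boxtimes>\<^bsub>R\<^esub> (N \<boxtimes>\<^bsub>S\<^esub> P))"
  by (intro tensor_lift_hom M N1 inner_balanced)

private lemma inner_tens:
  "\<lbrakk>z \<in> carrier P; x \<in> carrier M; y \<in> carrier N\<rbrakk> \<Longrightarrow>
    tensor_lift R M N (M \<boxtimes>\<^bsub>R\<^esub> (N \<boxtimes>\<^bsub>S\<^esub> P)) (\<lambda>x y. tens R M (N \<boxtimes>\<^bsub>S\<^esub> P) x (tens S N P y z)) (tens R M N x y) =
    tens R M (N \<boxtimes>\<^bsub>S\<^esub> P) x (tens S N P y z)"
  by (rule tensor_lift_tens[OF M N1(1) inner_balanced])

text \<open>The inner lift is additive in \<open>u\<close> but its values are known only on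
  elementary tensors, so the conditions that involve \<open>z\<close> are proved by induction on
  \<open>u\<close>.\<close>

private lemma outer_balanced:
  "balanced S (M \<boxtimes>\<^bsub>R\<^esub> N) P (M \<boxtimes>\<^bsub>R\<^esub> (N \<boxtimes>\<^bsub>S\<^esub> P))
     (\<lambda>u z. tensor_lift R M N (M \<boxtimes>\<^bsub>R\<^esub> (N \<boxtimes>\<^bsub>S\<^esub> P)) (\<lambda>x y. tens R M (N \<boxtimes>\<^bsub>S\<^esub> P) x (tens S N P y z)) u)"
proof -
  note [simp] = M N P N1 inner_tens add_hom_closed[OF inner_hom] add_hom_add[OF inner_hom] left_module_lact_closed
    right_module_ract_closed
  interpret T: abelian_group "M \<boxtimes>\<^bsub>R\<^esub> (N \<boxtimes>\<^bsub>S\<^esub> P)" by simp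
  interpret P: left_module S P by simp
  let ?\<phi> = "\<lambda>u z. tensor_lift R M N (M \<boxtimes>\<^bsub>R\<^esub> (N \<boxtimes>\<^bsub>S\<^esub> P)) (\<lambda>x y. tens R M (N \<boxtimes>\<^bsub>S\<^esub> P) x (tens S N P y z)) u"
  have "?\<phi> u (z \<oplus>\<^bsub>P\<^esub> z') = ?\<phi> u z \<oplus>\<^bsub>M \<boxtimes>\<^bsub>R\<^esub> (N \<boxtimes>\<^bsub>S\<^esub> P)\<^esub> ?\<phi> u z'"
    if "u \<in> carrier (M \<boxtimes>\<^bsub>R\<^esub> N)" "z \<in> carrier P" "z' \<in> carrier P" for u z z'
    using M N1(1) that
    by (induction rule: tensor_induct) (simp_all add: tens_add_right T.a_ac)
  moreover have "?\<phi> (u \<leftharpoonup>\<^bsub>M \<boxtimes>\<^bsub>R\<^esub> N\<^esub> a) z = ?\<phi> u (a \<rightharpoonup>\<^bsub>P\<^esub> z)"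
    if "u \<in> carrier (M \<boxtimes>\<^bsub>R\<^esub> N)" "z \<in> carrier P" "a \<in> carrier S" for u z a
    using M N1(1) that
    by (induction rule: tensor_induct)
      (simp_all add: tens_ract)
  ultimately show ?thesis
    by (simp add: balanced_def)
qed

private lemmas assoc_lift = tensor_right_module[OF M N] P outer_balanced

lemma assoc_hom: "assoc R S M N P \<in> add_hom ((M \<boxtimes>\<^bsub>R\<^esub> N) \<boxtimes>\<^bsub>S\<^esub> P) (M \<boxtimes>\<^bsub>R\<^esub> (N \<boxtimes>\<^bsub>S\<^esub> P))"
  unfolding assoc_def by (rule tensor_lift_hom[OF assoc_lift])

lemma assoc_closed [simp]:
  "u \<in> carrier ((M \<boxtimes>\<^bsub>R\<^esub> N) \<boxtimes>\<^bsub>S\<^esub> P) \<Longrightarrow> assoc R S M N P u \<in> carrier (M \<boxtimes>\<^bsub>R\<^esub> (N \<boxtimes>\<^bsub>S\<^esub> P))"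
  by (rule add_hom_closed[OF assoc_hom])

lemma assoc_add [simp]:
  "\<lbrakk>u \<in> carrier ((M \<boxtimes>\<^bsub>R\<^esub> N) \<boxtimes>\<^bsub>S\<^esub> P); v \<in> carrier ((M \<boxtimes>\<^bsub>R\<^esub> N) \<boxtimes>\<^bsub>S\<^esub> P)\<rbrakk> \<Longrightarrow>
    assoc R S M N P (u \<oplus>\<^bsub>(M \<boxtimes>\<^bsub>R\<^esub> N) \<boxtimes>\<^bsub>S\<^esub> P\<^esub> v) =
    assoc R S M N P u \<oplus>\<^bsub>M \<boxtimes>\<^bsub>R\<^esub> (N \<boxtimes>\<^bsub>S\<^esub> P)\<^esub> assoc R S M N P v"
  by (rule add_hom_add[OF assoc_hom])

lemma assoc_tens [simp]:
  "\<lbrakk>x \<in> carrier M; y \<in> carrier N; z \<in> carrier P\<rbrakk> \<Longrightarrow>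
    assoc R S M N P (tens S (M \<boxtimes>\<^bsub>R\<^esub> N) P (tens R M N x y) z) = tens R M (N \<boxtimes>\<^bsub>S\<^esub> P) x (tens S N P y z)"
  unfolding assoc_def by (simp add: tensor_lift_tens[OF assoc_lift] inner_tens)

private lemma inner_balanced':
  "x \<in> carrier M \<Longrightarrow> balanced S N P ((M \<boxtimes>\<^bsub>R\<^esub> N) \<boxtimes>\<^bsub>S\<^esub> P) (\<lambda>y z. tens S (M \<boxtimes>\<^bsub>R\<^esub> N) P (tens R M N x y) z)"
  using M N P N1 unfolding balanced_def
  by (auto simp: tens_add_left tens_add_right tens_ract N1 right_module_ract_closed simp flip: ract_tens)

private lemma inner_hom':
  "x \<in> carrier M \<Longrightarrow> tensor_lift S N P ((M \<boxtimes>\<^bsub>R\<^esub> N) \<boxtimes>\<^bsub>S\<^esub> P) (\<lambda>y z. tens S (M \<boxtimes>\<^bsub>R\<^esub> N) P (tens R M N x y) z)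
    \<in> add_hom (N \<boxtimes>\<^bsub>S\<^esub> P) ((M \<boxtimes>\<^bsub>R\<^esub> N) \<boxtimes>\<^bsub>S\<^esub> P)"
  by (intro tensor_lift_hom P N1 inner_balanced')

private lemma inner_tens':
  "\<lbrakk>z \<in> carrier P; x \<in> carrier M; y \<in> carrier N\<rbrakk> \<Longrightarrow>
    tensor_lift S N P ((M \<boxtimes>\<^bsub>R\<^esub> N) \<boxtimes>\<^bsub>S\<^esub> P) (\<lambda>y z. tens S (M \<boxtimes>\<^bsub>R\<^esub> N) P (tens R M N x y) z) (tens S N P y z) =
    tens S (M \<boxtimes>\<^bsub>R\<^esub> N) P (tens R M N x y) z"
  by (rule tensor_lift_tens[OF N1(2) P inner_balanced'])

private lemma outer_balanced':
  "balanced R M (N \<boxtimes>\<^bsub>S\<^esub> P) ((M \<boxtimes>\<^bsub>R\<^esub> N) \<boxtimes>\<^bsub>S\<^esub> P)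
     (\<lambda>x u. tensor_lift S N P ((M \<boxtimes>\<^bsub>R\<^esub> N) \<boxtimes>\<^bsub>S\<^esub> P) (\<lambda>y z. tens S (M \<boxtimes>\<^bsub>R\<^esub> N) P (tens R M N x y) z) u)"
proof -
  note [simp] = M N P N1 inner_tens' add_hom_closed[OF inner_hom'] add_hom_add[OF inner_hom'] left_module_lact_closed
    right_module_ract_closed
  interpret T: abelian_group "(M \<boxtimes>\<^bsub>R\<^esub> N) \<boxtimes>\<^bsub>S\<^esub> P" by simp
  interpret M: right_module R M by simp
  let ?\<phi> = "\<lambda>x u. tensor_lift S N P ((M \<boxtimes>\<^bsub>R\<^esub> N) \<boxtimes>\<^bsub>S\<^esub> P) (\<lambda>y z. tens S (M \<boxtimes>\<^bsub>R\<^esub> N) P (tens R M N x y) z) u"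
  have "?\<phi> (x \<oplus>\<^bsub>M\<^esub> x') u = ?\<phi> x u \<oplus>\<^bsub>(M \<boxtimes>\<^bsub>R\<^esub> N) \<boxtimes>\<^bsub>S\<^esub> P\<^esub> ?\<phi> x' u"
    if "u \<in> carrier (N \<boxtimes>\<^bsub>S\<^esub> P)" "x \<in> carrier M" "x' \<in> carrier M" for u x x'
    using N1(2) P that
    by (induction rule: tensor_induct) (simp_all add: tens_add_left T.a_ac)
  moreover have "?\<phi> (x \<leftharpoonup>\<^bsub>M\<^esub> a) u = ?\<phi> x (a \<rightharpoonup>\<^bsub>N \<boxtimes>\<^bsub>S\<^esub> P\<^esub> u)"
    if "u \<in> carrier (N \<boxtimes>\<^bsub>S\<^esub> P)" "x \<in> carrier M" "a \<in> carrier R" for u x a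
    using N1(2) P that
    by (induction rule: tensor_induct)
      (simp_all add: tens_ract)
  ultimately show ?thesis
    by (simp add: balanced_def)
qed

private lemmas assoc_inv_lift = M tensor_left_module[OF N P] outer_balanced'

lemma assoc_inv_hom: "assoc_inv R S M N P \<in> add_hom (M \<boxtimes>\<^bsub>R\<^esub> (N \<boxtimes>\<^bsub>S\<^esub> P)) ((M \<boxtimes>\<^bsub>R\<^esub> N) \<boxtimes>\<^bsub>S\<^esub> P)"
  unfolding assoc_inv_def by (rule tensor_lift_hom[OF assoc_inv_lift])

lemma assoc_inv_closed [simp]:
  "u \<in> carrier (M \<boxtimes>\<^bsub>R\<^esub> (N \<boxtimes>\<^bsub>S\<^esub> P)) \<Longrightarrow> assoc_inv R S M N P u \<in> carrier ((M \<boxtimes>\<^bsub>R\<^esub> N) \<boxtimes>\<^bsub>S\<^esub> P)"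
  by (rule add_hom_closed[OF assoc_inv_hom])

lemma assoc_inv_add [simp]:
  "\<lbrakk>u \<in> carrier (M \<boxtimes>\<^bsub>R\<^esub> (N \<boxtimes>\<^bsub>S\<^esub> P)); v \<in> carrier (M \<boxtimes>\<^bsub>R\<^esub> (N \<boxtimes>\<^bsub>S\<^esub> P))\<rbrakk> \<Longrightarrow>
    assoc_inv R S M N P (u \<oplus>\<^bsub>M \<boxtimes>\<^bsub>R\<^esub> (N \<boxtimes>\<^bsub>S\<^esub> P)\<^esub> v) =
    assoc_inv R S M N P u \<oplus>\<^bsub>(M \<boxtimes>\<^bsub>R\<^esub> N) \<boxtimes>\<^bsub>S\<^esub> P\<^esub> assoc_inv R S M N P v"
  by (rule add_hom_add[OF assoc_inv_hom])

lemma assoc_inv_tens [simp]: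
  "\<lbrakk>x \<in> carrier M; y \<in> carrier N; z \<in> carrier P\<rbrakk> \<Longrightarrow>
    assoc_inv R S M N P (tens R M (N \<boxtimes>\<^bsub>S\<^esub> P) x (tens S N P y z)) = tens S (M \<boxtimes>\<^bsub>R\<^esub> N) P (tens R M N x y) z"
  unfolding assoc_inv_def by (simp add: tensor_lift_tens[OF assoc_inv_lift] inner_tens')

text \<open>An induction inside an induction: the second factor is itself split into elementary
  tensors. Identities between rebracketings reduce in this way to a check on three elements.\<close>

lemma tensor_induct_right [consumes 1, case_names tens add]:
  assumes u: "u \<in> carrier (M \<boxtimes>\<^bsub>R\<^esub> (N \<boxtimes>\<^bsub>S\<^esub> P))"
    and tens: "\<And>x y z. \<lbrakk>x \<in> carrier M; y \<in> carrier N; z \<in> carrier P\<rbrakk> \<Longrightarrow>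
      Q (tens R M (N \<boxtimes>\<^bsub>S\<^esub> P) x (tens S N P y z))"
    and add: "\<And>u v. \<lbrakk>u \<in> carrier (M \<boxtimes>\<^bsub>R\<^esub> (N \<boxtimes>\<^bsub>S\<^esub> P)); v \<in> carrier (M \<boxtimes>\<^bsub>R\<^esub> (N \<boxtimes>\<^bsub>S\<^esub> P)); Q u; Q v\<rbrakk> \<Longrightarrow>
      Q (u \<oplus>\<^bsub>M \<boxtimes>\<^bsub>R\<^esub> (N \<boxtimes>\<^bsub>S\<^esub> P)\<^esub> v)"
  shows "Q u"
proof (rule tensor_induct[OF M tensor_left_module[OF N P] u])
  fix x v assume x: "x \<in> carrier M" and v: "v \<in> carrier (N \<boxtimes>\<^bsub>S\<^esub> P)"
  show "Q (tens R M (N \<boxtimes>\<^bsub>S\<^esub> P) x v)"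
    using N1(2) P v by (induction rule: tensor_induct) (simp_all add: x tens add tens_add_right M N P)
qed (rule add)

lemma tensor_induct_left [consumes 1, case_names tens add]:
  assumes u: "u \<in> carrier ((M \<boxtimes>\<^bsub>R\<^esub> N) \<boxtimes>\<^bsub>S\<^esub> P)"
    and tens: "\<And>x y z. \<lbrakk>x \<in> carrier M; y \<in> carrier N; z \<in> carrier P\<rbrakk> \<Longrightarrow>
      Q (tens S (M \<boxtimes>\<^bsub>R\<^esub> N) P (tens R M N x y) z)"
    and add: "\<And>u v. \<lbrakk>u \<in> carrier ((M \<boxtimes>\<^bsub>R\<^esub> N) \<boxtimes>\<^bsub>S\<^esub> P); v \<in> carrier ((M \<boxtimes>\<^bsub>R\<^esub> N) \<boxtimes>\<^bsub>S\<^esub> P); Q u; Q v\<rbrakk> \<Longrightarrow>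
      Q (u \<oplus>\<^bsub>(M \<boxtimes>\<^bsub>R\<^esub> N) \<boxtimes>\<^bsub>S\<^esub> P\<^esub> v)"
  shows "Q u"
proof (rule tensor_induct[OF tensor_right_module[OF M N] P u])
  fix z v assume z: "z \<in> carrier P" and v: "v \<in> carrier (M \<boxtimes>\<^bsub>R\<^esub> N)"
  show "Q (tens S (M \<boxtimes>\<^bsub>R\<^esub> N) P v z)"
    using M N1(1) v by (induction rule: tensor_induct) (simp_all add: z tens add tens_add_left M N P)
qed (rule add)

lemma assoc_assoc_inv [simp]:
  "u \<in> carrier (M \<boxtimes>\<^bsub>R\<^esub> (N \<boxtimes>\<^bsub>S\<^esub> P)) \<Longrightarrow> assoc R S M N P (assoc_inv R S M N P u) = u"
  by (induction rule: tensor_induct_right) simp_all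

lemma assoc_inv_assoc [simp]:
  "u \<in> carrier ((M \<boxtimes>\<^bsub>R\<^esub> N) \<boxtimes>\<^bsub>S\<^esub> P) \<Longrightarrow> assoc_inv R S M N P (assoc R S M N P u) = u"
  by (induction rule: tensor_induct_left) simp_all

end

lemma assoc_left_hom [simp]:
  assumes M: "bimodule L R M" and N: "bimodule R S N" and P: "left_module S P"
  shows "assoc R S M N P \<in> left_hom L ((M \<boxtimes>\<^bsub>R\<^esub> N) \<boxtimes>\<^bsub>S\<^esub> P) (M \<boxtimes>\<^bsub>R\<^esub> (N \<boxtimes>\<^bsub>S\<^esub> P))"
  unfolding left_hom_iff
proof (intro conjI ballI)
  note [simp] = M N P bimoduleD[OF M] bimoduleD[OF N]
  show "assoc R S M N P \<in> add_hom ((M \<boxtimes>\<^bsub>R\<^esub> N) \<boxtimes>\<^bsub>S\<^esub> P) (M \<boxtimes>\<^bsub>R\<^esub> (N \<boxtimes>\<^bsub>S\<^esub> P))"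
    by (simp add: assoc_hom)
  fix a u assume "a \<in> carrier L" "u \<in> carrier ((M \<boxtimes>\<^bsub>R\<^esub> N) \<boxtimes>\<^bsub>S\<^esub> P)"
  then show "assoc R S M N P (a \<rightharpoonup>\<^bsub>(M \<boxtimes>\<^bsub>R\<^esub> N) \<boxtimes>\<^bsub>S\<^esub> P\<^esub> u) = a \<rightharpoonup>\<^bsub>M \<boxtimes>\<^bsub>R\<^esub> (N \<boxtimes>\<^bsub>S\<^esub> P)\<^esub> assoc R S M N P u"
    using tensor_induct_left[OF bimoduleD(2)[OF M] N P, of u "\<lambda>u. assoc R S M N P (a \<rightharpoonup>\<^bsub>(M \<boxtimes>\<^bsub>R\<^esub> N) \<boxtimes>\<^bsub>S\<^esub> P\<^esub> u) = a \<rightharpoonup>\<^bsub>M \<boxtimes>\<^bsub>R\<^esub> (N \<boxtimes>\<^bsub>S\<^esub> P)\<^esub> assoc R S M N P u"]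
    by simp
qed

lemma assoc_right_hom [simp]:
  assumes M: "right_module R M" and N: "bimodule R S N" and P: "bimodule S K P"
  shows "assoc R S M N P \<in> right_hom K ((M \<boxtimes>\<^bsub>R\<^esub> N) \<boxtimes>\<^bsub>S\<^esub> P) (M \<boxtimes>\<^bsub>R\<^esub> (N \<boxtimes>\<^bsub>S\<^esub> P))"
  unfolding right_hom_iff
proof (intro conjI ballI)
  note [simp] = M N P bimoduleD[OF P] bimoduleD[OF N]
  show "assoc R S M N P \<in> add_hom ((M \<boxtimes>\<^bsub>R\<^esub> N) \<boxtimes>\<^bsub>S\<^esub> P) (M \<boxtimes>\<^bsub>R\<^esub> (N \<boxtimes>\<^bsub>S\<^esub> P))"
    by (simp add: assoc_hom)
  fix a u assume "a \<in> carrier K" "u \<in> carrier ((M \<boxtimes>\<^bsub>R\<^esub> N) \<boxtimes>\<^bsub>S\<^esub> P)"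
  then show "assoc R S M N P (u \<leftharpoonup>\<^bsub>(M \<boxtimes>\<^bsub>R\<^esub> N) \<boxtimes>\<^bsub>S\<^esub> P\<^esub> a) = assoc R S M N P u \<leftharpoonup>\<^bsub>M \<boxtimes>\<^bsub>R\<^esub> (N \<boxtimes>\<^bsub>S\<^esub> P)\<^esub> a"
    using tensor_induct_left[OF M N bimoduleD(1)[OF P], of u "\<lambda>u. assoc R S M N P (u \<leftharpoonup>\<^bsub>(M \<boxtimes>\<^bsub>R\<^esub> N) \<boxtimes>\<^bsub>S\<^esub> P\<^esub> a) = assoc R S M N P u \<leftharpoonup>\<^bsub>M \<boxtimes>\<^bsub>R\<^esub> (N \<boxtimes>\<^bsub>S\<^esub> P)\<^esub> a"]
    by simp
qed

text \<open>The inverse of a linear bijection is linear: apply \<open>assoc\<close> to both sides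
  and cancel.\<close>

lemma assoc_inv_left_hom [simp]:
  assumes M: "bimodule L R M" and N: "bimodule R S N" and P: "left_module S P"
  shows "assoc_inv R S M N P \<in> left_hom L (M \<boxtimes>\<^bsub>R\<^esub> (N \<boxtimes>\<^bsub>S\<^esub> P)) ((M \<boxtimes>\<^bsub>R\<^esub> N) \<boxtimes>\<^bsub>S\<^esub> P)"
  unfolding left_hom_iff
proof (intro conjI ballI)
  note [simp] = M N P bimoduleD[OF M] bimoduleD[OF N]
  show "assoc_inv R S M N P \<in> add_hom (M \<boxtimes>\<^bsub>R\<^esub> (N \<boxtimes>\<^bsub>S\<^esub> P)) ((M \<boxtimes>\<^bsub>R\<^esub> N) \<boxtimes>\<^bsub>S\<^esub> P)"
    by (simp add: assoc_inv_hom)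
  fix a u assume au: "a \<in> carrier L" "u \<in> carrier (M \<boxtimes>\<^bsub>R\<^esub> (N \<boxtimes>\<^bsub>S\<^esub> P))"
  let ?v = "assoc_inv R S M N P u"
  have "assoc R S M N P (a \<rightharpoonup>\<^bsub>(M \<boxtimes>\<^bsub>R\<^esub> N) \<boxtimes>\<^bsub>S\<^esub> P\<^esub> ?v) = a \<rightharpoonup>\<^bsub>M \<boxtimes>\<^bsub>R\<^esub> (N \<boxtimes>\<^bsub>S\<^esub> P)\<^esub> u"
    using au by (simp add: left_hom_lact[OF assoc_left_hom[OF M N P]])
  then show "assoc_inv R S M N P (a \<rightharpoonup>\<^bsub>M \<boxtimes>\<^bsub>R\<^esub> (N \<boxtimes>\<^bsub>S\<^esub> P)\<^esub> u) = a \<rightharpoonup>\<^bsub>(M \<boxtimes>\<^bsub>R\<^esub> N) \<boxtimes>\<^bsub>S\<^esub> P\<^esub> ?v"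
    using au assoc_inv_assoc[of R M S N P "a \<rightharpoonup>\<^bsub>(M \<boxtimes>\<^bsub>R\<^esub> N) \<boxtimes>\<^bsub>S\<^esub> P\<^esub> ?v"] by simp
qed

lemma assoc_inv_right_hom [simp]:
  assumes M: "right_module R M" and N: "bimodule R S N" and P: "bimodule S K P"
  shows "assoc_inv R S M N P \<in> right_hom K (M \<boxtimes>\<^bsub>R\<^esub> (N \<boxtimes>\<^bsub>S\<^esub> P)) ((M \<boxtimes>\<^bsub>R\<^esub> N) \<boxtimes>\<^bsub>S\<^esub> P)"
  unfolding right_hom_iff
proof (intro conjI ballI)
  note [simp] = M N P bimoduleD[OF P] bimoduleD[OF N]
  show "assoc_inv R S M N P \<in> add_hom (M \<boxtimes>\<^bsub>R\<^esub> (N \<boxtimes>\<^bsub>S\<^esub> P)) ((M \<boxtimes>\<^bsub>R\<^esub> N) \<boxtimes>\<^bsub>S\<^esub> P)"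
    by (simp add: assoc_inv_hom)
  fix a u assume au: "a \<in> carrier K" "u \<in> carrier (M \<boxtimes>\<^bsub>R\<^esub> (N \<boxtimes>\<^bsub>S\<^esub> P))"
  let ?v = "assoc_inv R S M N P u"
  have "assoc R S M N P (?v \<leftharpoonup>\<^bsub>(M \<boxtimes>\<^bsub>R\<^esub> N) \<boxtimes>\<^bsub>S\<^esub> P\<^esub> a) = u \<leftharpoonup>\<^bsub>M \<boxtimes>\<^bsub>R\<^esub> (N \<boxtimes>\<^bsub>S\<^esub> P)\<^esub> a"
    using au by (simp add: right_hom_ract[OF assoc_right_hom[OF M N P]])
  then show "assoc_inv R S M N P (u \<leftharpoonup>\<^bsub>M \<boxtimes>\<^bsub>R\<^esub> (N \<boxtimes>\<^bsub>S\<^esub> P)\<^esub> a) = ?v \<leftharpoonup>\<^bsub>(M \<boxtimes>\<^bsub>R\<^esub> N) \<boxtimes>\<^bsub>S\<^esub> P\<^esub> a"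
    using au assoc_inv_assoc[of R M S N P "?v \<leftharpoonup>\<^bsub>(M \<boxtimes>\<^bsub>R\<^esub> N) \<boxtimes>\<^bsub>S\<^esub> P\<^esub> a"] by simp
qed

text \<open>This is the additive case in the later inductions that show membership in the image of a
  tensored submodule.\<close>

lemma tensor_map_image_add:
  assumes M: "right_module R M" "left_module R N" and M': "right_module R M'" "left_module R N'"
    and f: "f \<in> right_hom R M M'" and g: "g \<in> left_hom R N N'"
    and u: "u \<in> tensor_map R M N M' N' f g ` carrier (M \<boxtimes>\<^bsub>R\<^esub> N)"
    and v: "v \<in> tensor_map R M N M' N' f g ` carrier (M \<boxtimes>\<^bsub>R\<^esub> N)"
  shows "u \<oplus>\<^bsub>M' \<boxtimes>\<^bsub>R\<^esub> N'\<^esub> v \<in> tensor_map R M N M' N' f g ` carrier (M \<boxtimes>\<^bsub>R\<^esub> N)"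
proof -
  interpret T: abelian_group "M \<boxtimes>\<^bsub>R\<^esub> N" by (rule tensor_abelian_group[OF M])
  obtain s where s: "s \<in> carrier (M \<boxtimes>\<^bsub>R\<^esub> N)" "u = tensor_map R M N M' N' f g s"
    using u by blast
  obtain t where t: "t \<in> carrier (M \<boxtimes>\<^bsub>R\<^esub> N)" "v = tensor_map R M N M' N' f g t"
    using v by blast
  show ?thesis
    using s t T.a_closed[OF s(1) t(1)] tensor_map_add[OF M M' f g s(1) t(1)] by (metis image_eqI)
qed

section \<open>Submodules and direct sums\<close>

lemma sub_bimod_simps [simp]:
  "carrier (sub_bimod M X) = X" "ring.add (sub_bimod M X) = ring.add M" "\<zero>\<^bsub>sub_bimod M X\<^esub> = \<zero>\<^bsub>M\<^esub>"
  "lact (sub_bimod M X) = lact M" "ract (sub_bimod M X) = ract M"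
  by (simp_all add: sub_bimod_def)

text \<open>Serves as the middle term of the exact sequence that computes an intersection of
  submodules.\<close>

definition dsum :: "('l, 'm, 'r) bimod \<Rightarrow> ('l, 'n, 'r) bimod \<Rightarrow> ('l, 'm \<times> 'n, 'r) bimod" where
  "dsum M N = \<lparr>carrier = carrier M \<times> carrier N, monoid.mult = undefined, one = undefined,
     ring.zero = (\<zero>\<^bsub>M\<^esub>, \<zero>\<^bsub>N\<^esub>), add = (\<lambda>u v. (fst u \<oplus>\<^bsub>M\<^esub> fst v, snd u \<oplus>\<^bsub>N\<^esub> snd v)),
     lact = (\<lambda>a u. (a \<rightharpoonup>\<^bsub>M\<^esub> fst u, a \<rightharpoonup>\<^bsub>N\<^esub> snd u)), ract = (\<lambda>u a. (fst u \<leftharpoonup>\<^bsub>M\<^esub> a, snd u \<leftharpoonup>\<^bsub>N\<^esub> a))\<rparr>"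

lemma dsum_simps [simp]:
  "carrier (dsum M N) = carrier M \<times> carrier N" "\<zero>\<^bsub>dsum M N\<^esub> = (\<zero>\<^bsub>M\<^esub>, \<zero>\<^bsub>N\<^esub>)"
  "u \<oplus>\<^bsub>dsum M N\<^esub> v = (fst u \<oplus>\<^bsub>M\<^esub> fst v, snd u \<oplus>\<^bsub>N\<^esub> snd v)"
  "a \<rightharpoonup>\<^bsub>dsum M N\<^esub> u = (a \<rightharpoonup>\<^bsub>M\<^esub> fst u, a \<rightharpoonup>\<^bsub>N\<^esub> snd u)"
  "u \<leftharpoonup>\<^bsub>dsum M N\<^esub> b = (fst u \<leftharpoonup>\<^bsub>M\<^esub> b, snd u \<leftharpoonup>\<^bsub>N\<^esub> b)"
  by (simp_all add: dsum_def)

lemma dsum_abelian_group: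
  assumes "abelian_group M" "abelian_group N"
  shows "abelian_group (dsum M N)"
proof -
  interpret M: abelian_group M by fact
  interpret N: abelian_group N by fact
  show ?thesis
    by (rule abelian_groupI) (auto simp: M.a_ac N.a_ac intro: M.l_neg N.l_neg M.a_inv_closed N.a_inv_closed)
qed

text \<open>Exactness at the middle term involves the last module only through the kernel of
  \<open>g\<close>. So the first two modules are matched by bijections, and the last one by an
  injection that preserves zero.\<close>

lemma exact_at_cong:
  assumes p: "bij_betw p (carrier X) (carrier X')" and q: "bij_betw q (carrier Y) (carrier Y')"
    and r: "inj_on r (carrier Z)" "r \<zero>\<^bsub>Z\<^esub> = \<zero>\<^bsub>Z'\<^esub>" "\<zero>\<^bsub>Z\<^esub> \<in> carrier Z"
    and f: "\<And>x. x \<in> carrier X \<Longrightarrow> f x \<in> carrier Y" and g: "\<And>y. y \<in> carrier Y \<Longrightarrow> g y \<in> carrier Z"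
    and qf: "\<And>x. x \<in> carrier X \<Longrightarrow> q (f x) = f' (p x)"
    and rg: "\<And>y. y \<in> carrier Y \<Longrightarrow> r (g y) = g' (q y)"
  shows "exact_at X Y Z f g \<longleftrightarrow> exact_at X' Y' Z' f' g'"
proof -
  have X': "carrier X' = p ` carrier X" and Y': "carrier Y' = q ` carrier Y" and iq: "inj_on q (carrier Y)"
    using p q by (auto simp: bij_betw_def)
  have "f' ` carrier X' = q ` f ` carrier X"
    unfolding X' by (auto simp: qf image_iff)
  moreover have "{y \<in> carrier Y'. g' y = \<zero>\<^bsub>Z'\<^esub>} = q ` {y \<in> carrier Y. g y = \<zero>\<^bsub>Z\<^esub>}"
  proof -
    have "g' (q y) = \<zero>\<^bsub>Z'\<^esub> \<longleftrightarrow> g y = \<zero>\<^bsub>Z\<^esub>" if "y \<in> carrier Y" for y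
      using that r g[OF that] rg[OF that] by (metis inj_onD)
    then show ?thesis by (auto simp: Y')
  qed
  moreover have "f ` carrier X \<subseteq> carrier Y"
    using f by auto
  ultimately show ?thesis
    unfolding exact_at_def by (simp add: inj_on_image_eq_iff[OF iq])
qed

lemma (in abelian_group) eq_of_diff_zero:
  assumes "x \<ominus> y = \<zero>" "x \<in> carrier G" "y \<in> carrier G"
  shows "x = y"
proof -
  have "\<ominus> (\<ominus> y) = x"
    using assms by (intro minus_equality) (simp_all add: a_minus_def)
  then show ?thesis using assms(3) by (simp only: minus_minus)
qed

lemma tensor_zero_closed:
  "\<lbrakk>right_module R M; left_module R N\<rbrakk> \<Longrightarrow> \<zero>\<^bsub>M \<boxtimes>\<^bsub>R\<^esub> N\<^esub> \<in> carrier (M \<boxtimes>\<^bsub>R\<^esub> N)"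
  using abelian_group.axioms(1)[OF tensor_abelian_group] abelian_monoid.zero_closed by blast

lemma infinite_times_eqpoll_self: "infinite A \<Longrightarrow> A \<times> A \<approx> A"
  by (simp add: eqpoll_iff_card_of_ordIso card_of_Times_same_infinite)

text \<open>The tensor product is a quotient of the free abelian group on pairs, and an infinite set
  absorbs both pairs and finite integer combinations. This keeps iterated tensor products within the
  size on which flatness is tested.\<close>

lemma tensor_lepoll:
  assumes "infinite (UNIV :: 'x set)" "carrier M \<lesssim> (UNIV :: 'x set)" "carrier N \<lesssim> (UNIV :: 'x set)"
  shows "carrier (M \<boxtimes>\<^bsub>R\<^esub> N) \<lesssim> (UNIV :: 'x set)"
proof -
  have "carrier M \<times> carrier N \<lesssim> (UNIV :: 'x set) \<times> (UNIV :: 'x set)"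
    using assms by (intro times_lepoll_mono)
  also have "\<dots> \<approx> (UNIV :: 'x set)"
    using assms(1) by (rule infinite_times_eqpoll_self)
  finally have *: "carrier M \<times> carrier N \<lesssim> (UNIV :: 'x set)" .
  then obtain i :: "_ \<Rightarrow> 'x" where i: "inj_on i (carrier M \<times> carrier N)"
    by (auto simp: lepoll_def)
  have "carrier (M \<boxtimes>\<^bsub>R\<^esub> N) \<lesssim> carrier (free_Abelian_group (carrier M \<times> carrier N))"
    unfolding carrier_tensor by (rule image_lepoll)
  also have "carrier (free_Abelian_group (carrier M \<times> carrier N)) \<approx> carrier (free_Abelian_group (i ` (carrier M \<times> carrier N)))"
    using i by (intro iso_imp_eqpoll_carrier) (simp add: isomorphic_free_Abelian_groups inj_on_image_eqpoll_self eqpoll_sym)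
  also have "\<dots> \<lesssim> carrier (free_Abelian_group (UNIV :: 'x set))"
    by (intro subset_imp_lepoll) auto
  also have "\<dots> \<approx> (UNIV :: 'x set)"
    using assms(1) by (rule eqpoll_free_Abelian_group_infinite)
  finally show ?thesis .
qed


section \<open>Flat and faithfully flat right modules\<close>

text \<open>Closure under negatives is a consequence of closure under the action, because
  \<open>- x\<close> is the scalar -1 applied to \<open>x\<close>.\<close>

lemma left_sub_bimodI:
  assumes M: "left_module R M" and X: "X \<subseteq> carrier M" "\<zero>\<^bsub>M\<^esub> \<in> X"
    and add: "\<And>x y. \<lbrakk>x \<in> X; y \<in> X\<rbrakk> \<Longrightarrow> x \<oplus>\<^bsub>M\<^esub> y \<in> X"
    and act: "\<And>a x. \<lbrakk>a \<in> carrier R; x \<in> X\<rbrakk> \<Longrightarrow> (a \<rightharpoonup>\<^bsub>M\<^esub> x) \<in> X"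
  shows "left_module R (sub_bimod M X)"
proof -
  interpret M: left_module R M by fact
  have neg: "\<exists>y\<in>X. y \<oplus>\<^bsub>M\<^esub> x = \<zero>\<^bsub>M\<^esub>" if x: "x \<in> X" for x
  proof
    have xM: "x \<in> carrier M" using x X by auto
    let ?o = "\<ominus>\<^bsub>R\<^esub> \<one>\<^bsub>R\<^esub>"
    show "(?o \<rightharpoonup>\<^bsub>M\<^esub> x) \<in> X" using x by (intro act) auto
    have "(\<zero>\<^bsub>R\<^esub> \<rightharpoonup>\<^bsub>M\<^esub> x) \<oplus>\<^bsub>M\<^esub> (\<zero>\<^bsub>R\<^esub> \<rightharpoonup>\<^bsub>M\<^esub> x) = (\<zero>\<^bsub>R\<^esub> \<rightharpoonup>\<^bsub>M\<^esub> x)"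
      using M.add_lact[of "\<zero>\<^bsub>R\<^esub>" "\<zero>\<^bsub>R\<^esub>" x] xM by simp
    then have "(\<zero>\<^bsub>R\<^esub> \<rightharpoonup>\<^bsub>M\<^esub> x) = \<zero>\<^bsub>M\<^esub>"
      using M.lact_closed[of "\<zero>\<^bsub>R\<^esub>" x] xM by (simp add: M.M.add.l_cancel_one)
    moreover have "(?o \<rightharpoonup>\<^bsub>M\<^esub> x) \<oplus>\<^bsub>M\<^esub> (\<one>\<^bsub>R\<^esub> \<rightharpoonup>\<^bsub>M\<^esub> x) = (\<zero>\<^bsub>R\<^esub> \<rightharpoonup>\<^bsub>M\<^esub> x)"
      using M.add_lact[of ?o "\<one>\<^bsub>R\<^esub>" x] xM by (simp add: M.lring.l_neg)
    ultimately show "(?o \<rightharpoonup>\<^bsub>M\<^esub> x) \<oplus>\<^bsub>M\<^esub> x = \<zero>\<^bsub>M\<^esub>"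
      using xM by (simp add: M.one_lact)
  qed
  have "abelian_group (sub_bimod M X)"
    using X add neg by (intro abelian_groupI) (auto simp: M.M.a_ac subsetD)
  then show ?thesis
    using X act M.lact_closed unfolding left_module_def left_module_axioms_def
    by (auto simp: M.lring.ring_axioms subsetD M.lact_add M.add_lact M.mult_lact M.one_lact)
qed

lemma sub_bimod_left_hom [simp]:
  "X \<subseteq> Y \<Longrightarrow> id \<in> left_hom R (sub_bimod M X) (sub_bimod M Y)"
  "X \<subseteq> Y \<Longrightarrow> (\<lambda>x. x) \<in> left_hom R (sub_bimod M X) (sub_bimod M Y)"
  "X \<subseteq> carrier M \<Longrightarrow> id \<in> left_hom R (sub_bimod M X) M"
  "X \<subseteq> carrier M \<Longrightarrow> (\<lambda>x. x) \<in> left_hom R (sub_bimod M X) M"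
  by (auto simp: left_hom_iff add_hom_iff)

lemma dsum_left_module:
  assumes "left_module R M" "left_module R N"
  shows "left_module R (dsum M N)"
proof -
  interpret M: left_module R M by fact
  interpret N: left_module R N by fact
  show ?thesis
    using dsum_abelian_group[OF M.M.abelian_group_axioms N.M.abelian_group_axioms]
    unfolding left_module_def left_module_axioms_def
    by (auto simp: M.lring.ring_axioms M.lact_closed N.lact_closed M.lact_add N.lact_add M.add_lact N.add_lact
        M.mult_lact N.mult_lact M.one_lact N.one_lact)
qed

text \<open>Transport of structure along an injection into the type on which flatness is tested. The
  right scalars become \<open>unit\<close> to match the test modules of
  \<open>flat_right\<close>.\<close>

definition left_copy :: "('m \<Rightarrow> 'x) \<Rightarrow> ('r, 'm, 'k) bimod \<Rightarrow> ('r, 'x, unit) bimod" where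
  "left_copy i X = \<lparr>carrier = i ` carrier X, monoid.mult = undefined, one = undefined,
     ring.zero = i \<zero>\<^bsub>X\<^esub>, add = (\<lambda>u v. i (inv_into (carrier X) i u \<oplus>\<^bsub>X\<^esub> inv_into (carrier X) i v)),
     lact = (\<lambda>a u. i (a \<rightharpoonup>\<^bsub>X\<^esub> inv_into (carrier X) i u)), ract = (\<lambda>_ _. undefined)\<rparr>"

lemma
  assumes X: "left_module R X" and i: "inj_on i (carrier X)"
  shows left_copy_module: "left_module R (left_copy i X)"
    and left_copy_hom: "i \<in> left_hom R X (left_copy i X)"
    and left_copy_inv_hom: "inv_into (carrier X) i \<in> left_hom R (left_copy i X) X"
    and left_copy_bij: "bij_betw i (carrier X) (carrier (left_copy i X))"
    and left_copy_inv: "x \<in> carrier X \<Longrightarrow> inv_into (carrier X) i (i x) = x"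
    and left_copy_inv': "u \<in> carrier (left_copy i X) \<Longrightarrow> i (inv_into (carrier X) i u) = u"
proof -
  interpret X: left_module R X by fact
  let ?j = "inv_into (carrier X) i"
  have j: "?j (i x) = x" if "x \<in> carrier X" for x
    using i that by simp
  have "abelian_group (left_copy i X)"
  proof (rule abelian_groupI)
    fix u assume "u \<in> carrier (left_copy i X)"
    then obtain x where x: "x \<in> carrier X" "u = i x" by (auto simp: left_copy_def)
    then show "\<exists>v\<in>carrier (left_copy i X). v \<oplus>\<^bsub>left_copy i X\<^esub> u = \<zero>\<^bsub>left_copy i X\<^esub>"
      by (intro bexI[of _ "i (\<ominus>\<^bsub>X\<^esub> x)"]) (auto simp: left_copy_def j X.M.l_neg)
  qed (auto simp: left_copy_def j X.M.a_ac)
  then show "left_module R (left_copy i X)"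
    unfolding left_module_def left_module_axioms_def
    by (auto simp: left_copy_def j X.lring.ring_axioms X.lact_closed X.lact_add X.add_lact X.mult_lact X.one_lact)
  show "i \<in> left_hom R X (left_copy i X)" "?j \<in> left_hom R (left_copy i X) X"
    by (auto simp: left_hom_iff add_hom_iff left_copy_def j X.lact_closed)
  show "bij_betw i (carrier X) (carrier (left_copy i X))"
    using i by (auto simp: left_copy_def bij_betw_def)
  show "x \<in> carrier X \<Longrightarrow> ?j (i x) = x" by (rule j)
  show "u \<in> carrier (left_copy i X) \<Longrightarrow> i (?j u) = u"
    by (auto simp: left_copy_def j)
qed

lemma left_copy_tensor_bij:
  assumes M: "right_module R M" and X: "left_module R X" and i: "inj_on i (carrier X)"
  shows "bij_betw (tensor_map R M X M (left_copy i X) id i) (carrier (M \<boxtimes>\<^bsub>R\<^esub> X)) (carrier (M \<boxtimes>\<^bsub>R\<^esub> (left_copy i X)))"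
proof (rule bij_betwI)
  let ?X' = "left_copy i X" and ?j = "inv_into (carrier X) i"
  note copy = left_copy_module[OF X i] left_copy_hom[OF X i] left_copy_inv_hom[OF X i]
    left_copy_inv[OF X i] left_copy_inv'[OF X i]
  note [simp] = copy(1-3) M X
  show "tensor_map R M X M ?X' id i \<in> carrier (M \<boxtimes>\<^bsub>R\<^esub> X) \<rightarrow> carrier (M \<boxtimes>\<^bsub>R\<^esub> ?X')" by auto
  show "tensor_map R M ?X' M X id ?j \<in> carrier (M \<boxtimes>\<^bsub>R\<^esub> ?X') \<rightarrow> carrier (M \<boxtimes>\<^bsub>R\<^esub> X)" by auto
  show "tensor_map R M ?X' M X id ?j (tensor_map R M X M ?X' id i u) = u" if "u \<in> carrier (M \<boxtimes>\<^bsub>R\<^esub> X)" for u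
    using that by (subst tensor_map_comp) (simp_all add: tensor_map_id copy(4))
  show "tensor_map R M X M ?X' id i (tensor_map R M ?X' M X id ?j v) = v" if "v \<in> carrier (M \<boxtimes>\<^bsub>R\<^esub> ?X')" for v
    using that by (subst tensor_map_comp) (simp_all add: tensor_map_id copy(5))
qed

text \<open>Flatness speaks about one carrier type only; this replaces a sequence of small enough
  modules by an isomorphic one there. Both equivalences are recorded, since flatness reads them in
  one direction and faithful flatness in the other.\<close>

lemma exact_left_copy:
  fixes X :: "('r, 'm1, 'k1) bimod" and Y :: "('r, 'm2, 'k2) bimod" and Z :: "('r, 'm3, 'k3) bimod" and M :: "('l, 'm, 'r) bimod"
  assumes M: "right_module R M" and XYZ: "left_module R X" "left_module R Y" "left_module R Z"
    and f: "f \<in> left_hom R X Y" and g: "g \<in> left_hom R Y Z"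
    and le: "carrier X \<lesssim> (UNIV :: 'x set)" "carrier Y \<lesssim> (UNIV :: 'x set)" "carrier Z \<lesssim> (UNIV :: 'x set)"
  obtains X' Y' Z' :: "('r, 'x, unit) bimod" and f' g'
  where "left_module R X'" "left_module R Y'" "left_module R Z'"
    "f' \<in> left_hom R X' Y'" "g' \<in> left_hom R Y' Z'"
    "exact_at X Y Z f g \<longleftrightarrow> exact_at X' Y' Z' f' g'"
    "exact_at (M \<boxtimes>\<^bsub>R\<^esub> X) (M \<boxtimes>\<^bsub>R\<^esub> Y) (M \<boxtimes>\<^bsub>R\<^esub> Z) (tensor_map R M X M Y id f) (tensor_map R M Y M Z id g) \<longleftrightarrow>
     exact_at (M \<boxtimes>\<^bsub>R\<^esub> X') (M \<boxtimes>\<^bsub>R\<^esub> Y') (M \<boxtimes>\<^bsub>R\<^esub> Z') (tensor_map R M X' M Y' id f') (tensor_map R M Y' M Z' id g')"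
proof -
  obtain i j k :: "_ \<Rightarrow> 'x"
    where i: "inj_on i (carrier X)" and j: "inj_on j (carrier Y)" and k: "inj_on k (carrier Z)"
    using le by (auto simp: lepoll_def)
  let ?X = "left_copy i X" and ?Y = "left_copy j Y" and ?Z = "left_copy k Z"
  let ?i = "inv_into (carrier X) i" and ?j = "inv_into (carrier Y) j"
  let ?f = "\<lambda>u. j (f (?i u))" and ?g = "\<lambda>u. k (g (?j u))"
  note I = left_copy_module[OF XYZ(1) i] left_copy_hom[OF XYZ(1) i] left_copy_inv_hom[OF XYZ(1) i]
  note J = left_copy_module[OF XYZ(2) j] left_copy_hom[OF XYZ(2) j] left_copy_inv_hom[OF XYZ(2) j]
  note K = left_copy_module[OF XYZ(3) k] left_copy_hom[OF XYZ(3) k] left_copy_inv_hom[OF XYZ(3) k]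
  note fg_closed = add_hom_closed[OF left_hom_add_hom[OF f]] add_hom_closed[OF left_hom_add_hom[OF g]]
  have f': "?f \<in> left_hom R ?X ?Y" and g': "?g \<in> left_hom R ?Y ?Z"
    using I J K f g by (auto simp: left_hom_iff add_hom_iff)
  note [simp] = M XYZ I(1) J(1) K(1)
  have Z0: "\<zero>\<^bsub>Z\<^esub> \<in> carrier Z"
    using left_module_abelian_group[OF XYZ(3)] by (simp add: abelian_group_def abelian_monoid.zero_closed)
  have 1: "exact_at X Y Z f g \<longleftrightarrow> exact_at ?X ?Y ?Z ?f ?g"
    by (rule exact_at_cong[OF left_copy_bij[OF XYZ(1) i] left_copy_bij[OF XYZ(2) j] k])
      (simp_all add: fg_closed i j k Z0 left_copy_def)
  have 2: "exact_at (M \<boxtimes>\<^bsub>R\<^esub> X) (M \<boxtimes>\<^bsub>R\<^esub> Y) (M \<boxtimes>\<^bsub>R\<^esub> Z) (tensor_map R M X M Y id f) (tensor_map R M Y M Z id g) \<longleftrightarrow>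
     exact_at (M \<boxtimes>\<^bsub>R\<^esub> ?X) (M \<boxtimes>\<^bsub>R\<^esub> ?Y) (M \<boxtimes>\<^bsub>R\<^esub> ?Z) (tensor_map R M ?X M ?Y id ?f) (tensor_map R M ?Y M ?Z id ?g)"
  proof (rule exact_at_cong[OF left_copy_tensor_bij[OF M XYZ(1) i] left_copy_tensor_bij[OF M XYZ(2) j]
        bij_betw_imp_inj_on[OF left_copy_tensor_bij[OF M XYZ(3) k]]])
    show "tensor_map R M Z M ?Z id k \<zero>\<^bsub>M \<boxtimes>\<^bsub>R\<^esub> Z\<^esub> = \<zero>\<^bsub>M \<boxtimes>\<^bsub>R\<^esub> ?Z\<^esub>"
      using K by (intro add_hom_zero tensor_map_hom) auto
    show "\<zero>\<^bsub>M \<boxtimes>\<^bsub>R\<^esub> Z\<^esub> \<in> carrier (M \<boxtimes>\<^bsub>R\<^esub> Z)"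
      by (simp add: tensor_zero_closed)
    fix u assume u: "u \<in> carrier (M \<boxtimes>\<^bsub>R\<^esub> X)"
    show "tensor_map R M X M Y id f u \<in> carrier (M \<boxtimes>\<^bsub>R\<^esub> Y)" using u f by simp
    have "tensor_map R M Y M ?Y id j (tensor_map R M X M Y id f u) = tensor_map R M X M ?Y id (\<lambda>x. j (f x)) u"
      using u f J by (subst tensor_map_comp) (auto simp: id_def)
    also have "\<dots> = tensor_map R M X M ?Y id (\<lambda>x. ?f (i x)) u"
      using u f I J i by (intro tensor_map_cong) (auto simp: id_def left_hom_iff add_hom_iff)
    also have "\<dots> = tensor_map R M ?X M ?Y id ?f (tensor_map R M X M ?X id i u)"
      using u I f' by (subst tensor_map_comp) (auto simp: id_def)
    finally show "tensor_map R M Y M ?Y id j (tensor_map R M X M Y id f u) = tensor_map R M ?X M ?Y id ?f (tensor_map R M X M ?X id i u)" .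
  next
    fix u assume u: "u \<in> carrier (M \<boxtimes>\<^bsub>R\<^esub> Y)"
    show "tensor_map R M Y M Z id g u \<in> carrier (M \<boxtimes>\<^bsub>R\<^esub> Z)" using u g by simp
    have "tensor_map R M Z M ?Z id k (tensor_map R M Y M Z id g u) = tensor_map R M Y M ?Z id (\<lambda>x. k (g x)) u"
      using u g K by (subst tensor_map_comp) (auto simp: id_def)
    also have "\<dots> = tensor_map R M Y M ?Z id (\<lambda>x. ?g (j x)) u"
      using u g J K j by (intro tensor_map_cong) (auto simp: id_def left_hom_iff add_hom_iff)
    also have "\<dots> = tensor_map R M ?Y M ?Z id ?g (tensor_map R M Y M ?Y id j u)"
      using u J g' by (subst tensor_map_comp) (auto simp: id_def)
    finally show "tensor_map R M Z M ?Z id k (tensor_map R M Y M Z id g u) = tensor_map R M ?Y M ?Z id ?g (tensor_map R M Y M ?Y id j u)" .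
  qed
  show thesis
    by (rule that[OF I(1) J(1) K(1) f' g' 1 2])
qed

lemma flat_right_exact:
  fixes X :: "('r, 'm1, 'k1) bimod" and Y :: "('r, 'm2, 'k2) bimod" and Z :: "('r, 'm3, 'k3) bimod"
  assumes flat: "flat_right TYPE('x) R M"
    and M: "right_module R M" and XYZ: "left_module R X" "left_module R Y" "left_module R Z"
    and fg: "f \<in> left_hom R X Y" "g \<in> left_hom R Y Z"
    and le: "carrier X \<lesssim> (UNIV :: 'x set)" "carrier Y \<lesssim> (UNIV :: 'x set)" "carrier Z \<lesssim> (UNIV :: 'x set)"
    and ex: "exact_at X Y Z f g"
  shows "exact_at (M \<boxtimes>\<^bsub>R\<^esub> X) (M \<boxtimes>\<^bsub>R\<^esub> Y) (M \<boxtimes>\<^bsub>R\<^esub> Z) (tensor_map R M X M Y id f) (tensor_map R M Y M Z id g)"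
proof (rule exact_left_copy[OF M XYZ fg le])
  fix X' Y' Z' :: "('r, 'x, unit) bimod" and f' g'
  assume *: "left_module R X'" "left_module R Y'" "left_module R Z'"
      "f' \<in> left_hom R X' Y'" "g' \<in> left_hom R Y' Z'"
    and iff: "exact_at X Y Z f g \<longleftrightarrow> exact_at X' Y' Z' f' g'"
      "exact_at (M \<boxtimes>\<^bsub>R\<^esub> X) (M \<boxtimes>\<^bsub>R\<^esub> Y) (M \<boxtimes>\<^bsub>R\<^esub> Z) (tensor_map R M X M Y id f) (tensor_map R M Y M Z id g) \<longleftrightarrow>
       exact_at (M \<boxtimes>\<^bsub>R\<^esub> X') (M \<boxtimes>\<^bsub>R\<^esub> Y') (M \<boxtimes>\<^bsub>R\<^esub> Z') (tensor_map R M X' M Y' id f') (tensor_map R M Y' M Z' id g')"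
  show ?thesis
    using flat[unfolded flat_right_def, rule_format, of X' Y' Z' f' g'] ex * unfolding iff by simp
qed

lemma faithfully_flat_right_exact:
  fixes X :: "('r, 'm1, 'k1) bimod" and Y :: "('r, 'm2, 'k2) bimod" and Z :: "('r, 'm3, 'k3) bimod"
  assumes flat: "faithfully_flat_right TYPE('x) R M"
    and M: "right_module R M" and XYZ: "left_module R X" "left_module R Y" "left_module R Z"
    and fg: "f \<in> left_hom R X Y" "g \<in> left_hom R Y Z"
    and le: "carrier X \<lesssim> (UNIV :: 'x set)" "carrier Y \<lesssim> (UNIV :: 'x set)" "carrier Z \<lesssim> (UNIV :: 'x set)"
    and ex: "exact_at (M \<boxtimes>\<^bsub>R\<^esub> X) (M \<boxtimes>\<^bsub>R\<^esub> Y) (M \<boxtimes>\<^bsub>R\<^esub> Z) (tensor_map R M X M Y id f) (tensor_map R M Y M Z id g)"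
  shows "exact_at X Y Z f g"
proof (rule exact_left_copy[OF M XYZ fg le])
  fix X' Y' Z' :: "('r, 'x, unit) bimod" and f' g'
  assume *: "left_module R X'" "left_module R Y'" "left_module R Z'"
      "f' \<in> left_hom R X' Y'" "g' \<in> left_hom R Y' Z'"
    and iff: "exact_at X Y Z f g \<longleftrightarrow> exact_at X' Y' Z' f' g'"
      "exact_at (M \<boxtimes>\<^bsub>R\<^esub> X) (M \<boxtimes>\<^bsub>R\<^esub> Y) (M \<boxtimes>\<^bsub>R\<^esub> Z) (tensor_map R M X M Y id f) (tensor_map R M Y M Z id g) \<longleftrightarrow>
       exact_at (M \<boxtimes>\<^bsub>R\<^esub> X') (M \<boxtimes>\<^bsub>R\<^esub> Y') (M \<boxtimes>\<^bsub>R\<^esub> Z') (tensor_map R M X' M Y' id f') (tensor_map R M Y' M Z' id g')"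
  show ?thesis
    using flat[unfolded faithfully_flat_right_def, rule_format, of X' Y' Z' f' g'] ex * unfolding iff by simp
qed

lemma faithfully_flat_right_imp_flat: "faithfully_flat_right U R M \<Longrightarrow> flat_right U R M"
  unfolding faithfully_flat_right_def flat_right_def by blast

text \<open>Injectivity of \<open>f\<close> is exactness of 0 \<rightarrow> X \<rightarrow> Y, with
  the zero module realised as a submodule of \<open>X\<close>. After tensoring, everything that
  comes from it is zero, so the kernel is zero, and differences give injectivity.\<close>

lemma flat_right_inj:
  fixes X :: "('r, 'm1, 'k1) bimod" and Y :: "('r, 'm2, 'k2) bimod"
  assumes flat: "flat_right TYPE('x) R M"
    and M: "right_module R M" and XY: "left_module R X" "left_module R Y"
    and f: "f \<in> left_hom R X Y" "inj_on f (carrier X)"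
    and le: "carrier X \<lesssim> (UNIV :: 'x set)" "carrier Y \<lesssim> (UNIV :: 'x set)"
  shows "inj_on (tensor_map R M X M Y id f) (carrier (M \<boxtimes>\<^bsub>R\<^esub> X))"
proof -
  interpret X: left_module R X by fact
  interpret Y: left_module R Y by fact
  let ?O = "sub_bimod X {\<zero>\<^bsub>X\<^esub>}"
  have act0: "(a \<rightharpoonup>\<^bsub>X\<^esub> \<zero>\<^bsub>X\<^esub>) = \<zero>\<^bsub>X\<^esub>" if "a \<in> carrier R" for a
    using that add_hom_zero[of X X "\<lambda>x. (a \<rightharpoonup>\<^bsub>X\<^esub> x)"] X.M.abelian_group_axioms
    by (simp add: add_hom_iff X.lact_closed X.lact_add)
  have O: "left_module R ?O"
    by (rule left_sub_bimodI[OF XY(1)]) (auto simp: act0)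
  have f0: "f \<zero>\<^bsub>X\<^esub> = \<zero>\<^bsub>Y\<^esub>"
    by (rule add_hom_zero[OF X.M.abelian_group_axioms Y.M.abelian_group_axioms left_hom_add_hom[OF f(1)]])
  have "exact_at ?O X Y id f"
  proof -
    have "y = \<zero>\<^bsub>X\<^esub>" if "y \<in> carrier X" "f y = \<zero>\<^bsub>Y\<^esub>" for y
      using inj_onD[OF f(2), of y "\<zero>\<^bsub>X\<^esub>"] f0 that by simp
    then show ?thesis
      using f0 by (auto simp: exact_at_def)
  qed
  moreover have "carrier ?O \<lesssim> (UNIV :: 'x set)"
    by (rule lepoll_trans[OF subset_imp_lepoll le(1)]) simp
  ultimately have ex: "exact_at (M \<boxtimes>\<^bsub>R\<^esub> ?O) (M \<boxtimes>\<^bsub>R\<^esub> X) (M \<boxtimes>\<^bsub>R\<^esub> Y) (tensor_map R M ?O M X id id) (tensor_map R M X M Y id f)"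
    using O XY M f le by (intro flat_right_exact[OF flat]) auto
  have zero: "tensor_map R M ?O M X id id u = \<zero>\<^bsub>M \<boxtimes>\<^bsub>R\<^esub> X\<^esub>" if "u \<in> carrier (M \<boxtimes>\<^bsub>R\<^esub> ?O)" for u
  proof -
    interpret T: abelian_group "M \<boxtimes>\<^bsub>R\<^esub> X" using M XY by simp
    show ?thesis
      using M O that by (induction rule: tensor_induct) (simp_all add: M XY O tens_zero_right)
  qed
  interpret TX: abelian_group "M \<boxtimes>\<^bsub>R\<^esub> X" using M XY by simp
  interpret TY: abelian_group "M \<boxtimes>\<^bsub>R\<^esub> Y" using M XY by simp
  have hom: "tensor_map R M X M Y id f \<in> add_hom (M \<boxtimes>\<^bsub>R\<^esub> X) (M \<boxtimes>\<^bsub>R\<^esub> Y)"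
    using M XY f by (intro tensor_map_hom) auto
  show ?thesis
  proof (rule inj_onI)
    fix u v assume uv: "u \<in> carrier (M \<boxtimes>\<^bsub>R\<^esub> X)" "v \<in> carrier (M \<boxtimes>\<^bsub>R\<^esub> X)" "tensor_map R M X M Y id f u = tensor_map R M X M Y id f v"
    have "tensor_map R M X M Y id f (u \<ominus>\<^bsub>M \<boxtimes>\<^bsub>R\<^esub> X\<^esub> v) = tensor_map R M X M Y id f u \<ominus>\<^bsub>M \<boxtimes>\<^bsub>R\<^esub> Y\<^esub> tensor_map R M X M Y id f v"
      by (rule add_hom_diff[OF TX.abelian_group_axioms TY.abelian_group_axioms hom uv(1,2)])
    then have "tensor_map R M X M Y id f (u \<ominus>\<^bsub>M \<boxtimes>\<^bsub>R\<^esub> X\<^esub> v) = \<zero>\<^bsub>M \<boxtimes>\<^bsub>R\<^esub> Y\<^esub>"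
      using uv add_hom_closed[OF hom] by (simp add: TY.r_neg a_minus_def)
    then have "u \<ominus>\<^bsub>M \<boxtimes>\<^bsub>R\<^esub> X\<^esub> v \<in> tensor_map R M ?O M X id id ` carrier (M \<boxtimes>\<^bsub>R\<^esub> ?O)"
      unfolding ex[unfolded exact_at_def] using uv by (simp add: TX.minus_closed)
    then obtain t where "t \<in> carrier (M \<boxtimes>\<^bsub>R\<^esub> ?O)" "u \<ominus>\<^bsub>M \<boxtimes>\<^bsub>R\<^esub> X\<^esub> v = tensor_map R M ?O M X id id t"
      by (rule imageE)
    then have "u \<ominus>\<^bsub>M \<boxtimes>\<^bsub>R\<^esub> X\<^esub> v = \<zero>\<^bsub>M \<boxtimes>\<^bsub>R\<^esub> X\<^esub>"
      by (simp only: zero)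
    then show "u = v"
      using uv(1,2) by (rule TX.eq_of_diff_zero)
  qed
qed

lemma flat_right_kernel:
  fixes Y :: "('r, 'm2, 'k2) bimod" and Z :: "('r, 'm3, 'k3) bimod"
  assumes flat: "flat_right TYPE('x) R M"
    and M: "right_module R M" and YZ: "left_module R Y" "left_module R Z"
    and f: "f \<in> left_hom R Y Z" and X: "left_module R (sub_bimod Y X)" "X = {y \<in> carrier Y. f y = \<zero>\<^bsub>Z\<^esub>}"
    and le: "carrier Y \<lesssim> (UNIV :: 'x set)" "carrier Z \<lesssim> (UNIV :: 'x set)"
    and u: "u \<in> carrier (M \<boxtimes>\<^bsub>R\<^esub> Y)" "tensor_map R M Y M Z id f u = \<zero>\<^bsub>M \<boxtimes>\<^bsub>R\<^esub> Z\<^esub>"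
  shows "u \<in> tensor_map R M (sub_bimod Y X) M Y id id ` carrier (M \<boxtimes>\<^bsub>R\<^esub> (sub_bimod Y X))"
proof -
  have "carrier (sub_bimod Y X) \<lesssim> (UNIV :: 'x set)"
    using le(1) X(2) by (auto intro: lepoll_trans[OF subset_imp_lepoll])
  moreover have "exact_at (sub_bimod Y X) Y Z id f"
    using X(2) by (auto simp: exact_at_def)
  ultimately have "exact_at (M \<boxtimes>\<^bsub>R\<^esub> (sub_bimod Y X)) (M \<boxtimes>\<^bsub>R\<^esub> Y) (M \<boxtimes>\<^bsub>R\<^esub> Z) (tensor_map R M (sub_bimod Y X) M Y id id) (tensor_map R M Y M Z id f)"
    using assms by (intro flat_right_exact[OF flat]) auto
  then show ?thesis
    using u unfolding exact_at_def by simp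
qed

text \<open>The equalizer is the kernel of \<open>f - g\<close>, and tensoring is additive in the
  map. In this form flatness applies to the corings, which are defined by equations.\<close>

lemma flat_right_equalizer:
  fixes Y :: "('r, 'm2, 'k2) bimod" and Z :: "('r, 'm3, 'k3) bimod"
  assumes flat: "flat_right TYPE('x) R M"
    and M: "right_module R M" and YZ: "left_module R Y" "left_module R Z"
    and f: "f \<in> left_hom R Y Z" and g: "g \<in> left_hom R Y Z"
    and X: "left_module R (sub_bimod Y X)" "X = {y \<in> carrier Y. f y = g y}"
    and le: "carrier Y \<lesssim> (UNIV :: 'x set)" "carrier Z \<lesssim> (UNIV :: 'x set)"
    and u: "u \<in> carrier (M \<boxtimes>\<^bsub>R\<^esub> Y)" "tensor_map R M Y M Z id f u = tensor_map R M Y M Z id g u"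
  shows "u \<in> tensor_map R M (sub_bimod Y X) M Y id id ` carrier (M \<boxtimes>\<^bsub>R\<^esub> (sub_bimod Y X))"
proof -
  interpret Z: left_module R Z by fact
  let ?d = "\<lambda>y. f y \<ominus>\<^bsub>Z\<^esub> g y"
  note fg_simps = add_hom_closed[OF left_hom_add_hom[OF f]] add_hom_closed[OF left_hom_add_hom[OF g]]
    add_hom_add[OF left_hom_add_hom[OF f]] add_hom_add[OF left_hom_add_hom[OF g]]
    left_hom_lact[OF f] left_hom_lact[OF g]
  have actm: "(a \<rightharpoonup>\<^bsub>Z\<^esub> (\<ominus>\<^bsub>Z\<^esub> x)) = \<ominus>\<^bsub>Z\<^esub> ((a \<rightharpoonup>\<^bsub>Z\<^esub> x))" if "a \<in> carrier R" "x \<in> carrier Z" for a x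
    using that add_hom_minus[of Z Z "\<lambda>x. (a \<rightharpoonup>\<^bsub>Z\<^esub> x)"] Z.M.abelian_group_axioms
    by (simp add: add_hom_iff Z.lact_closed Z.lact_add)
  have d: "?d \<in> left_hom R Y Z"
    by (auto simp: left_hom_iff add_hom_iff fg_simps a_minus_def Z.M.minus_add Z.M.a_ac Z.lact_add actm)
  have X': "X = {y \<in> carrier Y. ?d y = \<zero>\<^bsub>Z\<^esub>}"
    using X(2) by (auto simp: fg_simps a_minus_def Z.M.r_neg dest: Z.M.eq_of_diff_zero[unfolded a_minus_def])
  interpret TZ: abelian_group "M \<boxtimes>\<^bsub>R\<^esub> Z" using M YZ by simp
  \<comment> \<open>Additivity of the tensor functor on maps, stated as
    \<open>(f - g) + g = f\<close> so that the induction deals with sums only.\<close>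
  have "tensor_map R M Y M Z id ?d v \<oplus>\<^bsub>M \<boxtimes>\<^bsub>R\<^esub> Z\<^esub> tensor_map R M Y M Z id g v = tensor_map R M Y M Z id f v" if "v \<in> carrier (M \<boxtimes>\<^bsub>R\<^esub> Y)" for v
    using M YZ(1) that
  proof (induction rule: tensor_induct)
    case (tens x y)
    have "?d v \<oplus>\<^bsub>Z\<^esub> g v = f v" if "v \<in> carrier Y" for v
      using that by (simp add: fg_simps a_minus_def Z.M.a_assoc Z.M.l_neg)
    then show ?case
      using tens by (simp add: M YZ f g d fg_simps flip: tens_add_right)
  next
    case (add u v)
    have "a \<oplus>\<^bsub>M \<boxtimes>\<^bsub>R\<^esub> Z\<^esub> b \<oplus>\<^bsub>M \<boxtimes>\<^bsub>R\<^esub> Z\<^esub> (c \<oplus>\<^bsub>M \<boxtimes>\<^bsub>R\<^esub> Z\<^esub> d') = (a \<oplus>\<^bsub>M \<boxtimes>\<^bsub>R\<^esub> Z\<^esub> c) \<oplus>\<^bsub>M \<boxtimes>\<^bsub>R\<^esub> Z\<^esub> (b \<oplus>\<^bsub>M \<boxtimes>\<^bsub>R\<^esub> Z\<^esub> d')"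
      if "a \<in> carrier (M \<boxtimes>\<^bsub>R\<^esub> Z)" "b \<in> carrier (M \<boxtimes>\<^bsub>R\<^esub> Z)" "c \<in> carrier (M \<boxtimes>\<^bsub>R\<^esub> Z)" "d' \<in> carrier (M \<boxtimes>\<^bsub>R\<^esub> Z)" for a b c d'
      using that by (simp add: TZ.a_ac)
    then show ?case
      using add by (simp add: M YZ f g d)
  qed
  from this[OF u(1)] have "tensor_map R M Y M Z id ?d u = \<zero>\<^bsub>M \<boxtimes>\<^bsub>R\<^esub> Z\<^esub>"
    using u by (simp add: M YZ f g d)
  then show ?thesis
    by (rule flat_right_kernel[OF flat M YZ d X(1) X' le u(1)])
qed

text \<open>Apply flatness to \<open>0 \<rightarrow> X1 \<inter> X2 \<rightarrow> X1 \<oplus> X2 \<rightarrow> Y\<close>.\<close>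

lemma flat_right_inter:
  fixes Y :: "('r, 'm2, 'k2) bimod"
  assumes flat: "flat_right TYPE('x) R M" and inf: "infinite (UNIV :: 'x set)"
    and M: "right_module R M" and Y: "left_module R Y"
    and X1: "left_module R (sub_bimod Y X1)" "X1 \<subseteq> carrier Y"
    and X2: "left_module R (sub_bimod Y X2)" "X2 \<subseteq> carrier Y"
    and X12: "left_module R (sub_bimod Y (X1 \<inter> X2))"
    and le: "carrier Y \<lesssim> (UNIV :: 'x set)"
    and u1: "u \<in> tensor_map R M (sub_bimod Y X1) M Y id id ` carrier (M \<boxtimes>\<^bsub>R\<^esub> (sub_bimod Y X1))"
    and u2: "u \<in> tensor_map R M (sub_bimod Y X2) M Y id id ` carrier (M \<boxtimes>\<^bsub>R\<^esub> (sub_bimod Y X2))"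
  shows "u \<in> tensor_map R M (sub_bimod Y (X1 \<inter> X2)) M Y id id ` carrier (M \<boxtimes>\<^bsub>R\<^esub> (sub_bimod Y (X1 \<inter> X2)))"
proof -
  interpret Y: left_module R Y by fact
  interpret X1: left_module R "sub_bimod Y X1" by fact
  interpret X2: left_module R "sub_bimod Y X2" by fact
  interpret X12: left_module R "sub_bimod Y (X1 \<inter> X2)" by fact
  let ?X1 = "sub_bimod Y X1" and ?X2 = "sub_bimod Y X2" and ?X12 = "sub_bimod Y (X1 \<inter> X2)"
  let ?D = "dsum ?X1 ?X2"
  let ?f = "\<lambda>x. (x, \<ominus>\<^bsub>Y\<^esub> x)" and ?g = "\<lambda>z. fst z \<oplus>\<^bsub>Y\<^esub> snd z"
  let ?i1 = "\<lambda>x. (x, \<zero>\<^bsub>Y\<^esub>)" and ?i2 = "\<lambda>x. (\<zero>\<^bsub>Y\<^esub>, x)"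
  have D: "left_module R ?D"
    by (rule dsum_left_module[OF X1(1) X2(1)])
  note [simp] = X1.M.zero_closed[unfolded sub_bimod_simps] X2.M.zero_closed[unfolded sub_bimod_simps]
    X1.M.a_closed[unfolded sub_bimod_simps] X2.M.a_closed[unfolded sub_bimod_simps]
  have minus: "\<ominus>\<^bsub>Y\<^esub> x \<in> Xi" if "left_module R (sub_bimod Y Xi)" "Xi \<subseteq> carrier Y" "x \<in> Xi" for x Xi
  proof -
    interpret Xi: left_module R "sub_bimod Y Xi" by fact
    have "\<ominus>\<^bsub>sub_bimod Y Xi\<^esub> x \<in> Xi" "\<ominus>\<^bsub>sub_bimod Y Xi\<^esub> x \<oplus>\<^bsub>Y\<^esub> x = \<zero>\<^bsub>Y\<^esub>"
      using Xi.M.a_inv_closed[of x] Xi.M.l_neg[of x] that by simp_all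
    then show ?thesis
      using Y.M.minus_equality[of "\<ominus>\<^bsub>sub_bimod Y Xi\<^esub> x" x] that by (simp add: subsetD)
  qed
  note minus1 = minus[OF X1] and minus2 = minus[OF X2]
  have Y1: "x \<in> carrier Y" if "x \<in> X1" for x using X1(2) that by auto
  have Y2: "x \<in> carrier Y" if "x \<in> X2" for x using X2(2) that by auto
  have act0: "(a \<rightharpoonup>\<^bsub>Y\<^esub> \<zero>\<^bsub>Y\<^esub>) = \<zero>\<^bsub>Y\<^esub>" if "a \<in> carrier R" for a
    using that add_hom_zero[of Y Y "\<lambda>x. (a \<rightharpoonup>\<^bsub>Y\<^esub> x)"] Y.M.abelian_group_axioms
    by (simp add: add_hom_iff Y.lact_closed Y.lact_add)
  have actm: "(a \<rightharpoonup>\<^bsub>Y\<^esub> (\<ominus>\<^bsub>Y\<^esub> x)) = \<ominus>\<^bsub>Y\<^esub> ((a \<rightharpoonup>\<^bsub>Y\<^esub> x))" if "a \<in> carrier R" "x \<in> carrier Y" for a x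
    using that add_hom_minus[of Y Y "\<lambda>x. (a \<rightharpoonup>\<^bsub>Y\<^esub> x)"] Y.M.abelian_group_axioms
    by (simp add: add_hom_iff Y.lact_closed Y.lact_add)
  have f: "?f \<in> left_hom R ?X12 ?D"
    by (auto simp: left_hom_iff add_hom_iff minus2 Y.M.minus_add actm Y1 Y2)
  have g: "?g \<in> left_hom R ?D Y"
    by (auto simp: left_hom_iff add_hom_iff Y1 Y2 Y.lact_add Y.M.a_ac)
  have i1: "?i1 \<in> left_hom R ?X1 ?D" and i2: "?i2 \<in> left_hom R ?X2 ?D" and p: "fst \<in> left_hom R ?D ?X1"
    by (auto simp: left_hom_iff add_hom_iff act0)
  have ex: "exact_at ?X12 ?D Y ?f ?g"
  proof -
    have "x \<in> X2 \<and> y = \<ominus>\<^bsub>Y\<^esub> x" if "x \<in> X1" "y \<in> X2" "x \<oplus>\<^bsub>Y\<^esub> y = \<zero>\<^bsub>Y\<^esub>" for x y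
    proof -
      have "x = \<ominus>\<^bsub>Y\<^esub> y" "y = \<ominus>\<^bsub>Y\<^esub> x"
        using that Y1 Y2 Y.M.minus_equality[of x y] Y.M.minus_equality[of y x] by (auto simp: Y.M.a_comm)
      then show ?thesis using minus2[OF that(2)] by simp
    qed
    then show ?thesis
      unfolding exact_at_def by (auto simp: minus2 Y1 Y.M.r_neg image_iff)
  qed
  have sub_le: "carrier (sub_bimod Y Xi) \<lesssim> (UNIV :: 'x set)" if "Xi \<subseteq> carrier Y" for Xi
    using that le by (auto intro: lepoll_trans[OF subset_imp_lepoll])
  have "carrier ?D \<lesssim> (UNIV :: 'x set) \<times> (UNIV :: 'x set)"
    using times_lepoll_mono[OF sub_le[OF X1(2)] sub_le[OF X2(2)]] by simp
  also have "\<dots> \<approx> (UNIV :: 'x set)"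
    using inf by (rule infinite_times_eqpoll_self)
  finally have D_le: "carrier ?D \<lesssim> (UNIV :: 'x set)" .
  have exT: "exact_at (M \<boxtimes>\<^bsub>R\<^esub> ?X12) (M \<boxtimes>\<^bsub>R\<^esub> ?D) (M \<boxtimes>\<^bsub>R\<^esub> Y) (tensor_map R M ?X12 M ?D id ?f) (tensor_map R M ?D M Y id ?g)"
    using X1(2) by (intro flat_right_exact[OF flat M X12 D Y f g _ D_le le ex] sub_le) auto
  obtain t1 where t1: "t1 \<in> carrier (M \<boxtimes>\<^bsub>R\<^esub> ?X1)" "u = tensor_map R M ?X1 M Y id id t1" using u1 by blast
  obtain t2 where t2: "t2 \<in> carrier (M \<boxtimes>\<^bsub>R\<^esub> ?X2)" "u = tensor_map R M ?X2 M Y id id t2" using u2 by blast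
  note [simp] = M Y X1(1) X2(1) X12 D f g i1 i2 p X1(2) X2(2)
  interpret TX1: abelian_group "M \<boxtimes>\<^bsub>R\<^esub> ?X1" by simp
  interpret TX2: abelian_group "M \<boxtimes>\<^bsub>R\<^esub> ?X2" by simp
  interpret TD: abelian_group "M \<boxtimes>\<^bsub>R\<^esub> ?D" by simp
  interpret TY: abelian_group "M \<boxtimes>\<^bsub>R\<^esub> Y" by simp
  \<comment> \<open>\<open>u\<close> is lifted to the direct sum in two ways, through either
    summand. The difference dies under the sum map, hence comes from the intersection by exactness,
    and projecting it to the first summand recovers \<open>t1\<close>.\<close>
  define s1 where "s1 = tensor_map R M ?X1 M ?D id ?i1 t1"
  define s2 where "s2 = tensor_map R M ?X2 M ?D id ?i2 t2"
  have s: "s1 \<in> carrier (M \<boxtimes>\<^bsub>R\<^esub> ?D)" "s2 \<in> carrier (M \<boxtimes>\<^bsub>R\<^esub> ?D)"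
    using t1 t2 by (simp_all add: s1_def s2_def)
  have ghom: "tensor_map R M ?D M Y id ?g \<in> add_hom (M \<boxtimes>\<^bsub>R\<^esub> ?D) (M \<boxtimes>\<^bsub>R\<^esub> Y)"
    by (intro tensor_map_hom) simp_all
  have phom: "tensor_map R M ?D M ?X1 id fst \<in> add_hom (M \<boxtimes>\<^bsub>R\<^esub> ?D) (M \<boxtimes>\<^bsub>R\<^esub> ?X1)"
    by (intro tensor_map_hom) simp_all
  have g1: "tensor_map R M ?D M Y id ?g s1 = u"
  proof -
    have "tensor_map R M ?D M Y id ?g s1 = tensor_map R M ?X1 M Y id (\<lambda>x. ?g (?i1 x)) t1"
      unfolding s1_def using t1(1) by (subst tensor_map_comp) (simp_all add: id_def)
    also have "\<dots> = tensor_map R M ?X1 M Y id id t1"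
      using t1(1) by (intro tensor_map_cong[symmetric]) (simp_all add: Y1)
    finally show ?thesis using t1 by simp
  qed
  have g2: "tensor_map R M ?D M Y id ?g s2 = u"
  proof -
    have "tensor_map R M ?D M Y id ?g s2 = tensor_map R M ?X2 M Y id (\<lambda>x. ?g (?i2 x)) t2"
      unfolding s2_def using t2(1) by (subst tensor_map_comp) (simp_all add: id_def)
    also have "\<dots> = tensor_map R M ?X2 M Y id id t2"
      using t2(1) by (intro tensor_map_cong[symmetric]) (simp_all add: Y2)
    finally show ?thesis using t2 by simp
  qed
  have p1: "tensor_map R M ?D M ?X1 id fst s1 = t1"
    unfolding s1_def using t1(1) by (subst tensor_map_comp) (simp_all add: tensor_map_id)
  have p2: "tensor_map R M ?D M ?X1 id fst s2 = \<zero>\<^bsub>M \<boxtimes>\<^bsub>R\<^esub> ?X1\<^esub>"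
  proof -
    have "tensor_map R M ?D M ?X1 id fst (tensor_map R M ?X2 M ?D id ?i2 t) = \<zero>\<^bsub>M \<boxtimes>\<^bsub>R\<^esub> ?X1\<^esub>" if "t \<in> carrier (M \<boxtimes>\<^bsub>R\<^esub> ?X2)" for t
      using M X2(1) that by (induction rule: tensor_induct) (simp_all add: tens_zero_right tens_zero_right[where N = ?X1, simplified])
    then show ?thesis using t2(1) by (simp add: s2_def)
  qed
  have "tensor_map R M ?D M Y id ?g (s1 \<ominus>\<^bsub>M \<boxtimes>\<^bsub>R\<^esub> ?D\<^esub> s2) = \<zero>\<^bsub>M \<boxtimes>\<^bsub>R\<^esub> Y\<^esub>"
    using add_hom_diff[OF TD.abelian_group_axioms TY.abelian_group_axioms ghom s] g1 g2
      add_hom_closed[OF ghom s(1)] by (simp add: a_minus_def TY.r_neg)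
  then have "s1 \<ominus>\<^bsub>M \<boxtimes>\<^bsub>R\<^esub> ?D\<^esub> s2 \<in> tensor_map R M ?X12 M ?D id ?f ` carrier (M \<boxtimes>\<^bsub>R\<^esub> ?X12)"
    unfolding exT[unfolded exact_at_def] using TD.minus_closed[OF s] by simp
  then obtain t0 where t0: "t0 \<in> carrier (M \<boxtimes>\<^bsub>R\<^esub> ?X12)" "s1 \<ominus>\<^bsub>M \<boxtimes>\<^bsub>R\<^esub> ?D\<^esub> s2 = tensor_map R M ?X12 M ?D id ?f t0" by blast
  have "tensor_map R M ?D M ?X1 id fst (s1 \<ominus>\<^bsub>M \<boxtimes>\<^bsub>R\<^esub> ?D\<^esub> s2) = t1"
    using add_hom_diff[OF TD.abelian_group_axioms TX1.abelian_group_axioms phom s] p1 p2 t1(1)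
    by (simp add: a_minus_def)
  then have "t1 = tensor_map R M ?X12 M ?X1 id id t0"
    unfolding t0(2) using t0(1) by (subst (asm) tensor_map_comp) (simp_all add: id_def)
  then have "u = tensor_map R M ?X12 M Y id id t0"
    unfolding t1(2) using t0(1) by (simp add: tensor_map_comp) (simp add: id_def)
  then show ?thesis using t0(1) by blast
qed

text \<open>Descent of membership. If every \<open>m \<otimes> y\<close> lies in M \<otimes> X, then
  \<open>y\<close> belongs to the submodule \<open>W\<close> of all such elements, and M \<otimes> X
  maps onto M \<otimes> W. Faithful flatness reflects this as X = W. Quotients are avoided by using
  the sequence X \<rightarrow> W \<rightarrow> 0.\<close>

lemma faithfully_flat_right_mem:
  fixes Y :: "('r, 'm2, 'k2) bimod"
  assumes flat: "faithfully_flat_right TYPE('x) R M"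
    and M: "right_module R M" and Y: "left_module R Y"
    and X: "left_module R (sub_bimod Y X)" "X \<subseteq> carrier Y"
    and le: "carrier Y \<lesssim> (UNIV :: 'x set)"
    and y: "y \<in> carrier Y"
    and mem: "\<And>m. m \<in> carrier M \<Longrightarrow> tens R M Y m y \<in> tensor_map R M (sub_bimod Y X) M Y id id ` carrier (M \<boxtimes>\<^bsub>R\<^esub> (sub_bimod Y X))"
  shows "y \<in> X"
proof -
  interpret Y: left_module R Y by fact
  interpret M: right_module R M by fact
  interpret X: left_module R "sub_bimod Y X" by fact
  let ?X = "sub_bimod Y X"
  let ?I = "tensor_map R M ?X M Y id id ` carrier (M \<boxtimes>\<^bsub>R\<^esub> ?X)"
  \<comment> \<open>The largest candidate is used instead of the submodule generated by
    \<open>X\<close> and \<open>y\<close>: its defining property is immediately closed under sums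
    and scalars.\<close>
  define W where "W = {y \<in> carrier Y. \<forall>m\<in>carrier M. tens R M Y m y \<in> ?I}"
  let ?W = "sub_bimod Y W" and ?O = "sub_bimod Y {\<zero>\<^bsub>Y\<^esub>}"
  note [simp] = M Y X(1) X(2)
  interpret TX: abelian_group "M \<boxtimes>\<^bsub>R\<^esub> ?X" by simp
  interpret TY: abelian_group "M \<boxtimes>\<^bsub>R\<^esub> Y" by simp
  have X0: "\<zero>\<^bsub>Y\<^esub> \<in> X" using X.M.zero_closed by simp
  have I_add: "u \<oplus>\<^bsub>M \<boxtimes>\<^bsub>R\<^esub> Y\<^esub> v \<in> ?I" if uv: "u \<in> ?I" "v \<in> ?I" for u v
  proof -
    obtain s where s: "s \<in> carrier (M \<boxtimes>\<^bsub>R\<^esub> ?X)" "u = tensor_map R M ?X M Y id id s" using uv(1) by (elim imageE) (rule that)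
    obtain t where t: "t \<in> carrier (M \<boxtimes>\<^bsub>R\<^esub> ?X)" "v = tensor_map R M ?X M Y id id t" using uv(2) by (elim imageE) (rule that)
    show ?thesis
      using s t TX.a_closed by (intro image_eqI[where x = "s \<oplus>\<^bsub>M \<boxtimes>\<^bsub>R\<^esub> ?X\<^esub> t"]) simp_all
  qed
  have XW: "X \<subseteq> W"
  proof
    fix x assume x: "x \<in> X"
    have "tens R M Y m x \<in> ?I" if "m \<in> carrier M" for m
      using x that by (intro image_eqI[where x = "tens R M ?X m x"]) simp_all
    then show "x \<in> W"
      unfolding W_def using subsetD[OF X(2) x] by simp
  qed
  have WY: "W \<subseteq> carrier Y" by (auto simp: W_def)
  have W: "left_module R ?W"
  proof (rule left_sub_bimodI[OF Y WY])
    show "\<zero>\<^bsub>Y\<^esub> \<in> W" using X0 XW by auto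
    show "x \<oplus>\<^bsub>Y\<^esub> y \<in> W" if "x \<in> W" "y \<in> W" for x y
      using that unfolding W_def by (simp add: tens_add_right I_add)
    show "(a \<rightharpoonup>\<^bsub>Y\<^esub> x) \<in> W" if "a \<in> carrier R" "x \<in> W" for a x
      using that unfolding W_def by (simp add: M.ract_closed Y.lact_closed tens_ract[symmetric])
  qed
  have act0: "(a \<rightharpoonup>\<^bsub>Y\<^esub> \<zero>\<^bsub>Y\<^esub>) = \<zero>\<^bsub>Y\<^esub>" if "a \<in> carrier R" for a
    using that add_hom_zero[of Y Y "\<lambda>x. (a \<rightharpoonup>\<^bsub>Y\<^esub> x)"] Y.M.abelian_group_axioms
    by (simp add: add_hom_iff Y.lact_closed Y.lact_add)
  have O: "left_module R ?O"
    by (rule left_sub_bimodI[OF Y]) (auto simp: act0)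
  have sub_le: "carrier (sub_bimod Y V) \<lesssim> (UNIV :: 'x set)" if "V \<subseteq> carrier Y" for V
    using that le by (auto intro: lepoll_trans[OF subset_imp_lepoll])
  note [simp] = W O WY XW
  let ?z = "\<lambda>_. \<zero>\<^bsub>Y\<^esub>"
  have z: "?z \<in> left_hom R ?W ?O"
    by (auto simp: left_hom_iff add_hom_iff act0)
  interpret TW: abelian_group "M \<boxtimes>\<^bsub>R\<^esub> ?W" by simp
  interpret TO: abelian_group "M \<boxtimes>\<^bsub>R\<^esub> ?O" by simp
  \<comment> \<open>Membership is known in M \<otimes> Y, but surjectivity is wanted in M \<otimes>
    W; injectivity of M \<otimes> W \<rightarrow> M \<otimes> Y pulls the equality back.\<close>
  have inj: "inj_on (tensor_map R M ?W M Y id id) (carrier (M \<boxtimes>\<^bsub>R\<^esub> ?W))"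
    by (rule flat_right_inj[OF faithfully_flat_right_imp_flat[OF flat] M W Y sub_bimod_left_hom(3)[OF WY] _ sub_le[OF WY] le])
      simp
  have surj: "u \<in> tensor_map R M ?X M ?W id id ` carrier (M \<boxtimes>\<^bsub>R\<^esub> ?X)" if "u \<in> carrier (M \<boxtimes>\<^bsub>R\<^esub> ?W)" for u
    using M W that
  proof (induction rule: tensor_induct)
    case (tens x y)
    have WD: "y \<in> carrier Y" "tens R M Y m y \<in> ?I" if "y \<in> W" "m \<in> carrier M" for m y
      using that by (simp_all add: W_def)
    have "tensor_map R M ?W M Y id id (tens R M ?W x y) \<in> ?I"
      using tens WD by simp
    then obtain t where t: "t \<in> carrier (M \<boxtimes>\<^bsub>R\<^esub> ?X)" "tensor_map R M ?W M Y id id (tens R M ?W x y) = tensor_map R M ?X M Y id id t"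
      by (elim imageE) (rule that)
    have "tensor_map R M ?X M Y id id t = tensor_map R M ?W M Y id id (tensor_map R M ?X M ?W id id t)"
      using t(1) by (simp add: tensor_map_comp) (simp add: id_def)
    then have "tens R M ?W x y = tensor_map R M ?X M ?W id id t"
      using inj_onD[OF inj _ tens_closed tensor_map_closed[OF _ _ _ _ _ _ t(1)]] t(2) tens by simp
    then show ?case using t(1) by (rule image_eqI)
  next
    case (add u v)
    from add(3) obtain s where s: "s \<in> carrier (M \<boxtimes>\<^bsub>R\<^esub> ?X)" "u = tensor_map R M ?X M ?W id id s" by (elim imageE) (rule that)
    from add(4) obtain t where t: "t \<in> carrier (M \<boxtimes>\<^bsub>R\<^esub> ?X)" "v = tensor_map R M ?X M ?W id id t" by (elim imageE) (rule that)
    show ?case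
      using s t TX.a_closed
      by (intro image_eqI[where x = "s \<oplus>\<^bsub>M \<boxtimes>\<^bsub>R\<^esub> ?X\<^esub> t"]) (simp_all add: id_def)
  qed
  have zero: "tensor_map R M ?W M ?O id ?z u = \<zero>\<^bsub>M \<boxtimes>\<^bsub>R\<^esub> ?O\<^esub>" if "u \<in> carrier (M \<boxtimes>\<^bsub>R\<^esub> ?W)" for u
    using M W that
    by (induction rule: tensor_induct) (simp_all add: z tens_zero_right[where N = ?O, simplified])
  have exT: "exact_at (M \<boxtimes>\<^bsub>R\<^esub> ?X) (M \<boxtimes>\<^bsub>R\<^esub> ?W) (M \<boxtimes>\<^bsub>R\<^esub> ?O) (tensor_map R M ?X M ?W id id) (tensor_map R M ?W M ?O id ?z)"
    unfolding exact_at_def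
  proof (intro equalityI subsetI)
    fix u assume "u \<in> tensor_map R M ?X M ?W id id ` carrier (M \<boxtimes>\<^bsub>R\<^esub> ?X)"
    then obtain t where t: "t \<in> carrier (M \<boxtimes>\<^bsub>R\<^esub> ?X)" "u = tensor_map R M ?X M ?W id id t" by (elim imageE) (rule that)
    then have "u \<in> carrier (M \<boxtimes>\<^bsub>R\<^esub> ?W)" by simp
    then show "u \<in> {u \<in> carrier (M \<boxtimes>\<^bsub>R\<^esub> ?W). tensor_map R M ?W M ?O id ?z u = \<zero>\<^bsub>M \<boxtimes>\<^bsub>R\<^esub> ?O\<^esub>}" by (simp add: zero)
  qed (use surj in simp)
  have "exact_at ?X ?W ?O id ?z"
    by (rule faithfully_flat_right_exact[OF flat M X(1) W O sub_bimod_left_hom(1)[OF XW] z sub_le[OF X(2)] sub_le[OF WY] sub_le exT])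
      simp
  then have XW': "X = W"
    by (simp add: exact_at_def)
  have "y \<in> W"
    using y mem unfolding W_def by simp
  then show ?thesis
    by (simp only: XW')
qed

section \<open>Flat and faithfully flat left modules\<close>

text \<open>T is faithfully flat on both sides, so the right-module results recur with the two
  tensor factors and the two actions exchanged. Here too negatives arise from the scalar -1.\<close>

lemma right_sub_bimodI:
  assumes M: "right_module R M" and X: "X \<subseteq> carrier M" "\<zero>\<^bsub>M\<^esub> \<in> X"
    and add: "\<And>x y. \<lbrakk>x \<in> X; y \<in> X\<rbrakk> \<Longrightarrow> x \<oplus>\<^bsub>M\<^esub> y \<in> X"
    and act: "\<And>a x. \<lbrakk>a \<in> carrier R; x \<in> X\<rbrakk> \<Longrightarrow> (x \<leftharpoonup>\<^bsub>M\<^esub> a) \<in> X"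
  shows "right_module R (sub_bimod M X)"
proof -
  interpret M: right_module R M by fact
  have neg: "\<exists>y\<in>X. y \<oplus>\<^bsub>M\<^esub> x = \<zero>\<^bsub>M\<^esub>" if x: "x \<in> X" for x
  proof
    have xM: "x \<in> carrier M" using x X by auto
    let ?o = "\<ominus>\<^bsub>R\<^esub> \<one>\<^bsub>R\<^esub>"
    show "(x \<leftharpoonup>\<^bsub>M\<^esub> ?o) \<in> X" using x by (intro act) auto
    have "(x \<leftharpoonup>\<^bsub>M\<^esub> \<zero>\<^bsub>R\<^esub>) \<oplus>\<^bsub>M\<^esub> (x \<leftharpoonup>\<^bsub>M\<^esub> \<zero>\<^bsub>R\<^esub>) = (x \<leftharpoonup>\<^bsub>M\<^esub> \<zero>\<^bsub>R\<^esub>)"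
      using M.ract_add[of "\<zero>\<^bsub>R\<^esub>" "\<zero>\<^bsub>R\<^esub>" x] xM by simp
    then have "(x \<leftharpoonup>\<^bsub>M\<^esub> \<zero>\<^bsub>R\<^esub>) = \<zero>\<^bsub>M\<^esub>"
      using M.ract_closed[of "\<zero>\<^bsub>R\<^esub>" x] xM by (simp add: M.M.add.l_cancel_one)
    moreover have "(x \<leftharpoonup>\<^bsub>M\<^esub> ?o) \<oplus>\<^bsub>M\<^esub> (x \<leftharpoonup>\<^bsub>M\<^esub> \<one>\<^bsub>R\<^esub>) = (x \<leftharpoonup>\<^bsub>M\<^esub> \<zero>\<^bsub>R\<^esub>)"
      using M.ract_add[of ?o "\<one>\<^bsub>R\<^esub>" x] xM by (simp add: M.rring.l_neg)
    ultimately show "(x \<leftharpoonup>\<^bsub>M\<^esub> ?o) \<oplus>\<^bsub>M\<^esub> x = \<zero>\<^bsub>M\<^esub>"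
      using xM by (simp add: M.ract_one)
  qed
  have "abelian_group (sub_bimod M X)"
    using X add neg by (intro abelian_groupI) (auto simp: M.M.a_ac subsetD)
  then show ?thesis
    using X act M.ract_closed unfolding right_module_def right_module_axioms_def
    by (auto simp: M.rring.ring_axioms subsetD M.add_ract M.ract_add M.ract_mult M.ract_one)
qed

lemma sub_bimod_right_hom [simp]:
  "X \<subseteq> Y \<Longrightarrow> id \<in> right_hom R (sub_bimod M X) (sub_bimod M Y)"
  "X \<subseteq> Y \<Longrightarrow> (\<lambda>x. x) \<in> right_hom R (sub_bimod M X) (sub_bimod M Y)"
  "X \<subseteq> carrier M \<Longrightarrow> id \<in> right_hom R (sub_bimod M X) M"
  "X \<subseteq> carrier M \<Longrightarrow> (\<lambda>x. x) \<in> right_hom R (sub_bimod M X) M"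
  by (auto simp: right_hom_iff add_hom_iff)

lemma dsum_right_module:
  assumes "right_module R M" "right_module R N"
  shows "right_module R (dsum M N)"
proof -
  interpret M: right_module R M by fact
  interpret N: right_module R N by fact
  show ?thesis
    using dsum_abelian_group[OF M.M.abelian_group_axioms N.M.abelian_group_axioms]
    unfolding right_module_def right_module_axioms_def
    by (auto simp: M.rring.ring_axioms M.ract_closed N.ract_closed M.add_ract N.add_ract M.ract_add N.ract_add
        M.ract_mult N.ract_mult M.ract_one N.ract_one)
qed

definition right_copy :: "('m \<Rightarrow> 'x) \<Rightarrow> ('k, 'm, 'r) bimod \<Rightarrow> (unit, 'x, 'r) bimod" where
  "right_copy i X = \<lparr>carrier = i ` carrier X, monoid.mult = undefined, one = undefined,
     ring.zero = i \<zero>\<^bsub>X\<^esub>, add = (\<lambda>u v. i (inv_into (carrier X) i u \<oplus>\<^bsub>X\<^esub> inv_into (carrier X) i v)),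
     lact = (\<lambda>_ _. undefined), ract = (\<lambda>u a. i (inv_into (carrier X) i u \<leftharpoonup>\<^bsub>X\<^esub> a))\<rparr>"

lemma
  assumes X: "right_module R X" and i: "inj_on i (carrier X)"
  shows right_copy_module: "right_module R (right_copy i X)"
    and right_copy_hom: "i \<in> right_hom R X (right_copy i X)"
    and right_copy_inv_hom: "inv_into (carrier X) i \<in> right_hom R (right_copy i X) X"
    and right_copy_bij: "bij_betw i (carrier X) (carrier (right_copy i X))"
    and right_copy_inv: "x \<in> carrier X \<Longrightarrow> inv_into (carrier X) i (i x) = x"
    and right_copy_inv': "u \<in> carrier (right_copy i X) \<Longrightarrow> i (inv_into (carrier X) i u) = u"
proof -
  interpret X: right_module R X by fact
  let ?j = "inv_into (carrier X) i"
  have j: "?j (i x) = x" if "x \<in> carrier X" for x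
    using i that by simp
  have "abelian_group (right_copy i X)"
  proof (rule abelian_groupI)
    fix u assume "u \<in> carrier (right_copy i X)"
    then obtain x where x: "x \<in> carrier X" "u = i x" by (auto simp: right_copy_def)
    then show "\<exists>v\<in>carrier (right_copy i X). v \<oplus>\<^bsub>right_copy i X\<^esub> u = \<zero>\<^bsub>right_copy i X\<^esub>"
      by (intro bexI[of _ "i (\<ominus>\<^bsub>X\<^esub> x)"]) (auto simp: right_copy_def j X.M.l_neg)
  qed (auto simp: right_copy_def j X.M.a_ac)
  then show "right_module R (right_copy i X)"
    unfolding right_module_def right_module_axioms_def
    by (auto simp: right_copy_def j X.rring.ring_axioms X.ract_closed X.add_ract X.ract_add X.ract_mult X.ract_one)
  show "i \<in> right_hom R X (right_copy i X)" "?j \<in> right_hom R (right_copy i X) X"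
    by (auto simp: right_hom_iff add_hom_iff right_copy_def j X.ract_closed)
  show "bij_betw i (carrier X) (carrier (right_copy i X))"
    using i by (auto simp: right_copy_def bij_betw_def)
  show "x \<in> carrier X \<Longrightarrow> ?j (i x) = x" by (rule j)
  show "u \<in> carrier (right_copy i X) \<Longrightarrow> i (?j u) = u"
    by (auto simp: right_copy_def j)
qed

lemma right_copy_tensor_bij:
  assumes M: "left_module R M" and X: "right_module R X" and i: "inj_on i (carrier X)"
  shows "bij_betw (tensor_map R X M (right_copy i X) M i id) (carrier (X \<boxtimes>\<^bsub>R\<^esub> M)) (carrier ((right_copy i X) \<boxtimes>\<^bsub>R\<^esub> M))"
proof (rule bij_betwI)
  let ?X' = "right_copy i X" and ?j = "inv_into (carrier X) i"
  note copy = right_copy_module[OF X i] right_copy_hom[OF X i] right_copy_inv_hom[OF X i]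
    right_copy_inv[OF X i] right_copy_inv'[OF X i]
  note [simp] = copy(1-3) M X
  show "tensor_map R X M ?X' M i id \<in> carrier (X \<boxtimes>\<^bsub>R\<^esub> M) \<rightarrow> carrier (?X' \<boxtimes>\<^bsub>R\<^esub> M)" by auto
  show "tensor_map R ?X' M X M ?j id \<in> carrier (?X' \<boxtimes>\<^bsub>R\<^esub> M) \<rightarrow> carrier (X \<boxtimes>\<^bsub>R\<^esub> M)" by auto
  show "tensor_map R ?X' M X M ?j id (tensor_map R X M ?X' M i id u) = u" if "u \<in> carrier (X \<boxtimes>\<^bsub>R\<^esub> M)" for u
    using that by (subst tensor_map_comp) (simp_all add: tensor_map_id copy(4))
  show "tensor_map R X M ?X' M i id (tensor_map R ?X' M X M ?j id v) = v" if "v \<in> carrier (?X' \<boxtimes>\<^bsub>R\<^esub> M)" for v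
    using that by (subst tensor_map_comp) (simp_all add: tensor_map_id copy(5))
qed

lemma exact_right_copy:
  fixes X :: "('k1, 'm1, 'r) bimod" and Y :: "('k2, 'm2, 'r) bimod" and Z :: "('k3, 'm3, 'r) bimod" and M :: "('r, 'm, 'l) bimod"
  assumes M: "left_module R M" and XYZ: "right_module R X" "right_module R Y" "right_module R Z"
    and f: "f \<in> right_hom R X Y" and g: "g \<in> right_hom R Y Z"
    and le: "carrier X \<lesssim> (UNIV :: 'x set)" "carrier Y \<lesssim> (UNIV :: 'x set)" "carrier Z \<lesssim> (UNIV :: 'x set)"
  obtains X' Y' Z' :: "(unit, 'x, 'r) bimod" and f' g'
  where "right_module R X'" "right_module R Y'" "right_module R Z'"
    "f' \<in> right_hom R X' Y'" "g' \<in> right_hom R Y' Z'"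
    "exact_at X Y Z f g \<longleftrightarrow> exact_at X' Y' Z' f' g'"
    "exact_at (X \<boxtimes>\<^bsub>R\<^esub> M) (Y \<boxtimes>\<^bsub>R\<^esub> M) (Z \<boxtimes>\<^bsub>R\<^esub> M) (tensor_map R X M Y M f id) (tensor_map R Y M Z M g id) \<longleftrightarrow>
     exact_at (X' \<boxtimes>\<^bsub>R\<^esub> M) (Y' \<boxtimes>\<^bsub>R\<^esub> M) (Z' \<boxtimes>\<^bsub>R\<^esub> M) (tensor_map R X' M Y' M f' id) (tensor_map R Y' M Z' M g' id)"
proof -
  obtain i j k :: "_ \<Rightarrow> 'x"
    where i: "inj_on i (carrier X)" and j: "inj_on j (carrier Y)" and k: "inj_on k (carrier Z)"
    using le by (auto simp: lepoll_def)
  let ?X = "right_copy i X" and ?Y = "right_copy j Y" and ?Z = "right_copy k Z"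
  let ?i = "inv_into (carrier X) i" and ?j = "inv_into (carrier Y) j"
  let ?f = "\<lambda>u. j (f (?i u))" and ?g = "\<lambda>u. k (g (?j u))"
  note I = right_copy_module[OF XYZ(1) i] right_copy_hom[OF XYZ(1) i] right_copy_inv_hom[OF XYZ(1) i]
  note J = right_copy_module[OF XYZ(2) j] right_copy_hom[OF XYZ(2) j] right_copy_inv_hom[OF XYZ(2) j]
  note K = right_copy_module[OF XYZ(3) k] right_copy_hom[OF XYZ(3) k] right_copy_inv_hom[OF XYZ(3) k]
  note fg_closed = add_hom_closed[OF right_hom_add_hom[OF f]] add_hom_closed[OF right_hom_add_hom[OF g]]
  have f': "?f \<in> right_hom R ?X ?Y" and g': "?g \<in> right_hom R ?Y ?Z"
    using I J K f g by (auto simp: right_hom_iff add_hom_iff)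
  note [simp] = M XYZ I(1) J(1) K(1)
  have Z0: "\<zero>\<^bsub>Z\<^esub> \<in> carrier Z"
    using right_module_abelian_group[OF XYZ(3)] by (simp add: abelian_group_def abelian_monoid.zero_closed)
  have 1: "exact_at X Y Z f g \<longleftrightarrow> exact_at ?X ?Y ?Z ?f ?g"
    by (rule exact_at_cong[OF right_copy_bij[OF XYZ(1) i] right_copy_bij[OF XYZ(2) j] k])
      (simp_all add: fg_closed i j k Z0 right_copy_def)
  have 2: "exact_at (X \<boxtimes>\<^bsub>R\<^esub> M) (Y \<boxtimes>\<^bsub>R\<^esub> M) (Z \<boxtimes>\<^bsub>R\<^esub> M) (tensor_map R X M Y M f id) (tensor_map R Y M Z M g id) \<longleftrightarrow>
     exact_at (?X \<boxtimes>\<^bsub>R\<^esub> M) (?Y \<boxtimes>\<^bsub>R\<^esub> M) (?Z \<boxtimes>\<^bsub>R\<^esub> M) (tensor_map R ?X M ?Y M ?f id) (tensor_map R ?Y M ?Z M ?g id)"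
  proof (rule exact_at_cong[OF right_copy_tensor_bij[OF M XYZ(1) i] right_copy_tensor_bij[OF M XYZ(2) j]
        bij_betw_imp_inj_on[OF right_copy_tensor_bij[OF M XYZ(3) k]]])
    show "tensor_map R Z M ?Z M k id \<zero>\<^bsub>Z \<boxtimes>\<^bsub>R\<^esub> M\<^esub> = \<zero>\<^bsub>?Z \<boxtimes>\<^bsub>R\<^esub> M\<^esub>"
      using K by (intro add_hom_zero tensor_map_hom) auto
    show "\<zero>\<^bsub>Z \<boxtimes>\<^bsub>R\<^esub> M\<^esub> \<in> carrier (Z \<boxtimes>\<^bsub>R\<^esub> M)"
      by (simp add: tensor_zero_closed)
    fix u assume u: "u \<in> carrier (X \<boxtimes>\<^bsub>R\<^esub> M)"
    show "tensor_map R X M Y M f id u \<in> carrier (Y \<boxtimes>\<^bsub>R\<^esub> M)" using u f by simp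
    have "tensor_map R Y M ?Y M j id (tensor_map R X M Y M f id u) = tensor_map R X M ?Y M (\<lambda>x. j (f x)) id u"
      using u f J by (subst tensor_map_comp) (auto simp: id_def)
    also have "\<dots> = tensor_map R X M ?Y M (\<lambda>x. ?f (i x)) id u"
      using u f I J i by (intro tensor_map_cong) (auto simp: id_def right_hom_iff add_hom_iff)
    also have "\<dots> = tensor_map R ?X M ?Y M ?f id (tensor_map R X M ?X M i id u)"
      using u I f' by (subst tensor_map_comp) (auto simp: id_def)
    finally show "tensor_map R Y M ?Y M j id (tensor_map R X M Y M f id u) = tensor_map R ?X M ?Y M ?f id (tensor_map R X M ?X M i id u)" .
  next
    fix u assume u: "u \<in> carrier (Y \<boxtimes>\<^bsub>R\<^esub> M)"
    show "tensor_map R Y M Z M g id u \<in> carrier (Z \<boxtimes>\<^bsub>R\<^esub> M)" using u g by simp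
    have "tensor_map R Z M ?Z M k id (tensor_map R Y M Z M g id u) = tensor_map R Y M ?Z M (\<lambda>x. k (g x)) id u"
      using u g K by (subst tensor_map_comp) (auto simp: id_def)
    also have "\<dots> = tensor_map R Y M ?Z M (\<lambda>x. ?g (j x)) id u"
      using u g J K j by (intro tensor_map_cong) (auto simp: id_def right_hom_iff add_hom_iff)
    also have "\<dots> = tensor_map R ?Y M ?Z M ?g id (tensor_map R Y M ?Y M j id u)"
      using u J g' by (subst tensor_map_comp) (auto simp: id_def)
    finally show "tensor_map R Z M ?Z M k id (tensor_map R Y M Z M g id u) = tensor_map R ?Y M ?Z M ?g id (tensor_map R Y M ?Y M j id u)" .
  qed
  show thesis
    by (rule that[OF I(1) J(1) K(1) f' g' 1 2])
qed

lemma flat_left_exact: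
  fixes X :: "('k1, 'm1, 'r) bimod" and Y :: "('k2, 'm2, 'r) bimod" and Z :: "('k3, 'm3, 'r) bimod"
  assumes flat: "flat_left TYPE('x) R M"
    and M: "left_module R M" and XYZ: "right_module R X" "right_module R Y" "right_module R Z"
    and fg: "f \<in> right_hom R X Y" "g \<in> right_hom R Y Z"
    and le: "carrier X \<lesssim> (UNIV :: 'x set)" "carrier Y \<lesssim> (UNIV :: 'x set)" "carrier Z \<lesssim> (UNIV :: 'x set)"
    and ex: "exact_at X Y Z f g"
  shows "exact_at (X \<boxtimes>\<^bsub>R\<^esub> M) (Y \<boxtimes>\<^bsub>R\<^esub> M) (Z \<boxtimes>\<^bsub>R\<^esub> M) (tensor_map R X M Y M f id) (tensor_map R Y M Z M g id)"
proof (rule exact_right_copy[OF M XYZ fg le])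
  fix X' Y' Z' :: "(unit, 'x, 'r) bimod" and f' g'
  assume *: "right_module R X'" "right_module R Y'" "right_module R Z'"
      "f' \<in> right_hom R X' Y'" "g' \<in> right_hom R Y' Z'"
    and iff: "exact_at X Y Z f g \<longleftrightarrow> exact_at X' Y' Z' f' g'"
      "exact_at (X \<boxtimes>\<^bsub>R\<^esub> M) (Y \<boxtimes>\<^bsub>R\<^esub> M) (Z \<boxtimes>\<^bsub>R\<^esub> M) (tensor_map R X M Y M f id) (tensor_map R Y M Z M g id) \<longleftrightarrow>
       exact_at (X' \<boxtimes>\<^bsub>R\<^esub> M) (Y' \<boxtimes>\<^bsub>R\<^esub> M) (Z' \<boxtimes>\<^bsub>R\<^esub> M) (tensor_map R X' M Y' M f' id) (tensor_map R Y' M Z' M g' id)"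
  show ?thesis
    using flat[unfolded flat_left_def, rule_format, of X' Y' Z' f' g'] ex * unfolding iff by simp
qed

lemma faithfully_flat_left_exact:
  fixes X :: "('k1, 'm1, 'r) bimod" and Y :: "('k2, 'm2, 'r) bimod" and Z :: "('k3, 'm3, 'r) bimod"
  assumes flat: "faithfully_flat_left TYPE('x) R M"
    and M: "left_module R M" and XYZ: "right_module R X" "right_module R Y" "right_module R Z"
    and fg: "f \<in> right_hom R X Y" "g \<in> right_hom R Y Z"
    and le: "carrier X \<lesssim> (UNIV :: 'x set)" "carrier Y \<lesssim> (UNIV :: 'x set)" "carrier Z \<lesssim> (UNIV :: 'x set)"
    and ex: "exact_at (X \<boxtimes>\<^bsub>R\<^esub> M) (Y \<boxtimes>\<^bsub>R\<^esub> M) (Z \<boxtimes>\<^bsub>R\<^esub> M) (tensor_map R X M Y M f id) (tensor_map R Y M Z M g id)"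
  shows "exact_at X Y Z f g"
proof (rule exact_right_copy[OF M XYZ fg le])
  fix X' Y' Z' :: "(unit, 'x, 'r) bimod" and f' g'
  assume *: "right_module R X'" "right_module R Y'" "right_module R Z'"
      "f' \<in> right_hom R X' Y'" "g' \<in> right_hom R Y' Z'"
    and iff: "exact_at X Y Z f g \<longleftrightarrow> exact_at X' Y' Z' f' g'"
      "exact_at (X \<boxtimes>\<^bsub>R\<^esub> M) (Y \<boxtimes>\<^bsub>R\<^esub> M) (Z \<boxtimes>\<^bsub>R\<^esub> M) (tensor_map R X M Y M f id) (tensor_map R Y M Z M g id) \<longleftrightarrow>
       exact_at (X' \<boxtimes>\<^bsub>R\<^esub> M) (Y' \<boxtimes>\<^bsub>R\<^esub> M) (Z' \<boxtimes>\<^bsub>R\<^esub> M) (tensor_map R X' M Y' M f' id) (tensor_map R Y' M Z' M g' id)"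
  show ?thesis
    using flat[unfolded faithfully_flat_left_def, rule_format, of X' Y' Z' f' g'] ex * unfolding iff by simp
qed

lemma faithfully_flat_left_imp_flat: "faithfully_flat_left U R M \<Longrightarrow> flat_left U R M"
  unfolding faithfully_flat_left_def flat_left_def by blast

text \<open>Exactness of 0 \<rightarrow> X \<rightarrow> Y again, now with the flat module as the
  right-hand factor.\<close>

lemma flat_left_inj:
  fixes X :: "('k1, 'm1, 'r) bimod" and Y :: "('k2, 'm2, 'r) bimod"
  assumes flat: "flat_left TYPE('x) R M"
    and M: "left_module R M" and XY: "right_module R X" "right_module R Y"
    and f: "f \<in> right_hom R X Y" "inj_on f (carrier X)"
    and le: "carrier X \<lesssim> (UNIV :: 'x set)" "carrier Y \<lesssim> (UNIV :: 'x set)"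
  shows "inj_on (tensor_map R X M Y M f id) (carrier (X \<boxtimes>\<^bsub>R\<^esub> M))"
proof -
  interpret X: right_module R X by fact
  interpret Y: right_module R Y by fact
  let ?O = "sub_bimod X {\<zero>\<^bsub>X\<^esub>}"
  have act0: "(\<zero>\<^bsub>X\<^esub> \<leftharpoonup>\<^bsub>X\<^esub> a) = \<zero>\<^bsub>X\<^esub>" if "a \<in> carrier R" for a
    using that add_hom_zero[of X X "\<lambda>x. (x \<leftharpoonup>\<^bsub>X\<^esub> a)"] X.M.abelian_group_axioms
    by (simp add: add_hom_iff X.ract_closed X.add_ract)
  have O: "right_module R ?O"
    by (rule right_sub_bimodI[OF XY(1)]) (auto simp: act0)
  have f0: "f \<zero>\<^bsub>X\<^esub> = \<zero>\<^bsub>Y\<^esub>"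
    by (rule add_hom_zero[OF X.M.abelian_group_axioms Y.M.abelian_group_axioms right_hom_add_hom[OF f(1)]])
  have "exact_at ?O X Y id f"
  proof -
    have "y = \<zero>\<^bsub>X\<^esub>" if "y \<in> carrier X" "f y = \<zero>\<^bsub>Y\<^esub>" for y
      using inj_onD[OF f(2), of y "\<zero>\<^bsub>X\<^esub>"] f0 that by simp
    then show ?thesis
      using f0 by (auto simp: exact_at_def)
  qed
  moreover have "carrier ?O \<lesssim> (UNIV :: 'x set)"
    by (rule lepoll_trans[OF subset_imp_lepoll le(1)]) simp
  ultimately have ex: "exact_at (?O \<boxtimes>\<^bsub>R\<^esub> M) (X \<boxtimes>\<^bsub>R\<^esub> M) (Y \<boxtimes>\<^bsub>R\<^esub> M) (tensor_map R ?O M X M id id) (tensor_map R X M Y M f id)"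
    using O XY M f le by (intro flat_left_exact[OF flat]) auto
  have zero: "tensor_map R ?O M X M id id u = \<zero>\<^bsub>X \<boxtimes>\<^bsub>R\<^esub> M\<^esub>" if "u \<in> carrier (?O \<boxtimes>\<^bsub>R\<^esub> M)" for u
  proof -
    interpret T: abelian_group "X \<boxtimes>\<^bsub>R\<^esub> M" using M XY by simp
    show ?thesis
      using O M that by (induction rule: tensor_induct) (simp_all add: M XY O tens_zero_left)
  qed
  interpret TX: abelian_group "X \<boxtimes>\<^bsub>R\<^esub> M" using M XY by simp
  interpret TY: abelian_group "Y \<boxtimes>\<^bsub>R\<^esub> M" using M XY by simp
  have hom: "tensor_map R X M Y M f id \<in> add_hom (X \<boxtimes>\<^bsub>R\<^esub> M) (Y \<boxtimes>\<^bsub>R\<^esub> M)"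
    using M XY f by (intro tensor_map_hom) auto
  show ?thesis
  proof (rule inj_onI)
    fix u v assume uv: "u \<in> carrier (X \<boxtimes>\<^bsub>R\<^esub> M)" "v \<in> carrier (X \<boxtimes>\<^bsub>R\<^esub> M)" "tensor_map R X M Y M f id u = tensor_map R X M Y M f id v"
    have "tensor_map R X M Y M f id (u \<ominus>\<^bsub>X \<boxtimes>\<^bsub>R\<^esub> M\<^esub> v) = tensor_map R X M Y M f id u \<ominus>\<^bsub>Y \<boxtimes>\<^bsub>R\<^esub> M\<^esub> tensor_map R X M Y M f id v"
      by (rule add_hom_diff[OF TX.abelian_group_axioms TY.abelian_group_axioms hom uv(1,2)])
    then have "tensor_map R X M Y M f id (u \<ominus>\<^bsub>X \<boxtimes>\<^bsub>R\<^esub> M\<^esub> v) = \<zero>\<^bsub>Y \<boxtimes>\<^bsub>R\<^esub> M\<^esub>"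
      using uv add_hom_closed[OF hom] by (simp add: TY.r_neg a_minus_def)
    then have "u \<ominus>\<^bsub>X \<boxtimes>\<^bsub>R\<^esub> M\<^esub> v \<in> tensor_map R ?O M X M id id ` carrier (?O \<boxtimes>\<^bsub>R\<^esub> M)"
      unfolding ex[unfolded exact_at_def] using uv by (simp add: TX.minus_closed)
    then obtain t where "t \<in> carrier (?O \<boxtimes>\<^bsub>R\<^esub> M)" "u \<ominus>\<^bsub>X \<boxtimes>\<^bsub>R\<^esub> M\<^esub> v = tensor_map R ?O M X M id id t"
      by (rule imageE)
    then have "u \<ominus>\<^bsub>X \<boxtimes>\<^bsub>R\<^esub> M\<^esub> v = \<zero>\<^bsub>X \<boxtimes>\<^bsub>R\<^esub> M\<^esub>"
      by (simp only: zero)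
    then show "u = v"
      using uv(1,2) by (rule TX.eq_of_diff_zero)
  qed
qed

lemma flat_left_kernel:
  fixes Y :: "('k2, 'm2, 'r) bimod" and Z :: "('k3, 'm3, 'r) bimod"
  assumes flat: "flat_left TYPE('x) R M"
    and M: "left_module R M" and YZ: "right_module R Y" "right_module R Z"
    and f: "f \<in> right_hom R Y Z" and X: "right_module R (sub_bimod Y X)" "X = {y \<in> carrier Y. f y = \<zero>\<^bsub>Z\<^esub>}"
    and le: "carrier Y \<lesssim> (UNIV :: 'x set)" "carrier Z \<lesssim> (UNIV :: 'x set)"
    and u: "u \<in> carrier (Y \<boxtimes>\<^bsub>R\<^esub> M)" "tensor_map R Y M Z M f id u = \<zero>\<^bsub>Z \<boxtimes>\<^bsub>R\<^esub> M\<^esub>"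
  shows "u \<in> tensor_map R (sub_bimod Y X) M Y M id id ` carrier ((sub_bimod Y X) \<boxtimes>\<^bsub>R\<^esub> M)"
proof -
  have "carrier (sub_bimod Y X) \<lesssim> (UNIV :: 'x set)"
    using le(1) X(2) by (auto intro: lepoll_trans[OF subset_imp_lepoll])
  moreover have "exact_at (sub_bimod Y X) Y Z id f"
    using X(2) by (auto simp: exact_at_def)
  ultimately have "exact_at ((sub_bimod Y X) \<boxtimes>\<^bsub>R\<^esub> M) (Y \<boxtimes>\<^bsub>R\<^esub> M) (Z \<boxtimes>\<^bsub>R\<^esub> M) (tensor_map R (sub_bimod Y X) M Y M id id) (tensor_map R Y M Z M f id)"
    using assms by (intro flat_left_exact[OF flat]) auto
  then show ?thesis
    using u unfolding exact_at_def by simp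
qed

text \<open>Passes to the kernel of the difference. It identifies D \<otimes> T inside TP \<otimes>
  T, as its mirror image does for T \<otimes> C.\<close>

lemma flat_left_equalizer:
  fixes Y :: "('k2, 'm2, 'r) bimod" and Z :: "('k3, 'm3, 'r) bimod"
  assumes flat: "flat_left TYPE('x) R M"
    and M: "left_module R M" and YZ: "right_module R Y" "right_module R Z"
    and f: "f \<in> right_hom R Y Z" and g: "g \<in> right_hom R Y Z"
    and X: "right_module R (sub_bimod Y X)" "X = {y \<in> carrier Y. f y = g y}"
    and le: "carrier Y \<lesssim> (UNIV :: 'x set)" "carrier Z \<lesssim> (UNIV :: 'x set)"
    and u: "u \<in> carrier (Y \<boxtimes>\<^bsub>R\<^esub> M)" "tensor_map R Y M Z M f id u = tensor_map R Y M Z M g id u"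
  shows "u \<in> tensor_map R (sub_bimod Y X) M Y M id id ` carrier ((sub_bimod Y X) \<boxtimes>\<^bsub>R\<^esub> M)"
proof -
  interpret Z: right_module R Z by fact
  let ?d = "\<lambda>y. f y \<ominus>\<^bsub>Z\<^esub> g y"
  note fg_simps = add_hom_closed[OF right_hom_add_hom[OF f]] add_hom_closed[OF right_hom_add_hom[OF g]]
    add_hom_add[OF right_hom_add_hom[OF f]] add_hom_add[OF right_hom_add_hom[OF g]]
    right_hom_ract[OF f] right_hom_ract[OF g]
  have actm: "((\<ominus>\<^bsub>Z\<^esub> x) \<leftharpoonup>\<^bsub>Z\<^esub> a) = \<ominus>\<^bsub>Z\<^esub> ((x \<leftharpoonup>\<^bsub>Z\<^esub> a))" if "a \<in> carrier R" "x \<in> carrier Z" for a x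
    using that add_hom_minus[of Z Z "\<lambda>x. (x \<leftharpoonup>\<^bsub>Z\<^esub> a)"] Z.M.abelian_group_axioms
    by (simp add: add_hom_iff Z.ract_closed Z.add_ract)
  have d: "?d \<in> right_hom R Y Z"
    by (auto simp: right_hom_iff add_hom_iff fg_simps a_minus_def Z.M.minus_add Z.M.a_ac Z.add_ract actm)
  have X': "X = {y \<in> carrier Y. ?d y = \<zero>\<^bsub>Z\<^esub>}"
    using X(2) by (auto simp: fg_simps a_minus_def Z.M.r_neg dest: Z.M.eq_of_diff_zero[unfolded a_minus_def])
  interpret TZ: abelian_group "Z \<boxtimes>\<^bsub>R\<^esub> M" using M YZ by simp
  have "tensor_map R Y M Z M ?d id v \<oplus>\<^bsub>Z \<boxtimes>\<^bsub>R\<^esub> M\<^esub> tensor_map R Y M Z M g id v = tensor_map R Y M Z M f id v" if "v \<in> carrier (Y \<boxtimes>\<^bsub>R\<^esub> M)" for v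
    using YZ(1) M that
  proof (induction rule: tensor_induct)
    case (tens x y)
    have "?d v \<oplus>\<^bsub>Z\<^esub> g v = f v" if "v \<in> carrier Y" for v
      using that by (simp add: fg_simps a_minus_def Z.M.a_assoc Z.M.l_neg)
    then show ?case
      using tens by (simp add: M YZ f g d fg_simps flip: tens_add_left)
  next
    case (add u v)
    have "a \<oplus>\<^bsub>Z \<boxtimes>\<^bsub>R\<^esub> M\<^esub> b \<oplus>\<^bsub>Z \<boxtimes>\<^bsub>R\<^esub> M\<^esub> (c \<oplus>\<^bsub>Z \<boxtimes>\<^bsub>R\<^esub> M\<^esub> d') = (a \<oplus>\<^bsub>Z \<boxtimes>\<^bsub>R\<^esub> M\<^esub> c) \<oplus>\<^bsub>Z \<boxtimes>\<^bsub>R\<^esub> M\<^esub> (b \<oplus>\<^bsub>Z \<boxtimes>\<^bsub>R\<^esub> M\<^esub> d')"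
      if "a \<in> carrier (Z \<boxtimes>\<^bsub>R\<^esub> M)" "b \<in> carrier (Z \<boxtimes>\<^bsub>R\<^esub> M)" "c \<in> carrier (Z \<boxtimes>\<^bsub>R\<^esub> M)" "d' \<in> carrier (Z \<boxtimes>\<^bsub>R\<^esub> M)" for a b c d'
      using that by (simp add: TZ.a_ac)
    then show ?case
      using add by (simp add: M YZ f g d)
  qed
  from this[OF u(1)] have "tensor_map R Y M Z M ?d id u = \<zero>\<^bsub>Z \<boxtimes>\<^bsub>R\<^esub> M\<^esub>"
    using u by (simp add: M YZ f g d)
  then show ?thesis
    by (rule flat_left_kernel[OF flat M YZ d X(1) X' le u(1)])
qed

text \<open>The sequence 0 \<rightarrow> X1 \<inter> X2 \<rightarrow> X1 \<oplus> X2 \<rightarrow> Y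
  is tensored on the right. It is what lets the two memberships of a coproduct be combined into
  membership in \<open>Tbar\<close> tensored with T.\<close>

lemma flat_left_inter:
  fixes Y :: "('k2, 'm2, 'r) bimod"
  assumes flat: "flat_left TYPE('x) R M" and inf: "infinite (UNIV :: 'x set)"
    and M: "left_module R M" and Y: "right_module R Y"
    and X1: "right_module R (sub_bimod Y X1)" "X1 \<subseteq> carrier Y"
    and X2: "right_module R (sub_bimod Y X2)" "X2 \<subseteq> carrier Y"
    and X12: "right_module R (sub_bimod Y (X1 \<inter> X2))"
    and le: "carrier Y \<lesssim> (UNIV :: 'x set)"
    and u1: "u \<in> tensor_map R (sub_bimod Y X1) M Y M id id ` carrier ((sub_bimod Y X1) \<boxtimes>\<^bsub>R\<^esub> M)"
    and u2: "u \<in> tensor_map R (sub_bimod Y X2) M Y M id id ` carrier ((sub_bimod Y X2) \<boxtimes>\<^bsub>R\<^esub> M)"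
  shows "u \<in> tensor_map R (sub_bimod Y (X1 \<inter> X2)) M Y M id id ` carrier ((sub_bimod Y (X1 \<inter> X2)) \<boxtimes>\<^bsub>R\<^esub> M)"
proof -
  interpret Y: right_module R Y by fact
  interpret X1: right_module R "sub_bimod Y X1" by fact
  interpret X2: right_module R "sub_bimod Y X2" by fact
  interpret X12: right_module R "sub_bimod Y (X1 \<inter> X2)" by fact
  let ?X1 = "sub_bimod Y X1" and ?X2 = "sub_bimod Y X2" and ?X12 = "sub_bimod Y (X1 \<inter> X2)"
  let ?D = "dsum ?X1 ?X2"
  let ?f = "\<lambda>x. (x, \<ominus>\<^bsub>Y\<^esub> x)" and ?g = "\<lambda>z. fst z \<oplus>\<^bsub>Y\<^esub> snd z"
  let ?i1 = "\<lambda>x. (x, \<zero>\<^bsub>Y\<^esub>)" and ?i2 = "\<lambda>x. (\<zero>\<^bsub>Y\<^esub>, x)"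
  have D: "right_module R ?D"
    by (rule dsum_right_module[OF X1(1) X2(1)])
  note [simp] = X1.M.zero_closed[unfolded sub_bimod_simps] X2.M.zero_closed[unfolded sub_bimod_simps]
    X1.M.a_closed[unfolded sub_bimod_simps] X2.M.a_closed[unfolded sub_bimod_simps]
  have minus: "\<ominus>\<^bsub>Y\<^esub> x \<in> Xi" if "right_module R (sub_bimod Y Xi)" "Xi \<subseteq> carrier Y" "x \<in> Xi" for x Xi
  proof -
    interpret Xi: right_module R "sub_bimod Y Xi" by fact
    have "\<ominus>\<^bsub>sub_bimod Y Xi\<^esub> x \<in> Xi" "\<ominus>\<^bsub>sub_bimod Y Xi\<^esub> x \<oplus>\<^bsub>Y\<^esub> x = \<zero>\<^bsub>Y\<^esub>"
      using Xi.M.a_inv_closed[of x] Xi.M.l_neg[of x] that by simp_all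
    then show ?thesis
      using Y.M.minus_equality[of "\<ominus>\<^bsub>sub_bimod Y Xi\<^esub> x" x] that by (simp add: subsetD)
  qed
  note minus1 = minus[OF X1] and minus2 = minus[OF X2]
  have Y1: "x \<in> carrier Y" if "x \<in> X1" for x using X1(2) that by auto
  have Y2: "x \<in> carrier Y" if "x \<in> X2" for x using X2(2) that by auto
  have act0: "(\<zero>\<^bsub>Y\<^esub> \<leftharpoonup>\<^bsub>Y\<^esub> a) = \<zero>\<^bsub>Y\<^esub>" if "a \<in> carrier R" for a
    using that add_hom_zero[of Y Y "\<lambda>x. (x \<leftharpoonup>\<^bsub>Y\<^esub> a)"] Y.M.abelian_group_axioms
    by (simp add: add_hom_iff Y.ract_closed Y.add_ract)
  have actm: "((\<ominus>\<^bsub>Y\<^esub> x) \<leftharpoonup>\<^bsub>Y\<^esub> a) = \<ominus>\<^bsub>Y\<^esub> ((x \<leftharpoonup>\<^bsub>Y\<^esub> a))" if "a \<in> carrier R" "x \<in> carrier Y" for a x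
    using that add_hom_minus[of Y Y "\<lambda>x. (x \<leftharpoonup>\<^bsub>Y\<^esub> a)"] Y.M.abelian_group_axioms
    by (simp add: add_hom_iff Y.ract_closed Y.add_ract)
  have f: "?f \<in> right_hom R ?X12 ?D"
    by (auto simp: right_hom_iff add_hom_iff minus2 Y.M.minus_add actm Y1 Y2)
  have g: "?g \<in> right_hom R ?D Y"
    by (auto simp: right_hom_iff add_hom_iff Y1 Y2 Y.add_ract Y.M.a_ac)
  have i1: "?i1 \<in> right_hom R ?X1 ?D" and i2: "?i2 \<in> right_hom R ?X2 ?D" and p: "fst \<in> right_hom R ?D ?X1"
    by (auto simp: right_hom_iff add_hom_iff act0)
  have ex: "exact_at ?X12 ?D Y ?f ?g"
  proof -
    have "x \<in> X2 \<and> y = \<ominus>\<^bsub>Y\<^esub> x" if "x \<in> X1" "y \<in> X2" "x \<oplus>\<^bsub>Y\<^esub> y = \<zero>\<^bsub>Y\<^esub>" for x y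
    proof -
      have "x = \<ominus>\<^bsub>Y\<^esub> y" "y = \<ominus>\<^bsub>Y\<^esub> x"
        using that Y1 Y2 Y.M.minus_equality[of x y] Y.M.minus_equality[of y x] by (auto simp: Y.M.a_comm)
      then show ?thesis using minus2[OF that(2)] by simp
    qed
    then show ?thesis
      unfolding exact_at_def by (auto simp: minus2 Y1 Y.M.r_neg image_iff)
  qed
  have sub_le: "carrier (sub_bimod Y Xi) \<lesssim> (UNIV :: 'x set)" if "Xi \<subseteq> carrier Y" for Xi
    using that le by (auto intro: lepoll_trans[OF subset_imp_lepoll])
  have "carrier ?D \<lesssim> (UNIV :: 'x set) \<times> (UNIV :: 'x set)"
    using times_lepoll_mono[OF sub_le[OF X1(2)] sub_le[OF X2(2)]] by simp
  also have "\<dots> \<approx> (UNIV :: 'x set)"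
    using inf by (rule infinite_times_eqpoll_self)
  finally have D_le: "carrier ?D \<lesssim> (UNIV :: 'x set)" .
  have exT: "exact_at (?X12 \<boxtimes>\<^bsub>R\<^esub> M) (?D \<boxtimes>\<^bsub>R\<^esub> M) (Y \<boxtimes>\<^bsub>R\<^esub> M) (tensor_map R ?X12 M ?D M ?f id) (tensor_map R ?D M Y M ?g id)"
    using X1(2) by (intro flat_left_exact[OF flat M X12 D Y f g _ D_le le ex] sub_le) auto
  obtain t1 where t1: "t1 \<in> carrier (?X1 \<boxtimes>\<^bsub>R\<^esub> M)" "u = tensor_map R ?X1 M Y M id id t1" using u1 by blast
  obtain t2 where t2: "t2 \<in> carrier (?X2 \<boxtimes>\<^bsub>R\<^esub> M)" "u = tensor_map R ?X2 M Y M id id t2" using u2 by blast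
  note [simp] = M Y X1(1) X2(1) X12 D f g i1 i2 p X1(2) X2(2)
  interpret TX1: abelian_group "?X1 \<boxtimes>\<^bsub>R\<^esub> M" by simp
  interpret TX2: abelian_group "?X2 \<boxtimes>\<^bsub>R\<^esub> M" by simp
  interpret TD: abelian_group "?D \<boxtimes>\<^bsub>R\<^esub> M" by simp
  interpret TY: abelian_group "Y \<boxtimes>\<^bsub>R\<^esub> M" by simp
  \<comment> \<open>Two lifts of the same \<open>u\<close>, one through each summand; their
    difference is in the kernel of the sum map and so comes from the intersection.\<close>
  define s1 where "s1 = tensor_map R ?X1 M ?D M ?i1 id t1"
  define s2 where "s2 = tensor_map R ?X2 M ?D M ?i2 id t2"
  have s: "s1 \<in> carrier (?D \<boxtimes>\<^bsub>R\<^esub> M)" "s2 \<in> carrier (?D \<boxtimes>\<^bsub>R\<^esub> M)"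
    using t1 t2 by (simp_all add: s1_def s2_def)
  have ghom: "tensor_map R ?D M Y M ?g id \<in> add_hom (?D \<boxtimes>\<^bsub>R\<^esub> M) (Y \<boxtimes>\<^bsub>R\<^esub> M)"
    by (intro tensor_map_hom) simp_all
  have phom: "tensor_map R ?D M ?X1 M fst id \<in> add_hom (?D \<boxtimes>\<^bsub>R\<^esub> M) (?X1 \<boxtimes>\<^bsub>R\<^esub> M)"
    by (intro tensor_map_hom) simp_all
  have g1: "tensor_map R ?D M Y M ?g id s1 = u"
  proof -
    have "tensor_map R ?D M Y M ?g id s1 = tensor_map R ?X1 M Y M (\<lambda>x. ?g (?i1 x)) id t1"
      unfolding s1_def using t1(1) by (subst tensor_map_comp) (simp_all add: id_def)
    also have "\<dots> = tensor_map R ?X1 M Y M id id t1"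
      using t1(1) by (intro tensor_map_cong[symmetric]) (simp_all add: Y1)
    finally show ?thesis using t1 by simp
  qed
  have g2: "tensor_map R ?D M Y M ?g id s2 = u"
  proof -
    have "tensor_map R ?D M Y M ?g id s2 = tensor_map R ?X2 M Y M (\<lambda>x. ?g (?i2 x)) id t2"
      unfolding s2_def using t2(1) by (subst tensor_map_comp) (simp_all add: id_def)
    also have "\<dots> = tensor_map R ?X2 M Y M id id t2"
      using t2(1) by (intro tensor_map_cong[symmetric]) (simp_all add: Y2)
    finally show ?thesis using t2 by simp
  qed
  have p1: "tensor_map R ?D M ?X1 M fst id s1 = t1"
    unfolding s1_def using t1(1) by (subst tensor_map_comp) (simp_all add: tensor_map_id)
  have p2: "tensor_map R ?D M ?X1 M fst id s2 = \<zero>\<^bsub>?X1 \<boxtimes>\<^bsub>R\<^esub> M\<^esub>"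
  proof -
    have "tensor_map R ?D M ?X1 M fst id (tensor_map R ?X2 M ?D M ?i2 id t) = \<zero>\<^bsub>?X1 \<boxtimes>\<^bsub>R\<^esub> M\<^esub>" if "t \<in> carrier (?X2 \<boxtimes>\<^bsub>R\<^esub> M)" for t
      using X2(1) M that by (induction rule: tensor_induct) (simp_all add: tens_zero_left tens_zero_left[where M = ?X1, simplified])
    then show ?thesis using t2(1) by (simp add: s2_def)
  qed
  have "tensor_map R ?D M Y M ?g id (s1 \<ominus>\<^bsub>?D \<boxtimes>\<^bsub>R\<^esub> M\<^esub> s2) = \<zero>\<^bsub>Y \<boxtimes>\<^bsub>R\<^esub> M\<^esub>"
    using add_hom_diff[OF TD.abelian_group_axioms TY.abelian_group_axioms ghom s] g1 g2
      add_hom_closed[OF ghom s(1)] by (simp add: a_minus_def TY.r_neg)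
  then have "s1 \<ominus>\<^bsub>?D \<boxtimes>\<^bsub>R\<^esub> M\<^esub> s2 \<in> tensor_map R ?X12 M ?D M ?f id ` carrier (?X12 \<boxtimes>\<^bsub>R\<^esub> M)"
    unfolding exT[unfolded exact_at_def] using TD.minus_closed[OF s] by simp
  then obtain t0 where t0: "t0 \<in> carrier (?X12 \<boxtimes>\<^bsub>R\<^esub> M)" "s1 \<ominus>\<^bsub>?D \<boxtimes>\<^bsub>R\<^esub> M\<^esub> s2 = tensor_map R ?X12 M ?D M ?f id t0" by blast
  have "tensor_map R ?D M ?X1 M fst id (s1 \<ominus>\<^bsub>?D \<boxtimes>\<^bsub>R\<^esub> M\<^esub> s2) = t1"
    using add_hom_diff[OF TD.abelian_group_axioms TX1.abelian_group_axioms phom s] p1 p2 t1(1)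
    by (simp add: a_minus_def)
  then have "t1 = tensor_map R ?X12 M ?X1 M id id t0"
    unfolding t0(2) using t0(1) by (subst (asm) tensor_map_comp) (simp_all add: id_def)
  then have "u = tensor_map R ?X12 M Y M id id t0"
    unfolding t1(2) using t0(1) by (simp add: tensor_map_comp) (simp add: id_def)
  then show ?thesis using t0(1) by blast
qed

text \<open>The submodule \<open>W\<close> of all elements whose tensors with \<open>M\<close> come
  from \<open>X\<close> becomes equal to \<open>X\<close> after tensoring, hence equals
  \<open>X\<close> already. This is the descent along T as a left S-module.\<close>

lemma faithfully_flat_left_mem:
  fixes Y :: "('k2, 'm2, 'r) bimod"
  assumes flat: "faithfully_flat_left TYPE('x) R M"
    and M: "left_module R M" and Y: "right_module R Y"
    and X: "right_module R (sub_bimod Y X)" "X \<subseteq> carrier Y"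
    and le: "carrier Y \<lesssim> (UNIV :: 'x set)"
    and y: "y \<in> carrier Y"
    and mem: "\<And>m. m \<in> carrier M \<Longrightarrow> tens R Y M y m \<in> tensor_map R (sub_bimod Y X) M Y M id id ` carrier ((sub_bimod Y X) \<boxtimes>\<^bsub>R\<^esub> M)"
  shows "y \<in> X"
proof -
  interpret Y: right_module R Y by fact
  interpret M: left_module R M by fact
  interpret X: right_module R "sub_bimod Y X" by fact
  let ?X = "sub_bimod Y X"
  let ?I = "tensor_map R ?X M Y M id id ` carrier (?X \<boxtimes>\<^bsub>R\<^esub> M)"
  define W where "W = {y \<in> carrier Y. \<forall>m\<in>carrier M. tens R Y M y m \<in> ?I}"
  let ?W = "sub_bimod Y W" and ?O = "sub_bimod Y {\<zero>\<^bsub>Y\<^esub>}"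
  note [simp] = M Y X(1) X(2)
  interpret TX: abelian_group "?X \<boxtimes>\<^bsub>R\<^esub> M" by simp
  interpret TY: abelian_group "Y \<boxtimes>\<^bsub>R\<^esub> M" by simp
  have X0: "\<zero>\<^bsub>Y\<^esub> \<in> X" using X.M.zero_closed by simp
  have I_add: "u \<oplus>\<^bsub>Y \<boxtimes>\<^bsub>R\<^esub> M\<^esub> v \<in> ?I" if uv: "u \<in> ?I" "v \<in> ?I" for u v
  proof -
    obtain s where s: "s \<in> carrier (?X \<boxtimes>\<^bsub>R\<^esub> M)" "u = tensor_map R ?X M Y M id id s" using uv(1) by (elim imageE) (rule that)
    obtain t where t: "t \<in> carrier (?X \<boxtimes>\<^bsub>R\<^esub> M)" "v = tensor_map R ?X M Y M id id t" using uv(2) by (elim imageE) (rule that)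
    show ?thesis
      using s t TX.a_closed by (intro image_eqI[where x = "s \<oplus>\<^bsub>?X \<boxtimes>\<^bsub>R\<^esub> M\<^esub> t"]) simp_all
  qed
  have XW: "X \<subseteq> W"
  proof
    fix x assume x: "x \<in> X"
    have "tens R Y M x m \<in> ?I" if "m \<in> carrier M" for m
      using x that by (intro image_eqI[where x = "tens R ?X M x m"]) simp_all
    then show "x \<in> W"
      unfolding W_def using subsetD[OF X(2) x] by simp
  qed
  have WY: "W \<subseteq> carrier Y" by (auto simp: W_def)
  have W: "right_module R ?W"
  proof (rule right_sub_bimodI[OF Y WY])
    show "\<zero>\<^bsub>Y\<^esub> \<in> W" using X0 XW by auto
    show "x \<oplus>\<^bsub>Y\<^esub> y \<in> W" if "x \<in> W" "y \<in> W" for x y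
      using that unfolding W_def by (simp add: tens_add_left I_add)
    show "(x \<leftharpoonup>\<^bsub>Y\<^esub> a) \<in> W" if "a \<in> carrier R" "x \<in> W" for a x
      using that unfolding W_def by (simp add: M.lact_closed Y.ract_closed tens_ract)
  qed
  have act0: "(\<zero>\<^bsub>Y\<^esub> \<leftharpoonup>\<^bsub>Y\<^esub> a) = \<zero>\<^bsub>Y\<^esub>" if "a \<in> carrier R" for a
    using that add_hom_zero[of Y Y "\<lambda>x. (x \<leftharpoonup>\<^bsub>Y\<^esub> a)"] Y.M.abelian_group_axioms
    by (simp add: add_hom_iff Y.ract_closed Y.add_ract)
  have O: "right_module R ?O"
    by (rule right_sub_bimodI[OF Y]) (auto simp: act0)
  have sub_le: "carrier (sub_bimod Y V) \<lesssim> (UNIV :: 'x set)" if "V \<subseteq> carrier Y" for V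
    using that le by (auto intro: lepoll_trans[OF subset_imp_lepoll])
  note [simp] = W O WY XW
  let ?z = "\<lambda>_. \<zero>\<^bsub>Y\<^esub>"
  have z: "?z \<in> right_hom R ?W ?O"
    by (auto simp: right_hom_iff add_hom_iff act0)
  interpret TW: abelian_group "?W \<boxtimes>\<^bsub>R\<^esub> M" by simp
  interpret TO: abelian_group "?O \<boxtimes>\<^bsub>R\<^esub> M" by simp
  have inj: "inj_on (tensor_map R ?W M Y M id id) (carrier (?W \<boxtimes>\<^bsub>R\<^esub> M))"
    by (rule flat_left_inj[OF faithfully_flat_left_imp_flat[OF flat] M W Y sub_bimod_right_hom(3)[OF WY] _ sub_le[OF WY] le])
      simp
  have surj: "u \<in> tensor_map R ?X M ?W M id id ` carrier (?X \<boxtimes>\<^bsub>R\<^esub> M)" if "u \<in> carrier (?W \<boxtimes>\<^bsub>R\<^esub> M)" for u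
    using W M that
  proof (induction rule: tensor_induct)
    case (tens x y)
    have WD: "y \<in> carrier Y" "tens R Y M y m \<in> ?I" if "y \<in> W" "m \<in> carrier M" for m y
      using that by (simp_all add: W_def)
    have "tensor_map R ?W M Y M id id (tens R ?W M x y) \<in> ?I"
      using tens WD by simp
    then obtain t where t: "t \<in> carrier (?X \<boxtimes>\<^bsub>R\<^esub> M)" "tensor_map R ?W M Y M id id (tens R ?W M x y) = tensor_map R ?X M Y M id id t"
      by (elim imageE) (rule that)
    have "tensor_map R ?X M Y M id id t = tensor_map R ?W M Y M id id (tensor_map R ?X M ?W M id id t)"
      using t(1) by (simp add: tensor_map_comp) (simp add: id_def)
    then have "tens R ?W M x y = tensor_map R ?X M ?W M id id t"
      using inj_onD[OF inj _ tens_closed tensor_map_closed[OF _ _ _ _ _ _ t(1)]] t(2) tens by simp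
    then show ?case using t(1) by (rule image_eqI)
  next
    case (add u v)
    from add(3) obtain s where s: "s \<in> carrier (?X \<boxtimes>\<^bsub>R\<^esub> M)" "u = tensor_map R ?X M ?W M id id s" by (elim imageE) (rule that)
    from add(4) obtain t where t: "t \<in> carrier (?X \<boxtimes>\<^bsub>R\<^esub> M)" "v = tensor_map R ?X M ?W M id id t" by (elim imageE) (rule that)
    show ?case
      using s t TX.a_closed
      by (intro image_eqI[where x = "s \<oplus>\<^bsub>?X \<boxtimes>\<^bsub>R\<^esub> M\<^esub> t"]) (simp_all add: id_def)
  qed
  have zero: "tensor_map R ?W M ?O M ?z id u = \<zero>\<^bsub>?O \<boxtimes>\<^bsub>R\<^esub> M\<^esub>" if "u \<in> carrier (?W \<boxtimes>\<^bsub>R\<^esub> M)" for u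
    using W M that
    by (induction rule: tensor_induct) (simp_all add: z tens_zero_left[where M = ?O, simplified])
  have exT: "exact_at (?X \<boxtimes>\<^bsub>R\<^esub> M) (?W \<boxtimes>\<^bsub>R\<^esub> M) (?O \<boxtimes>\<^bsub>R\<^esub> M) (tensor_map R ?X M ?W M id id) (tensor_map R ?W M ?O M ?z id)"
    unfolding exact_at_def
  proof (intro equalityI subsetI)
    fix u assume "u \<in> tensor_map R ?X M ?W M id id ` carrier (?X \<boxtimes>\<^bsub>R\<^esub> M)"
    then obtain t where t: "t \<in> carrier (?X \<boxtimes>\<^bsub>R\<^esub> M)" "u = tensor_map R ?X M ?W M id id t" by (elim imageE) (rule that)
    then have "u \<in> carrier (?W \<boxtimes>\<^bsub>R\<^esub> M)" by simp
    then show "u \<in> {u \<in> carrier (?W \<boxtimes>\<^bsub>R\<^esub> M). tensor_map R ?W M ?O M ?z id u = \<zero>\<^bsub>?O \<boxtimes>\<^bsub>R\<^esub> M\<^esub>}" by (simp add: zero)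
  qed (use surj in simp)
  have "exact_at ?X ?W ?O id ?z"
    by (rule faithfully_flat_left_exact[OF flat M X(1) W O sub_bimod_right_hom(1)[OF XW] z sub_le[OF X(2)] sub_le[OF WY] sub_le exT])
      simp
  then have XW': "X = W"
    by (simp add: exact_at_def)
  have "y \<in> W"
    using y mem unfolding W_def by simp
  then show ?thesis
    by (simp only: XW')
qed

section \<open>Formal duals\<close>

lemma restr_simps [simp]:
  "carrier (restr \<phi> \<psi> M) = carrier M" "ring.add (restr \<phi> \<psi> M) = ring.add M" "\<zero>\<^bsub>restr \<phi> \<psi> M\<^esub> = \<zero>\<^bsub>M\<^esub>"
  "a \<rightharpoonup>\<^bsub>restr \<phi> \<psi> M\<^esub> x = \<phi> a \<rightharpoonup>\<^bsub>M\<^esub> x" "x \<leftharpoonup>\<^bsub>restr \<phi> \<psi> M\<^esub> b = x \<leftharpoonup>\<^bsub>M\<^esub> \<psi> b"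
  by (simp_all add: restr_def)

lemma regular_simps [simp]:
  "carrier (regular Q) = carrier Q" "ring.add (regular Q) = ring.add Q" "\<zero>\<^bsub>regular Q\<^esub> = \<zero>\<^bsub>Q\<^esub>"
  "a \<rightharpoonup>\<^bsub>regular Q\<^esub> x = a \<otimes>\<^bsub>Q\<^esub> x" "x \<leftharpoonup>\<^bsub>regular Q\<^esub> b = x \<otimes>\<^bsub>Q\<^esub> b"
  by (simp_all add: regular_def)

lemma restr_left_module:
  assumes "ring_hom_ring L L' \<phi>" "left_module L' M"
  shows "left_module L (restr \<phi> \<psi> M)"
proof -
  interpret h: ring_hom_ring L L' \<phi> by fact
  interpret M: left_module L' M by fact
  have "abelian_group (restr \<phi> \<psi> M)"
    by (rule abelian_group_cong[OF M.M.abelian_group_axioms]) simp_all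
  then show ?thesis
    unfolding left_module_def left_module_axioms_def
    by (simp add: h.R.ring_axioms M.lact_closed M.lact_add M.add_lact M.mult_lact M.one_lact)
qed

lemma restr_right_module:
  assumes "ring_hom_ring L L' \<psi>" "right_module L' M"
  shows "right_module L (restr \<phi> \<psi> M)"
proof -
  interpret h: ring_hom_ring L L' \<psi> by fact
  interpret M: right_module L' M by fact
  have "abelian_group (restr \<phi> \<psi> M)"
    by (rule abelian_group_cong[OF M.M.abelian_group_axioms]) simp_all
  then show ?thesis
    unfolding right_module_def right_module_axioms_def
    by (simp add: h.R.ring_axioms M.ract_closed M.ract_add M.add_ract M.ract_mult M.ract_one)
qed

lemma restr_bimodule:
  assumes \<phi>: "ring_hom_ring L L' \<phi>" and \<psi>: "ring_hom_ring Q Q' \<psi>" and M: "bimodule L' Q' M"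
  shows "bimodule L Q (restr \<phi> \<psi> M)"
proof -
  interpret f: ring_hom_ring L L' \<phi> by fact
  interpret g: ring_hom_ring Q Q' \<psi> by fact
  interpret M: bimodule L' Q' M by fact
  show ?thesis
    using restr_left_module[OF \<phi> M.left_module_axioms, of \<psi>] restr_right_module[OF \<psi> M.right_module_axioms, of \<phi>]
    unfolding bimodule_def bimodule_axioms_def by (simp add: M.lact_ract)
qed

lemma regular_bimodule: "ring Q \<Longrightarrow> bimodule Q Q (regular Q)"
proof -
  assume "ring Q"
  then interpret Q: ring Q .
  have "abelian_group (regular Q)"
    by (rule abelian_group_cong[OF Q.abelian_group_axioms]) simp_all
  then show ?thesis
    unfolding bimodule_def left_module_def right_module_def left_module_axioms_def right_module_axioms_def bimodule_axioms_def
    by (simp add: Q.ring_axioms Q.l_distr Q.r_distr Q.m_assoc)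
qed

lemma tensor_ker_restr:
  "tensor_ker R (restr \<phi>' \<psi> M) (restr \<phi> \<psi>' N) = tensor_ker R (restr \<phi>'' \<psi> M) (restr \<phi> \<psi>'' N)"
  by (simp add: tensor_ker_def tensor_rels_def)

text \<open>The relations of a tensor product use the inner actions only. So \<open>ev\<close> and
  \<open>evh\<close>, which are assumed linear for the outer actions of A and B, can be evaluated on
  the tensor products whose outer actions are restricted to R and S.\<close>

lemma tens_restr:
  "tens R (restr \<phi>' \<psi> M) (restr \<phi> \<psi>' N) = tens R (restr \<phi>'' \<psi> M) (restr \<phi> \<psi>'' N)"
  by (intro ext) (simp add: tens_def tensor_ker_restr[of R \<phi>' \<psi> M \<phi> \<psi>' N \<phi>'' \<psi>''])

lemma tensor_group_restr:
  "tensor_group R (restr \<phi>' \<psi> M) (restr \<phi> \<psi>' N) = tensor_group R (restr \<phi>'' \<psi> M) (restr \<phi> \<psi>'' N)"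
  by (simp add: tensor_group_def tensor_ker_restr[of R \<phi>' \<psi> M \<phi> \<psi>' N \<phi>'' \<psi>''])

section \<open>Linearity of the two evaluation maps\<close>

context formal_dual
begin

lemma A_ring [simp]: "ring A" and B_ring [simp]: "ring B" and R_ring [simp]: "ring R" and S_ring [simp]: "ring S"
  by (rule alpha.S.ring_axioms beta.S.ring_axioms alpha.R.ring_axioms beta.R.ring_axioms)+

lemma T0_bimodule [simp]: "bimodule S R T0" "left_module S T0" "right_module R T0"
  using restr_bimodule[OF beta.ring_hom_ring_axioms alpha.ring_hom_ring_axioms T.bimodule_axioms]
  by (auto dest: bimoduleD)

lemma P0_bimodule [simp]: "bimodule R S P0" "left_module R P0" "right_module S P0"
  using restr_bimodule[OF alpha.ring_hom_ring_axioms beta.ring_hom_ring_axioms That.bimodule_axioms]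
  by (auto dest: bimoduleD)

lemma A0_bimodule [simp]: "bimodule R R A0" "left_module R A0" "right_module R A0"
  using restr_bimodule[OF alpha.ring_hom_ring_axioms alpha.ring_hom_ring_axioms regular_bimodule[OF A_ring]]
  by (auto dest: bimoduleD)

lemma B0_bimodule [simp]: "bimodule S S B0" "left_module S B0" "right_module S B0"
  using restr_bimodule[OF beta.ring_hom_ring_axioms beta.ring_hom_ring_axioms regular_bimodule[OF B_ring]]
  by (auto dest: bimoduleD)

lemma T_bimodule [simp]: "bimodule B A T" "left_module B T" "right_module A T"
  by (rule T.bimodule_axioms T.left_module_axioms T.right_module_axioms)+

lemma That_bimodule [simp]: "bimodule A B That" "left_module A That" "right_module B That"
  by (rule That.bimodule_axioms That.left_module_axioms That.right_module_axioms)+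

lemmas act_simps [simp] = T.lact_closed T.ract_closed T.lact_add T.add_ract T.one_lact T.ract_one
  That.lact_closed That.ract_closed That.lact_add That.add_ract That.one_lact That.ract_one

abbreviation E where "E p x \<equiv> ev (tens S P0 T0 p x)"
abbreviation F where "F x p \<equiv> evh (tens R T0 P0 x p)"

lemma ev_add_hom: "ev \<in> add_hom PT A"
  using ev_hom tensor_group_restr[of S id \<beta> That \<beta> id T \<alpha> \<alpha>]
  by (simp add: bimod_hom_def left_hom_iff add_hom_iff tensor_simps)

lemma evh_add_hom: "evh \<in> add_hom TP B"
  using evh_hom tensor_group_restr[of R id \<alpha> T \<alpha> id That \<beta> \<beta>]
  by (simp add: bimod_hom_def left_hom_iff add_hom_iff tensor_simps)

lemmas ev_closed [simp] = add_hom_closed[OF ev_add_hom]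
lemmas ev_add [simp] = add_hom_add[OF ev_add_hom]
lemmas evh_closed [simp] = add_hom_closed[OF evh_add_hom]
lemmas evh_add [simp] = add_hom_add[OF evh_add_hom]

lemma Pa_bimodule: "bimodule A S (restr id \<beta> That)" "left_module A (restr id \<beta> That)" "right_module S (restr id \<beta> That)"
  and Ta_bimodule: "bimodule S A (restr \<beta> id T)" "left_module S (restr \<beta> id T)" "right_module A (restr \<beta> id T)"
  and Tb_bimodule: "bimodule B R (restr id \<alpha> T)" "left_module B (restr id \<alpha> T)" "right_module R (restr id \<alpha> T)"
  and Pb_bimodule: "bimodule R B (restr \<alpha> id That)" "left_module R (restr \<alpha> id That)" "right_module B (restr \<alpha> id That)"
proof -
  have "ring_hom_ring A A id" "ring_hom_ring B B id"
    by (auto intro!: ring_hom_ringI)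
  note id = this
  note r = restr_bimodule[OF id(1) beta.ring_hom_ring_axioms That.bimodule_axioms]
    restr_bimodule[OF beta.ring_hom_ring_axioms id(1) T.bimodule_axioms]
    restr_bimodule[OF id(2) alpha.ring_hom_ring_axioms T.bimodule_axioms]
    restr_bimodule[OF alpha.ring_hom_ring_axioms id(2) That.bimodule_axioms]
  show "bimodule A S (restr id \<beta> That)" "left_module A (restr id \<beta> That)" "right_module S (restr id \<beta> That)"
    "bimodule S A (restr \<beta> id T)" "left_module S (restr \<beta> id T)" "right_module A (restr \<beta> id T)"
    "bimodule B R (restr id \<alpha> T)" "left_module B (restr id \<alpha> T)" "right_module R (restr id \<alpha> T)"
    "bimodule R B (restr \<alpha> id That)" "left_module R (restr \<alpha> id That)" "right_module B (restr \<alpha> id That)"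
    using r by (auto dest: bimoduleD)
qed

text \<open>On \<open>PT\<close> only R acts, through \<alpha>. The full A-linearity survives on
  elementary tensors because these are the same elements as in the tensor product that carries the
  A-actions.\<close>

lemma ev_lact [simp]:
  assumes "a \<in> carrier A" "p \<in> carrier That" "x \<in> carrier T"
  shows "E (a \<rightharpoonup>\<^bsub>That\<^esub> p) x = a \<otimes>\<^bsub>A\<^esub> E p x"
proof -
  have "ev (a \<rightharpoonup>\<^bsub>restr id \<beta> That \<boxtimes>\<^bsub>S\<^esub> restr \<beta> id T\<^esub> tens S (restr id \<beta> That) (restr \<beta> id T) p x) =
      a \<otimes>\<^bsub>A\<^esub> ev (tens S (restr id \<beta> That) (restr \<beta> id T) p x)"
    using ev_hom assms by (simp add: bimod_hom_def left_hom_iff)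
  then show ?thesis
    using assms lact_tens[OF assms(1) Pa_bimodule(1) Ta_bimodule(2), of p x]
    by (simp add: tens_restr[of S id \<beta> That \<beta> id T \<alpha> \<alpha>])
qed

lemma ev_ract [simp]:
  assumes "a \<in> carrier A" "p \<in> carrier That" "x \<in> carrier T"
  shows "E p (x \<leftharpoonup>\<^bsub>T\<^esub> a) = E p x \<otimes>\<^bsub>A\<^esub> a"
proof -
  have "ev (tens S (restr id \<beta> That) (restr \<beta> id T) p x \<leftharpoonup>\<^bsub>restr id \<beta> That \<boxtimes>\<^bsub>S\<^esub> restr \<beta> id T\<^esub> a) =
      ev (tens S (restr id \<beta> That) (restr \<beta> id T) p x) \<otimes>\<^bsub>A\<^esub> a"
    using ev_hom assms by (simp add: bimod_hom_def right_hom_iff)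
  then show ?thesis
    using assms ract_tens[OF assms(1) Pa_bimodule(3) Ta_bimodule(1), of p x]
    by (simp add: tens_restr[of S id \<beta> That \<beta> id T \<alpha> \<alpha>])
qed

lemma evh_lact [simp]:
  assumes "b \<in> carrier B" "p \<in> carrier That" "x \<in> carrier T"
  shows "F (b \<rightharpoonup>\<^bsub>T\<^esub> x) p = b \<otimes>\<^bsub>B\<^esub> F x p"
proof -
  have "evh (b \<rightharpoonup>\<^bsub>restr id \<alpha> T \<boxtimes>\<^bsub>R\<^esub> restr \<alpha> id That\<^esub> tens R (restr id \<alpha> T) (restr \<alpha> id That) x p) =
      b \<otimes>\<^bsub>B\<^esub> evh (tens R (restr id \<alpha> T) (restr \<alpha> id That) x p)"
    using evh_hom assms by (simp add: bimod_hom_def left_hom_iff)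
  then show ?thesis
    using assms lact_tens[OF assms(1) Tb_bimodule(1) Pb_bimodule(2), of x p]
    by (simp add: tens_restr[of R id \<alpha> T \<alpha> id That \<beta> \<beta>])
qed

lemma evh_ract [simp]:
  assumes "b \<in> carrier B" "p \<in> carrier That" "x \<in> carrier T"
  shows "F x (p \<leftharpoonup>\<^bsub>That\<^esub> b) = F x p \<otimes>\<^bsub>B\<^esub> b"
proof -
  have "evh (tens R (restr id \<alpha> T) (restr \<alpha> id That) x p \<leftharpoonup>\<^bsub>restr id \<alpha> T \<boxtimes>\<^bsub>R\<^esub> restr \<alpha> id That\<^esub> b) =
      evh (tens R (restr id \<alpha> T) (restr \<alpha> id That) x p) \<otimes>\<^bsub>B\<^esub> b"
    using evh_hom assms by (simp add: bimod_hom_def right_hom_iff)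
  then show ?thesis
    using assms ract_tens[OF assms(1) Tb_bimodule(3) Pb_bimodule(1), of x p]
    by (simp add: tens_restr[of R id \<alpha> T \<alpha> id That \<beta> \<beta>])
qed

text \<open>As rewriting rules the compatibility laws move evaluations to \<open>ev\<close>:
  \<open>evh (x \<otimes> p) y\<close> becomes \<open>x ev (p \<otimes> y)\<close>, and
  \<open>p evh (x \<otimes> q)\<close> becomes \<open>ev (p \<otimes> x) q\<close>.\<close>

lemmas evh_ev' [simp] = evh_ev
lemmas ev_evh' [simp] = ev_evh

lemmas PT_induct = tensor_induct[OF P0_bimodule(3) T0_bimodule(2), consumes 1, case_names tens add]
lemmas TP_induct = tensor_induct[OF T0_bimodule(3) P0_bimodule(2), consumes 1, case_names tens add]

lemma ev_left_hom [simp]: "ev \<in> left_hom R PT A0"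
  unfolding left_hom_iff
proof (intro conjI ballI)
  show "ev \<in> add_hom PT A0" using ev_add_hom by (simp add: add_hom_iff)
  fix a u assume au: "a \<in> carrier R" "u \<in> carrier PT"
  from au(2,1) show "ev (a \<rightharpoonup>\<^bsub>PT\<^esub> u) = a \<rightharpoonup>\<^bsub>A0\<^esub> ev u"
    by (induction rule: PT_induct) (simp_all add: alpha.S.r_distr)
qed

lemma ev_right_hom [simp]: "ev \<in> right_hom R PT A0"
  unfolding right_hom_iff
proof (intro conjI ballI)
  show "ev \<in> add_hom PT A0" using ev_add_hom by (simp add: add_hom_iff)
  fix a u assume au: "a \<in> carrier R" "u \<in> carrier PT"
  from au(2,1) show "ev (u \<leftharpoonup>\<^bsub>PT\<^esub> a) = ev u \<leftharpoonup>\<^bsub>A0\<^esub> a"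
    by (induction rule: PT_induct) (simp_all add: alpha.S.l_distr)
qed

lemma evh_left_hom [simp]: "evh \<in> left_hom S TP B0"
  unfolding left_hom_iff
proof (intro conjI ballI)
  show "evh \<in> add_hom TP B0" using evh_add_hom by (simp add: add_hom_iff)
  fix a u assume au: "a \<in> carrier S" "u \<in> carrier TP"
  from au(2,1) show "evh (a \<rightharpoonup>\<^bsub>TP\<^esub> u) = a \<rightharpoonup>\<^bsub>B0\<^esub> evh u"
    by (induction rule: TP_induct) (simp_all add: beta.S.r_distr)
qed

lemma evh_right_hom [simp]: "evh \<in> right_hom S TP B0"
  unfolding right_hom_iff
proof (intro conjI ballI)
  show "evh \<in> add_hom TP B0" using evh_add_hom by (simp add: add_hom_iff)
  fix a u assume au: "a \<in> carrier S" "u \<in> carrier TP"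
  from au(2,1) show "evh (u \<leftharpoonup>\<^bsub>TP\<^esub> a) = evh u \<leftharpoonup>\<^bsub>B0\<^esub> a"
    by (induction rule: TP_induct) (simp_all add: beta.S.l_distr)
qed

lemma lact_T_right_hom [simp]: "b \<in> carrier B \<Longrightarrow> (\<lambda>x. b \<rightharpoonup>\<^bsub>T\<^esub> x) \<in> right_hom R T0 T0"
  by (simp add: right_hom_iff add_hom_iff T.lact_ract)

lemma ract_T_left_hom [simp]: "a \<in> carrier A \<Longrightarrow> (\<lambda>x. x \<leftharpoonup>\<^bsub>T\<^esub> a) \<in> left_hom S T0 T0"
  by (simp add: left_hom_iff add_hom_iff T.lact_ract)

lemma ract_T_right_hom [simp]: "x \<in> carrier T \<Longrightarrow> (\<lambda>a. x \<leftharpoonup>\<^bsub>T\<^esub> a) \<in> right_hom R A0 T0"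
  by (simp add: right_hom_iff add_hom_iff T.ract_add T.ract_mult)

lemma lact_T_left_hom [simp]: "x \<in> carrier T \<Longrightarrow> (\<lambda>b. b \<rightharpoonup>\<^bsub>T\<^esub> x) \<in> left_hom S B0 T0"
  by (simp add: left_hom_iff add_hom_iff T.add_lact T.mult_lact)

end

text \<open>Higher-order unification produces eta-expanded identities in induction proofs.\<close>

lemma ident_eq_id [simp]: "(\<lambda>x. x) = id"
  by (simp add: id_def)

lemma left_hom_comp: "\<lbrakk>f \<in> left_hom R M N; g \<in> left_hom R N K\<rbrakk> \<Longrightarrow> (\<lambda>x. g (f x)) \<in> left_hom R M K"
  by (simp add: left_hom_iff add_hom_iff)

lemma right_hom_comp: "\<lbrakk>f \<in> right_hom R M N; g \<in> right_hom R N K\<rbrakk> \<Longrightarrow> (\<lambda>x. g (f x)) \<in> right_hom R M K"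
  by (simp add: right_hom_iff add_hom_iff)

text \<open>C and D are equalizers of maps that are linear on both sides; this and its mirror image
  give them their module structures.\<close>

lemma left_equalizer_module:
  assumes M: "left_module R M" and N: "left_module R N" and f: "f \<in> left_hom R M N" and g: "g \<in> left_hom R M N"
  shows "left_module R (sub_bimod M {x \<in> carrier M. f x = g x})"
proof (rule left_sub_bimodI[OF M])
  interpret M: left_module R M by fact
  interpret N: left_module R N by fact
  show "\<zero>\<^bsub>M\<^esub> \<in> {x \<in> carrier M. f x = g x}"
    using add_hom_zero[OF M.M.abelian_group_axioms N.M.abelian_group_axioms left_hom_add_hom[OF f]]
      add_hom_zero[OF M.M.abelian_group_axioms N.M.abelian_group_axioms left_hom_add_hom[OF g]] by simp
qed (use M f g in \<open>auto simp: left_hom_iff add_hom_iff dest: left_module_abelian_group intro: abelian_monoid.a_closed abelian_group.axioms(1)\<close>)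

lemma right_equalizer_module:
  assumes M: "right_module R M" and N: "right_module R N" and f: "f \<in> right_hom R M N" and g: "g \<in> right_hom R M N"
  shows "right_module R (sub_bimod M {x \<in> carrier M. f x = g x})"
proof (rule right_sub_bimodI[OF M])
  interpret M: right_module R M by fact
  interpret N: right_module R N by fact
  show "\<zero>\<^bsub>M\<^esub> \<in> {x \<in> carrier M. f x = g x}"
    using add_hom_zero[OF M.M.abelian_group_axioms N.M.abelian_group_axioms right_hom_add_hom[OF f]]
      add_hom_zero[OF M.M.abelian_group_axioms N.M.abelian_group_axioms right_hom_add_hom[OF g]] by simp
qed (use M f g in \<open>auto simp: right_hom_iff add_hom_iff dest: right_module_abelian_group intro: abelian_monoid.a_closed abelian_group.axioms(1)\<close>)

lemma sub_bimod_bimodule: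
  assumes "bimodule L R M" "left_module L (sub_bimod M X)" "right_module R (sub_bimod M X)" "X \<subseteq> carrier M"
  shows "bimodule L R (sub_bimod M X)"
  using assms by (auto simp: bimodule_def bimodule_axioms_def subsetD)

lemma left_image_module:
  assumes M: "left_module R M" and N: "left_module R N" and f: "f \<in> left_hom R M N"
  shows "left_module R (sub_bimod N (f ` carrier M))"
proof (rule left_sub_bimodI[OF N])
  interpret M: left_module R M by fact
  interpret N: left_module R N by fact
  show "f ` carrier M \<subseteq> carrier N"
    using f by (auto simp: left_hom_iff add_hom_iff)
  show "\<zero>\<^bsub>N\<^esub> \<in> f ` carrier M"
    using add_hom_zero[OF M.M.abelian_group_axioms N.M.abelian_group_axioms left_hom_add_hom[OF f]]
    by (metis M.M.zero_closed image_eqI)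
  show "x \<oplus>\<^bsub>N\<^esub> y \<in> f ` carrier M" if xy: "x \<in> f ` carrier M" "y \<in> f ` carrier M" for x y
  proof -
    obtain u v where "u \<in> carrier M" "x = f u" "v \<in> carrier M" "y = f v" using xy by blast
    then show ?thesis using f by (intro image_eqI[of _ _ "u \<oplus>\<^bsub>M\<^esub> v"]) (auto simp: left_hom_iff add_hom_iff)
  qed
  show "a \<rightharpoonup>\<^bsub>N\<^esub> x \<in> f ` carrier M" if ax: "a \<in> carrier R" "x \<in> f ` carrier M" for a x
  proof -
    obtain u where "u \<in> carrier M" "x = f u" using ax by blast
    then show ?thesis using f ax(1) by (intro image_eqI[of _ _ "a \<rightharpoonup>\<^bsub>M\<^esub> u"]) (auto simp: left_hom_iff M.lact_closed)
  qed
qed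

lemma right_image_module:
  assumes M: "right_module R M" and N: "right_module R N" and f: "f \<in> right_hom R M N"
  shows "right_module R (sub_bimod N (f ` carrier M))"
proof (rule right_sub_bimodI[OF N])
  interpret M: right_module R M by fact
  interpret N: right_module R N by fact
  show "f ` carrier M \<subseteq> carrier N"
    using f by (auto simp: right_hom_iff add_hom_iff)
  show "\<zero>\<^bsub>N\<^esub> \<in> f ` carrier M"
    using add_hom_zero[OF M.M.abelian_group_axioms N.M.abelian_group_axioms right_hom_add_hom[OF f]]
    by (metis M.M.zero_closed image_eqI)
  show "x \<oplus>\<^bsub>N\<^esub> y \<in> f ` carrier M" if xy: "x \<in> f ` carrier M" "y \<in> f ` carrier M" for x y
  proof -
    obtain u v where "u \<in> carrier M" "x = f u" "v \<in> carrier M" "y = f v" using xy by blast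
    then show ?thesis using f by (intro image_eqI[of _ _ "u \<oplus>\<^bsub>M\<^esub> v"]) (auto simp: right_hom_iff add_hom_iff)
  qed
  show "x \<leftharpoonup>\<^bsub>N\<^esub> a \<in> f ` carrier M" if ax: "a \<in> carrier R" "x \<in> f ` carrier M" for a x
  proof -
    obtain u where "u \<in> carrier M" "x = f u" using ax by blast
    then show ?thesis using f ax(1) by (intro image_eqI[of _ _ "u \<leftharpoonup>\<^bsub>M\<^esub> a"]) (auto simp: right_hom_iff M.ract_closed)
  qed
qed

lemma corestrict_left_hom: "f \<in> left_hom R M N \<Longrightarrow> f \<in> left_hom R M (sub_bimod N (f ` carrier M))"
  by (simp add: left_hom_iff add_hom_iff)

lemma corestrict_right_hom: "f \<in> right_hom R M N \<Longrightarrow> f \<in> right_hom R M (sub_bimod N (f ` carrier M))"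
  by (simp add: right_hom_iff add_hom_iff)

section \<open>The corings C and D, and the retraction onto T \<otimes> C\<close>

context herd
begin

lemma gamma_left_hom [simp]: "\<gamma> \<in> left_hom S T0 TPT" and gamma_right_hom [simp]: "\<gamma> \<in> right_hom R T0 TPT"
  using shepherd_hom by (auto simp: bimod_hom_def)

lemma gamma_closed [simp]: "x \<in> carrier T \<Longrightarrow> \<gamma> x \<in> carrier TPT"
  using add_hom_closed[OF left_hom_add_hom[OF gamma_left_hom], of x] by simp

text \<open>The coproduct of C, but on all of \<open>PT\<close>, since the membership condition of C
  has to be stated there. \<open>DeltaD\<close> is the same for D, rebracketed to the right.\<close>

abbreviation "Delta \<equiv> tensor_map S P0 T0 P0 TPT id \<gamma>"
abbreviation "DeltaD d \<equiv> tensor_map R T0 (PT \<boxtimes>\<^bsub>R\<^esub> P0) T0 PTP id (assoc S R P0 T0 P0)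
       (assoc R R T0 PT P0 (tensor_map R T0 P0 TPT P0 \<gamma> id d))"
text \<open>Among four tensor factors, \<open>evC\<close> evaluates the first two and
  \<open>evD\<close> the last two; membership in C or D says that this evaluation of the coproduct
  inserts a unit.\<close>

abbreviation "evC v \<equiv> tensor_map R PT PT A0 PT ev id (assoc_inv S R P0 T0 PT v)"
abbreviation "evD v \<equiv> tensor_map S TP TP TP B0 id evh (assoc_inv R S T0 P0 TP v)"
text \<open>\<open>Gam\<close> applies \<open>\<gamma>\<close> to the last factor of T \<otimes> P
  \<otimes> T and \<open>Lam\<close> to the first one. They are the two sides of the coassociativity
  law, so they agree on \<open>\<gamma> x\<close>.\<close>

abbreviation "Gam \<equiv> tensor_map R T0 PT T0 (P0 \<boxtimes>\<^bsub>S\<^esub> TPT) id Delta"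
abbreviation "Lam t \<equiv> tensor_map R T0 (PT \<boxtimes>\<^bsub>R\<^esub> PT) T0 (P0 \<boxtimes>\<^bsub>S\<^esub> TPT) id (assoc S R P0 T0 PT)
        (assoc R R T0 PT PT (tensor_map R T0 PT TPT PT \<gamma> id t))"

lemma evC_left_hom: "(\<lambda>v. evC v) \<in> left_hom R (P0 \<boxtimes>\<^bsub>S\<^esub> TPT) (A0 \<boxtimes>\<^bsub>R\<^esub> PT)"
  by (rule left_hom_comp[where N = "PT \<boxtimes>\<^bsub>R\<^esub> PT"]) simp_all

lemma evC_right_hom: "(\<lambda>v. evC v) \<in> right_hom R (P0 \<boxtimes>\<^bsub>S\<^esub> TPT) (A0 \<boxtimes>\<^bsub>R\<^esub> PT)"
  by (rule right_hom_comp[where N = "PT \<boxtimes>\<^bsub>R\<^esub> PT"]) simp_all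

lemma evC_Delta_left_hom: "(\<lambda>c. evC (Delta c)) \<in> left_hom R PT (A0 \<boxtimes>\<^bsub>R\<^esub> PT)"
  by (rule left_hom_comp[OF _ evC_left_hom]) simp

lemma evC_Delta_right_hom: "(\<lambda>c. evC (Delta c)) \<in> right_hom R PT (A0 \<boxtimes>\<^bsub>R\<^esub> PT)"
  by (rule right_hom_comp[OF _ evC_right_hom]) simp

lemma one_tens_left_hom: "(\<lambda>c. tens R A0 PT \<one>\<^bsub>A\<^esub> c) \<in> left_hom R PT (A0 \<boxtimes>\<^bsub>R\<^esub> PT)"
  unfolding left_hom_iff
proof (intro conjI ballI)
  fix a c assume "a \<in> carrier R" "c \<in> carrier PT"
  then show "tens R A0 PT \<one>\<^bsub>A\<^esub> (a \<rightharpoonup>\<^bsub>PT\<^esub> c) = a \<rightharpoonup>\<^bsub>A0 \<boxtimes>\<^bsub>R\<^esub> PT\<^esub> tens R A0 PT \<one>\<^bsub>A\<^esub> c"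
    \<comment> \<open>The scalar crosses the tensor sign:
      \<open>1 \<otimes> a c = \<alpha> a \<otimes> c\<close>, which is the left action on
      A.\<close>
    using tens_ract[of R A0 PT "\<one>\<^bsub>A\<^esub>" c a] by simp
qed (simp add: add_hom_iff tens_add_right)

lemma one_tens_right_hom: "(\<lambda>c. tens R A0 PT \<one>\<^bsub>A\<^esub> c) \<in> right_hom R PT (A0 \<boxtimes>\<^bsub>R\<^esub> PT)"
  by (simp add: right_hom_iff add_hom_iff tens_add_right)

lemma carrier_C: "carrier C = {c \<in> carrier PT. evC (Delta c) = tens R A0 PT \<one>\<^bsub>A\<^esub> c}"
  by (simp add: C_def)

lemma C_sub: "sub_bimod PT (carrier C) = C"
  by (simp add: C_def)

lemma C_subset: "carrier C \<subseteq> carrier PT"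
  by (auto simp: carrier_C)

lemma C_bimodule [simp]: "bimodule R R C" "left_module R C" "right_module R C"
proof -
  have l: "left_module R C"
    using left_equalizer_module[OF _ _ evC_Delta_left_hom one_tens_left_hom] by (simp add: C_def)
  have r: "right_module R C"
    using right_equalizer_module[OF _ _ evC_Delta_right_hom one_tens_right_hom] by (simp add: C_def)
  show "left_module R C" "right_module R C" by (fact l r)+
  show "bimodule R R C"
    using sub_bimod_bimodule[of R R PT "carrier C"] l r C_subset unfolding C_sub by simp
qed

lemma DeltaD_left_hom: "(\<lambda>d. DeltaD d) \<in> left_hom S TP (T0 \<boxtimes>\<^bsub>R\<^esub> PTP)"
  by (rule left_hom_comp[where N = "T0 \<boxtimes>\<^bsub>R\<^esub> (PT \<boxtimes>\<^bsub>R\<^esub> P0)"])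
    (simp_all add: left_hom_comp[where N = "TPT \<boxtimes>\<^bsub>R\<^esub> P0"])

lemma DeltaD_right_hom: "(\<lambda>d. DeltaD d) \<in> right_hom S TP (T0 \<boxtimes>\<^bsub>R\<^esub> PTP)"
  by (rule right_hom_comp[where N = "T0 \<boxtimes>\<^bsub>R\<^esub> (PT \<boxtimes>\<^bsub>R\<^esub> P0)"])
    (simp_all add: right_hom_comp[where N = "TPT \<boxtimes>\<^bsub>R\<^esub> P0"])

lemma evD_left_hom: "(\<lambda>v. evD v) \<in> left_hom S (T0 \<boxtimes>\<^bsub>R\<^esub> PTP) (TP \<boxtimes>\<^bsub>S\<^esub> B0)"
  by (rule left_hom_comp[where N = "TP \<boxtimes>\<^bsub>S\<^esub> TP"]) simp_all

lemma evD_right_hom: "(\<lambda>v. evD v) \<in> right_hom S (T0 \<boxtimes>\<^bsub>R\<^esub> PTP) (TP \<boxtimes>\<^bsub>S\<^esub> B0)"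
  by (rule right_hom_comp[where N = "TP \<boxtimes>\<^bsub>S\<^esub> TP"]) simp_all

lemma tens_one_right_hom: "(\<lambda>d. tens S TP B0 d \<one>\<^bsub>B\<^esub>) \<in> right_hom S TP (TP \<boxtimes>\<^bsub>S\<^esub> B0)"
  unfolding right_hom_iff
proof (intro conjI ballI)
  fix a d assume "a \<in> carrier S" "d \<in> carrier TP"
  then show "tens S TP B0 (d \<leftharpoonup>\<^bsub>TP\<^esub> a) \<one>\<^bsub>B\<^esub> = tens S TP B0 d \<one>\<^bsub>B\<^esub> \<leftharpoonup>\<^bsub>TP \<boxtimes>\<^bsub>S\<^esub> B0\<^esub> a"
    using tens_ract[of S TP B0 d "\<one>\<^bsub>B\<^esub>" a] by simp
qed (simp add: add_hom_iff tens_add_left)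

lemma tens_one_left_hom: "(\<lambda>d. tens S TP B0 d \<one>\<^bsub>B\<^esub>) \<in> left_hom S TP (TP \<boxtimes>\<^bsub>S\<^esub> B0)"
  by (simp add: left_hom_iff add_hom_iff tens_add_left)

lemma carrier_D: "carrier D = {d \<in> carrier TP. evD (DeltaD d) = tens S TP B0 d \<one>\<^bsub>B\<^esub>}"
  by (simp add: D_def)

lemma D_sub: "sub_bimod TP (carrier D) = D"
  by (simp add: D_def)

lemma D_subset: "carrier D \<subseteq> carrier TP"
  by (auto simp: carrier_D)

lemma D_bimodule [simp]: "bimodule S S D" "left_module S D" "right_module S D"
proof -
  have l: "left_module S D"
    using left_equalizer_module[OF _ _ left_hom_comp[OF DeltaD_left_hom evD_left_hom] tens_one_left_hom]
    by (simp add: D_def)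
  have r: "right_module S D"
    using right_equalizer_module[OF _ _ right_hom_comp[OF DeltaD_right_hom evD_right_hom] tens_one_right_hom]
    by (simp add: D_def)
  show "left_module S D" "right_module S D" by (fact l r)+
  show "bimodule S S D"
    using sub_bimod_bimodule[of S S TP "carrier D"] l r D_subset unfolding D_sub by simp
qed

lemmas TPT_induct = tensor_induct[OF T0_bimodule(3) tensor_left_module[OF P0_bimodule(1) T0_bimodule(2)],
    consumes 1, case_names tens add]

lemma Gam_gamma: "x \<in> carrier T \<Longrightarrow> Gam (\<gamma> x) = Lam (\<gamma> x)"
  using shepherd_coassoc by simp

text \<open>In \<open>Lam (x \<otimes> v)\<close> the evaluated pair sits inside
  \<open>\<gamma> x\<close>, so the counit law for \<open>ev\<close> turns it into
  \<open>x \<otimes> 1 \<otimes> v\<close>.\<close>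

lemma evC_Lam_gamma:
  assumes "t \<in> carrier TPT"
  shows "tensor_map R T0 (P0 \<boxtimes>\<^bsub>S\<^esub> TPT) T0 (A0 \<boxtimes>\<^bsub>R\<^esub> PT) id (\<lambda>v. evC v) (Lam t) =
    tensor_map R T0 PT T0 (A0 \<boxtimes>\<^bsub>R\<^esub> PT) id (\<lambda>c. tens R A0 PT \<one>\<^bsub>A\<^esub> c) t"
proof -
  note [simp] = evC_left_hom one_tens_left_hom
  \<comment> \<open>\<open>\<gamma> x\<close> is only known to be some element of
    \<open>TPT\<close>. Replacing it by an arbitrary \<open>s\<close> permits induction; the counit
    law enters afterwards at \<open>s = \<gamma> x\<close>.\<close>
  have aux: "tensor_map R T0 (P0 \<boxtimes>\<^bsub>S\<^esub> TPT) T0 (A0 \<boxtimes>\<^bsub>R\<^esub> PT) id (\<lambda>v. evC v)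
       (tensor_map R T0 (PT \<boxtimes>\<^bsub>R\<^esub> PT) T0 (P0 \<boxtimes>\<^bsub>S\<^esub> TPT) id (assoc S R P0 T0 PT) (assoc R R T0 PT PT (tens R TPT PT s v))) =
     assoc R R T0 A0 PT (tens R (T0 \<boxtimes>\<^bsub>R\<^esub> A0) PT (tensor_map R T0 PT T0 A0 id ev s) v)"
    if "s \<in> carrier TPT" "v \<in> carrier PT" for s v
    using that
    by (induction rule: TPT_induct) (simp_all add: tens_add_left)
  from assms show ?thesis
    by (induction rule: TPT_induct) (simp_all add: aux ev_shepherd)
qed


lemma C_incl_left_hom [simp]: "id \<in> left_hom R C PT"
  and C_incl_right_hom [simp]: "id \<in> right_hom R C PT"
  using sub_bimod_left_hom(3)[OF C_subset, of R] sub_bimod_right_hom(3)[OF C_subset, of R] by (simp_all add: C_sub)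

lemma D_incl_left_hom [simp]: "id \<in> left_hom S D TP"
  and D_incl_right_hom [simp]: "id \<in> right_hom S D TP"
  using sub_bimod_left_hom(3)[OF D_subset, of S] sub_bimod_right_hom(3)[OF D_subset, of S] by (simp_all add: D_sub)

lemma in_C_PT [simp]: "c \<in> carrier C \<Longrightarrow> c \<in> carrier PT"
  using C_subset by auto

lemma in_D_TP [simp]: "d \<in> carrier D \<Longrightarrow> d \<in> carrier TP"
  using D_subset by auto

lemmas TC_induct = tensor_induct[OF T0_bimodule(3) C_bimodule(2), consumes 1, case_names tens add]

lemma tens_T0_add: "\<lbrakk>left_module R N; x \<in> carrier T; x' \<in> carrier T; y \<in> carrier N\<rbrakk> \<Longrightarrow>
    tens R T0 N (x \<oplus>\<^bsub>T\<^esub> x') y = tens R T0 N x y \<oplus>\<^bsub>T0 \<boxtimes>\<^bsub>R\<^esub> N\<^esub> tens R T0 N x' y"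
  using tens_add_left[of R T0 N x x' y] by simp

lemma tens_add_T0: "\<lbrakk>right_module S N; x \<in> carrier T; x' \<in> carrier T; y \<in> carrier N\<rbrakk> \<Longrightarrow>
    tens S N T0 y (x \<oplus>\<^bsub>T\<^esub> x') = tens S N T0 y x \<oplus>\<^bsub>N \<boxtimes>\<^bsub>S\<^esub> T0\<^esub> tens S N T0 y x'"
  using tens_add_right[of S N T0 y x x'] by simp

text \<open>Evaluated at \<open>Delta c\<close>, this is the splitting map of T \<otimes> PT onto T
  \<otimes> C. It is written through A, as \<open>x\<close> acted on by the result of
  \<open>evC\<close>, because the membership condition of C is an equation in A \<otimes>
  PT.\<close>

abbreviation "Xi x v \<equiv> tensor_map R A0 PT T0 PT (\<lambda>a. x \<leftharpoonup>\<^bsub>T\<^esub> a) id (evC v)"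

text \<open>By \<open>x ev (p \<otimes> z) = evh (x \<otimes> p) z\<close> the action from the right
  on \<open>x\<close> becomes an action from the left on the first factor of
  \<open>t\<close>.\<close>

lemma Xi_tens:
  assumes "x \<in> carrier T" "p \<in> carrier That" "t \<in> carrier TPT"
  shows "Xi x (tens S P0 TPT p t) = tensor_map R T0 PT T0 PT (\<lambda>y. F x p \<rightharpoonup>\<^bsub>T\<^esub> y) id t"
  using assms(3)
  by (induction rule: TPT_induct) (simp_all add: assms(1,2) tens_add_right)

text \<open>For \<open>c\<close> in C, \<open>evC (Delta c)\<close> is \<open>1 \<otimes> c\<close>,
  so letting A act on \<open>x\<close> gives \<open>x \<otimes> c\<close> back: the splitting map
  fixes the elements that come from C.\<close>

lemma tens_C_eq:
  assumes "x \<in> carrier T" "c \<in> carrier C"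
  shows "tens R T0 PT x c = Xi x (Delta c)"
proof -
  have "evC (Delta c) = tens R A0 PT \<one>\<^bsub>A\<^esub> c"
    using assms(2) by (simp only: carrier_C mem_Collect_eq)
  then show ?thesis
    using assms by (simp only:) simp
qed

end

section \<open>Descent along T as a right R-module: the coring C\<close>

context tame_herd
begin

abbreviation "test_UNIV \<equiv> (UNIV :: ('r, 's, 'a, 'b, 't, 'p) test set)"

text \<open>Each basic carrier embeds as singleton lists. Lists also make the type infinite, which
  \<open>tensor_lepoll\<close> requires.\<close>

lemma test_lepoll [simp]:
  "carrier R \<lesssim> test_UNIV" "carrier S \<lesssim> test_UNIV" "carrier A \<lesssim> test_UNIV" "carrier B \<lesssim> test_UNIV"
  "carrier T \<lesssim> test_UNIV" "carrier That \<lesssim> test_UNIV" "infinite test_UNIV"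
proof -
  have *: "X \<lesssim> test_UNIV" if "inj f" for X :: "'x set" and f :: "'x \<Rightarrow> ('r, 's, 'a, 'b, 't, 'p) test"
    using inj_on_subset[OF that subset_UNIV] unfolding lepoll_def by (intro exI[of _ f]) simp
  show "carrier R \<lesssim> test_UNIV" by (rule *[of "\<lambda>x. [Inl x]"]) (simp add: inj_def)
  show "carrier S \<lesssim> test_UNIV" by (rule *[of "\<lambda>x. [Inr (Inl x)]"]) (simp add: inj_def)
  show "carrier A \<lesssim> test_UNIV" by (rule *[of "\<lambda>x. [Inr (Inr (Inl x))]"]) (simp add: inj_def)
  show "carrier B \<lesssim> test_UNIV" by (rule *[of "\<lambda>x. [Inr (Inr (Inr (Inl x)))]"]) (simp add: inj_def)
  show "carrier T \<lesssim> test_UNIV" by (rule *[of "\<lambda>x. [Inr (Inr (Inr (Inr (Inl x))))]"]) (simp add: inj_def)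
  show "carrier That \<lesssim> test_UNIV" by (rule *[of "\<lambda>x. [Inr (Inr (Inr (Inr (Inr x))))]"]) (simp add: inj_def)
  show "infinite test_UNIV" by (rule infinite_UNIV_listI)
qed

lemmas tensor_test_lepoll [simp] = tensor_lepoll[OF test_lepoll(7)]

lemmas T_right_flat = faithfully_flat_right_imp_flat[OF T_right_ff]
lemmas T_left_flat = faithfully_flat_left_imp_flat[OF T_left_ff]

text \<open>By coassociativity and the counit law for \<open>ev\<close>, \<open>\<gamma> x\<close>
  satisfies the equation of C in its last two factors. T is flat over R, so that equalizer is T
  \<otimes> C.\<close>

lemma gamma_in_TC:
  assumes "x \<in> carrier T"
  obtains t where "t \<in> carrier (T0 \<boxtimes>\<^bsub>R\<^esub> C)" "\<gamma> x = tensor_map R T0 C T0 PT id id t"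
proof -
  have "tensor_map R T0 PT T0 (A0 \<boxtimes>\<^bsub>R\<^esub> PT) id (\<lambda>c. evC (Delta c)) (\<gamma> x) =
      tensor_map R T0 (P0 \<boxtimes>\<^bsub>S\<^esub> TPT) T0 (A0 \<boxtimes>\<^bsub>R\<^esub> PT) id (\<lambda>v. evC v) (Gam (\<gamma> x))"
    using assms by (subst tensor_map_comp) (simp_all add: evC_left_hom)
  also have "\<dots> = tensor_map R T0 PT T0 (A0 \<boxtimes>\<^bsub>R\<^esub> PT) id (\<lambda>c. tens R A0 PT \<one>\<^bsub>A\<^esub> c) (\<gamma> x)"
    using assms by (simp only: Gam_gamma evC_Lam_gamma gamma_closed)
  finally have "\<gamma> x \<in> tensor_map R T0 (sub_bimod PT (carrier C)) T0 PT id id ` carrier (T0 \<boxtimes>\<^bsub>R\<^esub> sub_bimod PT (carrier C))"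
    using assms
    by (intro flat_right_equalizer[OF T_right_flat _ _ _ evC_Delta_left_hom one_tens_left_hom])
      (simp_all only: C_sub carrier_C[symmetric], simp_all)
  then show thesis
    using that by (auto simp only: C_sub)
qed

text \<open>If \<open>\<alpha> d = 0\<close>, then
  \<open>x \<otimes> d = x d \<otimes> 1 = 0\<close> in T \<otimes> R for every \<open>x\<close>,
  and faithful flatness forces \<open>d = 0\<close>.\<close>

lemma inj_alpha: "inj_on \<alpha> (carrier R)"
proof (rule inj_onI)
  fix a b assume ab: "a \<in> carrier R" "b \<in> carrier R" "\<alpha> a = \<alpha> b"
  let ?R = "regular R"
  define d where "d = a \<ominus>\<^bsub>R\<^esub> b"
  have d: "d \<in> carrier R" "\<alpha> d = \<zero>\<^bsub>A\<^esub>"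
    using ab by (simp_all add: d_def a_minus_def alpha.S.r_neg)
  have R: "bimodule R R ?R" "left_module R ?R"
    using regular_bimodule[OF R_ring] by (auto dest: bimoduleD)
  have Z: "left_module R (sub_bimod ?R {\<zero>\<^bsub>R\<^esub>})"
    by (rule left_sub_bimodI[OF R(2)]) auto
  have zero_T: "x \<leftharpoonup>\<^bsub>T\<^esub> \<zero>\<^bsub>A\<^esub> = \<zero>\<^bsub>T\<^esub>" if "x \<in> carrier T" for x
    by (rule add_hom_zero[of A0 T0 "\<lambda>a. x \<leftharpoonup>\<^bsub>T\<^esub> a", simplified])
      (use that in \<open>simp_all add: right_module_abelian_group[OF A0_bimodule(3)] right_module_abelian_group[OF T0_bimodule(3)] right_hom_add_hom[OF ract_T_right_hom]\<close>)
  have "d \<in> {\<zero>\<^bsub>R\<^esub>}"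
  proof (rule faithfully_flat_right_mem[OF T_right_ff T0_bimodule(3) R(2) Z])
    fix x assume x: "x \<in> carrier T0"
    have "tens R T0 ?R x d = tens R T0 ?R (x \<leftharpoonup>\<^bsub>T0\<^esub> d) \<one>\<^bsub>R\<^esub>"
      using x d tens_ract[of R T0 ?R x "\<one>\<^bsub>R\<^esub>" d] R by simp
    also have "\<dots> = tens R T0 ?R x \<zero>\<^bsub>R\<^esub>"
      using x d tens_zero_left[of R T0 ?R] tens_zero_right[of R T0 ?R] R by (simp add: zero_T)
    also have "\<dots> = tensor_map R T0 (sub_bimod ?R {\<zero>\<^bsub>R\<^esub>}) T0 ?R id id (tens R T0 (sub_bimod ?R {\<zero>\<^bsub>R\<^esub>}) x \<zero>\<^bsub>R\<^esub>)"
      using x R Z by simp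
    finally show "tens R T0 ?R x d \<in> tensor_map R T0 (sub_bimod ?R {\<zero>\<^bsub>R\<^esub>}) T0 ?R id id ` carrier (T0 \<boxtimes>\<^bsub>R\<^esub> sub_bimod ?R {\<zero>\<^bsub>R\<^esub>})"
      by (rule image_eqI) (use x in simp)
  qed (use d in auto)
  then show "a = b"
    using ab(1,2) alpha.R.eq_of_diff_zero[of a b] by (simp add: d_def)
qed

text \<open>In T \<otimes> A one has \<open>x \<otimes> ev c = x ev c \<otimes> 1\<close>, an
  element of T \<otimes> \<alpha>(R) for every \<open>x\<close>; membership descends.\<close>

lemma ev_C:
  assumes c: "c \<in> carrier C"
  shows "ev c \<in> \<alpha> ` carrier R"
proof -
  let ?Y = "\<alpha> ` carrier R"
  have sub: "?Y \<subseteq> carrier A0" by auto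
  note incl = sub_bimod_left_hom(3)[OF sub, of R]
  have one: "\<one>\<^bsub>A\<^esub> \<in> ?Y" by (metis alpha.R.one_closed alpha.hom_one image_eqI)
  have Y: "left_module R (sub_bimod A0 ?Y)"
  proof (rule left_sub_bimodI[OF A0_bimodule(2)])
    show "\<zero>\<^bsub>A0\<^esub> \<in> ?Y" by (metis alpha.R.zero_closed alpha.hom_zero image_eqI restr_simps(3) regular_simps(3))
    show "x \<oplus>\<^bsub>A0\<^esub> y \<in> ?Y" if "x \<in> ?Y" "y \<in> ?Y" for x y
      using that by (auto simp flip: alpha.hom_add)
    show "a \<rightharpoonup>\<^bsub>A0\<^esub> x \<in> ?Y" if "a \<in> carrier R" "x \<in> ?Y" for a x
      using that by (auto simp flip: alpha.hom_mult)
  qed auto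
  show ?thesis
  proof (rule faithfully_flat_right_mem[OF T_right_ff T0_bimodule(3) A0_bimodule(2) Y])
    fix x assume "x \<in> carrier T0"
    then have x: "x \<in> carrier T" by simp
    \<comment> \<open>Multiplying the first factor commutes with evaluating the last two. The counit
      law therefore leaves \<open>evh (x \<otimes> p) y \<otimes> 1\<close>, which is
      \<open>x ev (p \<otimes> y) \<otimes> 1\<close>.\<close>
    have eq: "tensor_map R T0 PT T0 A0 id ev (Xi x (Delta u)) = tens R T0 A0 (x \<leftharpoonup>\<^bsub>T\<^esub> ev u) \<one>\<^bsub>A\<^esub>"
      if "u \<in> carrier PT" for u
      using that
    proof (induction rule: PT_induct)
      case (tens p y)
      have "tensor_map R T0 PT T0 A0 id ev (tensor_map R T0 PT T0 PT (\<lambda>y. F x p \<rightharpoonup>\<^bsub>T\<^esub> y) id (\<gamma> y)) =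
          tensor_map R T0 A0 T0 A0 (\<lambda>y. F x p \<rightharpoonup>\<^bsub>T\<^esub> y) id (tensor_map R T0 PT T0 A0 id ev (\<gamma> y))"
        using tens x by (simp add: tensor_map_comp)
      then show ?case
        using tens x by (simp add: Xi_tens ev_shepherd)
    next
      case (add u v)
      then show ?case using x by (simp add: evC_left_hom T.ract_add tens_T0_add)
    qed
    have "tens R T0 A0 x (ev c) = tensor_map R T0 PT T0 A0 id ev (tens R T0 PT x c)"
      using x c by simp
    also have "\<dots> = tens R T0 A0 (x \<leftharpoonup>\<^bsub>T\<^esub> ev c) \<one>\<^bsub>A\<^esub>"
      using x c by (simp only: tens_C_eq eq in_C_PT)
    also have "\<dots> = tensor_map R T0 (sub_bimod A0 ?Y) T0 A0 id id (tens R T0 (sub_bimod A0 ?Y) (x \<leftharpoonup>\<^bsub>T\<^esub> ev c) \<one>\<^bsub>A\<^esub>)"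
      using x c Y one by (simp add: incl)
    finally show "tens R T0 A0 x (ev c) \<in> tensor_map R T0 (sub_bimod A0 ?Y) T0 A0 id id ` carrier (T0 \<boxtimes>\<^bsub>R\<^esub> sub_bimod A0 ?Y)"
      by (rule image_eqI) (use x c one in simp)
  qed (use c sub in auto)
qed

text \<open>By the counit law \<open>x \<otimes> 1\<close> is the evaluation of
  \<open>\<gamma> x\<close>, which lies in T \<otimes> C. So \<open>x \<otimes> 1\<close> lies in T
  \<otimes> ev(C) for every \<open>x\<close>, and membership of 1 descends.\<close>

lemma one_in_ev_C:
  obtains c where "c \<in> carrier C" "ev c = \<one>\<^bsub>A\<^esub>"
proof -
  let ?Y = "sub_bimod A0 (ev ` carrier C)"
  have "id \<in> left_hom R C PT" by simp
  then have ev': "ev \<in> left_hom R C A0"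
    using left_hom_comp[of id R C PT ev A0] by simp
  then have ev: "ev \<in> left_hom R C ?Y"
    by (rule corestrict_left_hom)
  have Y [simp]: "left_module R ?Y"
    by (rule left_image_module[OF C_bimodule(2) A0_bimodule(2) ev'])
  have sub [simp]: "ev ` carrier C \<subseteq> carrier A"
    by auto
  have "\<one>\<^bsub>A\<^esub> \<in> ev ` carrier C"
  proof (rule faithfully_flat_right_mem[OF T_right_ff T0_bimodule(3) A0_bimodule(2) Y])
    fix x assume "x \<in> carrier T0"
    then have x: "x \<in> carrier T" by simp
    then obtain t where t: "t \<in> carrier (T0 \<boxtimes>\<^bsub>R\<^esub> C)" "\<gamma> x = tensor_map R T0 C T0 PT id id t"
      by (rule gamma_in_TC)
    have "tens R T0 A0 x \<one>\<^bsub>A\<^esub> = tensor_map R T0 PT T0 A0 id ev (tensor_map R T0 C T0 PT id id t)"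
      using ev_shepherd[OF x] by (simp only: t)
    also have "\<dots> = tensor_map R T0 ?Y T0 A0 id id (tensor_map R T0 C T0 ?Y id ev t)"
      using t(1) ev by (simp add: tensor_map_comp)
    finally show "tens R T0 A0 x \<one>\<^bsub>A\<^esub> \<in> tensor_map R T0 ?Y T0 A0 id id ` carrier (T0 \<boxtimes>\<^bsub>R\<^esub> ?Y)"
      by (rule image_eqI) (use t(1) ev in simp)
  qed simp_all
  then show thesis
    using that by (auto simp only: image_iff)
qed

text \<open>After tensoring with \<open>x\<close>, the coproduct is \<open>Gam\<close> of
  \<open>x \<otimes> c\<close>, and the splitting expresses this through terms
  \<open>evh (x \<otimes> p) \<gamma> y\<close>. There \<open>Gam\<close> may be replaced by
  \<open>Lam\<close>, whose leading factors come from a value of \<open>\<gamma>\<close> and hence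
  from T \<otimes> C.\<close>

lemma Delta_in_CPT:
  assumes c: "c \<in> carrier C"
  obtains u where "u \<in> carrier (C \<boxtimes>\<^bsub>R\<^esub> PT)"
    "Delta c = assoc S R P0 T0 PT (tensor_map R C PT PT PT id id u)"
proof -
  let ?g = "\<lambda>u. assoc S R P0 T0 PT (tensor_map R C PT PT PT id id u)"
  let ?Z = "P0 \<boxtimes>\<^bsub>S\<^esub> TPT"
  let ?Y = "sub_bimod ?Z (?g ` carrier (C \<boxtimes>\<^bsub>R\<^esub> PT))"
  let ?I = "tensor_map R T0 ?Y T0 ?Z id id ` carrier (T0 \<boxtimes>\<^bsub>R\<^esub> ?Y)"
  have g: "?g \<in> left_hom R (C \<boxtimes>\<^bsub>R\<^esub> PT) ?Z"
    by (rule left_hom_comp[where N = "PT \<boxtimes>\<^bsub>R\<^esub> PT"]) simp_all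
  have Y [simp]: "left_module R ?Y"
    by (rule left_image_module[OF _ _ g]) simp_all
  have gY: "?g u \<in> carrier ?Y" if "u \<in> carrier (C \<boxtimes>\<^bsub>R\<^esub> PT)" for u
    using that by simp
  have sub: "?g ` carrier (C \<boxtimes>\<^bsub>R\<^esub> PT) \<subseteq> carrier ?Z"
    by auto
  note incl = sub_bimod_left_hom(3)[OF sub, of R]
  have I_add: "u \<oplus>\<^bsub>T0 \<boxtimes>\<^bsub>R\<^esub> ?Z\<^esub> v \<in> ?I" if "u \<in> ?I" "v \<in> ?I" for u v
    by (rule tensor_map_image_add[OF _ _ _ _ _ _ that]) (simp_all add: incl)
  have tens_I: "tens R T0 ?Z z (?g u) \<in> ?I" if "z \<in> carrier T" "u \<in> carrier (C \<boxtimes>\<^bsub>R\<^esub> PT)" for z u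
    by (rule image_eqI[where x = "tens R T0 ?Y z (?g u)"]) (use that in \<open>simp_all add: incl\<close>)
  \<comment> \<open>\<open>\<gamma> z\<close> is written as the image of some \<open>t\<close> in T
    \<otimes> C, and induction on \<open>t\<close> reaches elementary tensors whose second entry is
    in C.\<close>
  have Lam1: "tensor_map R T0 (PT \<boxtimes>\<^bsub>R\<^esub> PT) T0 ?Z id (assoc S R P0 T0 PT)
      (assoc R R T0 PT PT (tens R TPT PT (tensor_map R T0 C T0 PT id id t) v)) \<in> ?I" (is "?L t \<in> _")
    if "t \<in> carrier (T0 \<boxtimes>\<^bsub>R\<^esub> C)" "v \<in> carrier PT" for t v
    using that
  proof (induction rule: TC_induct)
    case (tens z c')
    then have "?L (tens R T0 C z c') = tens R T0 ?Z z (?g (tens R C PT c' v))"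
      by simp
    then show ?case
      using tens_I[of z "tens R C PT c' v"] tens by (simp only: restr_simps tens_closed)
  next
    case (add s t)
    then have "?L (s \<oplus>\<^bsub>T0 \<boxtimes>\<^bsub>R\<^esub> C\<^esub> t) = ?L s \<oplus>\<^bsub>T0 \<boxtimes>\<^bsub>R\<^esub> ?Z\<^esub> ?L t"
      by (simp add: tens_add_left)
    then show ?case
      using I_add[OF add(3,4)] add(5) by (simp only:)
  qed
  have Lam_I: "Lam t \<in> ?I" if "t \<in> carrier TPT" for t
    using that
  proof (induction rule: TPT_induct)
    case (tens z v)
    then have z: "z \<in> carrier T" by simp
    obtain t where t: "t \<in> carrier (T0 \<boxtimes>\<^bsub>R\<^esub> C)" "\<gamma> z = tensor_map R T0 C T0 PT id id t"
      by (rule gamma_in_TC[OF z])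
    have "tensor_map R T0 PT TPT PT \<gamma> id (tens R T0 PT z v) = tens R TPT PT (tensor_map R T0 C T0 PT id id t) v"
      using tens z t by simp
    then show ?case
      using Lam1[OF t(1) tens(2)] by (simp only: id_def)
  next
    case (add s t)
    then have "Lam (s \<oplus>\<^bsub>TPT\<^esub> t) = Lam s \<oplus>\<^bsub>T0 \<boxtimes>\<^bsub>R\<^esub> ?Z\<^esub> Lam t"
      by simp
    then show ?case
      using I_add[OF add(3,4)] by (simp only: id_def)
  qed
  \<comment> \<open>Multiplication by \<open>evh (x \<otimes> p)\<close> touches only the leading
    factor T. It commutes with \<open>Gam\<close> and preserves the image \<open>?I\<close>, so the
    claim reduces to \<open>Lam (\<gamma> y)\<close>.\<close>
  have Gam_I: "Gam (Xi x (Delta u)) \<in> ?I" if x: "x \<in> carrier T" and u: "u \<in> carrier PT" for x u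
    using u
  proof (induction rule: PT_induct)
    case (tens p y)
    then have py: "p \<in> carrier That" "y \<in> carrier T" by simp_all
    let ?b = "\<lambda>y. F x p \<rightharpoonup>\<^bsub>T\<^esub> y"
    have b [simp]: "?b \<in> right_hom R T0 T0" using x py by simp
    have "Gam (Xi x (Delta (tens S P0 T0 p y))) = Gam (tensor_map R T0 PT T0 PT ?b id (\<gamma> y))"
      using x py by (simp add: Xi_tens)
    also have "\<dots> = tensor_map R T0 ?Z T0 ?Z ?b id (Lam (\<gamma> y))"
      using py unfolding Gam_gamma[OF py(2), symmetric] by (simp add: tensor_map_comp)
    finally have eq: "Gam (Xi x (Delta (tens S P0 T0 p y))) = tensor_map R T0 ?Z T0 ?Z ?b id (Lam (\<gamma> y))" .
    obtain w where w: "w \<in> carrier (T0 \<boxtimes>\<^bsub>R\<^esub> ?Y)" "Lam (\<gamma> y) = tensor_map R T0 ?Y T0 ?Z id id w"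
      using Lam_I[OF gamma_closed[OF py(2)]] by blast
    have "tensor_map R T0 ?Z T0 ?Z ?b id (tensor_map R T0 ?Y T0 ?Z id id w) =
        tensor_map R T0 ?Y T0 ?Z id id (tensor_map R T0 ?Y T0 ?Y ?b id w)"
      using w(1) by (simp add: tensor_map_comp incl)
    moreover have "tensor_map R T0 ?Y T0 ?Y ?b id w \<in> carrier (T0 \<boxtimes>\<^bsub>R\<^esub> ?Y)"
      using w(1) by simp
    ultimately have "tensor_map R T0 ?Z T0 ?Z ?b id (tensor_map R T0 ?Y T0 ?Z id id w) \<in> ?I"
      by (rule image_eqI)
    then show ?case
      unfolding eq w(2)[symmetric] id_def[symmetric] .
  next
    case (add u v)
    then have "Gam (Xi x (Delta (u \<oplus>\<^bsub>PT\<^esub> v))) = Gam (Xi x (Delta u)) \<oplus>\<^bsub>T0 \<boxtimes>\<^bsub>R\<^esub> ?Z\<^esub> Gam (Xi x (Delta v))"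
      using x by simp
    then show ?case
      using I_add[OF add(3,4)] by (simp only: id_def)
  qed
  have "Delta c \<in> ?g ` carrier (C \<boxtimes>\<^bsub>R\<^esub> PT)"
  proof (rule faithfully_flat_right_mem[OF T_right_ff T0_bimodule(3) _ Y sub])
    fix x assume "x \<in> carrier T0"
    then have x: "x \<in> carrier T" by simp
    have "tens R T0 ?Z x (Delta c) = Gam (tens R T0 PT x c)"
      using x c by simp
    also have "\<dots> = Gam (Xi x (Delta c))"
      by (simp only: tens_C_eq[OF x c])
    finally show "tens R T0 ?Z x (Delta c) \<in> ?I"
      using Gam_I[OF x in_C_PT[OF c]] by (simp only:)
  qed (use c in simp_all)
  then show thesis
    using that by blast
qed

end

section \<open>Mirror constructions for the coring D\<close>

context herd
begin

lemmas DT_induct = tensor_induct[OF D_bimodule(3) T0_bimodule(2), consumes 1, case_names tens add]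
lemmas TPT_induct3 = tensor_induct_right[OF T0_bimodule(3) P0_bimodule(1) T0_bimodule(2), consumes 1, case_names tens add]

abbreviation "aiT \<equiv> assoc_inv R S T0 P0 T0"

lemma DeltaD_hom_simps [simp]:
  "(\<lambda>d. DeltaD d) \<in> left_hom S TP (T0 \<boxtimes>\<^bsub>R\<^esub> PTP)" "(\<lambda>d. DeltaD d) \<in> right_hom S TP (T0 \<boxtimes>\<^bsub>R\<^esub> PTP)"
  by (rule DeltaD_left_hom DeltaD_right_hom)+

abbreviation "Xih x v \<equiv> tensor_map S TP B0 TP T0 id (\<lambda>b. b \<rightharpoonup>\<^bsub>T\<^esub> x) (evD v)"

text \<open>The mirror of the splitting: \<open>evh (y \<otimes> q) x = y ev (q \<otimes> x)\<close>
  turns the action on \<open>x\<close> into multiplication of the last factor of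
  \<open>\<gamma> z\<close> by \<open>ev (q \<otimes> x)\<close>.\<close>

lemma Xih_DeltaD:
  assumes "x \<in> carrier T" "z \<in> carrier T" "q \<in> carrier That"
  shows "Xih x (DeltaD (tens R T0 P0 z q)) =
    tensor_map S TP T0 TP T0 id (\<lambda>y. y \<leftharpoonup>\<^bsub>T\<^esub> E q x) (aiT (\<gamma> z))"
proof -
  have "Xih x (tensor_map R T0 (PT \<boxtimes>\<^bsub>R\<^esub> P0) T0 PTP id (assoc S R P0 T0 P0) (assoc R R T0 PT P0 (tens R TPT P0 s q))) =
      tensor_map S TP T0 TP T0 id (\<lambda>y. y \<leftharpoonup>\<^bsub>T\<^esub> E q x) (aiT s)" if "s \<in> carrier TPT" for s
    using that by (induction rule: TPT_induct3) (simp_all add: assms tens_add_left)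
  then show ?thesis
    using assms by simp
qed

lemma tens_D_eq:
  assumes "x \<in> carrier T" "d \<in> carrier D"
  shows "tens S TP T0 d x = Xih x (DeltaD d)"
proof -
  have "evD (DeltaD d) = tens S TP B0 d \<one>\<^bsub>B\<^esub>"
    using assms(2) by (simp only: carrier_D mem_Collect_eq)
  then show ?thesis
    using assms by (simp only:) simp
qed

text \<open>On elementary tensors, \<open>Theta\<close> sends \<open>x \<otimes> p \<otimes> y \<otimes> q \<otimes> z\<close> to \<open>x \<otimes> p \<otimes> evh (y \<otimes> q) \<otimes> z\<close> and
  \<open>Rot\<close> only moves the brackets, from the left of \<open>z\<close> to the right of \<open>x\<close>.\<close>

abbreviation "Theta w \<equiv> assoc_inv S S TP B0 T0 (tensor_map S TP (TP \<boxtimes>\<^bsub>S\<^esub> T0) TP (B0 \<boxtimes>\<^bsub>S\<^esub> T0) id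
    (tensor_map S TP T0 B0 T0 evh id) (assoc_inv R S T0 P0 (TP \<boxtimes>\<^bsub>S\<^esub> T0)
      (tensor_map R T0 (P0 \<boxtimes>\<^bsub>S\<^esub> TPT) T0 (P0 \<boxtimes>\<^bsub>S\<^esub> (TP \<boxtimes>\<^bsub>S\<^esub> T0)) id
        (tensor_map S P0 TPT P0 (TP \<boxtimes>\<^bsub>S\<^esub> T0) id aiT) w)))"

abbreviation "jj v \<equiv> assoc_inv S S P0 TP T0 (tensor_map S P0 TPT P0 (TP \<boxtimes>\<^bsub>S\<^esub> T0) id aiT v)"

lemma jj_left_hom [simp]: "(\<lambda>v. jj v) \<in> left_hom R (P0 \<boxtimes>\<^bsub>S\<^esub> TPT) (PTP \<boxtimes>\<^bsub>S\<^esub> T0)"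
  by (rule left_hom_comp[where N = "P0 \<boxtimes>\<^bsub>S\<^esub> (TP \<boxtimes>\<^bsub>S\<^esub> T0)"]) simp_all

abbreviation "Rot w \<equiv> assoc_inv R S T0 PTP T0 (tensor_map R T0 (P0 \<boxtimes>\<^bsub>S\<^esub> TPT) T0 (PTP \<boxtimes>\<^bsub>S\<^esub> T0) id (\<lambda>v. jj v) w)"

text \<open>The last three factors of \<open>Gam t\<close> are a value of \<open>\<gamma>\<close>,
  and evaluating their first two by \<open>evh\<close> gives \<open>1 \<otimes> y\<close> by the
  counit law.\<close>

lemma Theta_Gam:
  assumes "t \<in> carrier TPT"
  shows "Theta (Gam t) = tensor_map S TP T0 (TP \<boxtimes>\<^bsub>S\<^esub> B0) T0 (\<lambda>d. tens S TP B0 d \<one>\<^bsub>B\<^esub>) id (aiT t)"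
  using assms by (induction rule: TPT_induct3) (simp_all add: tens_one_right_hom evh_shepherd)

text \<open>In \<open>Lam (x \<otimes> q \<otimes> y)\<close> the factor \<open>y\<close> is a
  spectator, and \<open>Theta\<close> evaluates the last factor of \<open>\<gamma> x\<close> against
  \<open>q\<close>, exactly as the membership condition of D does.\<close>

lemma Theta_Lam:
  assumes "t \<in> carrier TPT"
  shows "Theta (Lam t) = tensor_map S TP T0 (TP \<boxtimes>\<^bsub>S\<^esub> B0) T0 (\<lambda>d. evD (DeltaD d)) id (aiT t)"
proof -
  have evD_DeltaD: "(\<lambda>d. evD (DeltaD d)) \<in> right_hom S TP (TP \<boxtimes>\<^bsub>S\<^esub> B0)"
    by (rule right_hom_comp[OF DeltaD_right_hom evD_right_hom])
  have aux: "Theta (tensor_map R T0 (PT \<boxtimes>\<^bsub>R\<^esub> PT) T0 (P0 \<boxtimes>\<^bsub>S\<^esub> TPT) id (assoc S R P0 T0 PT)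
        (assoc R R T0 PT PT (tens R TPT PT s (tens S P0 T0 q y)))) =
      tens S (TP \<boxtimes>\<^bsub>S\<^esub> B0) T0 (evD (tensor_map R T0 (PT \<boxtimes>\<^bsub>R\<^esub> P0) T0 PTP id (assoc S R P0 T0 P0)
       (assoc R R T0 PT P0 (tens R TPT P0 s q)))) y"
    if "s \<in> carrier TPT" "q \<in> carrier That" "y \<in> carrier T" for s q y
    using that by (induction rule: TPT_induct3) (simp_all add: tens_add_left)
  from assms show ?thesis
    by (induction rule: TPT_induct3) (simp_all add: aux evD_DeltaD)
qed

text \<open>Both sides apply \<open>\<gamma>\<close> to the first factor and differ in brackets
  only. This makes coassociativity, which is stated with right-nested brackets, available for
  \<open>DeltaD\<close>.\<close>

lemma Rot_Lam:
  assumes "t \<in> carrier TPT"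
  shows "tensor_map S TP T0 (T0 \<boxtimes>\<^bsub>R\<^esub> PTP) T0 (\<lambda>d. DeltaD d) id (aiT t) = Rot (Lam t)"
proof -
  have aux: "Rot (tensor_map R T0 (PT \<boxtimes>\<^bsub>R\<^esub> PT) T0 (P0 \<boxtimes>\<^bsub>S\<^esub> TPT) id (assoc S R P0 T0 PT)
        (assoc R R T0 PT PT (tens R TPT PT s (tens S P0 T0 q y)))) =
      tens S (T0 \<boxtimes>\<^bsub>R\<^esub> PTP) T0 (tensor_map R T0 (PT \<boxtimes>\<^bsub>R\<^esub> P0) T0 PTP id (assoc S R P0 T0 P0)
       (assoc R R T0 PT P0 (tens R TPT P0 s q))) y"
    if "s \<in> carrier TPT" "q \<in> carrier That" "y \<in> carrier T" for s q y
    using that by (induction rule: TPT_induct3) (simp_all add: tens_add_left)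
  from assms show ?thesis
    by (induction rule: TPT_induct3) (simp_all add: aux)
qed

end

section \<open>Descent along T as a left S-module: the coring D\<close>

context tame_herd
begin

text \<open>Since \<open>Gam\<close> and \<open>Lam\<close> agree on \<open>\<gamma> x\<close>,
  applying \<open>Theta\<close> to both yields the equation of D in the first two factors. T is flat
  over S, so that equalizer is D \<otimes> T.\<close>

lemma gamma_in_DT:
  assumes "x \<in> carrier T"
  obtains t where "t \<in> carrier (D \<boxtimes>\<^bsub>S\<^esub> T0)" "aiT (\<gamma> x) = tensor_map S D T0 TP T0 id id t"
proof -
  have "tensor_map S TP T0 (TP \<boxtimes>\<^bsub>S\<^esub> B0) T0 (\<lambda>d. evD (DeltaD d)) id (aiT (\<gamma> x)) =
      tensor_map S TP T0 (TP \<boxtimes>\<^bsub>S\<^esub> B0) T0 (\<lambda>d. tens S TP B0 d \<one>\<^bsub>B\<^esub>) id (aiT (\<gamma> x))"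
    using assms by (simp only: Theta_Gam[symmetric] Theta_Lam[symmetric] gamma_closed Gam_gamma)
  then have "aiT (\<gamma> x) \<in> tensor_map S (sub_bimod TP (carrier D)) T0 TP T0 id id ` carrier (sub_bimod TP (carrier D) \<boxtimes>\<^bsub>S\<^esub> T0)"
    using assms
    by (intro flat_left_equalizer[OF T_left_flat _ _ _ right_hom_comp[OF DeltaD_right_hom evD_right_hom] tens_one_right_hom])
      (simp_all only: D_sub carrier_D[symmetric], simp_all)
  then show thesis
    using that by (auto simp only: D_sub)
qed

text \<open>From \<open>\<beta> d = 0\<close> follows
  \<open>d \<otimes> x = 1 \<otimes> d x = 0\<close> in S \<otimes> T for every
  \<open>x\<close>.\<close>

lemma inj_beta: "inj_on \<beta> (carrier S)"
proof (rule inj_onI)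
  fix a b assume ab: "a \<in> carrier S" "b \<in> carrier S" "\<beta> a = \<beta> b"
  let ?R = "regular S"
  define d where "d = a \<ominus>\<^bsub>S\<^esub> b"
  have d: "d \<in> carrier S" "\<beta> d = \<zero>\<^bsub>B\<^esub>"
    using ab by (simp_all add: d_def a_minus_def beta.S.r_neg)
  have R: "bimodule S S ?R" "right_module S ?R"
    using regular_bimodule[OF S_ring] by (auto dest: bimoduleD)
  have Z: "right_module S (sub_bimod ?R {\<zero>\<^bsub>S\<^esub>})"
    by (rule right_sub_bimodI[OF R(2)]) auto
  have zero_T: "\<zero>\<^bsub>B\<^esub> \<rightharpoonup>\<^bsub>T\<^esub> x = \<zero>\<^bsub>T\<^esub>" if "x \<in> carrier T" for x
    by (rule add_hom_zero[of B0 T0 "\<lambda>b. b \<rightharpoonup>\<^bsub>T\<^esub> x", simplified])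
      (use that in \<open>simp_all add: left_module_abelian_group[OF B0_bimodule(2)] left_module_abelian_group[OF T0_bimodule(2)] left_hom_add_hom[OF lact_T_left_hom]\<close>)
  have "d \<in> {\<zero>\<^bsub>S\<^esub>}"
  proof (rule faithfully_flat_left_mem[OF T_left_ff T0_bimodule(2) R(2) Z])
    fix x assume x: "x \<in> carrier T0"
    have "tens S ?R T0 d x = tens S ?R T0 \<one>\<^bsub>S\<^esub> (d \<rightharpoonup>\<^bsub>T0\<^esub> x)"
      using x d tens_ract[of S ?R T0 "\<one>\<^bsub>S\<^esub>" x d] R by simp
    also have "\<dots> = tens S ?R T0 \<zero>\<^bsub>S\<^esub> x"
      using x d tens_zero_left[of S ?R T0] tens_zero_right[of S ?R T0] R by (simp add: zero_T)
    also have "\<dots> = tensor_map S (sub_bimod ?R {\<zero>\<^bsub>S\<^esub>}) T0 ?R T0 id id (tens S (sub_bimod ?R {\<zero>\<^bsub>S\<^esub>}) T0 \<zero>\<^bsub>S\<^esub> x)"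
      using x R Z by simp
    finally show "tens S ?R T0 d x \<in> tensor_map S (sub_bimod ?R {\<zero>\<^bsub>S\<^esub>}) T0 ?R T0 id id ` carrier (sub_bimod ?R {\<zero>\<^bsub>S\<^esub>} \<boxtimes>\<^bsub>S\<^esub> T0)"
      by (rule image_eqI) (use x in simp)
  qed (use d in auto)
  then show "a = b"
    using ab(1,2) beta.R.eq_of_diff_zero[of a b] by (simp add: d_def)
qed

text \<open>The splitting for D gives \<open>evh d \<otimes> x = 1 \<otimes> evh d x\<close> in B
  \<otimes> T, an element of \<beta>(S) \<otimes> T, and membership descends.\<close>

lemma evh_D:
  assumes d: "d \<in> carrier D"
  shows "evh d \<in> \<beta> ` carrier S"
proof -
  let ?Y = "\<beta> ` carrier S"
  have sub: "?Y \<subseteq> carrier B0" by auto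
  note incl = sub_bimod_right_hom(3)[OF sub, of S]
  have one: "\<one>\<^bsub>B\<^esub> \<in> ?Y" by (metis beta.R.one_closed beta.hom_one image_eqI)
  have Y: "right_module S (sub_bimod B0 ?Y)"
  proof (rule right_sub_bimodI[OF B0_bimodule(3)])
    show "\<zero>\<^bsub>B0\<^esub> \<in> ?Y" by (metis beta.R.zero_closed beta.hom_zero image_eqI restr_simps(3) regular_simps(3))
    show "x \<oplus>\<^bsub>B0\<^esub> y \<in> ?Y" if "x \<in> ?Y" "y \<in> ?Y" for x y
      using that by (auto simp flip: beta.hom_add)
    show "x \<leftharpoonup>\<^bsub>B0\<^esub> a \<in> ?Y" if "a \<in> carrier S" "x \<in> ?Y" for a x
      using that by (auto simp flip: beta.hom_mult)
  qed auto
  show ?thesis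
  proof (rule faithfully_flat_left_mem[OF T_left_ff T0_bimodule(2) B0_bimodule(3) Y])
    fix x assume "x \<in> carrier T0"
    then have x: "x \<in> carrier T" by simp
    have eq: "tensor_map S TP T0 B0 T0 evh id (Xih x (DeltaD u)) = tens S B0 T0 \<one>\<^bsub>B\<^esub> (evh u \<rightharpoonup>\<^bsub>T\<^esub> x)"
      if "u \<in> carrier TP" for u
      using that
    proof (induction rule: TP_induct)
      case (tens z q)
      have "tensor_map S TP T0 B0 T0 evh id (tensor_map S TP T0 TP T0 id (\<lambda>y. y \<leftharpoonup>\<^bsub>T\<^esub> E q x) (aiT (\<gamma> z))) =
          tensor_map S B0 T0 B0 T0 id (\<lambda>y. y \<leftharpoonup>\<^bsub>T\<^esub> E q x) (tensor_map S TP T0 B0 T0 evh id (aiT (\<gamma> z)))"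
        using tens x by (simp add: tensor_map_comp)
      then show ?case
        using tens x Xih_DeltaD[of x z q] by (simp add: evh_shepherd)
    next
      case (add u v)
      have "DeltaD (u \<oplus>\<^bsub>TP\<^esub> v) = DeltaD u \<oplus>\<^bsub>T0 \<boxtimes>\<^bsub>R\<^esub> PTP\<^esub> DeltaD v"
        by (rule add_hom_add[OF left_hom_add_hom[OF DeltaD_left_hom] add(1,2)])
      with add show ?case using x by (simp add: T.add_lact tens_add_T0)
    qed
    have "tens S B0 T0 (evh d) x = tensor_map S TP T0 B0 T0 evh id (tens S TP T0 d x)"
      using x d by simp
    also have "\<dots> = tens S B0 T0 \<one>\<^bsub>B\<^esub> (evh d \<rightharpoonup>\<^bsub>T\<^esub> x)"
      using x d by (simp only: tens_D_eq eq in_D_TP)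
    also have "\<dots> = tensor_map S (sub_bimod B0 ?Y) T0 B0 T0 id id (tens S (sub_bimod B0 ?Y) T0 \<one>\<^bsub>B\<^esub> (evh d \<rightharpoonup>\<^bsub>T\<^esub> x))"
      using x d Y one by (simp add: incl)
    finally show "tens S B0 T0 (evh d) x \<in> tensor_map S (sub_bimod B0 ?Y) T0 B0 T0 id id ` carrier (sub_bimod B0 ?Y \<boxtimes>\<^bsub>S\<^esub> T0)"
      by (rule image_eqI) (use x d one in simp)
  qed (use d sub in auto)
qed

text \<open>\<open>1 \<otimes> x\<close> is the evaluation of \<open>\<gamma> x\<close>, which lies
  in D \<otimes> T; so 1 lies in evh(D) after tensoring with T, hence before.\<close>

lemma one_in_evh_D:
  obtains d where "d \<in> carrier D" "evh d = \<one>\<^bsub>B\<^esub>"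
proof -
  let ?Y = "sub_bimod B0 (evh ` carrier D)"
  have "id \<in> right_hom S D TP" by simp
  then have ev': "evh \<in> right_hom S D B0"
    using right_hom_comp[of id S D TP evh B0] by simp
  then have ev: "evh \<in> right_hom S D ?Y"
    by (rule corestrict_right_hom)
  have Y [simp]: "right_module S ?Y"
    by (rule right_image_module[OF D_bimodule(3) B0_bimodule(3) ev'])
  have sub [simp]: "evh ` carrier D \<subseteq> carrier B"
    by auto
  have "\<one>\<^bsub>B\<^esub> \<in> evh ` carrier D"
  proof (rule faithfully_flat_left_mem[OF T_left_ff T0_bimodule(2) B0_bimodule(3) Y])
    fix x assume "x \<in> carrier T0"
    then have x: "x \<in> carrier T" by simp
    then obtain t where t: "t \<in> carrier (D \<boxtimes>\<^bsub>S\<^esub> T0)" "aiT (\<gamma> x) = tensor_map S D T0 TP T0 id id t"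
      by (rule gamma_in_DT)
    have "tens S B0 T0 \<one>\<^bsub>B\<^esub> x = tensor_map S TP T0 B0 T0 evh id (tensor_map S D T0 TP T0 id id t)"
      using evh_shepherd[OF x] by (simp only: t)
    also have "\<dots> = tensor_map S ?Y T0 B0 T0 id id (tensor_map S D T0 ?Y T0 evh id t)"
      using t(1) ev by (simp add: tensor_map_comp)
    finally show "tens S B0 T0 \<one>\<^bsub>B\<^esub> x \<in> tensor_map S ?Y T0 B0 T0 id id ` carrier (?Y \<boxtimes>\<^bsub>S\<^esub> T0)"
      by (rule image_eqI) (use t(1) ev in simp)
  qed simp_all
  then show thesis
    using that by (auto simp only: image_iff)
qed

text \<open>\<open>DeltaD d \<otimes> x\<close> is computed from \<open>d \<otimes> x\<close>, which
  the splitting expresses through values of \<open>\<gamma>\<close>. On these, \<open>DeltaD\<close>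
  is \<open>Rot\<close> of \<open>Lam\<close>, hence of \<open>Gam\<close>, whose last three factors
  lie in D \<otimes> T.\<close>

lemma DeltaD_in_TPD:
  assumes d: "d \<in> carrier D"
  obtains u where "u \<in> carrier (TP \<boxtimes>\<^bsub>S\<^esub> D)"
    "DeltaD d = assoc R S T0 P0 TP (tensor_map S TP D TP TP id id u)"
proof -
  let ?g = "\<lambda>u. assoc R S T0 P0 TP (tensor_map S TP D TP TP id id u)"
  let ?Z = "T0 \<boxtimes>\<^bsub>R\<^esub> PTP"
  let ?Y = "sub_bimod ?Z (?g ` carrier (TP \<boxtimes>\<^bsub>S\<^esub> D))"
  let ?I = "tensor_map S ?Y T0 ?Z T0 id id ` carrier (?Y \<boxtimes>\<^bsub>S\<^esub> T0)"
  let ?G = "tensor_map S TP T0 ?Z T0 (\<lambda>d. DeltaD d) id"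
  have g: "?g \<in> right_hom S (TP \<boxtimes>\<^bsub>S\<^esub> D) ?Z"
    by (rule right_hom_comp[where N = "TP \<boxtimes>\<^bsub>S\<^esub> TP"]) simp_all
  have Y [simp]: "right_module S ?Y"
    by (rule right_image_module[OF _ _ g]) simp_all
  have sub: "?g ` carrier (TP \<boxtimes>\<^bsub>S\<^esub> D) \<subseteq> carrier ?Z"
    by auto
  note incl = sub_bimod_right_hom(3)[OF sub, of S]
  have I_add: "u \<oplus>\<^bsub>?Z \<boxtimes>\<^bsub>S\<^esub> T0\<^esub> v \<in> ?I" if "u \<in> ?I" "v \<in> ?I" for u v
    by (rule tensor_map_image_add[OF _ _ _ _ _ _ that]) (simp_all add: incl)
  have tens_I: "tens S ?Z T0 (?g u) z \<in> ?I" if "z \<in> carrier T" "u \<in> carrier (TP \<boxtimes>\<^bsub>S\<^esub> D)" for z u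
    by (rule image_eqI[where x = "tens S ?Y T0 (?g u) z"]) (use that in \<open>simp_all add: incl\<close>)
  have Gam1: "assoc_inv R S T0 PTP T0 (tens R T0 (PTP \<boxtimes>\<^bsub>S\<^esub> T0) x (assoc_inv S S P0 TP T0
      (tens S P0 (TP \<boxtimes>\<^bsub>S\<^esub> T0) p (tensor_map S D T0 TP T0 id id t)))) \<in> ?I" (is "?L t \<in> _")
    if "t \<in> carrier (D \<boxtimes>\<^bsub>S\<^esub> T0)" "x \<in> carrier T" "p \<in> carrier That" for t x p
    using that
  proof (induction rule: DT_induct)
    case (tens d' z)
    then have "?L (tens S D T0 d' z) = tens S ?Z T0 (?g (tens S TP D (tens R T0 P0 x p) d')) z"
      by simp
    then show ?case
      using tens_I[of z "tens S TP D (tens R T0 P0 x p) d'"] tens by (simp only: restr_simps tens_closed)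
  next
    case (add s t)
    then have "?L (s \<oplus>\<^bsub>D \<boxtimes>\<^bsub>S\<^esub> T0\<^esub> t) = ?L s \<oplus>\<^bsub>?Z \<boxtimes>\<^bsub>S\<^esub> T0\<^esub> ?L t"
      by (simp add: tens_add_right)
    then show ?case
      using I_add[OF add(3,4)] add(5,6) by (simp only:)
  qed
  have Gam_I: "Rot (Gam t) \<in> ?I" if "t \<in> carrier TPT" for t
    using that
  proof (induction rule: TPT_induct3)
    case (tens x p y)
    then have xpy: "x \<in> carrier T" "p \<in> carrier That" "y \<in> carrier T" by simp_all
    obtain t where t: "t \<in> carrier (D \<boxtimes>\<^bsub>S\<^esub> T0)" "aiT (\<gamma> y) = tensor_map S D T0 TP T0 id id t"
      by (rule gamma_in_DT[OF xpy(3)])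
    have "Rot (Gam (tens R T0 PT x (tens S P0 T0 p y))) = assoc_inv R S T0 PTP T0 (tens R T0 (PTP \<boxtimes>\<^bsub>S\<^esub> T0) x (assoc_inv S S P0 TP T0
      (tens S P0 (TP \<boxtimes>\<^bsub>S\<^esub> T0) p (tensor_map S D T0 TP T0 id id t))))"
      using xpy t(2) by simp
    then show ?case
      using Gam1[OF t(1) xpy(1,2)] by (simp only: id_def)
  next
    case (add s t)
    then have "Rot (Gam (s \<oplus>\<^bsub>TPT\<^esub> t)) = Rot (Gam s) \<oplus>\<^bsub>?Z \<boxtimes>\<^bsub>S\<^esub> T0\<^esub> Rot (Gam t)"
      by simp
    then show ?case
      using I_add[OF add(3,4)] by (simp only: id_def)
  qed
  \<comment> \<open>Multiplying the last factor T by \<open>ev (q \<otimes> x)\<close> commutes with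
    \<open>?G\<close>, which acts on the other factors, and it preserves \<open>?I\<close>.\<close>
  have G_I: "?G (Xih x (DeltaD u)) \<in> ?I" if x: "x \<in> carrier T" and u: "u \<in> carrier TP" for x u
    using u
  proof (induction rule: TP_induct)
    case (tens z q)
    then have zq: "z \<in> carrier T" "q \<in> carrier That" by simp_all
    let ?b = "\<lambda>y. y \<leftharpoonup>\<^bsub>T\<^esub> E q x"
    have b [simp]: "?b \<in> left_hom S T0 T0" using x zq by simp
    have "?G (Xih x (DeltaD (tens R T0 P0 z q))) = tensor_map S ?Z T0 ?Z T0 id ?b (?G (aiT (\<gamma> z)))"
      unfolding Xih_DeltaD[OF x zq] using x zq by (simp add: tensor_map_comp)
    also have "\<dots> = tensor_map S ?Z T0 ?Z T0 id ?b (Rot (Gam (\<gamma> z)))"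
      using zq by (simp only: Rot_Lam gamma_closed Gam_gamma)
    finally have eq: "?G (Xih x (DeltaD (tens R T0 P0 z q))) = tensor_map S ?Z T0 ?Z T0 id ?b (Rot (Gam (\<gamma> z)))" .
    obtain w where w: "w \<in> carrier (?Y \<boxtimes>\<^bsub>S\<^esub> T0)" "Rot (Gam (\<gamma> z)) = tensor_map S ?Y T0 ?Z T0 id id w"
      using Gam_I[OF gamma_closed[OF zq(1)]] by blast
    have "tensor_map S ?Z T0 ?Z T0 id ?b (tensor_map S ?Y T0 ?Z T0 id id w) =
        tensor_map S ?Y T0 ?Z T0 id id (tensor_map S ?Y T0 ?Y T0 id ?b w)"
      using w(1) by (simp add: tensor_map_comp incl)
    moreover have "tensor_map S ?Y T0 ?Y T0 id ?b w \<in> carrier (?Y \<boxtimes>\<^bsub>S\<^esub> T0)"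
      using w(1) by simp
    ultimately have "tensor_map S ?Z T0 ?Z T0 id ?b (tensor_map S ?Y T0 ?Z T0 id id w) \<in> ?I"
      by (rule image_eqI)
    then show ?case
      unfolding eq[unfolded id_def] w(2)[symmetric, unfolded id_def] id_def .
  next
    case (add u v)
    have "DeltaD (u \<oplus>\<^bsub>TP\<^esub> v) = DeltaD u \<oplus>\<^bsub>?Z\<^esub> DeltaD v"
      by (rule add_hom_add[OF left_hom_add_hom[OF DeltaD_left_hom] add(1,2)])
    then have "?G (Xih x (DeltaD (u \<oplus>\<^bsub>TP\<^esub> v))) = ?G (Xih x (DeltaD u)) \<oplus>\<^bsub>?Z \<boxtimes>\<^bsub>S\<^esub> T0\<^esub> ?G (Xih x (DeltaD v))"
      using x add(1,2) by simp
    then show ?case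
      using I_add[OF add(3,4)] by (simp only: id_def)
  qed
  have "DeltaD d \<in> ?g ` carrier (TP \<boxtimes>\<^bsub>S\<^esub> D)"
  proof (rule faithfully_flat_left_mem[OF T_left_ff T0_bimodule(2) _ Y sub])
    fix x assume "x \<in> carrier T0"
    then have x: "x \<in> carrier T" by simp
    have "tens S ?Z T0 (DeltaD d) x = ?G (tens S TP T0 d x)"
      using x d by simp
    also have "\<dots> = ?G (Xih x (DeltaD d))"
      by (simp only: tens_D_eq[OF x d])
    finally show "tens S ?Z T0 (DeltaD d) x \<in> ?I"
      using G_I[OF x in_D_TP[OF d]] by (simp only:)
  qed (use d in simp_all)
  then show thesis
    using that by blast
qed

end

lemma left_module_inter:
  assumes M: "left_module R M" and X: "left_module R (sub_bimod M X)" and Y: "left_module R (sub_bimod M Y)"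
    and sub: "X \<subseteq> carrier M"
  shows "left_module R (sub_bimod M (X \<inter> Y))"
proof -
  interpret X: left_module R "sub_bimod M X" by fact
  interpret Y: left_module R "sub_bimod M Y" by fact
  show ?thesis
    using sub X.M.zero_closed Y.M.zero_closed X.M.a_closed Y.M.a_closed X.lact_closed Y.lact_closed
    by (intro left_sub_bimodI[OF M]) auto
qed

lemma right_module_inter:
  assumes M: "right_module R M" and X: "right_module R (sub_bimod M X)" and Y: "right_module R (sub_bimod M Y)"
    and sub: "X \<subseteq> carrier M"
  shows "right_module R (sub_bimod M (X \<inter> Y))"
proof -
  interpret X: right_module R "sub_bimod M X" by fact
  interpret Y: right_module R "sub_bimod M Y" by fact
  show ?thesis
    using sub X.M.zero_closed Y.M.zero_closed X.M.a_closed Y.M.a_closed X.ract_closed Y.ract_closed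
    by (intro right_sub_bimodI[OF M]) auto
qed

section \<open>The coherd as an intersection inside PTP, and its inclusions\<close>

context herd
begin

lemma C_simps: "ring.add C = ring.add PT" "lact C = lact PT" "ract C = ract PT"
  unfolding C_def sub_bimod_simps by (rule refl)+

lemma D_simps: "ring.add D = ring.add TP" "lact D = lact TP" "ract D = ract TP"
  unfolding D_def sub_bimod_simps by (rule refl)+

abbreviation "iCP u \<equiv> assoc S R P0 T0 P0 (tensor_map R C P0 PT P0 id id u)"
abbreviation "iPD \<equiv> tensor_map S P0 D P0 TP id id"

lemma iCP_left_hom: "(\<lambda>u. iCP u) \<in> left_hom R (C \<boxtimes>\<^bsub>R\<^esub> P0) PTP"
  by (rule left_hom_comp[where N = "PT \<boxtimes>\<^bsub>R\<^esub> P0"]) simp_all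

lemma iCP_right_hom: "(\<lambda>u. iCP u) \<in> right_hom S (C \<boxtimes>\<^bsub>R\<^esub> P0) PTP"
  by (rule right_hom_comp[where N = "PT \<boxtimes>\<^bsub>R\<^esub> P0"]) simp_all

lemma CP_eq: "CP = (\<lambda>u. iCP u) ` carrier (C \<boxtimes>\<^bsub>R\<^esub> P0)"
  by (simp add: CP_def comp_def)

lemma CP_subset: "CP \<subseteq> carrier PTP"
  by (auto simp: CP_eq)

lemma PD_subset: "PD \<subseteq> carrier PTP"
  by (auto simp: PD_def)

lemma CP_module [simp]: "left_module R (sub_bimod PTP CP)" "right_module S (sub_bimod PTP CP)"
  unfolding CP_eq
  by (rule left_image_module[OF _ _ iCP_left_hom] right_image_module[OF _ _ iCP_right_hom]; simp)+

lemma PD_module [simp]: "left_module R (sub_bimod PTP PD)" "right_module S (sub_bimod PTP PD)"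
  unfolding PD_def
  by (rule left_image_module right_image_module; simp)+

lemma carrier_Tbar: "carrier Tbar = CP \<inter> PD"
  by (simp add: Tbar_def)

lemma Tbar_sub: "sub_bimod PTP (CP \<inter> PD) = Tbar"
  by (simp add: Tbar_def)

lemma Tbar_bimodule [simp]: "bimodule R S Tbar" "left_module R Tbar" "right_module S Tbar"
proof -
  show l: "left_module R Tbar"
    unfolding Tbar_def by (rule left_module_inter) (simp_all add: CP_subset)
  show r: "right_module S Tbar"
    unfolding Tbar_def by (rule right_module_inter) (simp_all add: CP_subset)
  show "bimodule R S Tbar"
    using sub_bimod_bimodule[of R S PTP "CP \<inter> PD"] l r CP_subset unfolding Tbar_sub by auto
qed

lemma Tbar_simps [simp]:
  "ring.add Tbar = ring.add PTP" "\<zero>\<^bsub>Tbar\<^esub> = \<zero>\<^bsub>PTP\<^esub>" "lact Tbar = lact PTP" "ract Tbar = ract PTP"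
  by (simp_all add: Tbar_def)

lemma in_Tbar_PTP [simp]: "w \<in> carrier Tbar \<Longrightarrow> w \<in> carrier PTP"
  using CP_subset unfolding carrier_Tbar by auto

lemma Tbar_incl_left_hom [simp]: "id \<in> left_hom R Tbar PTP"
  and Tbar_incl_right_hom [simp]: "id \<in> right_hom S Tbar PTP"
  by (simp_all add: left_hom_iff right_hom_iff add_hom_iff)

text \<open>The rebracketing inverse to \<open>jj\<close>; \<open>incl_TbT\<close> is the inclusion
  of \<open>Tbar\<close> tensored with T, followed by \<open>JJ\<close>.\<close>

abbreviation "JJ v \<equiv> tensor_map S P0 (TP \<boxtimes>\<^bsub>S\<^esub> T0) P0 TPT id (assoc R S T0 P0 T0) (assoc S S P0 TP T0 v)"

lemma JJ_jj [simp]: "v \<in> carrier (P0 \<boxtimes>\<^bsub>S\<^esub> TPT) \<Longrightarrow> JJ (jj v) = v"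
  by (simp add: tensor_map_comp) (rule tensor_map_id, simp_all)

lemma jj_JJ [simp]: "v \<in> carrier (PTP \<boxtimes>\<^bsub>S\<^esub> T0) \<Longrightarrow> jj (JJ v) = v"
proof -
  assume v: "v \<in> carrier (PTP \<boxtimes>\<^bsub>S\<^esub> T0)"
  have "tensor_map S P0 TPT P0 (TP \<boxtimes>\<^bsub>S\<^esub> T0) id aiT (JJ v) = assoc S S P0 TP T0 v"
    using v by (simp add: tensor_map_comp) (rule tensor_map_id, simp_all)
  then show ?thesis using v by simp
qed

lemma incl_TbT_eq: "incl_TbT w = JJ (tensor_map S Tbar T0 PTP T0 id id w)"
  by (simp add: incl_TbT_def)

lemma incl_TbT_right_hom: "incl_TbT \<in> right_hom R TbT (P0 \<boxtimes>\<^bsub>S\<^esub> TPT)"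
proof -
  have "(\<lambda>w. JJ (tensor_map S Tbar T0 PTP T0 id id w)) \<in> right_hom R TbT (P0 \<boxtimes>\<^bsub>S\<^esub> TPT)"
    by (rule right_hom_comp[where N = "PTP \<boxtimes>\<^bsub>S\<^esub> T0"], simp,
        rule right_hom_comp[where N = "P0 \<boxtimes>\<^bsub>S\<^esub> (TP \<boxtimes>\<^bsub>S\<^esub> T0)"]) simp_all
  then show ?thesis by (simp add: incl_TbT_eq[symmetric])
qed

lemma incl_TTb_left_hom: "incl_TTb \<in> left_hom S TTb (T0 \<boxtimes>\<^bsub>R\<^esub> PTP)"
  unfolding incl_TTb_def by simp

end

section \<open>Existence and linearity of cov and covbar\<close>

context tame_herd
begin

text \<open>T is flat as a left S-module, so \<open>Tbar \<subseteq> PTP\<close> stays injective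
  after tensoring on the right, and rebracketing is invertible.\<close>

lemma inj_incl_TbT: "inj_on incl_TbT (carrier TbT)"
proof -
  have "carrier Tbar \<lesssim> test_UNIV"
    by (rule lepoll_trans[OF subset_imp_lepoll[of _ "carrier PTP"]]) (auto simp only: in_Tbar_PTP, simp)
  then have "inj_on (tensor_map S Tbar T0 PTP T0 id id) (carrier TbT)"
    by (intro flat_left_inj[OF T_left_flat]) simp_all
  moreover have "inj_on (\<lambda>v. JJ v) (carrier (PTP \<boxtimes>\<^bsub>S\<^esub> T0))"
    by (rule inj_on_inverseI[where g = "\<lambda>v. jj v"]) (rule jj_JJ)
  ultimately show ?thesis
    unfolding inj_on_def incl_TbT_eq by simp
qed

lemma inj_incl_TTb: "inj_on incl_TTb (carrier TTb)"
proof -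
  have "carrier Tbar \<lesssim> test_UNIV"
    by (rule lepoll_trans[OF subset_imp_lepoll[of _ "carrier PTP"]]) (auto simp only: in_Tbar_PTP, simp)
  then show ?thesis
    unfolding incl_TTb_def by (intro flat_right_inj[OF T_right_flat]) simp_all
qed

text \<open>The coproduct of \<open>c\<close> lies in CP \<otimes> T by \<open>Delta_in_CPT\<close>,
  and in PD \<otimes> T because \<open>\<gamma>\<close> has values in D \<otimes> T. Flatness turns
  the two memberships into one for the intersection \<open>Tbar\<close>.\<close>

lemma Delta_in_TbT:
  assumes c: "c \<in> carrier C"
  shows "Delta c \<in> incl_TbT ` carrier TbT"
proof -
  let ?CP = "sub_bimod PTP CP" and ?PD = "sub_bimod PTP PD"
  let ?IC = "tensor_map S ?CP T0 PTP T0 id id ` carrier (?CP \<boxtimes>\<^bsub>S\<^esub> T0)"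
  let ?IP = "tensor_map S ?PD T0 PTP T0 id id ` carrier (?PD \<boxtimes>\<^bsub>S\<^esub> T0)"
  note inclC [simp] = sub_bimod_right_hom(3)[OF CP_subset, of S]
  note inclP [simp] = sub_bimod_right_hom(3)[OF PD_subset, of S]
  have IC_add: "u \<oplus>\<^bsub>PTP \<boxtimes>\<^bsub>S\<^esub> T0\<^esub> v \<in> ?IC" if "u \<in> ?IC" "v \<in> ?IC" for u v
    by (rule tensor_map_image_add[OF _ _ _ _ _ _ that]) simp_all
  have IP_add: "u \<oplus>\<^bsub>PTP \<boxtimes>\<^bsub>S\<^esub> T0\<^esub> v \<in> ?IP" if "u \<in> ?IP" "v \<in> ?IP" for u v
    by (rule tensor_map_image_add[OF _ _ _ _ _ _ that]) simp_all
  have tens_IC: "tens S PTP T0 w z \<in> ?IC" if "w \<in> CP" "z \<in> carrier T" for w z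
    by (rule image_eqI[where x = "tens S ?CP T0 w z"]) (use that in simp_all)
  have tens_IP: "tens S PTP T0 w z \<in> ?IP" if "w \<in> PD" "z \<in> carrier T" for w z
    by (rule image_eqI[where x = "tens S ?PD T0 w z"]) (use that in simp_all)
  \<comment> \<open>An instance of the pentagon identity: two ways of rebracketing P \<otimes> T
    \<otimes> P \<otimes> T agree.\<close>
  have pent: "jj (assoc S R P0 T0 PT (tens R PT PT v (tens S P0 T0 q z))) = tens S PTP T0 (assoc S R P0 T0 P0 (tens R PT P0 v q)) z"
    if "v \<in> carrier PT" "q \<in> carrier That" "z \<in> carrier T" for v q z
    using that by (induction rule: PT_induct) (simp_all add: tens_add_left)
  obtain u where u: "u \<in> carrier (C \<boxtimes>\<^bsub>R\<^esub> PT)" "Delta c = assoc S R P0 T0 PT (tensor_map R C PT PT PT id id u)"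
    by (rule Delta_in_CPT[OF c])
  have "jj (assoc S R P0 T0 PT (tensor_map R C PT PT PT id id u)) \<in> ?IC"
    using u(1)
  proof (induction rule: tensor_induct_right[OF C_bimodule(3) P0_bimodule(1) T0_bimodule(2), consumes 1, case_names tens add])
    case (tens c' q z)
    then have q: "q \<in> carrier That" "z \<in> carrier T" by simp_all
    have "iCP (tens R C P0 c' q) \<in> CP"
      unfolding CP_eq using tens by (intro imageI) simp
    then have w: "assoc S R P0 T0 P0 (tens R PT P0 c' q) \<in> CP"
      using tens by simp
    have "jj (assoc S R P0 T0 PT (tensor_map R C PT PT PT id id (tens R C PT c' (tens S P0 T0 q z)))) =
        tens S PTP T0 (assoc S R P0 T0 P0 (tens R PT P0 c' q)) z"
      using tens pent[of c' q z] by simp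
    then show ?case
      using tens_IC[OF w q(2)] by (simp only: id_def)
  next
    case (add s t)
    then have "jj (assoc S R P0 T0 PT (tensor_map R C PT PT PT id id (s \<oplus>\<^bsub>C \<boxtimes>\<^bsub>R\<^esub> PT\<^esub> t))) =
      jj (assoc S R P0 T0 PT (tensor_map R C PT PT PT id id s)) \<oplus>\<^bsub>PTP \<boxtimes>\<^bsub>S\<^esub> T0\<^esub> jj (assoc S R P0 T0 PT (tensor_map R C PT PT PT id id t))"
      by simp
    then show ?case
      using IC_add[OF add(3,4)] by (simp only: id_def)
  qed
  then have inC: "jj (Delta c) \<in> ?IC"
    by (simp only: u(2))
  \<comment> \<open>This membership concerns the value of \<open>\<gamma>\<close> alone, so it holds
    on all of \<open>PT\<close>, where induction over elementary tensors is possible.\<close>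
  have inP: "jj (Delta v) \<in> ?IP" if "v \<in> carrier PT" for v
    using that
  proof (induction rule: PT_induct)
    case (tens p y)
    then have py: "p \<in> carrier That" "y \<in> carrier T" by simp_all
    obtain t where t: "t \<in> carrier (D \<boxtimes>\<^bsub>S\<^esub> T0)" "aiT (\<gamma> y) = tensor_map S D T0 TP T0 id id t"
      by (rule gamma_in_DT[OF py(2)])
    have "assoc_inv S S P0 TP T0 (tens S P0 (TP \<boxtimes>\<^bsub>S\<^esub> T0) p (tensor_map S D T0 TP T0 id id t)) \<in> ?IP"
      using t(1)
    proof (induction rule: DT_induct)
      case (tens d z)
      then have z: "z \<in> carrier T" by simp
      have w: "tens S P0 TP p d \<in> PD"
        unfolding PD_def by (rule image_eqI[where x = "tens S P0 D p d"]) (use tens py in simp_all)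
      have "assoc_inv S S P0 TP T0 (tens S P0 (TP \<boxtimes>\<^bsub>S\<^esub> T0) p (tensor_map S D T0 TP T0 id id (tens S D T0 d z))) =
          tens S PTP T0 (tens S P0 TP p d) z"
        using tens py by simp
      then show ?case
        using tens_IP[OF w z] by (simp only: id_def)
    next
      case (add s t)
      then have "assoc_inv S S P0 TP T0 (tens S P0 (TP \<boxtimes>\<^bsub>S\<^esub> T0) p (tensor_map S D T0 TP T0 id id (s \<oplus>\<^bsub>D \<boxtimes>\<^bsub>S\<^esub> T0\<^esub> t))) =
        assoc_inv S S P0 TP T0 (tens S P0 (TP \<boxtimes>\<^bsub>S\<^esub> T0) p (tensor_map S D T0 TP T0 id id s)) \<oplus>\<^bsub>PTP \<boxtimes>\<^bsub>S\<^esub> T0\<^esub>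
        assoc_inv S S P0 TP T0 (tens S P0 (TP \<boxtimes>\<^bsub>S\<^esub> T0) p (tensor_map S D T0 TP T0 id id t))"
        using py by (simp add: tens_add_right)
      then show ?case
        using IP_add[OF add(3,4)] by (simp only: id_def)
    qed
    moreover have "jj (Delta (tens S P0 T0 p y)) = assoc_inv S S P0 TP T0 (tens S P0 (TP \<boxtimes>\<^bsub>S\<^esub> T0) p (tensor_map S D T0 TP T0 id id t))"
      using py t(2) by simp
    ultimately show ?case
      by (simp only: id_def)
  next
    case (add u v)
    then have "jj (Delta (u \<oplus>\<^bsub>PT\<^esub> v)) = jj (Delta u) \<oplus>\<^bsub>PTP \<boxtimes>\<^bsub>S\<^esub> T0\<^esub> jj (Delta v)"
      by simp
    then show ?case
      using IP_add[OF add(3,4)] by (simp only: id_def)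
  qed
  have "jj (Delta c) \<in> tensor_map S (sub_bimod PTP (CP \<inter> PD)) T0 PTP T0 id id ` carrier (sub_bimod PTP (CP \<inter> PD) \<boxtimes>\<^bsub>S\<^esub> T0)"
    by (rule flat_left_inter[OF T_left_flat _ _ _ _ CP_subset _ PD_subset _ _ inC inP[OF in_C_PT[OF c]]])
      (simp_all add: Tbar_sub)
  then obtain w where w: "w \<in> carrier TbT" "jj (Delta c) = tensor_map S Tbar T0 PTP T0 id id w"
    unfolding Tbar_sub by blast
  \<comment> \<open>The two memberships were compared in PTP \<otimes> T; \<open>JJ\<close> returns
    to the right-nested brackets in which \<open>cov\<close> is defined.\<close>
  have "incl_TbT w = Delta c"
    unfolding incl_TbT_eq w(2)[symmetric] using c by (intro JJ_jj) simp
  then show ?thesis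
    using w(1) by (metis image_eqI)
qed

text \<open>The roles are exchanged: membership in T \<otimes> PD is the one that needs
  \<open>d\<close> in D, while membership in T \<otimes> CP follows from \<open>\<gamma>\<close>
  having values in T \<otimes> C.\<close>

lemma DeltaD_in_TTb:
  assumes d: "d \<in> carrier D"
  shows "DeltaD d \<in> incl_TTb ` carrier TTb"
proof -
  let ?CP = "sub_bimod PTP CP" and ?PD = "sub_bimod PTP PD"
  let ?Z = "T0 \<boxtimes>\<^bsub>R\<^esub> PTP"
  let ?IC = "tensor_map R T0 ?CP T0 PTP id id ` carrier (T0 \<boxtimes>\<^bsub>R\<^esub> ?CP)"
  let ?IP = "tensor_map R T0 ?PD T0 PTP id id ` carrier (T0 \<boxtimes>\<^bsub>R\<^esub> ?PD)"
  note inclC [simp] = sub_bimod_left_hom(3)[OF CP_subset, of R]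
  note inclP [simp] = sub_bimod_left_hom(3)[OF PD_subset, of R]
  have IC_add: "u \<oplus>\<^bsub>?Z\<^esub> v \<in> ?IC" if "u \<in> ?IC" "v \<in> ?IC" for u v
    by (rule tensor_map_image_add[OF _ _ _ _ _ _ that]) simp_all
  have IP_add: "u \<oplus>\<^bsub>?Z\<^esub> v \<in> ?IP" if "u \<in> ?IP" "v \<in> ?IP" for u v
    by (rule tensor_map_image_add[OF _ _ _ _ _ _ that]) simp_all
  have tens_IC: "tens R T0 PTP z w \<in> ?IC" if "w \<in> CP" "z \<in> carrier T" for w z
    by (rule image_eqI[where x = "tens R T0 ?CP z w"]) (use that in simp_all)
  have tens_IP: "tens R T0 PTP z w \<in> ?IP" if "w \<in> PD" "z \<in> carrier T" for w z
    by (rule image_eqI[where x = "tens R T0 ?PD z w"]) (use that in simp_all)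
  obtain u where u: "u \<in> carrier (TP \<boxtimes>\<^bsub>S\<^esub> D)" "DeltaD d = assoc R S T0 P0 TP (tensor_map S TP D TP TP id id u)"
    by (rule DeltaD_in_TPD[OF d])
  have "assoc R S T0 P0 TP (tensor_map S TP D TP TP id id u) \<in> ?IP"
    using u(1)
  proof (induction rule: tensor_induct_left[OF T0_bimodule(3) P0_bimodule(1) D_bimodule(2), consumes 1, case_names tens add])
    case (tens z p d')
    then have z: "z \<in> carrier T" by simp
    have w: "tens S P0 TP p d' \<in> PD"
      unfolding PD_def by (rule image_eqI[where x = "tens S P0 D p d'"]) (use tens in simp_all)
    have "assoc R S T0 P0 TP (tensor_map S TP D TP TP id id (tens S TP D (tens R T0 P0 z p) d')) = tens R T0 PTP z (tens S P0 TP p d')"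
      using tens by simp
    then show ?case
      using tens_IP[OF w z] by (simp only: id_def)
  next
    case (add s t)
    then have "assoc R S T0 P0 TP (tensor_map S TP D TP TP id id (s \<oplus>\<^bsub>TP \<boxtimes>\<^bsub>S\<^esub> D\<^esub> t)) =
      assoc R S T0 P0 TP (tensor_map S TP D TP TP id id s) \<oplus>\<^bsub>?Z\<^esub> assoc R S T0 P0 TP (tensor_map S TP D TP TP id id t)"
      by simp
    then show ?case
      using IP_add[OF add(3,4)] by (simp only: id_def)
  qed
  then have inP: "DeltaD d \<in> ?IP"
    by (simp only: u(2))
  have inC: "DeltaD v \<in> ?IC" if "v \<in> carrier TP" for v
    using that
  proof (induction rule: TP_induct)
    case (tens y q)
    then have yq: "y \<in> carrier T" "q \<in> carrier That" by simp_all
    let ?L = "\<lambda>s. tensor_map R T0 (PT \<boxtimes>\<^bsub>R\<^esub> P0) T0 PTP id (assoc S R P0 T0 P0) (assoc R R T0 PT P0 (tens R TPT P0 s q))"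
    obtain t where t: "t \<in> carrier (T0 \<boxtimes>\<^bsub>R\<^esub> C)" "\<gamma> y = tensor_map R T0 C T0 PT id id t"
      by (rule gamma_in_TC[OF yq(1)])
    have "?L (tensor_map R T0 C T0 PT id id t) \<in> ?IC"
      using t(1)
    proof (induction rule: TC_induct)
      case (tens z c)
      then have z: "z \<in> carrier T" by simp
      have "iCP (tens R C P0 c q) \<in> CP"
        unfolding CP_eq using tens yq by (intro imageI) simp
      then have w: "assoc S R P0 T0 P0 (tens R PT P0 c q) \<in> CP"
        using tens yq by simp
      have "?L (tensor_map R T0 C T0 PT id id (tens R T0 C z c)) = tens R T0 PTP z (assoc S R P0 T0 P0 (tens R PT P0 c q))"
        using tens yq by simp
      then show ?case
        using tens_IC[OF w z] by (simp only: id_def)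
    next
      case (add s t)
      then have "?L (tensor_map R T0 C T0 PT id id (s \<oplus>\<^bsub>T0 \<boxtimes>\<^bsub>R\<^esub> C\<^esub> t)) =
        ?L (tensor_map R T0 C T0 PT id id s) \<oplus>\<^bsub>?Z\<^esub> ?L (tensor_map R T0 C T0 PT id id t)"
        using yq by (simp add: tens_add_left)
      then show ?case
        using IC_add[OF add(3,4)] by (simp only: id_def)
    qed
    moreover have "DeltaD (tens R T0 P0 y q) = ?L (tensor_map R T0 C T0 PT id id t)"
      using yq t(2) by simp
    ultimately show ?case
      by (simp only: id_def)
  next
    case (add u v)
    have "DeltaD (u \<oplus>\<^bsub>TP\<^esub> v) = DeltaD u \<oplus>\<^bsub>?Z\<^esub> DeltaD v"
      by (rule add_hom_add[OF left_hom_add_hom[OF DeltaD_left_hom] add(1,2)])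
    then show ?case
      using IC_add[OF add(3,4)] by (simp only: id_def)
  qed
  have "DeltaD d \<in> tensor_map R T0 (sub_bimod PTP (CP \<inter> PD)) T0 PTP id id ` carrier (T0 \<boxtimes>\<^bsub>R\<^esub> sub_bimod PTP (CP \<inter> PD))"
    by (rule flat_right_inter[OF T_right_flat _ _ _ _ CP_subset _ PD_subset _ _ inC[OF in_D_TP[OF d]] inP])
      (simp_all add: Tbar_sub)
  then show ?thesis
    unfolding Tbar_sub incl_TTb_def .
qed

lemma
  assumes "c \<in> carrier C"
  shows cov_closed [simp]: "cov c \<in> carrier TbT" and incl_cov: "incl_TbT (cov c) = Delta c"
  using Delta_in_TbT[OF assms] unfolding cov_def by (rule inv_into_into, rule f_inv_into_f)

lemma
  assumes "d \<in> carrier D"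
  shows covbar_closed [simp]: "covbar d \<in> carrier TTb" and incl_covbar: "incl_TTb (covbar d) = DeltaD d"
  using DeltaD_in_TTb[OF assms] unfolding covbar_def by (rule inv_into_into, rule f_inv_into_f)

text \<open>\<open>cov\<close> inverts the inclusion on its image; as the inclusion is injective and
  right linear, linearity is inherited from \<open>Delta\<close>. The tensor map over R in
  \<open>ker_A\<close> requires it of its first factor.\<close>

lemma cov_right_hom [simp]: "cov \<in> right_hom R C TbT"
proof -
  interpret TbT: right_module R TbT by simp
  interpret C: right_module R C by simp
  have Delta: "Delta \<in> right_hom R PT (P0 \<boxtimes>\<^bsub>S\<^esub> TPT)" by simp
  have "cov (x \<oplus>\<^bsub>C\<^esub> y) = cov x \<oplus>\<^bsub>TbT\<^esub> cov y" if xy: "x \<in> carrier C" "y \<in> carrier C" for x y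
  proof (rule inj_onD[OF inj_incl_TbT])
    have "Delta (x \<oplus>\<^bsub>C\<^esub> y) = Delta x \<oplus>\<^bsub>P0 \<boxtimes>\<^bsub>S\<^esub> TPT\<^esub> Delta y"
      using xy by (simp add: C_simps)
    then show "incl_TbT (cov (x \<oplus>\<^bsub>C\<^esub> y)) = incl_TbT (cov x \<oplus>\<^bsub>TbT\<^esub> cov y)"
      using xy C.M.a_closed[OF xy]
      by (simp only: incl_cov cov_closed add_hom_add[OF right_hom_add_hom[OF incl_TbT_right_hom]])
  qed (rule cov_closed[OF C.M.a_closed[OF xy]], rule TbT.M.a_closed[OF cov_closed[OF xy(1)] cov_closed[OF xy(2)]])
  moreover have "cov (x \<leftharpoonup>\<^bsub>C\<^esub> a) = cov x \<leftharpoonup>\<^bsub>TbT\<^esub> a" if xa: "x \<in> carrier C" "a \<in> carrier R" for x a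
  proof (rule inj_onD[OF inj_incl_TbT])
    have "Delta (x \<leftharpoonup>\<^bsub>C\<^esub> a) = Delta x \<leftharpoonup>\<^bsub>P0 \<boxtimes>\<^bsub>S\<^esub> TPT\<^esub> a"
      using xa by (simp add: C_simps right_hom_ract[OF Delta])
    then show "incl_TbT (cov (x \<leftharpoonup>\<^bsub>C\<^esub> a)) = incl_TbT (cov x \<leftharpoonup>\<^bsub>TbT\<^esub> a)"
      using xa C.ract_closed[OF xa(2,1)]
      by (simp only: incl_cov cov_closed right_hom_ract[OF incl_TbT_right_hom])
  qed (rule cov_closed[OF C.ract_closed[OF xa(2,1)]], rule TbT.ract_closed[OF xa(2) cov_closed[OF xa(1)]])
  ultimately show ?thesis
    by (simp add: right_hom_iff add_hom_iff)
qed

lemma covbar_left_hom [simp]: "covbar \<in> left_hom S D TTb"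
proof -
  interpret TTb: left_module S TTb by simp
  interpret D: left_module S D by simp
  have "covbar (x \<oplus>\<^bsub>D\<^esub> y) = covbar x \<oplus>\<^bsub>TTb\<^esub> covbar y" if xy: "x \<in> carrier D" "y \<in> carrier D" for x y
  proof (rule inj_onD[OF inj_incl_TTb])
    have "DeltaD (x \<oplus>\<^bsub>D\<^esub> y) = DeltaD x \<oplus>\<^bsub>T0 \<boxtimes>\<^bsub>R\<^esub> PTP\<^esub> DeltaD y"
      using add_hom_add[OF left_hom_add_hom[OF DeltaD_left_hom] in_D_TP[OF xy(1)] in_D_TP[OF xy(2)]] by (simp only: D_simps)
    then show "incl_TTb (covbar (x \<oplus>\<^bsub>D\<^esub> y)) = incl_TTb (covbar x \<oplus>\<^bsub>TTb\<^esub> covbar y)"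
      using xy D.M.a_closed[OF xy]
      by (simp only: incl_covbar covbar_closed add_hom_add[OF left_hom_add_hom[OF incl_TTb_left_hom]])
  qed (rule covbar_closed[OF D.M.a_closed[OF xy]], rule TTb.M.a_closed[OF covbar_closed[OF xy(1)] covbar_closed[OF xy(2)]])
  moreover have "covbar (a \<rightharpoonup>\<^bsub>D\<^esub> x) = a \<rightharpoonup>\<^bsub>TTb\<^esub> covbar x" if xa: "x \<in> carrier D" "a \<in> carrier S" for x a
  proof (rule inj_onD[OF inj_incl_TTb])
    have "DeltaD (a \<rightharpoonup>\<^bsub>D\<^esub> x) = a \<rightharpoonup>\<^bsub>T0 \<boxtimes>\<^bsub>R\<^esub> PTP\<^esub> DeltaD x"
      using left_hom_lact[OF DeltaD_left_hom xa(2) in_D_TP[OF xa(1)]] by (simp only: D_simps)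
    then show "incl_TTb (covbar (a \<rightharpoonup>\<^bsub>D\<^esub> x)) = incl_TTb (a \<rightharpoonup>\<^bsub>TTb\<^esub> covbar x)"
      using xa D.lact_closed[OF xa(2,1)]
      by (simp only: incl_covbar covbar_closed left_hom_lact[OF incl_TTb_left_hom])
  qed (rule covbar_closed[OF D.lact_closed[OF xa(2,1)]], rule TTb.lact_closed[OF xa(2) covbar_closed[OF xa(1)]])
  ultimately show ?thesis
    by (simp add: left_hom_iff add_hom_iff)
qed

end

section \<open>Quotients by the kernel of a multiplicative map\<close>

text \<open>Serves both A' and B'. \<open>N\<close> is just an abelian group with a product, so the
  quotient is not treated through ideals of a ring: all arithmetic of cosets is read off from the
  values of \<open>e\<close> in the ring \<open>Q\<close>.\<close>

locale mult_map = N: abelian_group N + Q: ring Q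
  for N :: "('n, 'y) ring_scheme" and Q :: "('q, 'z) ring_scheme" +
  fixes e :: "'n \<Rightarrow> 'q"
  assumes e_hom: "e \<in> add_hom N Q"
    and mult_closed: "\<lbrakk>u \<in> carrier N; v \<in> carrier N\<rbrakk> \<Longrightarrow> u \<otimes>\<^bsub>N\<^esub> v \<in> carrier N"
    and e_mult: "\<lbrakk>u \<in> carrier N; v \<in> carrier N\<rbrakk> \<Longrightarrow> e (u \<otimes>\<^bsub>N\<^esub> v) = e u \<otimes>\<^bsub>Q\<^esub> e v"
begin

definition K where "K = {v \<in> carrier N. e v = \<zero>\<^bsub>Q\<^esub>}"

text \<open>On a coset of \<open>K\<close> the map \<open>e\<close> is constant, so the image is a
  singleton and its element is the induced value.\<close>

definition \<nu> where "\<nu> X = the_elem (e ` X)"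

lemma e_simps [simp]:
  "u \<in> carrier N \<Longrightarrow> e u \<in> carrier Q"
  "\<lbrakk>u \<in> carrier N; v \<in> carrier N\<rbrakk> \<Longrightarrow> e (u \<oplus>\<^bsub>N\<^esub> v) = e u \<oplus>\<^bsub>Q\<^esub> e v"
  "e \<zero>\<^bsub>N\<^esub> = \<zero>\<^bsub>Q\<^esub>"
  using e_hom add_hom_zero[OF N.abelian_group_axioms Q.abelian_group_axioms e_hom]
  by (auto simp: add_hom_iff)

lemma e_minus: "u \<in> carrier N \<Longrightarrow> e (\<ominus>\<^bsub>N\<^esub> u) = \<ominus>\<^bsub>Q\<^esub> e u"
  by (rule add_hom_minus[OF N.abelian_group_axioms Q.abelian_group_axioms e_hom])

text \<open>The cosets of the kernel are the fibres of \<open>e\<close>; every identity between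
  cosets thereby becomes an equation in \<open>Q\<close>.\<close>

lemma coset_eq:
  assumes w: "w \<in> carrier N"
  shows "K +>\<^bsub>N\<^esub> w = {v \<in> carrier N. e v = e w}"
proof (intro equalityI subsetI)
  fix v assume "v \<in> K +>\<^bsub>N\<^esub> w"
  then show "v \<in> {v \<in> carrier N. e v = e w}"
    using w by (auto simp: a_r_coset_def' K_def)
next
  fix v assume v: "v \<in> {v \<in> carrier N. e v = e w}"
  then have "v \<ominus>\<^bsub>N\<^esub> w \<in> K"
    using w by (simp add: K_def a_minus_def e_minus Q.r_neg)
  moreover have "v = (v \<ominus>\<^bsub>N\<^esub> w) \<oplus>\<^bsub>N\<^esub> w"
    using v w by (simp add: a_minus_def N.a_assoc N.l_neg)
  ultimately show "v \<in> K +>\<^bsub>N\<^esub> w"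
    unfolding a_r_coset_def' by blast
qed

lemma nu_coset: "w \<in> carrier N \<Longrightarrow> \<nu> (K +>\<^bsub>N\<^esub> w) = e w"
proof -
  assume "w \<in> carrier N"
  then have "e ` (K +>\<^bsub>N\<^esub> w) = {e w}"
    by (auto simp: coset_eq)
  then show ?thesis by (simp add: \<nu>_def)
qed

lemma coset_eq_iff:
  assumes "u \<in> carrier N" "v \<in> carrier N"
  shows "K +>\<^bsub>N\<^esub> u = K +>\<^bsub>N\<^esub> v \<longleftrightarrow> e u = e v"
proof
  assume "K +>\<^bsub>N\<^esub> u = K +>\<^bsub>N\<^esub> v"
  then show "e u = e v"
    using nu_coset[OF assms(1)] nu_coset[OF assms(2)] by metis
next
  assume "e u = e v"
  then show "K +>\<^bsub>N\<^esub> u = K +>\<^bsub>N\<^esub> v"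
    by (simp only: coset_eq[OF assms(1)] coset_eq[OF assms(2)])
qed

lemma carrier_quot: "carrier (N Quot K) = (\<lambda>w. K +>\<^bsub>N\<^esub> w) ` carrier N"
  by (auto simp: FactRing_def A_RCOSETS_def' )

lemma quot_add:
  assumes uv: "u \<in> carrier N" "v \<in> carrier N"
  shows "(K +>\<^bsub>N\<^esub> u) \<oplus>\<^bsub>N Quot K\<^esub> (K +>\<^bsub>N\<^esub> v) = K +>\<^bsub>N\<^esub> (u \<oplus>\<^bsub>N\<^esub> v)"
proof -
  have "(K +>\<^bsub>N\<^esub> u) \<oplus>\<^bsub>N Quot K\<^esub> (K +>\<^bsub>N\<^esub> v) = (\<Union>a\<in>K +>\<^bsub>N\<^esub> u. \<Union>b\<in>K +>\<^bsub>N\<^esub> v. {a \<oplus>\<^bsub>N\<^esub> b})"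
    by (simp add: FactRing_def set_add_def')
  also have "\<dots> = K +>\<^bsub>N\<^esub> (u \<oplus>\<^bsub>N\<^esub> v)"
  proof (intro equalityI subsetI)
    fix w assume "w \<in> (\<Union>a\<in>K +>\<^bsub>N\<^esub> u. \<Union>b\<in>K +>\<^bsub>N\<^esub> v. {a \<oplus>\<^bsub>N\<^esub> b})"
    then show "w \<in> K +>\<^bsub>N\<^esub> (u \<oplus>\<^bsub>N\<^esub> v)"
      using uv by (auto simp: coset_eq)
  next
    fix w assume "w \<in> K +>\<^bsub>N\<^esub> (u \<oplus>\<^bsub>N\<^esub> v)"
    then have w: "w \<in> carrier N" "e w = e u \<oplus>\<^bsub>Q\<^esub> e v"
      using uv by (simp_all add: coset_eq)
    have "\<ominus>\<^bsub>N\<^esub> u \<oplus>\<^bsub>N\<^esub> w \<in> K +>\<^bsub>N\<^esub> v"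
      using uv w by (simp add: coset_eq e_minus Q.r_neg1)
    moreover have "u \<in> K +>\<^bsub>N\<^esub> u" "w = u \<oplus>\<^bsub>N\<^esub> (\<ominus>\<^bsub>N\<^esub> u \<oplus>\<^bsub>N\<^esub> w)"
      using uv w by (simp_all add: coset_eq N.r_neg2)
    ultimately show "w \<in> (\<Union>a\<in>K +>\<^bsub>N\<^esub> u. \<Union>b\<in>K +>\<^bsub>N\<^esub> v. {a \<oplus>\<^bsub>N\<^esub> b})"
      by blast
  qed
  finally show ?thesis .
qed

lemma quot_mult:
  assumes uv: "u \<in> carrier N" "v \<in> carrier N"
  shows "(K +>\<^bsub>N\<^esub> u) \<otimes>\<^bsub>N Quot K\<^esub> (K +>\<^bsub>N\<^esub> v) = K +>\<^bsub>N\<^esub> (u \<otimes>\<^bsub>N\<^esub> v)"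
proof -
  have eq: "K +>\<^bsub>N\<^esub> (a \<otimes>\<^bsub>N\<^esub> b) = K +>\<^bsub>N\<^esub> (u \<otimes>\<^bsub>N\<^esub> v)"
    if "a \<in> K +>\<^bsub>N\<^esub> u" "b \<in> K +>\<^bsub>N\<^esub> v" for a b
    using that uv by (simp add: coset_eq mult_closed e_mult)
  have mem: "u \<in> K +>\<^bsub>N\<^esub> u" "v \<in> K +>\<^bsub>N\<^esub> v"
    using uv by (simp_all add: coset_eq)
  have "(K +>\<^bsub>N\<^esub> u) \<otimes>\<^bsub>N Quot K\<^esub> (K +>\<^bsub>N\<^esub> v) = (\<Union>a\<in>K +>\<^bsub>N\<^esub> u. \<Union>b\<in>K +>\<^bsub>N\<^esub> v. K +>\<^bsub>N\<^esub> (a \<otimes>\<^bsub>N\<^esub> b))"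
    by (simp add: FactRing_def rcoset_mult_def)
  also have "\<dots> = (\<Union>a\<in>K +>\<^bsub>N\<^esub> u. \<Union>b\<in>K +>\<^bsub>N\<^esub> v. K +>\<^bsub>N\<^esub> (u \<otimes>\<^bsub>N\<^esub> v))"
    by (simp only: eq cong: SUP_cong)
  also have "\<dots> = K +>\<^bsub>N\<^esub> (u \<otimes>\<^bsub>N\<^esub> v)"
    using mem by blast
  finally show ?thesis .
qed

lemma nu_rng_hom: "\<nu> \<in> rng_hom (N Quot K) Q"
  unfolding rng_hom_def
proof (rule IntI)
  show "\<nu> \<in> add_hom (N Quot K) Q"
    by (auto simp: add_hom_iff carrier_quot nu_coset quot_add)
  show "\<nu> \<in> hom (N Quot K) Q"
    by (auto simp: hom_def carrier_quot nu_coset quot_mult mult_closed e_mult)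
qed

lemma nu_rng_iso:
  assumes "e ` carrier N = carrier Q"
  shows "\<nu> \<in> rng_iso (N Quot K) Q"
proof -
  have "inj_on \<nu> (carrier (N Quot K))"
    by (clarsimp simp: inj_on_def carrier_quot nu_coset coset_eq_iff)
  moreover have "\<nu> ` carrier (N Quot K) = carrier Q"
    using assms by (auto simp: carrier_quot nu_coset image_image)
  ultimately show ?thesis
    by (simp add: rng_iso_def nu_rng_hom bij_betw_def)
qed

text \<open>A coset is determined by its value under \<open>e\<close>, so associativity,
  distributivity and the unit laws are inherited from \<open>Q\<close>, with any preimage of 1
  representing the unit.\<close>

lemma unital_quot:
  assumes surj: "e ` carrier N = carrier Q"
  shows "unital (N Quot K)"
proof -
  obtain i where i: "i \<in> carrier N" "e i = \<one>\<^bsub>Q\<^esub>"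
    using surj Q.one_closed by (metis imageE)
  let ?P = "(N Quot K)\<lparr>one := K +>\<^bsub>N\<^esub> i\<rparr>"
  have zero: "\<zero>\<^bsub>N Quot K\<^esub> = K +>\<^bsub>N\<^esub> \<zero>\<^bsub>N\<^esub>"
    by (auto simp: FactRing_def coset_eq K_def)
  have "ring ?P"
  proof (rule ringI)
    show "abelian_group ?P"
    proof (rule abelian_groupI)
      fix x assume "x \<in> carrier ?P"
      then obtain u where u: "u \<in> carrier N" "x = K +>\<^bsub>N\<^esub> u" by (auto simp: carrier_quot)
      then have "(K +>\<^bsub>N\<^esub> (\<ominus>\<^bsub>N\<^esub> u)) \<oplus>\<^bsub>?P\<^esub> x = \<zero>\<^bsub>?P\<^esub>"
        by (simp add: quot_add zero N.l_neg)
      then show "\<exists>y\<in>carrier ?P. y \<oplus>\<^bsub>?P\<^esub> x = \<zero>\<^bsub>?P\<^esub>"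
        using u by (intro bexI[of _ "K +>\<^bsub>N\<^esub> (\<ominus>\<^bsub>N\<^esub> u)"]) (auto simp: carrier_quot)
    qed (clarsimp simp: carrier_quot quot_add zero N.a_ac; blast?)+
    show "Group.monoid ?P"
      by (rule monoidI)
        (clarsimp simp: carrier_quot quot_mult mult_closed e_mult Q.m_assoc i coset_eq_iff; blast intro: mult_closed i)+
  qed (clarsimp simp: carrier_quot quot_mult quot_add mult_closed e_mult Q.l_distr Q.r_distr coset_eq_iff)+
  then show ?thesis
    unfolding unital_def using i by (auto simp: carrier_quot)
qed

end

lemma add_hom_diff_hom:
  assumes "abelian_group N" "f \<in> add_hom M N" "g \<in> add_hom M N"
  shows "(\<lambda>x. f x \<ominus>\<^bsub>N\<^esub> g x) \<in> add_hom M N"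
proof -
  interpret N: abelian_group N by fact
  show ?thesis
    using assms(2,3) by (auto simp: add_hom_iff a_minus_def N.minus_add N.a_ac)
qed

section \<open>The evaluation maps\<close>

context herd
begin

text \<open>On elementary tensors \<open>ev (p \<otimes> x) q = p evh (x \<otimes> q)\<close>, and
  the right-hand side makes sense for every \<open>u\<close> in \<open>TP\<close>. With this closed
  form, balancedness of the outer map is just linearity of \<open>evh\<close>.\<close>

lemma h_inner:
  assumes "p \<in> carrier That" "u \<in> carrier TP"
  shows "tensor_lift R T0 P0 That (\<lambda>x q. E p x \<rightharpoonup>\<^bsub>That\<^esub> q) u = p \<leftharpoonup>\<^bsub>That\<^esub> evh u"
  by (rule tensor_lift_eq[OF T0_bimodule(3) P0_bimodule(2) _ _ assms(2)])
    (use assms(1) in \<open>simp_all add: add_hom_iff That.ract_add\<close>)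

lemma h_balanced: "balanced S P0 TP That (\<lambda>p. tensor_lift R T0 P0 That (\<lambda>x q. E p x \<rightharpoonup>\<^bsub>That\<^esub> q))"
proof -
  interpret TP: abelian_group TP by simp
  interpret TPl: left_module S TP by simp
  show ?thesis
    unfolding balanced_def
    using TP.a_closed TPl.lact_closed
    by (simp add: h_inner That.ract_add left_hom_lact[OF evh_left_hom] That.ract_mult
        right_module_abelian_group[OF That_bimodule(3)])
qed

lemma h_add_hom: "h \<in> add_hom PTP That"
  unfolding h_def by (rule tensor_lift_hom[OF _ _ h_balanced]) simp_all

lemma h_tens [simp]: "\<lbrakk>p \<in> carrier That; u \<in> carrier TP\<rbrakk> \<Longrightarrow> h (tens S P0 TP p u) = p \<leftharpoonup>\<^bsub>That\<^esub> evh u"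
  unfolding h_def by (subst tensor_lift_tens[OF _ _ h_balanced]) (simp_all add: h_inner)

lemmas h_closed [simp] = add_hom_closed[OF h_add_hom]
lemmas h_add [simp] = add_hom_add[OF h_add_hom]

lemmas PTP_induct = tensor_induct[OF P0_bimodule(3) tensor_left_module[OF T0_bimodule(1) P0_bimodule(2)],
    consumes 1, case_names tens add]
lemmas PTP_induct3 = tensor_induct_right[OF P0_bimodule(3) T0_bimodule(1) P0_bimodule(2), consumes 1, case_names tens add]

lemma h_left_hom: "h \<in> left_hom R PTP P0"
  unfolding left_hom_iff
proof (intro conjI ballI)
  show "h \<in> add_hom PTP P0" using h_add_hom by (simp add: add_hom_iff)
  fix a u assume au: "a \<in> carrier R" "u \<in> carrier PTP"
  from au(2,1) show "h (a \<rightharpoonup>\<^bsub>PTP\<^esub> u) = a \<rightharpoonup>\<^bsub>P0\<^esub> h u"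
    by (induction rule: PTP_induct) (simp_all add: That.lact_ract)
qed

lemma h_right_hom: "h \<in> right_hom S PTP P0"
  unfolding right_hom_iff
proof (intro conjI ballI)
  show "h \<in> add_hom PTP P0" using h_add_hom by (simp add: add_hom_iff)
  fix a u assume au: "a \<in> carrier S" "u \<in> carrier PTP"
  from au(2,1) show "h (u \<leftharpoonup>\<^bsub>PTP\<^esub> a) = h u \<leftharpoonup>\<^bsub>P0\<^esub> a"
    by (induction rule: PTP_induct) (simp_all add: That.ract_mult right_hom_ract[OF evh_right_hom])
qed

lemma h_Tbar_left_hom [simp]: "h \<in> left_hom R Tbar P0" and h_Tbar_right_hom [simp]: "h \<in> right_hom S Tbar P0"
  using h_left_hom h_right_hom by (simp_all add: left_hom_iff right_hom_iff add_hom_iff)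

lemmas TbT_induct = tensor_induct[OF Tbar_bimodule(3) T0_bimodule(2), consumes 1, case_names tens add]
lemmas TTb_induct = tensor_induct[OF T0_bimodule(3) Tbar_bimodule(2), consumes 1, case_names tens add]

lemma eval_A_left_hom: "eval_A \<in> left_hom R TbT A0"
proof -
  have "(\<lambda>w. ev (tensor_map S Tbar T0 P0 T0 h id w)) \<in> left_hom R TbT A0"
    by (rule left_hom_comp[where N = PT]) simp_all
  then show ?thesis by (simp add: eval_A_def[abs_def])
qed

lemma eval_A_right_hom: "eval_A \<in> right_hom R TbT A0"
proof -
  have "(\<lambda>w. ev (tensor_map S Tbar T0 P0 T0 h id w)) \<in> right_hom R TbT A0"
    by (rule right_hom_comp[where N = PT]) simp_all
  then show ?thesis by (simp add: eval_A_def[abs_def])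
qed

lemma eval_B_left_hom: "eval_B \<in> left_hom S TTb B0"
proof -
  have "(\<lambda>w. evh (tensor_map R T0 Tbar T0 P0 id h w)) \<in> left_hom S TTb B0"
    by (rule left_hom_comp[where N = TP]) simp_all
  then show ?thesis by (simp add: eval_B_def[abs_def])
qed

lemma eval_B_right_hom: "eval_B \<in> right_hom S TTb B0"
proof -
  have "(\<lambda>w. evh (tensor_map R T0 Tbar T0 P0 id h w)) \<in> right_hom S TTb B0"
    by (rule right_hom_comp[where N = TP]) simp_all
  then show ?thesis by (simp add: eval_B_def[abs_def])
qed

lemma eval_A_add_hom: "eval_A \<in> add_hom TbT A"
  using left_hom_add_hom[OF eval_A_left_hom] by (simp add: add_hom_iff)

lemma eval_B_add_hom: "eval_B \<in> add_hom TTb B"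
  using left_hom_add_hom[OF eval_B_left_hom] by (simp add: add_hom_iff)

lemmas eval_A_simps [simp] = add_hom_closed[OF eval_A_add_hom] add_hom_add[OF eval_A_add_hom]
lemmas eval_B_simps [simp] = add_hom_closed[OF eval_B_add_hom] add_hom_add[OF eval_B_add_hom]

lemma eval_A_tens [simp]: "\<lbrakk>w \<in> carrier Tbar; x \<in> carrier T\<rbrakk> \<Longrightarrow> eval_A (tens S Tbar T0 w x) = E (h w) x"
  by (simp add: eval_A_def)

lemma eval_B_tens [simp]: "\<lbrakk>w \<in> carrier Tbar; x \<in> carrier T\<rbrakk> \<Longrightarrow> eval_B (tens R T0 Tbar x w) = F x (h w)"
  by (simp add: eval_B_def)

text \<open>The right action of A through the last factor T. The bimodule \<open>TbT\<close> itself
  is acted on by R only, but the product multiplies by elements of A.\<close>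

abbreviation "ractA a \<equiv> tensor_map S Tbar T0 Tbar T0 id (\<lambda>x. x \<leftharpoonup>\<^bsub>T\<^esub> a)"
abbreviation "lactB b \<equiv> tensor_map R T0 Tbar T0 Tbar (\<lambda>x. b \<rightharpoonup>\<^bsub>T\<^esub> x) id"

lemma eval_A_ractA: "\<lbrakk>u \<in> carrier TbT; a \<in> carrier A\<rbrakk> \<Longrightarrow> eval_A (ractA a u) = eval_A u \<otimes>\<^bsub>A\<^esub> a"
  by (induction rule: TbT_induct) (simp_all add: alpha.S.l_distr)

lemma eval_B_lactB: "\<lbrakk>u \<in> carrier TTb; b \<in> carrier B\<rbrakk> \<Longrightarrow> eval_B (lactB b u) = b \<otimes>\<^bsub>B\<^esub> eval_B u"
  by (induction rule: TTb_induct) (simp_all add: beta.S.r_distr)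

text \<open>\<open>evh (x \<otimes> p) y ev (q \<otimes> z)\<close> equals
  \<open>x ev (p \<otimes> y) ev (q \<otimes> z)\<close>, and by left linearity \<open>ev (p
  \<otimes> y) ev (q \<otimes> z) = ev (p evh (y \<otimes> q) \<otimes> z)\<close>. So
  \<open>y\<close> and \<open>q\<close> enter only through \<open>evh\<close>.\<close>

lemma chi_inner1:
  assumes "x \<in> carrier T" "z \<in> carrier T" "p \<in> carrier That" "u \<in> carrier TP"
  shows "tensor_lift R T0 P0 T (\<lambda>y q. (F x p \<rightharpoonup>\<^bsub>T\<^esub> y) \<leftharpoonup>\<^bsub>T\<^esub> E q z) u = x \<leftharpoonup>\<^bsub>T\<^esub> E (p \<leftharpoonup>\<^bsub>That\<^esub> evh u) z"
proof (rule tensor_lift_eq[OF T0_bimodule(3) P0_bimodule(2) _ _ assms(4)])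
  show "(\<lambda>u. x \<leftharpoonup>\<^bsub>T\<^esub> E (p \<leftharpoonup>\<^bsub>That\<^esub> evh u) z) \<in> add_hom TP T"
    using assms tens_add_left[of S P0 T0 _ _ z]
    by (simp add: add_hom_iff That.ract_add T.ract_add)
qed (use assms in \<open>simp add: T.ract_mult\<close>)

text \<open>The inner form depends on \<open>p\<close> and \<open>u\<close> through
  \<open>p evh u\<close>, which is the value of \<open>h\<close>; so this layer of the lift is
  evaluated by \<open>h w\<close>.\<close>

lemma chi_inner2:
  assumes "x \<in> carrier T" "z \<in> carrier T" "w \<in> carrier PTP"
  shows "tensor_lift S P0 TP T (\<lambda>p. tensor_lift R T0 P0 T (\<lambda>y q. (F x p \<rightharpoonup>\<^bsub>T\<^esub> y) \<leftharpoonup>\<^bsub>T\<^esub> E q z)) w = x \<leftharpoonup>\<^bsub>T\<^esub> E (h w) z"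
proof (rule tensor_lift_eq[OF _ _ _ _ assms(3)])
  show "(\<lambda>w. x \<leftharpoonup>\<^bsub>T\<^esub> E (h w) z) \<in> add_hom PTP T"
    using assms tens_add_left[of S P0 T0 _ _ z]
    by (simp add: add_hom_iff T.ract_add)
qed (use assms in \<open>simp_all add: chi_inner1\<close>)

lemma chi_inner3:
  assumes "x \<in> carrier T" "v \<in> carrier TbT"
  shows "tensor_lift S Tbar T0 T (\<lambda>w z. tensor_lift S P0 TP T (\<lambda>p. tensor_lift R T0 P0 T
      (\<lambda>y q. (F x p \<rightharpoonup>\<^bsub>T\<^esub> y) \<leftharpoonup>\<^bsub>T\<^esub> E q z)) w) v = x \<leftharpoonup>\<^bsub>T\<^esub> eval_A v"
proof (rule tensor_lift_eq[OF _ _ _ _ assms(2)])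
  show "(\<lambda>v. x \<leftharpoonup>\<^bsub>T\<^esub> eval_A v) \<in> add_hom TbT T"
    using assms(1) by (simp add: add_hom_iff T.ract_add)
qed (use assms in \<open>simp_all add: chi_inner2\<close>)

lemma chi_balanced: "balanced R T0 TbT T (\<lambda>x. tensor_lift S Tbar T0 T (\<lambda>w z. tensor_lift S P0 TP T (\<lambda>p. tensor_lift R T0 P0 T
      (\<lambda>y q. (F x p \<rightharpoonup>\<^bsub>T\<^esub> y) \<leftharpoonup>\<^bsub>T\<^esub> E q z)) w))"
proof -
  interpret TbT: left_module R TbT by simp
  show ?thesis
    unfolding balanced_def
    using TbT.lact_closed TbT.M.a_closed
    by (simp add: chi_inner3 T.ract_add left_hom_lact[OF eval_A_left_hom] T.ract_mult
        right_module_abelian_group[OF T_bimodule(3)])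
qed

lemma chi_add_hom: "chi \<in> add_hom (T0 \<boxtimes>\<^bsub>R\<^esub> TbT) T"
  unfolding chi_def by (rule tensor_lift_hom[OF _ _ chi_balanced]) simp_all

lemma chi_tens [simp]: "\<lbrakk>x \<in> carrier T; v \<in> carrier TbT\<rbrakk> \<Longrightarrow> chi (tens R T0 TbT x v) = x \<leftharpoonup>\<^bsub>T\<^esub> eval_A v"
  unfolding chi_def by (subst tensor_lift_tens[OF _ _ chi_balanced]) (simp_all add: chi_inner3)

lemmas chi_simps [simp] = add_hom_closed[OF chi_add_hom] add_hom_add[OF chi_add_hom]

lemmas TTbT_induct = tensor_induct[OF T0_bimodule(3) tensor_left_module[OF Tbar_bimodule(1) T0_bimodule(2)],
    consumes 1, case_names tens add]

lemma chi_left_hom [simp]: "chi \<in> left_hom S (T0 \<boxtimes>\<^bsub>R\<^esub> TbT) T0"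
  unfolding left_hom_iff
proof (intro conjI ballI)
  show "chi \<in> add_hom (T0 \<boxtimes>\<^bsub>R\<^esub> TbT) T0" using chi_add_hom by (simp add: add_hom_iff)
  fix a u assume au: "a \<in> carrier S" "u \<in> carrier (T0 \<boxtimes>\<^bsub>R\<^esub> TbT)"
  from au(2,1) show "chi (a \<rightharpoonup>\<^bsub>T0 \<boxtimes>\<^bsub>R\<^esub> TbT\<^esub> u) = a \<rightharpoonup>\<^bsub>T0\<^esub> chi u"
    by (induction rule: TTbT_induct) (simp_all add: T.lact_ract)
qed

lemma chi_right_hom [simp]: "chi \<in> right_hom R (T0 \<boxtimes>\<^bsub>R\<^esub> TbT) T0"
  unfolding right_hom_iff
proof (intro conjI ballI)
  show "chi \<in> add_hom (T0 \<boxtimes>\<^bsub>R\<^esub> TbT) T0" using chi_add_hom by (simp add: add_hom_iff)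
  fix a u assume au: "a \<in> carrier R" "u \<in> carrier (T0 \<boxtimes>\<^bsub>R\<^esub> TbT)"
  from au(2,1) show "chi (u \<leftharpoonup>\<^bsub>T0 \<boxtimes>\<^bsub>R\<^esub> TbT\<^esub> a) = chi u \<leftharpoonup>\<^bsub>T0\<^esub> a"
    by (induction rule: TTbT_induct) (simp_all add: T.ract_mult right_hom_ract[OF eval_A_right_hom])
qed

lemma mult_A_add_hom: "mult_A \<in> add_hom (TbT \<boxtimes>\<^bsub>R\<^esub> TbT) TbT"
  unfolding mult_A_def comp_def
  by (rule add_homI) simp_all

lemma mult_A_tens:
  assumes "u \<in> carrier TbT" "v \<in> carrier TbT"
  shows "mult_A (tens R TbT TbT u v) = ractA (eval_A v) u"
  using assms
proof (induction rule: TbT_induct)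
  case (tens w x)
  then show ?case by (simp add: mult_A_def)
next
  case (add u u')
  then show ?case
    using add_hom_add[OF mult_A_add_hom] by (simp add: tens_add_left)
qed

lemma chi_assoc_right_hom: "(\<lambda>u. chi (assoc R S T0 Tbar T0 u)) \<in> right_hom R (TTb \<boxtimes>\<^bsub>S\<^esub> T0) T0"
  by (rule right_hom_comp[where N = "T0 \<boxtimes>\<^bsub>R\<^esub> TbT"]) simp_all

lemma mult_B_add_hom: "mult_B \<in> add_hom (TTb \<boxtimes>\<^bsub>S\<^esub> TTb) TTb"
  unfolding mult_B_def comp_def
  by (rule add_homI) (simp_all add: chi_assoc_right_hom)

text \<open>With the other bracketing, \<open>x \<cdot> ev\<close> turns into
  \<open>evh \<cdot> y\<close> by the compatibility of the evaluations, so the same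
  \<open>chi\<close> is left multiplication by \<open>eval_B\<close>. This gives the product of
  \<open>TTb\<close> as \<open>eval_B u \<cdot> v\<close>.\<close>

lemma chi_assoc_tens:
  assumes "u \<in> carrier TTb" "x \<in> carrier T"
  shows "chi (assoc R S T0 Tbar T0 (tens S TTb T0 u x)) = eval_B u \<rightharpoonup>\<^bsub>T\<^esub> x"
  using assms by (induction rule: TTb_induct) (simp_all add: tens_add_left T.add_lact)

lemma mult_B_tens:
  assumes "v \<in> carrier TTb" "u \<in> carrier TTb"
  shows "mult_B (tens S TTb TTb u v) = lactB (eval_B u) v"
  using assms
proof (induction rule: TTb_induct)
  case (tens x w)
  then show ?case by (simp add: mult_B_def comp_def chi_assoc_right_hom chi_assoc_tens)
next
  case (add v v')
  then show ?case
    using add_hom_add[OF mult_B_add_hom] by (simp add: tens_add_right)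
qed

text \<open>\<open>mu\<close> sends \<open>x \<otimes> p \<otimes> y\<close> to \<open>x ev (p \<otimes> y) = evh (x \<otimes> p) y\<close>.\<close>

definition mu where "mu = tensor_lift R T0 PT T (\<lambda>x v. x \<leftharpoonup>\<^bsub>T\<^esub> ev v)"

lemma mu_balanced: "balanced R T0 PT T (\<lambda>x v. x \<leftharpoonup>\<^bsub>T\<^esub> ev v)"
  unfolding balanced_def
  by (simp add: T.ract_add left_hom_lact[OF ev_left_hom] T.ract_mult right_module_abelian_group[OF T_bimodule(3)])

lemma mu_add_hom: "mu \<in> add_hom TPT T"
  unfolding mu_def by (rule tensor_lift_hom[OF _ _ mu_balanced]) simp_all

lemma mu_tens [simp]: "\<lbrakk>x \<in> carrier T; v \<in> carrier PT\<rbrakk> \<Longrightarrow> mu (tens R T0 PT x v) = x \<leftharpoonup>\<^bsub>T\<^esub> ev v"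
  unfolding mu_def by (subst tensor_lift_tens[OF _ _ mu_balanced]) simp_all

lemmas mu_simps [simp] = add_hom_closed[OF mu_add_hom] add_hom_add[OF mu_add_hom]

lemma mu_left_hom [simp]: "mu \<in> left_hom S TPT T0"
  unfolding left_hom_iff
proof (intro conjI ballI)
  show "mu \<in> add_hom TPT T0" using mu_add_hom by (simp add: add_hom_iff)
  fix a u assume au: "a \<in> carrier S" "u \<in> carrier TPT"
  from au(2,1) show "mu (a \<rightharpoonup>\<^bsub>TPT\<^esub> u) = a \<rightharpoonup>\<^bsub>T0\<^esub> mu u"
    by (induction rule: TPT_induct) (simp_all add: T.lact_ract)
qed

text \<open>\<open>mu\<close> factors through T \<otimes> A as evaluation followed by the action,
  and the counit law sends \<open>\<gamma> x\<close> to \<open>x \<otimes> 1\<close>. Thus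
  \<open>mu\<close> is a retraction of the shepherd.\<close>

lemma mu_gamma [simp]:
  assumes x: "x \<in> carrier T"
  shows "mu (\<gamma> x) = x"
proof -
  have bal: "balanced R T0 A0 T (\<lambda>x a. x \<leftharpoonup>\<^bsub>T\<^esub> a)"
    unfolding balanced_def
    by (simp add: T.ract_add T.ract_mult right_module_abelian_group[OF T_bimodule(3)])
  let ?act = "tensor_lift R T0 A0 T (\<lambda>x a. x \<leftharpoonup>\<^bsub>T\<^esub> a)"
  note act = tensor_lift_hom[OF _ _ bal, simplified] tensor_lift_tens[OF _ _ bal, simplified]
  have "mu t = ?act (tensor_map R T0 PT T0 A0 id ev t)" if "t \<in> carrier TPT" for t
    using that by (induction rule: TPT_induct) (simp_all add: act add_hom_add[OF act(1)])
  then show ?thesis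
    using x by (simp add: ev_shepherd act T.ract_one)
qed

text \<open>\<open>cov c\<close> is known only through its image in the fourfold tensor product, so
  \<open>eval_A\<close> has to be expressed there before it can be computed on
  \<open>cov c\<close>.\<close>

lemma eval_A_incl:
  assumes "w \<in> carrier TbT"
  shows "eval_A w = ev (tensor_map S P0 TPT P0 T0 id mu (incl_TbT w))"
proof -
  have aux: "ev (tensor_map S P0 TPT P0 T0 id mu (JJ (tens S PTP T0 w z))) = E (h w) z"
    if "w \<in> carrier PTP" "z \<in> carrier T" for w z
    using that
  proof (induction rule: PTP_induct3)
    case (add u v)
    then show ?case
      using tens_add_left[of S P0 T0 "h u" "h v" z] by (simp add: tens_add_left[of S PTP T0])
  qed simp_all
  from assms show ?thesis
    unfolding incl_TbT_eq
    by (induction rule: TbT_induct) (simp_all add: aux)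
qed

text \<open>Evaluating the coproduct of \<open>x \<otimes> q\<close> in this way contracts the three
  factors of \<open>\<gamma> x\<close> by \<open>mu\<close>, and \<open>mu (\<gamma> x) = x\<close>
  leaves \<open>evh (x \<otimes> q)\<close>.\<close>

lemma evh_h_DeltaD:
  assumes "d \<in> carrier TP"
  shows "evh (tensor_map R T0 PTP T0 P0 id h (DeltaD d)) = evh d"
proof -
  note [simp] = h_left_hom
  have aux: "evh (tensor_map R T0 PTP T0 P0 id h (tensor_map R T0 (PT \<boxtimes>\<^bsub>R\<^esub> P0) T0 PTP id (assoc S R P0 T0 P0)
       (assoc R R T0 PT P0 (tens R TPT P0 s q)))) = F (mu s) q"
    if "s \<in> carrier TPT" "q \<in> carrier That" for s q
    using that
  proof (induction rule: TPT_induct3)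
    case (tens x p y)
    \<comment> \<open>Rewriting \<open>x ev (p \<otimes> y)\<close> as
      \<open>evh (x \<otimes> p) y\<close> lets left B-linearity extract the factor; right
      B-linearity extracts the same product from
      \<open>evh (x \<otimes> p evh (y \<otimes> q))\<close>.\<close>
    then have "F (x \<leftharpoonup>\<^bsub>T\<^esub> E p y) q = F x p \<otimes>\<^bsub>B\<^esub> F y q"
      by (simp flip: evh_ev)
    then show ?case using tens evh_ract[of "F y q" p x]
      by (simp del: ev_evh ev_evh')
  next
    case (add u v)
    then show ?case
      using tens_T0_add[of P0 "mu u" "mu v" q] by (simp add: tens_add_left[of R TPT P0])
  qed
  from assms show ?thesis
  proof (induction rule: TP_induct)
    case (add u v)
    have "DeltaD (u \<oplus>\<^bsub>TP\<^esub> v) = DeltaD u \<oplus>\<^bsub>T0 \<boxtimes>\<^bsub>R\<^esub> PTP\<^esub> DeltaD v"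
      by (rule add_hom_add[OF left_hom_add_hom[OF DeltaD_left_hom] add(1,2)])
    with add show ?case by simp
  qed (simp add: aux)
qed

end

section \<open>The defining relations of A' and B'\<close>

context tame_herd
begin

lemma counit_C:
  assumes "c \<in> carrier C"
  shows "counit_C c \<in> carrier R" "\<alpha> (counit_C c) = ev c"
  using ev_C[OF assms] unfolding counit_C_def by (simp_all add: inv_into_into f_inv_into_f)

lemma counit_D:
  assumes "d \<in> carrier D"
  shows "counit_D d \<in> carrier S" "\<beta> (counit_D d) = evh d"
  using evh_D[OF assms] unfolding counit_D_def by (simp_all add: inv_into_into f_inv_into_f)

text \<open>Injectivity of \<alpha> determines the chosen preimage by its value in A, so that
  additivity, linearity and unit values of the counit can all be checked in A.\<close>

lemma counit_C_eqI: "\<lbrakk>c \<in> carrier C; r \<in> carrier R; ev c = \<alpha> r\<rbrakk> \<Longrightarrow> counit_C c = r"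
  using inj_onD[OF inj_alpha] counit_C by metis

lemma counit_D_eqI: "\<lbrakk>d \<in> carrier D; s \<in> carrier S; evh d = \<beta> s\<rbrakk> \<Longrightarrow> counit_D d = s"
  using inj_onD[OF inj_beta] counit_D by metis

lemma counit_C_balanced: "balanced R C TbT TbT (\<lambda>c w. counit_C c \<rightharpoonup>\<^bsub>TbT\<^esub> w)"
proof -
  interpret TbT: left_module R TbT by simp
  interpret C: right_module R C by simp
  have add: "counit_C (c \<oplus>\<^bsub>C\<^esub> c') = counit_C c \<oplus>\<^bsub>R\<^esub> counit_C c'" if "c \<in> carrier C" "c' \<in> carrier C" for c c'
    using that C.M.a_closed[OF that]
    by (intro counit_C_eqI) (simp_all add: counit_C C_simps)
  have mult: "counit_C (c \<leftharpoonup>\<^bsub>C\<^esub> r) = counit_C c \<otimes>\<^bsub>R\<^esub> r" if "c \<in> carrier C" "r \<in> carrier R" for c r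
    using that C.ract_closed[OF that(2,1)]
    by (intro counit_C_eqI) (simp_all add: counit_C C_simps right_hom_ract[OF ev_right_hom])
  show ?thesis
    unfolding balanced_def
    by (auto simp only: add mult counit_C TbT.lact_closed TbT.lact_add TbT.add_lact TbT.mult_lact TbT.M.abelian_group_axioms)
qed

lemma counit_D_balanced: "balanced S TTb D TTb (\<lambda>w d. w \<leftharpoonup>\<^bsub>TTb\<^esub> counit_D d)"
proof -
  interpret TTb: right_module S TTb by simp
  interpret D: left_module S D by simp
  have add: "counit_D (d \<oplus>\<^bsub>D\<^esub> d') = counit_D d \<oplus>\<^bsub>S\<^esub> counit_D d'" if "d \<in> carrier D" "d' \<in> carrier D" for d d'
    using that D.M.a_closed[OF that]
    by (intro counit_D_eqI) (simp_all add: counit_D D_simps)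
  have mult: "counit_D (s \<rightharpoonup>\<^bsub>D\<^esub> d) = s \<otimes>\<^bsub>S\<^esub> counit_D d" if "d \<in> carrier D" "s \<in> carrier S" for d s
    using that D.lact_closed[OF that(2,1)]
    by (intro counit_D_eqI) (simp_all add: counit_D D_simps left_hom_lact[OF evh_left_hom])
  show ?thesis
    unfolding balanced_def
    by (auto simp only: add mult counit_D TTb.ract_closed TTb.add_ract TTb.ract_add TTb.ract_mult TTb.M.abelian_group_axioms)
qed

text \<open>Through the inclusion, \<open>eval_A (cov c)\<close> is \<open>ev\<close> of the
  coproduct with \<open>mu\<close> applied to the value of \<open>\<gamma>\<close>, and
  \<open>mu\<close> undoes \<open>\<gamma>\<close>.\<close>

lemma eval_A_cov: "c \<in> carrier C \<Longrightarrow> eval_A (cov c) = ev c"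
proof -
  assume c: "c \<in> carrier C"
  have "eval_A (cov c) = ev (tensor_map S P0 TPT P0 T0 id mu (Delta c))"
    using c by (simp only: eval_A_incl cov_closed incl_cov)
  also have "tensor_map S P0 TPT P0 T0 id mu (Delta c) = c"
  proof -
    have "tensor_map S P0 TPT P0 T0 id mu (Delta c) = tensor_map S P0 T0 P0 T0 (\<lambda>p. id (id p)) (\<lambda>y. mu (\<gamma> y)) c"
      using c by (intro tensor_map_comp) simp_all
    also have "\<dots> = c"
      using c by (intro tensor_map_id) simp_all
    finally show ?thesis .
  qed
  finally show ?thesis .
qed

lemma eval_B_covbar: "d \<in> carrier D \<Longrightarrow> eval_B (covbar d) = evh d"
proof -
  assume d: "d \<in> carrier D"
  have "tensor_map R T0 Tbar T0 P0 id h w = tensor_map R T0 PTP T0 P0 id h (incl_TTb w)" if "w \<in> carrier TTb" for w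
    using that unfolding incl_TTb_def by (subst tensor_map_comp) (simp_all add: h_left_hom)
  then have "eval_B (covbar d) = evh (tensor_map R T0 PTP T0 P0 id h (DeltaD d))"
    using d by (simp only: eval_B_def covbar_closed incl_covbar)
  then show ?thesis
    using d by (simp only: evh_h_DeltaD in_D_TP)
qed

abbreviation "kmap_A u \<equiv> mult_A (tensor_map R C TbT TbT TbT cov id u) \<ominus>\<^bsub>TbT\<^esub>
     tensor_lift R C TbT TbT (\<lambda>c w. counit_C c \<rightharpoonup>\<^bsub>TbT\<^esub> w) u"

abbreviation "kmap_B u \<equiv> mult_B (tensor_map S TTb D TTb TTb id covbar u) \<ominus>\<^bsub>TTb\<^esub>
     tensor_lift S TTb D TTb (\<lambda>w d. w \<leftharpoonup>\<^bsub>TTb\<^esub> counit_D d) u"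

lemma kmap_A_hom: "(\<lambda>u. kmap_A u) \<in> add_hom (C \<boxtimes>\<^bsub>R\<^esub> TbT) TbT"
proof (rule add_hom_diff_hom)
  show "(\<lambda>u. mult_A (tensor_map R C TbT TbT TbT cov id u)) \<in> add_hom (C \<boxtimes>\<^bsub>R\<^esub> TbT) TbT"
    by (rule add_homI) (simp_all add: add_hom_closed[OF mult_A_add_hom] add_hom_add[OF mult_A_add_hom])
  show "(\<lambda>u. tensor_lift R C TbT TbT (\<lambda>c w. counit_C c \<rightharpoonup>\<^bsub>TbT\<^esub> w) u) \<in> add_hom (C \<boxtimes>\<^bsub>R\<^esub> TbT) TbT"
    using tensor_lift_hom[OF _ _ counit_C_balanced] by simp
qed simp

lemma kmap_B_hom: "(\<lambda>u. kmap_B u) \<in> add_hom (TTb \<boxtimes>\<^bsub>S\<^esub> D) TTb"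
proof (rule add_hom_diff_hom)
  show "(\<lambda>u. mult_B (tensor_map S TTb D TTb TTb id covbar u)) \<in> add_hom (TTb \<boxtimes>\<^bsub>S\<^esub> D) TTb"
    by (rule add_homI) (simp_all add: add_hom_closed[OF mult_B_add_hom] add_hom_add[OF mult_B_add_hom])
  show "(\<lambda>u. tensor_lift S TTb D TTb (\<lambda>w d. w \<leftharpoonup>\<^bsub>TTb\<^esub> counit_D d) u) \<in> add_hom (TTb \<boxtimes>\<^bsub>S\<^esub> D) TTb"
    using tensor_lift_hom[OF _ _ counit_D_balanced] by simp
qed simp

lemma kmap_A_tens:
  assumes "c \<in> carrier C" "v \<in> carrier TbT"
  shows "kmap_A (tens R C TbT c v) = ractA (eval_A v) (cov c) \<ominus>\<^bsub>TbT\<^esub> (counit_C c \<rightharpoonup>\<^bsub>TbT\<^esub> v)"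
  using assms by (simp add: tensor_lift_tens[OF _ _ counit_C_balanced] mult_A_tens)

lemma kmap_B_tens:
  assumes "d \<in> carrier D" "v \<in> carrier TTb"
  shows "kmap_B (tens S TTb D v d) = lactB (eval_B v) (covbar d) \<ominus>\<^bsub>TTb\<^esub> (v \<leftharpoonup>\<^bsub>TTb\<^esub> counit_D d)"
  using assms by (simp add: tensor_lift_tens[OF _ _ counit_D_balanced] mult_B_tens)

text \<open>If \<open>ev c = 1\<close> and \<open>eval_A v = 0\<close>, then \<open>cov c\<close> times \<open>v\<close> vanishes and \<open>v\<close> is, up to sign,
  the defining relation of \<open>A'\<close> at \<open>c \<otimes> v\<close>. So \<open>ker_A\<close> is the whole kernel of \<open>eval_A\<close>.\<close>

lemma ker_A_eq: "ker_A = {v \<in> carrier TbT. eval_A v = \<zero>\<^bsub>A\<^esub>}"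
proof (intro equalityI subsetI)
  interpret TbT: left_module R TbT by simp
  have zero: "eval_A (kmap_A u) = \<zero>\<^bsub>A\<^esub>" if "u \<in> carrier (C \<boxtimes>\<^bsub>R\<^esub> TbT)" for u
    using C_bimodule(3) TbT.left_module_axioms that
  proof (induction rule: tensor_induct)
    case (tens c v)
    have "eval_A (kmap_A (tens R C TbT c v)) = eval_A (ractA (eval_A v) (cov c)) \<ominus>\<^bsub>A\<^esub> eval_A (counit_C c \<rightharpoonup>\<^bsub>TbT\<^esub> v)"
      unfolding kmap_A_tens[OF tens]
      using tens TbT.lact_closed[OF counit_C(1)[OF tens(1)] tens(2)]
      by (intro add_hom_diff[OF _ _ eval_A_add_hom]) (simp_all add: alpha.S.abelian_group_axioms)
    also have "\<dots> = \<zero>\<^bsub>A\<^esub>"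
      using tens left_hom_lact[OF eval_A_left_hom counit_C(1)[OF tens(1)] tens(2)]
      by (simp add: eval_A_ractA eval_A_cov counit_C a_minus_def alpha.S.r_neg)
    finally show ?case .
  next
    case (add u v)
    then show ?case
      by (simp only: add_hom_add[OF kmap_A_hom] add_hom_closed[OF kmap_A_hom] eval_A_simps alpha.S.l_zero alpha.S.zero_closed)
  qed
  show "v \<in> {v \<in> carrier TbT. eval_A v = \<zero>\<^bsub>A\<^esub>}" if vk: "v \<in> ker_A" for v
  proof -
    obtain u where u: "u \<in> carrier (C \<boxtimes>\<^bsub>R\<^esub> TbT)" "v = kmap_A u"
      using vk unfolding ker_A_def by (elim imageE) (rule that)
    show ?thesis
      using zero[OF u(1)] add_hom_closed[OF kmap_A_hom u(1)] unfolding u(2) by (intro CollectI conjI)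
  qed
  show "v \<in> ker_A" if "v \<in> {v \<in> carrier TbT. eval_A v = \<zero>\<^bsub>A\<^esub>}" for v
  proof -
    have v: "v \<in> carrier TbT" "eval_A v = \<zero>\<^bsub>A\<^esub>" using that by simp_all
    obtain c where c: "c \<in> carrier C" "ev c = \<one>\<^bsub>A\<^esub>" by (rule one_in_ev_C)
    have one: "counit_C c = \<one>\<^bsub>R\<^esub>" using c by (intro counit_C_eqI) simp_all
    have z: "ractA \<zero>\<^bsub>A\<^esub> u = \<zero>\<^bsub>TbT\<^esub>" if "u \<in> carrier TbT" for u
      using that
    proof (induction rule: TbT_induct)
      case (tens w x)
      then have x: "x \<in> carrier T" by simp
      have "x \<leftharpoonup>\<^bsub>T\<^esub> \<zero>\<^bsub>A\<^esub> = \<zero>\<^bsub>T\<^esub>"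
        by (rule add_hom_zero[of A0 T0 "\<lambda>a. x \<leftharpoonup>\<^bsub>T\<^esub> a", simplified])
          (use x in \<open>simp_all add: right_module_abelian_group[OF A0_bimodule(3)] right_module_abelian_group[OF T0_bimodule(3)] right_hom_add_hom[OF ract_T_right_hom]\<close>)
      then show ?case
        using tens tens_zero_right[of S Tbar T0 w] by simp
    qed simp
    \<comment> \<open>The relation at \<open>c \<otimes> v\<close> is \<open>cov c\<close> times
      \<open>v\<close> minus \<open>\<epsilon>(c) v\<close>, which equals \<open>- v\<close> here;
      hence the witness is taken at \<open>c \<otimes> (- v)\<close>.\<close>
    have minus: "\<ominus>\<^bsub>TbT\<^esub> v \<in> carrier TbT" using v by simp
    have ev_minus: "eval_A (\<ominus>\<^bsub>TbT\<^esub> v) = \<zero>\<^bsub>A\<^esub>"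
      using add_hom_minus[OF _ _ eval_A_add_hom v(1)] v(2) by (simp add: alpha.S.abelian_group_axioms)
    have "kmap_A (tens R C TbT c (\<ominus>\<^bsub>TbT\<^esub> v)) = v"
      unfolding kmap_A_tens[OF c(1) minus] ev_minus one z[OF cov_closed[OF c(1)]] TbT.one_lact[OF minus]
      using v by (simp add: a_minus_def)
    then show ?thesis
      unfolding ker_A_def using tens_closed[OF c(1) minus, of R] by (metis (no_types, lifting) image_eqI)
  qed
qed

text \<open>Some \<open>d\<close> in D with \<open>evh d = 1\<close> plays the part of
  \<open>c\<close>, now as the right-hand factor: if \<open>eval_B v = 0\<close>, then
  \<open>v\<close> times \<open>covbar d\<close> vanishes and the relation at
  \<open>v \<otimes> d\<close> is \<open>- v\<close>.\<close>

lemma ker_B_eq: "ker_B = {v \<in> carrier TTb. eval_B v = \<zero>\<^bsub>B\<^esub>}"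
proof (intro equalityI subsetI)
  interpret TTb: right_module S TTb by simp
  have zero: "eval_B (kmap_B u) = \<zero>\<^bsub>B\<^esub>" if "u \<in> carrier (TTb \<boxtimes>\<^bsub>S\<^esub> D)" for u
    using TTb.right_module_axioms D_bimodule(2) that
  proof (induction rule: tensor_induct)
    case (tens v d)
    have "eval_B (kmap_B (tens S TTb D v d)) = eval_B (lactB (eval_B v) (covbar d)) \<ominus>\<^bsub>B\<^esub> eval_B (v \<leftharpoonup>\<^bsub>TTb\<^esub> counit_D d)"
      unfolding kmap_B_tens[OF tens(2,1)]
      using tens TTb.ract_closed[OF counit_D(1)[OF tens(2)] tens(1)]
      by (intro add_hom_diff[OF _ _ eval_B_add_hom]) (simp_all add: beta.S.abelian_group_axioms)
    also have "\<dots> = \<zero>\<^bsub>B\<^esub>"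
      using tens right_hom_ract[OF eval_B_right_hom counit_D(1)[OF tens(2)] tens(1)]
      by (simp add: eval_B_lactB eval_B_covbar counit_D a_minus_def beta.S.r_neg)
    finally show ?case .
  next
    case (add u v)
    then show ?case
      by (simp only: add_hom_add[OF kmap_B_hom] add_hom_closed[OF kmap_B_hom] eval_B_simps beta.S.l_zero beta.S.zero_closed)
  qed
  show "v \<in> {v \<in> carrier TTb. eval_B v = \<zero>\<^bsub>B\<^esub>}" if vk: "v \<in> ker_B" for v
  proof -
    obtain u where u: "u \<in> carrier (TTb \<boxtimes>\<^bsub>S\<^esub> D)" "v = kmap_B u"
      using vk unfolding ker_B_def by (elim imageE) (rule that)
    show ?thesis
      using zero[OF u(1)] add_hom_closed[OF kmap_B_hom u(1)] unfolding u(2) by (intro CollectI conjI)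
  qed
  show "v \<in> ker_B" if "v \<in> {v \<in> carrier TTb. eval_B v = \<zero>\<^bsub>B\<^esub>}" for v
  proof -
    have v: "v \<in> carrier TTb" "eval_B v = \<zero>\<^bsub>B\<^esub>" using that by simp_all
    obtain d where d: "d \<in> carrier D" "evh d = \<one>\<^bsub>B\<^esub>" by (rule one_in_evh_D)
    have one: "counit_D d = \<one>\<^bsub>S\<^esub>" using d by (intro counit_D_eqI) simp_all
    have z: "lactB \<zero>\<^bsub>B\<^esub> u = \<zero>\<^bsub>TTb\<^esub>" if "u \<in> carrier TTb" for u
      using that
    proof (induction rule: TTb_induct)
      case (tens x w)
      then have x: "x \<in> carrier T" by simp
      have "\<zero>\<^bsub>B\<^esub> \<rightharpoonup>\<^bsub>T\<^esub> x = \<zero>\<^bsub>T\<^esub>"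
        by (rule add_hom_zero[of B0 T0 "\<lambda>b. b \<rightharpoonup>\<^bsub>T\<^esub> x", simplified])
          (use x in \<open>simp_all add: left_module_abelian_group[OF B0_bimodule(2)] left_module_abelian_group[OF T0_bimodule(2)] left_hom_add_hom[OF lact_T_left_hom]\<close>)
      then show ?case
        using tens tens_zero_left[of R T0 Tbar w] by simp
    qed simp
    have minus: "\<ominus>\<^bsub>TTb\<^esub> v \<in> carrier TTb" using v by simp
    have ev_minus: "eval_B (\<ominus>\<^bsub>TTb\<^esub> v) = \<zero>\<^bsub>B\<^esub>"
      using add_hom_minus[OF _ _ eval_B_add_hom v(1)] v(2) by (simp add: beta.S.abelian_group_axioms)
    have "kmap_B (tens S TTb D (\<ominus>\<^bsub>TTb\<^esub> v) d) = v"
      unfolding kmap_B_tens[OF d(1) minus] ev_minus one z[OF covbar_closed[OF d(1)]] TTb.ract_one[OF minus]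
      using v by (simp add: a_minus_def)
    then show ?thesis
      unfolding ker_B_def using tens_closed[OF minus d(1), of S] by (metis (no_types, lifting) image_eqI)
  qed
qed

section \<open>The comparison maps\<close>

lemma mult_map_A: "mult_map (TbT\<lparr>monoid.mult := \<lambda>u v. mult_A (tens R TbT TbT u v)\<rparr>) A eval_A"
proof -
  let ?N = "TbT\<lparr>monoid.mult := \<lambda>u v. mult_A (tens R TbT TbT u v)\<rparr>"
  have "abelian_group ?N"
    by (rule abelian_group_cong[of TbT]) simp_all
  moreover have "eval_A \<in> add_hom ?N A"
    using eval_A_add_hom by (simp add: add_hom_iff)
  ultimately show ?thesis
    unfolding mult_map_def mult_map_axioms_def by (simp add: mult_A_tens eval_A_ractA)
qed

lemma mult_map_B: "mult_map (TTb\<lparr>monoid.mult := \<lambda>u v. mult_B (tens S TTb TTb u v)\<rparr>) B eval_B"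
proof -
  let ?N = "TTb\<lparr>monoid.mult := \<lambda>u v. mult_B (tens S TTb TTb u v)\<rparr>"
  have "abelian_group ?N"
    by (rule abelian_group_cong[of TTb]) simp_all
  moreover have "eval_B \<in> add_hom ?N B"
    using eval_B_add_hom by (simp add: add_hom_iff)
  ultimately show ?thesis
    unfolding mult_map_def mult_map_axioms_def by (simp add: mult_B_tens eval_B_lactB)
qed

sublocale mA: mult_map "TbT\<lparr>monoid.mult := \<lambda>u v. mult_A (tens R TbT TbT u v)\<rparr>" A eval_A
  by (rule mult_map_A)

sublocale mB: mult_map "TTb\<lparr>monoid.mult := \<lambda>u v. mult_B (tens S TTb TTb u v)\<rparr>" B eval_B
  by (rule mult_map_B)

lemma A'_eq: "A' = TbT\<lparr>monoid.mult := \<lambda>u v. mult_A (tens R TbT TbT u v)\<rparr> Quot mA.K"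
  by (simp add: A'_def ker_A_eq mA.K_def)

lemma B'_eq: "B' = TTb\<lparr>monoid.mult := \<lambda>u v. mult_B (tens S TTb TTb u v)\<rparr> Quot mB.K"
  by (simp add: B'_def ker_B_eq mB.K_def)

lemma nu_pi_A: "w \<in> carrier TbT \<Longrightarrow> mA.\<nu> (pi_A w) = eval_A w"
  using mA.nu_coset[of w] by (simp add: pi_A_def ker_A_eq mA.K_def a_r_coset_def r_coset_def)

lemma nu_pi_B: "w \<in> carrier TTb \<Longrightarrow> mB.\<nu> (pi_B w) = eval_B w"
  using mB.nu_coset[of w] by (simp add: pi_B_def ker_B_eq mB.K_def a_r_coset_def r_coset_def)

text \<open>If \<open>p = h w\<close>, then
  \<open>ev (p \<otimes> x) = eval_A (w \<otimes> x)\<close>; such values generate the image of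
  \<open>ev\<close>, which is all of A for a tame herd.\<close>

lemma eval_A_surj:
  assumes h: "carrier That \<subseteq> h ` carrier Tbar"
  shows "eval_A ` carrier TbT = carrier A"
proof
  interpret TbT: left_module R TbT by simp
  have ex: "\<exists>w\<in>carrier TbT. eval_A w = ev u" if "u \<in> carrier PT" for u
    using that
  proof (induction rule: PT_induct)
    case (tens p x)
    then have px: "p \<in> carrier That" "x \<in> carrier T" by simp_all
    obtain w where "w \<in> carrier Tbar" "p = h w"
      using h px(1) by blast
    then show ?case
      using px by (intro bexI[of _ "tens S Tbar T0 w x"]) simp_all
  next
    case (add u v)
    obtain w w' where "w \<in> carrier TbT" "eval_A w = ev u" "w' \<in> carrier TbT" "eval_A w' = ev v"
      using add(3,4) by blast
    then show ?case
      using add(1,2) TbT.M.a_closed[of w w'] by (intro bexI[of _ "w \<oplus>\<^bsub>TbT\<^esub> w'"]) simp_all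
  qed
  show "carrier A \<subseteq> eval_A ` carrier TbT"
  proof
    fix a assume "a \<in> carrier A"
    then obtain u where "u \<in> carrier PT" "a = ev u"
      unfolding ev_surj[symmetric] by (elim imageE) (rule that)
    with ex[of u] show "a \<in> eval_A ` carrier TbT"
      by (metis image_eqI)
  qed
  show "eval_A ` carrier TbT \<subseteq> carrier A"
    by (rule image_subsetI) (rule eval_A_simps(1))
qed

lemma eval_B_surj:
  assumes h: "carrier That \<subseteq> h ` carrier Tbar"
  shows "eval_B ` carrier TTb = carrier B"
proof
  interpret TTb: right_module S TTb by simp
  have ex: "\<exists>w\<in>carrier TTb. eval_B w = evh u" if "u \<in> carrier TP" for u
    using that
  proof (induction rule: TP_induct)
    case (tens x p)
    then have px: "p \<in> carrier That" "x \<in> carrier T" by simp_all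
    obtain w where "w \<in> carrier Tbar" "p = h w"
      using h px(1) by blast
    then show ?case
      using px by (intro bexI[of _ "tens R T0 Tbar x w"]) simp_all
  next
    case (add u v)
    obtain w w' where "w \<in> carrier TTb" "eval_B w = evh u" "w' \<in> carrier TTb" "eval_B w' = evh v"
      using add(3,4) by blast
    then show ?case
      using add(1,2) TTb.M.a_closed[of w w'] by (intro bexI[of _ "w \<oplus>\<^bsub>TTb\<^esub> w'"]) simp_all
  qed
  show "carrier B \<subseteq> eval_B ` carrier TTb"
  proof
    fix a assume "a \<in> carrier B"
    then obtain u where "u \<in> carrier TP" "a = evh u"
      unfolding evh_surj[symmetric] by (elim imageE) (rule that)
    with ex[of u] show "a \<in> eval_B ` carrier TTb"
      by (metis image_eqI)
  qed
  show "eval_B ` carrier TTb \<subseteq> carrier B"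
    by (rule image_subsetI) (rule eval_B_simps(1))
qed

lemma h_surj_PD:
  assumes "PD \<subseteq> carrier Tbar"
  shows "carrier That \<subseteq> h ` carrier Tbar"
proof
  fix p assume p: "p \<in> carrier That"
  obtain d where d: "d \<in> carrier D" "evh d = \<one>\<^bsub>B\<^esub>" by (rule one_in_evh_D)
  \<comment> \<open>The hypothesis on PD is what makes this candidate preimage of \<open>p\<close>
    an element of \<open>Tbar\<close>; \<open>evh d = 1\<close> then returns
    \<open>p\<close>.\<close>
  have w: "tens S P0 TP p d \<in> PD"
    unfolding PD_def by (rule image_eqI[where x = "tens S P0 D p d"]) (use p d in simp_all)
  have "p = h (tens S P0 TP p d)"
    using p d by simp
  then show "p \<in> h ` carrier Tbar"
    by (rule image_eqI) (rule subsetD[OF assms w])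
qed

lemma comparison_maps:
  "mA.\<nu> \<in> rng_hom A' A \<and> (\<forall>w\<in>carrier TbT. mA.\<nu> (pi_A w) = eval_A w) \<and>
    mB.\<nu> \<in> rng_hom B' B \<and> (\<forall>w\<in>carrier TTb. mB.\<nu> (pi_B w) = eval_B w)"
  "carrier That \<subseteq> h ` carrier Tbar \<Longrightarrow>
     mA.\<nu> \<in> rng_iso A' A \<and> mB.\<nu> \<in> rng_iso B' B \<and> unital A' \<and> unital B'"
proof -
  show "mA.\<nu> \<in> rng_hom A' A \<and> (\<forall>w\<in>carrier TbT. mA.\<nu> (pi_A w) = eval_A w) \<and>
    mB.\<nu> \<in> rng_hom B' B \<and> (\<forall>w\<in>carrier TTb. mB.\<nu> (pi_B w) = eval_B w)"
    using mA.nu_rng_hom mB.nu_rng_hom unfolding A'_eq B'_eq by (intro conjI ballI nu_pi_A nu_pi_B)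
  assume h: "carrier That \<subseteq> h ` carrier Tbar"
  have "eval_A ` carrier (TbT\<lparr>monoid.mult := \<lambda>u v. mult_A (tens R TbT TbT u v)\<rparr>) = carrier A"
    and "eval_B ` carrier (TTb\<lparr>monoid.mult := \<lambda>u v. mult_B (tens S TTb TTb u v)\<rparr>) = carrier B"
    using eval_A_surj[OF h] eval_B_surj[OF h] by simp_all
  then show "mA.\<nu> \<in> rng_iso A' A \<and> mB.\<nu> \<in> rng_iso B' B \<and> unital A' \<and> unital B'"
    unfolding A'_eq B'_eq by (intro conjI mA.nu_rng_iso mB.nu_rng_iso mA.unital_quot mB.unital_quot)
qed

lemma bimod_iso_h_surj: "h \<in> bimod_iso R S Tbar P0 \<Longrightarrow> carrier That \<subseteq> h ` carrier Tbar"
  by (simp add: bimod_iso_def bij_betw_def)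

end

theorem theorem3p5:
  fixes R :: "('r, 'x1) ring_scheme" and S :: "('s, 'x2) ring_scheme"
    and A :: "('a, 'x3) ring_scheme" and B :: "('b, 'x4) ring_scheme"
    and \<alpha> :: "'r \<Rightarrow> 'a" and \<beta> :: "'s \<Rightarrow> 'b"
    and T :: "('b, 't, 'a) bimod" and That :: "('a, 'p, 'b) bimod"
    and ev :: "('p \<times> 't \<Rightarrow>\<^sub>0 int) set \<Rightarrow> 'a"
    and evh :: "('t \<times> 'p \<Rightarrow>\<^sub>0 int) set \<Rightarrow> 'b"
    and \<gamma> :: "'t \<Rightarrow> ('t \<times> ('p \<times> 't \<Rightarrow>\<^sub>0 int) set \<Rightarrow>\<^sub>0 int) set"
  assumes "tame_herd R S A B \<alpha> \<beta> T That ev evh \<gamma>"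
  shows
    "let T0 = restr \<beta> \<alpha> T;
         P0 = restr \<alpha> \<beta> That;
         Tbar = herd.Tbar R S A B \<alpha> \<beta> T That ev evh \<gamma>;
         CP = herd.CP R S A \<alpha> \<beta> T That ev \<gamma>;
         PD = herd.PD R S B \<alpha> \<beta> T That evh \<gamma>;
         h = herd.h R S \<alpha> \<beta> T That ev;
         A' = herd.A' R S A B \<alpha> \<beta> T That ev evh \<gamma>;
         B' = herd.B' R S A B \<alpha> \<beta> T That ev evh \<gamma>;
         \<pi>\<^sub>A = herd.pi_A R S A B \<alpha> \<beta> T That ev evh \<gamma>;
         \<pi>\<^sub>B = herd.pi_B R S A B \<alpha> \<beta> T That ev evh \<gamma>;
         eval\<^sub>A = herd.eval_A R S A B \<alpha> \<beta> T That ev evh \<gamma>;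
         eval\<^sub>B = herd.eval_B R S A B \<alpha> \<beta> T That ev evh \<gamma>
     in \<exists>\<nu>\<^sub>A \<nu>\<^sub>B.
       (\<nu>\<^sub>A \<in> rng_hom A' A \<and> (\<forall>w\<in>carrier (Tbar \<boxtimes>\<^bsub>S\<^esub> T0). \<nu>\<^sub>A (\<pi>\<^sub>A w) = eval\<^sub>A w) \<and>
        \<nu>\<^sub>B \<in> rng_hom B' B \<and> (\<forall>w\<in>carrier (T0 \<boxtimes>\<^bsub>R\<^esub> Tbar). \<nu>\<^sub>B (\<pi>\<^sub>B w) = eval\<^sub>B w)) \<and>
       (h \<in> bimod_iso R S Tbar P0 \<longrightarrow>
          \<nu>\<^sub>A \<in> rng_iso A' A \<and> \<nu>\<^sub>B \<in> rng_iso B' B \<and> unital A' \<and> unital B') \<and>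
       (flat_left TYPE(('r, 's, 'a, 'b, 't, 'p) test) R P0 \<and>
        flat_right TYPE(('r, 's, 'a, 'b, 't, 'p) test) S P0 \<and>
        carrier Tbar = PD \<and> PD = CP \<longrightarrow>
          \<nu>\<^sub>A \<in> rng_iso A' A \<and> \<nu>\<^sub>B \<in> rng_iso B' B)"
proof -
  interpret tame_herd R S A B \<alpha> \<beta> T That ev evh \<gamma> by fact
  show ?thesis
    unfolding Let_def
  proof (rule exI[of _ mA.\<nu>], rule exI[of _ mB.\<nu>], rule conjI[OF comparison_maps(1)], rule conjI; rule impI)
    assume "h \<in> bimod_iso R S Tbar P0"
    from comparison_maps(2)[OF bimod_iso_h_surj[OF this]]
    show "mA.\<nu> \<in> rng_iso A' A \<and> mB.\<nu> \<in> rng_iso B' B \<and> unital A' \<and> unital B'" .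
  next
    assume "flat_left TYPE(('r, 's, 'a, 'b, 't, 'p) test) R P0 \<and>
      flat_right TYPE(('r, 's, 'a, 'b, 't, 'p) test) S P0 \<and> carrier Tbar = PD \<and> PD = CP"
    \<comment> \<open>The equality for \<open>Tbar\<close> supplies the preimages
      \<open>p \<otimes> d\<close>, and the third part joins the second through surjectivity of
      \<open>h\<close>.\<close>
    then have "PD \<subseteq> carrier Tbar" by simp
    from comparison_maps(2)[OF h_surj_PD[OF this]]
    show "mA.\<nu> \<in> rng_iso A' A \<and> mB.\<nu> \<in> rng_iso B' B" by blast
  qed
qed

end
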